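(* Let $L=L(\sigma,T_1,T_2,H_2)$ and $\tilde L=L(\tilde\sigma,\tilde T_1,\tilde T_2,\tilde H_2)$ be two boundary value problems of the form described in the context, with spectral data $\{\lambda_{nk},\alpha_{nk}\}_{(n,k)\in J}$ and $\{\tilde\lambda_{nk},\tilde\alpha_{nk}\}_{(n,k)\in\tilde J}$, respectively. If $J=\tilde J$ and $\lambda_{nk}=\tilde\lambda_{nk}$, $\alpha_{nk}=\tilde\alpha_{nk}$ for all $(n,k)\in J$, then $$\sigma(x)=\tilde\sigma(x)+H_1^\diamond\ \text{ a.e. on }(0,\pi),\quad T_1=\tilde T_1,\quad T_2=\tilde T_2,\quad H_2=\tilde H_2-T_2H_1^\diamond T_2,\qquad( * )$$ where $H_1^\diamond\in\mathbb C^{m\times m}$ is a constant matrix satisfying $$H_1^\diamond=(H_1^\diamond)^\dagger=T_1^\perp H_1^\diamond T_1^\perp.\qquad( ** )$$ Thus, the spectral data $\{\lambda_{nk},\alpha_{nk}\}_{(n,k)\in J}$ uniquely specify the problem $L$ up to a transform $( * )$ given by an arbitrary matrix $H_1^\diamond$ satisfying $( ** )$.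
   Context: Let $m\ge 1$; $\dagger$ denotes conjugate transpose and $I$ the unit $(m\times m)$-matrix. Let $\sigma\in L_2((0,\pi);\mathbb C^{m\times m})$ with $\sigma(x)=(\sigma(x))^\dagger$. Put $Y^{[1]}:=Y'-\sigma Y$ and $\ell Y:=-(Y^{[1]})'-\sigma Y^{[1]}-\sigma^2Y$. Let $T_1,T_2,H_2\in\mathbb C^{m\times m}$ satisfy $T_j=T_j^\dagger=T_j^2$, $T_j^\perp:=I-T_j$ ($j=1,2$), $H_2=H_2^\dagger=T_2H_2T_2$. Denote $$V_1(Y):=T_1Y^{[1]}(0)-T_1^\perp Y(0),\quad V_2(Y):=T_2(Y^{[1]}(\pi)-H_2Y(\pi))-T_2^\perp Y(\pi),\quad V_1^\perp(Y):=T_1Y(0)+T_1^\perp Y^{[1]}(0).$$ $L=L(\sigma,T_1,T_2,H_2)$ is the boundary value problem $\ell Y=\lambda Y$ on $(0,\pi)$, $V_1(Y)=V_2(Y)=0$ (solutions have $Y,Y^{[1]}$ absolutely continuous on $[0,\pi]$). Spectral data: let $p^\perp:=\dim(\operatorname{Ker}T_1\cap\operatorname{Ker}T_2)$ and $J:=\{(n,k)\colon n\in\mathbb N,\ k=1,\dots,m\}\cup\{(0,k)\colon k=p^\perp+1,\dots,m\}$, ordered lexicographically, $\mathbb N=\{1,2,\dots\}$. The eigenvalues of $L$ are real and, counted with multiplicity (dimension of the space of eigenfunctions), are numbered as $\{\lambda_{nk}\}_{(n,k)\in J}$ in non-decreasing order. The Weyl solution $\Phi(x,\lambda)$ is the matrix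 solution of $\ell\Phi=\lambda\Phi$ with $V_1(\Phi)=I$, $V_2(\Phi)=0$; the Weyl matrix $M(\lambda):=V_1^\perp(\Phi)$ is meromorphic with simple poles at the eigenvalues of $L$; the weight matrices are $\alpha_{nk}:=\operatorname{Res}_{\lambda=\lambda_{nk}}M(\lambda)$. The spectral data of $L$ are $\{\lambda_{nk},\alpha_{nk}\}_{(n,k)\in J}$. Objects with a tilde are the analogous objects for $\tilde L$, which has the same $m$; in particular its quasi-derivative is $Y'-\tilde\sigma Y$ and $\tilde J$ is defined by $\tilde T_1,\tilde T_2$. *)

theory Defs
  imports "HOL-Complex_Analysis.Complex_Analysis" "HOL-Library.Function_Algebras"
begin

definition dagger :: "complex^'n^'m \<Rightarrow> complex^'m^'n" where
  "dagger A = map_matrix cnj (transpose A)"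

definition perp :: "complex^'m^'m \<Rightarrow> complex^'m^'m" where
  "perp T = mat 1 - T"

text \<open>Vector-valued functions are treated as functions with values in the \<open>m \<times> 1\<close> matrices
  \<open>complex^1^'m\<close>; thus one set of definitions, with an arbitrary number of columns, covers both
  the vector solutions (eigenfunctions) and the square matrix solutions (the Weyl solution).\<close>

definition cscale :: "complex \<Rightarrow> complex^'n^'m \<Rightarrow> complex^'n^'m" where
  "cscale c A = map_matrix ((*) c) A"

definition sl_problem ::
  "(real \<Rightarrow> complex^'m^'m) \<Rightarrow> complex^'m^'m \<Rightarrow> complex^'m^'m \<Rightarrow> complex^'m^'m \<Rightarrow> bool" where
  "sl_problem \<sigma> T1 T2 H2 \<longleftrightarrow>
     \<sigma> \<in> borel_measurable (lebesgue_on {0<..<pi}) \<and>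
     integrable (lebesgue_on {0<..<pi}) (\<lambda>x. (norm (\<sigma> x))\<^sup>2) \<and>
     (AE x in lebesgue_on {0<..<pi}. \<sigma> x = dagger (\<sigma> x)) \<and>
     T1 = dagger T1 \<and> T1 = T1 ** T1 \<and>
     T2 = dagger T2 \<and> T2 = T2 ** T2 \<and>
     H2 = dagger H2 \<and> H2 = T2 ** H2 ** T2"

text \<open>Classical absolute continuity on \<open>[a, b]\<close>: \<open>D\<close> is a finite family of non-overlapping
  closed subintervals.\<close>

definition abs_continuous_on_interval ::
  "real \<Rightarrow> real \<Rightarrow> (real \<Rightarrow> 'a::real_normed_vector) \<Rightarrow> bool" where
  "abs_continuous_on_interval a b f \<longleftrightarrow>
     (\<forall>e>0. \<exists>d>0. \<forall>D. D division_of \<Union>D \<and> \<Union>D \<subseteq> {a..b} \<and>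
        (\<Sum>K\<in>D. Sup K - Inf K) < d \<longrightarrow> (\<Sum>K\<in>D. norm (f (Sup K) - f (Inf K))) < e)"

text \<open>The quasi-derivative is given by \<open>Y' - \<sigma> Y\<close> only almost everywhere, whereas
  its values at \<open>0\<close> and \<open>\<pi>\<close> enter the boundary forms. We therefore carry along its absolutely
  continuous representative \<open>Y1\<close>, which \<open>Y\<close> determines uniquely on \<open>[0, \<pi>]\<close>.\<close>

definition quasi_derivative ::
  "(real \<Rightarrow> complex^'m^'m) \<Rightarrow> (real \<Rightarrow> complex^'n^'m) \<Rightarrow> (real \<Rightarrow> complex^'n^'m) \<Rightarrow> bool" where
  "quasi_derivative \<sigma> Y Y1 \<longleftrightarrow>
     abs_continuous_on_interval 0 pi Y \<and> abs_continuous_on_interval 0 pi Y1 \<and>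
     (AE x in lebesgue_on {0<..<pi}.
        \<exists>dY. (Y has_vector_derivative dY) (at x) \<and> Y1 x = dY - \<sigma> x ** Y x)"

definition sl_solution ::
  "(real \<Rightarrow> complex^'m^'m) \<Rightarrow> complex \<Rightarrow> (real \<Rightarrow> complex^'n^'m) \<Rightarrow> (real \<Rightarrow> complex^'n^'m) \<Rightarrow> bool" where
  "sl_solution \<sigma> z Y Y1 \<longleftrightarrow>
     quasi_derivative \<sigma> Y Y1 \<and>
     (AE x in lebesgue_on {0<..<pi}.
        \<exists>dY1. (Y1 has_vector_derivative dY1) (at x) \<and>
          - dY1 - \<sigma> x ** Y1 x - (\<sigma> x ** \<sigma> x) ** Y x = cscale z (Y x))"

definition V1 ::
  "complex^'m^'m \<Rightarrow> (real \<Rightarrow> complex^'n^'m) \<Rightarrow> (real \<Rightarrow> complex^'n^'m) \<Rightarrow> complex^'n^'m" where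
  "V1 T1 Y Y1 = T1 ** Y1 0 - perp T1 ** Y 0"

definition V2 ::
  "complex^'m^'m \<Rightarrow> complex^'m^'m \<Rightarrow> (real \<Rightarrow> complex^'n^'m) \<Rightarrow> (real \<Rightarrow> complex^'n^'m) \<Rightarrow> complex^'n^'m" where
  "V2 T2 H2 Y Y1 = T2 ** (Y1 pi - H2 ** Y pi) - perp T2 ** Y pi"

definition V1_perp ::
  "complex^'m^'m \<Rightarrow> (real \<Rightarrow> complex^'n^'m) \<Rightarrow> (real \<Rightarrow> complex^'n^'m) \<Rightarrow> complex^'n^'m" where
  "V1_perp T1 Y Y1 = T1 ** Y 0 + perp T1 ** Y1 0"

text \<open>Functions on \<open>[0, \<pi>]\<close> are represented by their extension by \<open>0\<close>, so that the complex
  dimension of the eigenspace (the zero function included) is that of a space of functions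
  on \<open>[0, \<pi>]\<close>.\<close>

definition eigenspace ::
  "(real \<Rightarrow> complex^'m^'m) \<Rightarrow> complex^'m^'m \<Rightarrow> complex^'m^'m \<Rightarrow> complex^'m^'m \<Rightarrow> complex
    \<Rightarrow> (real \<Rightarrow> complex^1^'m) set" where
  "eigenspace \<sigma> T1 T2 H2 z =
     {Y. (\<forall>x. x \<notin> {0..pi} \<longrightarrow> Y x = 0) \<and>
         (\<exists>Y1. sl_solution \<sigma> z Y Y1 \<and> V1 T1 Y Y1 = 0 \<and> V2 T2 H2 Y Y1 = 0)}"

definition fscale :: "complex \<Rightarrow> (real \<Rightarrow> complex^'n^'m) \<Rightarrow> real \<Rightarrow> complex^'n^'m" where
  "fscale c Y = (\<lambda>x. cscale c (Y x))"

lemma vector_space_fscale: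
  "vector_space (fscale :: complex \<Rightarrow> (real \<Rightarrow> complex^'n^'m) \<Rightarrow> real \<Rightarrow> complex^'n^'m)"
  by unfold_locales (auto simp: fscale_def cscale_def fun_eq_iff vec_eq_iff algebra_simps)

definition eigen_multiplicity ::
  "(real \<Rightarrow> complex^'m^'m) \<Rightarrow> complex^'m^'m \<Rightarrow> complex^'m^'m \<Rightarrow> complex^'m^'m \<Rightarrow> complex \<Rightarrow> nat" where
  "eigen_multiplicity \<sigma> T1 T2 H2 z = vector_space.dim fscale (eigenspace \<sigma> T1 T2 H2 z)"

definition p_perp :: "complex^'m^'m \<Rightarrow> complex^'m^'m \<Rightarrow> nat" where
  "p_perp T1 T2 = vec.dim ({v. T1 *v v = 0} \<inter> {v. T2 *v v = 0})"

definition index_set :: "complex^'m^'m \<Rightarrow> complex^'m^'m \<Rightarrow> (nat \<times> nat) set" where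
  "index_set T1 T2 =
     {(n, k). 1 \<le> n \<and> 1 \<le> k \<and> k \<le> CARD('m)} \<union>
     {(0, k) | k. p_perp T1 T2 + 1 \<le> k \<and> k \<le> CARD('m)}"

text \<open>Every complex \<open>z\<close> occurs among the real numbers \<open>lam n k\<close> exactly as often as its
  multiplicity as an eigenvalue (not at all, if it is no eigenvalue). As every index in
  \<open>index_set T1 T2\<close> has only finitely many predecessors in the lexicographic order, monotonicity
  determines the numbering.\<close>

definition eigenvalue_numbering ::
  "(real \<Rightarrow> complex^'m^'m) \<Rightarrow> complex^'m^'m \<Rightarrow> complex^'m^'m \<Rightarrow> complex^'m^'m
    \<Rightarrow> (nat \<Rightarrow> nat \<Rightarrow> real) \<Rightarrow> bool" where
  "eigenvalue_numbering \<sigma> T1 T2 H2 lam \<longleftrightarrow>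
     (\<forall>(n, k) \<in> index_set T1 T2. \<forall>(n', k') \<in> index_set T1 T2.
        n < n' \<or> n = n' \<and> k \<le> k' \<longrightarrow> lam n k \<le> lam n' k') \<and>
     (\<forall>z. finite {(n, k) \<in> index_set T1 T2. complex_of_real (lam n k) = z} \<and>
          card {(n, k) \<in> index_set T1 T2. complex_of_real (lam n k) = z}
            = eigen_multiplicity \<sigma> T1 T2 H2 z)"

definition weyl_solution ::
  "(real \<Rightarrow> complex^'m^'m) \<Rightarrow> complex^'m^'m \<Rightarrow> complex^'m^'m \<Rightarrow> complex^'m^'m \<Rightarrow> complex
    \<Rightarrow> (real \<Rightarrow> complex^'m^'m) \<Rightarrow> (real \<Rightarrow> complex^'m^'m) \<Rightarrow> bool" where
  "weyl_solution \<sigma> T1 T2 H2 z \<Phi> \<Phi>1 \<longleftrightarrow>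
     sl_solution \<sigma> z \<Phi> \<Phi>1 \<and> V1 T1 \<Phi> \<Phi>1 = mat 1 \<and> V2 T2 H2 \<Phi> \<Phi>1 = 0"

text \<open>Meaningful only if \<open>z\<close> is not an eigenvalue: then the Weyl solution exists and is unique
  on \<open>[0, \<pi>]\<close>.\<close>

definition weyl_matrix ::
  "(real \<Rightarrow> complex^'m^'m) \<Rightarrow> complex^'m^'m \<Rightarrow> complex^'m^'m \<Rightarrow> complex^'m^'m \<Rightarrow> complex
    \<Rightarrow> complex^'m^'m" where
  "weyl_matrix \<sigma> T1 T2 H2 z =
     (THE M. \<exists>\<Phi> \<Phi>1. weyl_solution \<sigma> T1 T2 H2 z \<Phi> \<Phi>1 \<and> M = V1_perp T1 \<Phi> \<Phi>1)"

definition weight_matrix ::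
  "(real \<Rightarrow> complex^'m^'m) \<Rightarrow> complex^'m^'m \<Rightarrow> complex^'m^'m \<Rightarrow> complex^'m^'m \<Rightarrow> complex
    \<Rightarrow> complex^'m^'m" where
  "weight_matrix \<sigma> T1 T2 H2 z0 = (\<chi> i j. residue (\<lambda>z. weyl_matrix \<sigma> T1 T2 H2 z $ i $ j) z0)"

definition spectral_data ::
  "(real \<Rightarrow> complex^'m^'m) \<Rightarrow> complex^'m^'m \<Rightarrow> complex^'m^'m \<Rightarrow> complex^'m^'m
    \<Rightarrow> (nat \<Rightarrow> nat \<Rightarrow> real) \<Rightarrow> (nat \<Rightarrow> nat \<Rightarrow> complex^'m^'m) \<Rightarrow> bool" where
  "spectral_data \<sigma> T1 T2 H2 lam \<alpha> \<longleftrightarrow>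
     eigenvalue_numbering \<sigma> T1 T2 H2 lam \<and>
     (\<forall>(n, k) \<in> index_set T1 T2. \<alpha> n k = weight_matrix \<sigma> T1 T2 H2 (complex_of_real (lam n k)))"

text \<open>The matrices \<open>H\<close> admissible in the transform: Hermitian, with \<open>H = T\<^sub>1\<^sup>\<bottom> H T\<^sub>1\<^sup>\<bottom>\<close>.\<close>

definition admissible_shift :: "complex^'m^'m \<Rightarrow> complex^'m^'m \<Rightarrow> bool" where
  "admissible_shift T1 H \<longleftrightarrow> H = dagger H \<and> H = perp T1 ** H ** perp T1"

text \<open>\<open>(\<sigma>, T1, T2, H2)\<close> is obtained from \<open>(\<sigma>', T1', T2', H2')\<close> by the transform with matrix \<open>H\<close>.\<close>

definition shift_transform ::
  "complex^'m^'m \<Rightarrow> (real \<Rightarrow> complex^'m^'m) \<Rightarrow> complex^'m^'m \<Rightarrow> complex^'m^'m \<Rightarrow> complex^'m^'m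
    \<Rightarrow> (real \<Rightarrow> complex^'m^'m) \<Rightarrow> complex^'m^'m \<Rightarrow> complex^'m^'m \<Rightarrow> complex^'m^'m \<Rightarrow> bool" where
  "shift_transform H \<sigma> T1 T2 H2 \<sigma>' T1' T2' H2' \<longleftrightarrow>
     (AE x in lebesgue_on {0<..<pi}. \<sigma> x = \<sigma>' x + H) \<and>
     T1 = T1' \<and> T2 = T2' \<and> H2 = H2' - T2 ** H ** T2"

end

theory Submission
  imports Defs
begin

text \<open>The Weyl matrix \<open>M\<close> obeys the Herglotz-type bound \<open>norm (M z) \<le> C (1 + norm z)\<^sup>2 / \<bar>Im z\<bar>\<close>. If two
  problems have the same spectral data, the poles of \<open>M - M'\<close> cancel and the bound makes the difference an affine function
  of \<open>z\<close>. On the rays \<open>z = \<rho>\<^sup>2\<close>, \<open>\<rho> \<in> (\<plusminus>1 + \<i>)\<real>\<close>, one has \<open>M z = - \<i> \<rho> (perp T1) + o(\<rho>)\<close> and \<open>M z T1 \<rightarrow> 0\<close>;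
  hence \<open>T1 = T1'\<close> and \<open>M - M'\<close> is a constant \<open>H\<close> with \<open>H = H\<^sup>\<dagger> = perp T1 H perp T1\<close>. Adding \<open>H\<close> to \<open>\<sigma>'\<close> replaces the
  quasi-derivative \<open>Y1\<close> by \<open>Y1 - H Y\<close> and \<open>M'\<close> by \<open>M' + H\<close>, so that one may assume \<open>M = M'\<close>.

  The upper right block \<open>P\<^sub>1\<^sub>2\<close> of the product of one fundamental matrix with the inverse of the other is then entire of
  order \<open>1/2\<close> in \<open>z\<close> and, expressed through the Weyl solutions, of size \<open>O(1/\<rho>)\<close> on the imaginary axis, so it vanishes by
  the Phragmen-Lindelof principle. The differential equation for the product now forces \<open>\<sigma> = \<sigma>'\<close> almost everywhere.
  Finally, fix a nonreal \<open>z\<close>: a pair of values at \<open>\<pi>\<close> satisfies the boundary condition \<open>V2 = 0\<close> of either problem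
  precisely if the solution with these values satisfies \<open>V1_perp = M V1\<close> at \<open>0\<close>; this gives \<open>T2 = T2'\<close> and \<open>H2 = H2'\<close>.\<close>

subsection \<open>Absolutely continuous functions\<close>

text \<open>The potential is only square integrable, so \<open>Y'\<close> need not be continuous and
  the equation holds almost everywhere. Every estimate therefore integrates a differential
  inequality whose weight involves \<open>(norm (\<sigma> x))\<^sup>2\<close>. Remainders are
  controlled in mean square, which is why the error \<open>o(\<rho>)\<close> comes out as
  \<open>norm \<rho>\<close> times the power \<open>-1/4\<close> of \<open>Im \<rho>\<close>. The
  Herglotz-type bound has its source in the Lagrange identity, which writes
  \<open>M z - dagger (M w)\<close> as an integral over products of Weyl solutions; it stands in for
  an expansion of \<open>M\<close> over its poles. The link to the numbering of the eigenvalues is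
  that each zero of the characteristic function has positive multiplicity and hence occurs in it.
  For \<open>P\<^sub>1\<^sub>2\<close> the columns must be split by \<open>T1\<close>: on the range
  of \<open>T1\<close> the Weyl solution gains a factor \<open>1/\<rho>\<close>, on the range of
  \<open>perp T1\<close> the regular solution does, so each product gains it exactly once.\<close>

lemma tagged_partial_length_le_measure:
  fixes U :: "real set"
  assumes p: "p tagged_partial_division_of cbox a b" and "finite p"
    and U: "U \<in> lmeasurable" "\<And>x K. (x, K) \<in> p \<Longrightarrow> K \<subseteq> U"
  shows "(\<Sum>K\<in>snd ` p. Sup K - Inf K) \<le> measure lebesgue U"
proof -
  have div: "snd ` p division_of \<Union>(snd ` p)"
    using p by (rule partial_division_of_tagged_division)
  have len: "Sup K - Inf K = measure lebesgue K" if KK: "K \<in> snd ` p" for K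
  proof -
    obtain x where "(x, K) \<in> p" using KK by auto
    then obtain u v where K: "K = cbox u v" "x \<in> K"
      using p by (meson tagged_partial_division_ofD)
    then show ?thesis by auto
  qed
  have "(\<Sum>K\<in>snd ` p. Sup K - Inf K) = (\<Sum>K\<in>snd ` p. measure lebesgue K)"
    using len by (intro sum.cong) auto
  also have "\<dots> = measure lebesgue (\<Union>(snd ` p))"
    using content_division[OF div] by simp
  also have "\<dots> \<le> measure lebesgue U"
    using U by (intro measure_mono_fmeasurable fmeasurableD lmeasurable_division[OF div]) fastforce
  finally show ?thesis .
qed

text \<open>\<open>snd\<close> need not be injective on \<open>p\<close>, but two tags can share an
  interval only if its interior is empty; it is then a point and contributes 0. This links Riemann
  sums, which run over tagged intervals, to absolute continuity, whose sums run over
  intervals.\<close>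

lemma sum_tags_eq_sum_intervals:
  fixes f :: "real \<Rightarrow> 'a::real_normed_vector"
  assumes p: "p tagged_partial_division_of cbox a b" and fin: "finite p"
  shows "(\<Sum>(x,K)\<in>p. norm (f (Sup K) - f (Inf K))) = (\<Sum>K\<in>snd ` p. norm (f (Sup K) - f (Inf K)))"
proof -
  have "(\<Sum>K\<in>snd ` p. norm (f (Sup K) - f (Inf K))) = sum ((\<lambda>K. norm (f (Sup K) - f (Inf K))) \<circ> snd) p"
  proof (rule sum.reindex_nontrivial[OF fin])
    fix s t assume st: "s \<in> p" "t \<in> p" "s \<noteq> t" "snd s = snd t"
    obtain x K y L where eq: "s = (x, K)" "t = (y, L)" by (cases s, cases t) auto
    have "interior K \<inter> interior L = {}"
      using tagged_partial_division_ofD(5)[OF p] st eq by metis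
    then have "interior K = {}" using st eq by simp
    moreover have "(x, K) \<in> p" using st eq by simp
    then obtain u v where K: "K = cbox u v" "x \<in> K"
      using p by (meson tagged_partial_division_ofD)
    ultimately have "u = v" by auto
    then show "norm (f (Sup (snd s)) - f (Inf (snd s))) = 0" using K eq by simp
  qed
  then show ?thesis by (simp add: case_prod_unfold comp_def)
qed

text \<open>A gauge argument: tags outside the null set are handled by differentiability, tags
  inside it by absolute continuity, because a small open neighbourhood of the null set bounds the
  total length of their intervals. Integrability of \<open>g\<close> is part of the
  conclusion.\<close>

theorem abs_continuous_fundamental_theorem:
  fixes f g :: "real \<Rightarrow> 'a::real_normed_vector"
  assumes ab: "a \<le> b" and ac: "abs_continuous_on_interval a b f" and N: "negligible N"
    and der: "\<And>x. x \<in> {a<..<b} - N \<Longrightarrow> (f has_vector_derivative g x) (at x)"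
  shows "(g has_integral (f b - f a)) {a..b}"
proof (cases "a = b")
  case True then show ?thesis using has_integral_refl(2)[of g a] by simp
next
  case False
  with ab have "a < b" by simp
  \<comment> \<open>The endpoints join the exceptional set because differentiability is known in the
    open interval only.\<close>
  define N' where "N' = N \<union> {a, b}"
  have N': "negligible N'" unfolding N'_def using N by simp
  \<comment> \<open>On the exceptional set the integrand is reset to 0, so that intervals tagged
    there contribute only an increment of \<open>f\<close>.\<close>
  define g0 where "g0 = (\<lambda>x. if x \<in> N' then 0 else g x)"
  have "(g0 has_integral (f b - f a)) (cbox a b)"
    unfolding has_integral
  proof (intro allI impI)
    fix e :: real assume "e > 0"
    then have "e/2 > 0" by simp
    then obtain \<delta> where \<delta>: "\<delta> > 0"
      and ac': "\<And>D. \<lbrakk>D division_of \<Union>D; \<Union>D \<subseteq> {a..b}; (\<Sum>K\<in>D. Sup K - Inf K) < \<delta>\<rbrakk>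
         \<Longrightarrow> (\<Sum>K\<in>D. norm (f (Sup K) - f (Inf K))) < e/2"
      using ac[unfolded abs_continuous_on_interval_def, rule_format, of "e/2"] by blast
    have "N' \<in> sets lebesgue" using N' by (simp add: negligible_imp_sets)
    then obtain U where U: "open U" "N' \<subseteq> U" "U - N' \<in> lmeasurable" "emeasure lebesgue (U - N') < ennreal \<delta>"
      using sets_lebesgue_outer_open \<delta> by metis
    have "U = (U - N') \<union> N'" using U by auto
    moreover have "N' \<in> lmeasurable" using N' by (simp add: negligible_imp_measurable)
    ultimately have Um: "U \<in> lmeasurable" using U(3) by (metis fmeasurable.Un)
    have "measure lebesgue U = measure lebesgue (U - N')"
      using measure_Diff_null_set[of U lebesgue N'] N' Um by (simp add: negligible_iff_null_sets fmeasurableD)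
    also have "\<dots> < \<delta>" using U(3,4) \<delta> by (simp add: emeasure_eq_measure2 ennreal_less_iff)
    finally have mU: "measure lebesgue U < \<delta>" .
    \<comment> \<open>With this slope error the intervals tagged outside \<open>N'\<close>
      contribute at most \<open>2 * \<eta> * (b - a)\<close>, which is \<open>e/2\<close>.\<close>
    define \<eta> where "\<eta> = e / (4 * (b - a))"
    have \<eta>: "\<eta> > 0" unfolding \<eta>_def using \<open>e > 0\<close> \<open>a < b\<close> by simp
    have "\<exists>d>0. \<forall>y\<in>{a..b}. norm (y - x) < d \<longrightarrow> norm (f y - f x - (y - x) *\<^sub>R g x) \<le> \<eta> * norm (y - x)"
      if "x \<in> {a..b} - N'" for x
    proof -
      have "(f has_vector_derivative g x) (at x within {a..b})"
        using der[of x] that unfolding N'_def by (rule_tac has_vector_derivative_at_within) auto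
      then have "\<forall>e>0. \<exists>d>0. \<forall>y\<in>{a..b}. norm (y - x) < d \<longrightarrow> norm (f y - f x - (y - x) *\<^sub>R g x) \<le> e * norm (y - x)"
        unfolding has_vector_derivative_def has_derivative_within_alt by (rule conjunct2)
      then show ?thesis using \<eta> by blast
    qed
    then have "\<exists>d. d > 0 \<and> (x \<in> {a..b} - N' \<longrightarrow> (\<forall>y\<in>{a..b}. norm (y - x) < d \<longrightarrow> norm (f y - f x - (y - x) *\<^sub>R g x) \<le> \<eta> * norm (y - x)))" for x
      by (cases "x \<in> {a..b} - N'") (auto intro: exI[of _ 1])
    then have "\<exists>d. \<forall>x. d x > 0 \<and> (x \<in> {a..b} - N' \<longrightarrow>
        (\<forall>y\<in>{a..b}. norm (y - x) < d x \<longrightarrow> norm (f y - f x - (y - x) *\<^sub>R g x) \<le> \<eta> * norm (y - x)))"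
      by (intro choice allI)
    then obtain d where d0: "\<forall>x. d x > 0 \<and> (x \<in> {a..b} - N' \<longrightarrow>
        (\<forall>y\<in>{a..b}. norm (y - x) < d x \<longrightarrow> norm (f y - f x - (y - x) *\<^sub>R g x) \<le> \<eta> * norm (y - x)))" ..
    have d1: "d x > 0" for x using d0 by simp
    have d2: "norm (f y - f x - (y - x) *\<^sub>R g x) \<le> \<eta> * norm (y - x)"
      if "x \<in> {a..b} - N'" "y \<in> {a..b}" "norm (y - x) < d x" for x y
      using d0[rule_format, of x, THEN conjunct2, rule_format, OF that] .
    \<comment> \<open>At exceptional points the gauge is the open set \<open>U\<close> of measure
      below \<open>\<delta>\<close>, elsewhere the ball on which the linear approximation is good to
      within \<open>\<eta>\<close>.\<close>
    define \<gamma> where "\<gamma> = (\<lambda>x. if x \<in> N' then U else ball x (d x))"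
    have g1: "gauge \<gamma>" unfolding gauge_def \<gamma>_def using U d1 by auto
    have g2: "norm ((\<Sum>(x,K)\<in>p. measure lborel K *\<^sub>R g0 x) - (f b - f a)) < e"
      if p: "p tagged_division_of cbox a b" and fine: "\<gamma> fine p" for p
    proof -
      have finp: "finite p" using p by auto
      have fba: "f b - f a = (\<Sum>(x,K)\<in>p. f (Sup K) - f (Inf K))" "b - a = (\<Sum>(x,K)\<in>p. Sup K - Inf K)"
        using additive_tagged_division_1[where f= f] additive_tagged_division_1[where f= "\<lambda>x. x"] ab p by auto
      define p2 where "p2 = {s \<in> p. fst s \<in> N'}"
      have p2p: "p2 tagged_partial_division_of cbox a b" "finite p2" "p2 \<subseteq> p"
        using p finp tagged_partial_division_subset[of p "cbox a b" p2] unfolding p2_def tagged_division_of_def by auto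
      have "(\<Sum>K\<in>snd ` p2. Sup K - Inf K) \<le> measure lebesgue U"
      proof (rule tagged_partial_length_le_measure[OF p2p(1,2) Um])
        fix x K assume "(x, K) \<in> p2"
        then show "K \<subseteq> U" using fine unfolding p2_def \<gamma>_def fine_def by fastforce
      qed
      then have less: "(\<Sum>K\<in>snd ` p2. norm (f (Sup K) - f (Inf K))) < e/2"
      proof (intro ac')
        show "snd ` p2 division_of \<Union>(snd ` p2)"
          using p2p(1) by (rule partial_division_of_tagged_division)
        show "\<Union>(snd ` p2) \<subseteq> {a..b}"
          using p2p(1) tagged_partial_division_ofD(3)[OF p2p(1)] by fastforce
      qed (use mU in linarith)
      let ?t = "\<lambda>(x,K). norm (measure lborel K *\<^sub>R g0 x - (f (Sup K) - f (Inf K)))"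
      have t2: "sum ?t p2 < e/2"
      proof -
        have "sum ?t p2 = (\<Sum>(x,K)\<in>p2. norm (f (Sup K) - f (Inf K)))"
          by (intro sum.cong) (auto simp: p2_def g0_def norm_minus_commute)
        then show ?thesis using less sum_tags_eq_sum_intervals[OF p2p(1,2), of f] by simp
      qed
      have t1: "sum ?t (p - p2) \<le> (\<Sum>(x,K)\<in>p - p2. 2 * \<eta> * (Sup K - Inf K))"
      proof (rule sum_mono, clarify)
        fix x K assume xK: "(x, K) \<in> p" "(x, K) \<notin> p2"
        then have xN: "x \<notin> N'" unfolding p2_def by auto
        obtain u v where K: "K = cbox u v" "x \<in> K" "K \<subseteq> {a..b}"
          using p xK(1) by (metis box_real(2) tagged_division_ofD(2,3,4))
        have uv: "u \<le> x" "x \<le> v" "u \<in> K" "v \<in> K" using K by auto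
        have Kb: "K \<subseteq> ball x (d x)" using fine xK(1) xN unfolding fine_def \<gamma>_def by fastforce
        have du: "norm (u - x) < d x" "norm (v - x) < d x" using subsetD[OF Kb uv(3)] subsetD[OF Kb uv(4)] by (auto simp: dist_real_def abs_minus_commute)
        have 1: "norm (f u - f x - (u - x) *\<^sub>R g x) \<le> \<eta> * norm (u - x)"
          using K uv xN du by (intro d2) auto
        have 2: "norm (f v - f x - (v - x) *\<^sub>R g x) \<le> \<eta> * norm (v - x)"
          using K uv xN du by (intro d2) auto
        have "measure lborel K *\<^sub>R g0 x - (f (Sup K) - f (Inf K)) = (v - u) *\<^sub>R g x - (f v - f u)"
          using K uv xN by (auto simp: g0_def)
        also have "\<dots> = (f u - f x - (u - x) *\<^sub>R g x) - (f v - f x - (v - x) *\<^sub>R g x)"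
          by (simp add: algebra_simps)
        finally have "norm (measure lborel K *\<^sub>R g0 x - (f (Sup K) - f (Inf K))) \<le> \<eta> * norm (u - x) + \<eta> * norm (v - x)"
          using 1 2 by (smt (verit) norm_triangle_ineq4)
        also have "\<dots> = \<eta> * (v - u)" using uv by (simp add: algebra_simps)
        also have "\<dots> \<le> 2 * \<eta> * (Sup K - Inf K)" using K uv \<eta> by auto
        finally show "norm (measure lborel K *\<^sub>R g0 x - (f (Sup K) - f (Inf K))) \<le> 2 * \<eta> * (Sup K - Inf K)" .
      qed
      also have "\<dots> \<le> (\<Sum>(x,K)\<in>p. 2 * \<eta> * (Sup K - Inf K))"
      proof (rule sum_mono2[OF finp])
        fix s assume s: "s \<in> p - (p - p2)"
        obtain x K where xK: "s = (x, K)" by (cases s)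
        have "(x, K) \<in> p" using s xK by simp
        then obtain u v where K: "K = cbox u v" "x \<in> K"
          using p by (metis tagged_division_ofD(2,4))
        then have "u \<le> v" by auto
        then show "0 \<le> (case s of (x, K) \<Rightarrow> 2 * \<eta> * (Sup K - Inf K))" using K \<eta> xK by simp
      qed auto
      also have "\<dots> = 2 * \<eta> * (b - a)" unfolding fba(2) sum_distrib_left by (simp add: case_prod_unfold)
      also have "\<dots> = e/2" unfolding \<eta>_def using \<open>a < b\<close> by (simp add: field_simps)
      finally have t1: "sum ?t (p - p2) \<le> e/2" .
      have "norm ((\<Sum>(x,K)\<in>p. measure lborel K *\<^sub>R g0 x) - (f b - f a)) = norm (\<Sum>(x,K)\<in>p. measure lborel K *\<^sub>R g0 x - (f (Sup K) - f (Inf K)))"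
        unfolding fba(1) by (simp add: sum_subtractf case_prod_unfold)
      also have "\<dots> \<le> sum ?t p" by (rule order_trans[OF norm_sum]) (simp add: case_prod_unfold)
      also have "\<dots> = sum ?t (p - p2) + sum ?t p2" by (rule sum.subset_diff[OF p2p(3) finp])
      finally show ?thesis using t1 t2 by linarith
    qed
    show "\<exists>\<gamma>. gauge \<gamma> \<and> (\<forall>p. p tagged_division_of cbox a b \<and> \<gamma> fine p \<longrightarrow>
         norm ((\<Sum>(x,K)\<in>p. measure lborel K *\<^sub>R g0 x) - (f b - f a)) < e)"
      by (rule exI[of _ \<gamma>], intro conjI allI impI, rule g1, elim conjE, rule g2)
  qed
  then show ?thesis
    unfolding cbox_interval by (rule has_integral_spike[OF N', rotated]) (simp add: g0_def)
qed

section \<open>Almost everywhere differentiability of indefinite integrals\<close>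

lemma cball_eq_interval: "cball ((u + v) / 2) ((v - u) / 2) = {u..v::real}"
  by (simp add: cball_eq_atLeastAtMost field_simps)

text \<open>Henstock's lemma against Vitali's covering theorem. At a bad point arbitrarily short
  intervals miss the linear prediction by more than \<open>c\<close> times their length. Henstock
  bounds the sum of such misses over disjoint intervals by \<open>e * c\<close>, so disjoint bad
  intervals have total length below \<open>e\<close>, and Vitali covers the bad set by them up to a
  null set.\<close>

lemma indefinite_integral_bad_set_negligible:
  fixes f :: "real \<Rightarrow> 'a::euclidean_space"
  assumes f: "f integrable_on {a..b}" and c: "c > 0"
  defines "F \<equiv> \<lambda>x. integral {a..x} f"
  shows "negligible {x \<in> {a<..<b}. \<forall>d>0. \<exists>y. y \<noteq> x \<and> \<bar>y - x\<bar> < d \<and>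
            norm (F y - F x - (y - x) *\<^sub>R f x) > c * \<bar>y - x\<bar>}" (is "negligible ?E")
  unfolding negligible_outer_le
proof (intro allI impI)
  fix e :: real assume e: "e > 0"
  then have ec: "e * c > 0" using c by simp
  have f': "f integrable_on cbox a b" using f by simp
  obtain \<gamma> where \<gamma>: "gauge \<gamma>" and hen: "\<And>p. \<lbrakk>p tagged_partial_division_of cbox a b; \<gamma> fine p\<rbrakk> \<Longrightarrow>
             (\<Sum>(x,k)\<in>p. norm (measure lborel k *\<^sub>R f x - integral k f)) < e * c"
    by (rule Henstock_lemma[OF f' ec]) (rule that, assumption+)
  have Fint: "integral {u..v} f = F v - F u" if "a \<le> u" "u \<le> v" "v \<le> b" for u v
  proof -
    have "f integrable_on {a..v}" using f by (rule integrable_on_subinterval) (use that in auto)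
    from Henstock_Kurzweil_Integration.integral_combine[OF that(1,2) this] show ?thesis unfolding F_def by (simp add: algebra_simps)
  qed
  \<comment> \<open>An index is a tag \<open>x\<close> with an interval having \<open>x\<close> as
    an endpoint. The covering theorem speaks of closed balls, so the interval is also described by
    its centre \<open>ctr\<close> and radius \<open>rad\<close>.\<close>
  define K where "K = {(x,u,v). x \<in> ?E \<and> u < v \<and> (x = u \<or> x = v) \<and> {u..v} \<subseteq> \<gamma> x \<and> {u..v} \<subseteq> {a..b} \<and>
       norm (F v - F u - (v - u) *\<^sub>R f x) > c * (v - u)}"
  define ctr where "ctr = (\<lambda>(x::real,u,v). (u + v) / 2 :: real)"
  define rad where "rad = (\<lambda>(x::real,u,v). (v - u) / 2 :: real)"
  have cb: "cball (ctr i) (rad i) = {fst (snd i)..snd (snd i)}" for i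
    unfolding ctr_def rad_def case_prod_unfold by (rule cball_eq_interval)
  have cover: "\<exists>i. i \<in> K \<and> x \<in> cball (ctr i) (rad i) \<and> rad i < d" if x: "x \<in> ?E" and d: "0 < d" for x d
  proof -
    have "open (\<gamma> x)" "x \<in> \<gamma> x" using \<gamma> by (auto simp: gauge_def)
    then obtain r where r: "r > 0" "ball x r \<subseteq> \<gamma> x" using open_contains_ball by blast
    \<comment> \<open>Keeps the interval inside \<open>[a, b]\<close> and inside the gauge
      neighbourhood of \<open>x\<close>, with radius below \<open>d\<close>.\<close>
    define d' where "d' = min (min d r) (min (x - a) (b - x))"
    have "d' > 0" unfolding d'_def using x d r by auto
    then obtain y where y: "y \<noteq> x" "\<bar>y - x\<bar> < d'" "norm (F y - F x - (y - x) *\<^sub>R f x) > c * \<bar>y - x\<bar>"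
      using x by blast
    define u where "u = min x y"
    define v where "v = max x y"
    have uv: "u < v" "x = u \<or> x = v" "v - u = \<bar>y - x\<bar>" using y unfolding u_def v_def by auto
    have 1: "{u..v} \<subseteq> ball x r" using y unfolding u_def v_def d'_def by (auto simp: dist_real_def)
    have 2: "{u..v} \<subseteq> {a..b}" using y unfolding u_def v_def d'_def by auto
    have "norm (F v - F u - (v - u) *\<^sub>R f x) = norm (F y - F x - (y - x) *\<^sub>R f x)"
    proof (cases "x \<le> y")
      case True then show ?thesis unfolding u_def v_def by (simp add: min_def max_def)
    next
      case False
      then have "F v - F u - (v - u) *\<^sub>R f x = - (F y - F x - (y - x) *\<^sub>R f x)"
        unfolding u_def v_def by (simp add: min_def max_def algebra_simps)
      then show ?thesis by (metis norm_minus_cancel)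
    qed
    then have "(x, u, v) \<in> K" unfolding K_def using x uv 1 2 r y by simp
    moreover have "x \<in> cball (ctr (x,u,v)) (rad (x,u,v))" unfolding cb using uv by auto
    moreover have "rad (x,u,v) < d" unfolding rad_def using uv y d unfolding d'_def by auto
    ultimately show ?thesis by (intro exI[of _ "(x,u,v)"] conjI)
  qed
  have rpos: "0 < rad i" if "i \<in> K" for i using that unfolding K_def rad_def by auto
  obtain C where C: "countable C" "C \<subseteq> K"
     "pairwise (\<lambda>i j. disjnt (cball (ctr i) (rad i)) (cball (ctr j) (rad j))) C"
     "negligible (?E - (\<Union>i\<in>C. cball (ctr i) (rad i)))"
    by (rule Vitali_covering_theorem_cballs[of K rad ?E ctr, OF rpos cover])
  have CK: "fst (snd i) < snd (snd i)" "fst i \<in> {fst (snd i)..snd (snd i)}" "{fst (snd i)..snd (snd i)} \<subseteq> \<gamma> (fst i)"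
      "{fst (snd i)..snd (snd i)} \<subseteq> {a..b}"
      "norm (F (snd (snd i)) - F (fst (snd i)) - (snd (snd i) - fst (snd i)) *\<^sub>R f (fst i)) > c * (snd (snd i) - fst (snd i))"
    if "i \<in> C" for i
  proof -
    have "i \<in> K" using that C(2) by (rule subsetD[rotated])
    moreover obtain x u v where i: "i = (x, u, v)" by (cases i)
    ultimately have H: "u < v" "x = u \<or> x = v" "{u..v} \<subseteq> \<gamma> x" "{u..v} \<subseteq> {a..b}"
       "norm (F v - F u - (v - u) *\<^sub>R f x) > c * (v - u)"
      unfolding K_def by simp_all
    show "fst (snd i) < snd (snd i)" "fst i \<in> {fst (snd i)..snd (snd i)}" "{fst (snd i)..snd (snd i)} \<subseteq> \<gamma> (fst i)"
      "{fst (snd i)..snd (snd i)} \<subseteq> {a..b}"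
      "norm (F (snd (snd i)) - F (fst (snd i)) - (snd (snd i) - fst (snd i)) *\<^sub>R f (fst i)) > c * (snd (snd i) - fst (snd i))"
      unfolding i fst_conv snd_conv using H by (fact | force)+
  qed
  \<comment> \<open>Partial divisions are finite, so the bound is obtained for finite subfamilies
    and carried over to the countable family afterwards.\<close>
  have fin_bound: "measure lebesgue (\<Union>i\<in>C'. cball (ctr i) (rad i)) \<le> e" if C': "C' \<subseteq> C" "finite C'" for C'
  proof -
    define g where "g = (\<lambda>i::real\<times>real\<times>real. (fst i, {fst (snd i)..snd (snd i)}))"
    have disj: "{fst (snd i)..snd (snd i)} \<inter> {fst (snd j)..snd (snd j)} = {}" if "i \<in> C'" "j \<in> C'" "i \<noteq> j" for i j
      using C(3) that C'(1) unfolding pairwise_def disjnt_def cb by blast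
    have inj: "inj_on g C'"
    proof (rule inj_onI, rule ccontr)
      fix i j assume ij: "i \<in> C'" "j \<in> C'" "g i = g j" "i \<noteq> j"
      have "{fst (snd i)..snd (snd i)} \<noteq> {}" using CK(2)[of i] ij C' by auto
      then show False using disj[OF ij(1,2,4)] ij(3) unfolding g_def by auto
    qed
    have "g ` C' tagged_partial_division_of cbox a b"
      unfolding tagged_partial_division_of_def
    proof (intro conjI allI impI)
      show "finite (g ` C')" using C' by simp
      fix x k assume "(x, k) \<in> g ` C'"
      then obtain i where i: "i \<in> C" "x = fst i" "k = {fst (snd i)..snd (snd i)}"
        using C' unfolding g_def by auto
      show "x \<in> k" "k \<subseteq> cbox a b" using CK[OF i(1)] i by auto
      show "\<exists>a b. k = cbox a b" using i by auto
    next
      fix x k y l assume H: "(x, k) \<in> g ` C' \<and> (y, l) \<in> g ` C' \<and> (x, k) \<noteq> (y, l)"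
      obtain i where i: "i \<in> C'" "(x, k) = g i" using H by (elim conjE imageE)
      obtain j where j: "j \<in> C'" "(y, l) = g j" using H by (elim conjE imageE)
      have "i \<noteq> j" using H i j by metis
      moreover have "k = {fst (snd i)..snd (snd i)}" "l = {fst (snd j)..snd (snd j)}"
        using i j unfolding g_def by simp_all
      ultimately have "k \<inter> l = {}" using disj[OF i(1) j(1)] by simp
      then show "interior k \<inter> interior l = {}" using interior_subset by fast
    qed
    moreover have "\<gamma> fine (g ` C')" unfolding fine_def g_def using CK(3) C' by auto
    ultimately have "(\<Sum>(x,k)\<in>g ` C'. norm (measure lborel k *\<^sub>R f x - integral k f)) < e * c"
      by (rule hen)
    also have "(\<Sum>(x,k)\<in>g ` C'. norm (measure lborel k *\<^sub>R f x - integral k f)) =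
        (\<Sum>i\<in>C'. norm ((snd (snd i) - fst (snd i)) *\<^sub>R f (fst i) - (F (snd (snd i)) - F (fst (snd i)))))"
      unfolding sum.reindex[OF inj] comp_def
    proof (intro sum.cong refl)
      fix i assume "i \<in> C'"
      then have i: "i \<in> C" using C' by auto
      show "(case g i of (x, k) \<Rightarrow> norm (measure lborel k *\<^sub>R f x - integral k f)) =
         norm ((snd (snd i) - fst (snd i)) *\<^sub>R f (fst i) - (F (snd (snd i)) - F (fst (snd i))))"
        using CK(1)[OF i] CK(4)[OF i] Fint[of "fst (snd i)" "snd (snd i)"] unfolding g_def by simp
    qed
    finally have S: "(\<Sum>i\<in>C'. norm ((snd (snd i) - fst (snd i)) *\<^sub>R f (fst i) - (F (snd (snd i)) - F (fst (snd i))))) < e * c" .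
    have "(\<Sum>i\<in>C'. (snd (snd i) - fst (snd i)) * c) \<le> (\<Sum>i\<in>C'. norm ((snd (snd i) - fst (snd i)) *\<^sub>R f (fst i) - (F (snd (snd i)) - F (fst (snd i)))))"
    proof (rule sum_mono)
      fix i assume "i \<in> C'"
      then have i: "i \<in> C" using C' by auto
      show "(snd (snd i) - fst (snd i)) * c \<le> norm ((snd (snd i) - fst (snd i)) *\<^sub>R f (fst i) - (F (snd (snd i)) - F (fst (snd i))))"
        using CK(5)[OF i] by (simp add: norm_minus_commute mult.commute)
    qed
    with S have "(\<Sum>i\<in>C'. (snd (snd i) - fst (snd i))) * c < e * c" by (simp add: sum_distrib_right)
    then have S2: "(\<Sum>i\<in>C'. (snd (snd i) - fst (snd i))) < e" using c by simp
    have "measure lebesgue (\<Union>i\<in>C'. cball (ctr i) (rad i)) \<le> (\<Sum>i\<in>C'. measure lebesgue (cball (ctr i) (rad i)))"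
      using C' by (intro measure_UNION_le) auto
    also have "\<dots> = (\<Sum>i\<in>C'. (snd (snd i) - fst (snd i)))"
      unfolding cb
    proof (intro sum.cong refl)
      fix i assume "i \<in> C'"
      then have i: "i \<in> C" using C' by auto
      show "measure lebesgue {fst (snd i)..snd (snd i)} = snd (snd i) - fst (snd i)"
        using CK(1)[OF i] by simp
    qed
    finally show ?thesis using S2 by linarith
  qed
  let ?U = "\<Union>i\<in>C. cball (ctr i) (rad i)"
  have cm: "cball (ctr i) (rad i) \<in> lmeasurable" for i by simp
  have Um: "?U \<in> lmeasurable" "measure lebesgue ?U \<le> e"
    by (rule fmeasurable_UN_bound[OF C(1) cm fin_bound], assumption+)
       (rule measure_UN_bound[OF C(1) cm fin_bound], assumption+)
  let ?R = "?E - ?U"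
  have Rm: "?R \<in> lmeasurable" "measure lebesgue ?R = 0"
    using C(4) by (simp_all add: negligible_imp_measurable negligible_imp_measure0)
  show "\<exists>T. ?E \<subseteq> T \<and> T \<in> lmeasurable \<and> measure lebesgue T \<le> e"
  proof (intro exI conjI)
    show "?E \<subseteq> ?R \<union> ?U" by blast
    show "?R \<union> ?U \<in> lmeasurable" using Rm Um by (intro fmeasurable.Un)
    have "measure lebesgue (?R \<union> ?U) \<le> measure lebesgue ?R + measure lebesgue ?U"
      using Rm Um by (intro measure_Un_le fmeasurableD)
    then show "measure lebesgue (?R \<union> ?U) \<le> e" using Rm Um by linarith
  qed
qed

text \<open>A point that is not bad for any of the tolerances \<open>inverse (real (Suc n))\<close>
  is a point of differentiability, and countably many null sets make up a null set.\<close>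

lemma indefinite_integral_has_derivative_ae:
  fixes f :: "real \<Rightarrow> 'a::euclidean_space"
  assumes f: "f integrable_on {a..b}"
  obtains N where "negligible N"
    "\<And>x. x \<in> {a<..<b} - N \<Longrightarrow> ((\<lambda>x. integral {a..x} f) has_vector_derivative f x) (at x)"
proof -
  define F where "F = (\<lambda>x. integral {a..x} f)"
  define E where "E = (\<lambda>n. {x \<in> {a<..<b}. \<forall>d>0. \<exists>y. y \<noteq> x \<and> \<bar>y - x\<bar> < d \<and>
            norm (F y - F x - (y - x) *\<^sub>R f x) > inverse (real (Suc n)) * \<bar>y - x\<bar>})"
  have "negligible (E n)" for n
    unfolding E_def F_def by (rule indefinite_integral_bad_set_negligible[OF f]) simp
  then have neg: "negligible (\<Union>n. E n)" by (intro negligible_countable_Union) auto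
  have "(F has_vector_derivative f x) (at x)" if x: "x \<in> {a<..<b} - (\<Union>n. E n)" for x
    unfolding has_vector_derivative_def has_derivative_at_alt
  proof (intro conjI allI impI bounded_linear_scaleR_left)
    fix e :: real assume "e > 0"
    then obtain n where n: "inverse (real (Suc n)) < e" using reals_Archimedean by blast
    have "x \<notin> E n" using x by blast
    then have "\<not> (\<forall>d>0. \<exists>y. y \<noteq> x \<and> \<bar>y - x\<bar> < d \<and> norm (F y - F x - (y - x) *\<^sub>R f x) > inverse (real (Suc n)) * \<bar>y - x\<bar>)"
      using x unfolding E_def by simp
    then obtain d where d1: "d > 0" and d2: "\<not> (\<exists>y. y \<noteq> x \<and> \<bar>y - x\<bar> < d \<and> norm (F y - F x - (y - x) *\<^sub>R f x) > inverse (real (Suc n)) * \<bar>y - x\<bar>)"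
      by blast
    have d: "norm (F y - F x - (y - x) *\<^sub>R f x) \<le> inverse (real (Suc n)) * \<bar>y - x\<bar>" if "y \<noteq> x" "\<bar>y - x\<bar> < d" for y
      using d2 that by (meson not_less)
    have "norm (F y - F x - (y - x) *\<^sub>R f x) \<le> e * norm (y - x)" if "norm (y - x) < d" for y
    proof (cases "y = x")
      case False
      then have "norm (F y - F x - (y - x) *\<^sub>R f x) \<le> inverse (real (Suc n)) * \<bar>y - x\<bar>" using d that by simp
      also have "\<dots> \<le> e * \<bar>y - x\<bar>" using n by (intro mult_right_mono) auto
      finally show ?thesis by simp
    qed simp
    then show "\<exists>d>0. \<forall>y. norm (y - x) < d \<longrightarrow> norm (F y - F x - (y - x) *\<^sub>R f x) \<le> e * norm (y - x)"
      using d1 by (intro exI[of _ d]) simp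
  qed
  then show ?thesis using that[OF neg] unfolding F_def by simp
qed

text \<open>Cuts an integrable dominating function into a bounded part and a remainder of small
  integral, which is what makes indefinite integrals absolutely continuous; dominated convergence
  provides the level \<open>n\<close>.\<close>

lemma truncation_integral_small:
  fixes h :: "real \<Rightarrow> real"
  assumes h: "h integrable_on {a..b}" and h0: "\<And>x. x \<in> {a..b} \<Longrightarrow> 0 \<le> h x" and e: "e > 0"
  obtains n :: nat where "(\<lambda>x. min (h x) (real n)) integrable_on {a..b}"
    "integral {a..b} (\<lambda>x. h x - min (h x) (real n)) < e"
proof -
  have ha: "h absolutely_integrable_on {a..b}" using h h0 by (intro nonnegative_absolutely_integrable_1)
  have int: "(\<lambda>x. min (h x) (real n)) integrable_on {a..b}" for n
    using absolutely_integrable_min_1[OF ha, of "\<lambda>_. real n"] by (simp add: set_lebesgue_integral_eq_integral(1))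
  have "(\<lambda>n. integral {a..b} (\<lambda>x. min (h x) (real n))) \<longlonglongrightarrow> integral {a..b} h"
  proof (rule dominated_convergence(2)[OF int h])
    fix n x assume x: "x \<in> {a..b}"
    show "norm (min (h x) (real n)) \<le> h x" using h0[OF x] by auto
    show "(\<lambda>n. min (h x) (real n)) \<longlonglongrightarrow> h x"
    proof (rule tendsto_eventually)
      obtain N :: nat where "h x \<le> real N" using real_arch_simple by blast
      then show "\<forall>\<^sub>F n in sequentially. min (h x) (real n) = h x"
        unfolding eventually_sequentially by (intro exI[of _ N]) (auto simp: min_def)
    qed
  qed
  then obtain n where n: "norm (integral {a..b} (\<lambda>x. min (h x) (real n)) - integral {a..b} h) < e"
    using e LIMSEQ_D by (metis order_refl)
  have "integral {a..b} (\<lambda>x. h x - min (h x) (real n)) < e"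
    using n by (subst integral_diff[OF h int]) auto
  then show ?thesis using that[OF int] by blast
qed

lemma abs_continuous_indefinite_integral:
  fixes f :: "real \<Rightarrow> 'a::euclidean_space"
  assumes f: "f integrable_on {a..b}" and h: "h integrable_on {a..b}"
    and fh: "\<And>x. x \<in> {a..b} \<Longrightarrow> norm (f x) \<le> h x"
  shows "abs_continuous_on_interval a b (\<lambda>x. integral {a..x} f)"
  unfolding abs_continuous_on_interval_def
proof (intro allI impI)
  fix e :: real assume "e > 0"
  then have e2: "e/2 > 0" by simp
  have h0: "0 \<le> h x" if "x \<in> {a..b}" for x using fh[OF that] norm_ge_zero order_trans by blast
  obtain n where n: "(\<lambda>x. min (h x) (real n)) integrable_on {a..b}"
    "integral {a..b} (\<lambda>x. h x - min (h x) (real n)) < e/2"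
    by (rule truncation_integral_small[OF h h0 e2])
  define g where "g = (\<lambda>x. h x - min (h x) (real n))"
  have gi: "g integrable_on {a..b}" unfolding g_def using h n by (intro integrable_diff)
  have g0: "0 \<le> g x" for x unfolding g_def by simp
  \<comment> \<open>The remainder \<open>g\<close> contributes less than \<open>e/2\<close> on any
    family of intervals, the bounded part at most \<open>n\<close> times the total length. The
    \<open>+ 1\<close> covers the case \<open>n = 0\<close>.\<close>
  have key: "(\<Sum>K\<in>D. norm (integral {a..Sup K} f - integral {a..Inf K} f)) < e"
    if D: "D division_of \<Union>D" "\<Union>D \<subseteq> {a..b}" "(\<Sum>K\<in>D. Sup K - Inf K) < e / (2 * (real n + 1))" for D
  proof -
    have sub: "K \<subseteq> {a..b}" if "K \<in> D" for K using D(2) that by blast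
    have bound: "norm (integral {a..Sup K} f - integral {a..Inf K} f) \<le> integral K g + real n * (Sup K - Inf K)"
      and gK: "(g has_integral integral K g) K" and len0: "Sup K - Inf K \<ge> 0" if K: "K \<in> D" for K
    proof -
      obtain u v where uv: "K = cbox u v" using division_ofD(4)[OF D(1) K] by auto
      have "K \<noteq> {}" using division_ofD(3)[OF D(1) K] .
      then have K': "K = {u..v}" "u \<le> v" using uv by auto
      have ab: "a \<le> u" "v \<le> b" using sub[OF K] K' by auto
      show "Sup K - Inf K \<ge> 0" using K' by simp
      have gi': "g integrable_on {u..v}" using gi by (rule integrable_on_subinterval) (use ab in auto)
      then show "(g has_integral integral K g) K" using K' by (simp add: integrable_integral)
      have hi: "h integrable_on {u..v}" using h by (rule integrable_on_subinterval) (use ab in auto)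
      have fi: "f integrable_on {u..v}" using f by (rule integrable_on_subinterval) (use ab in auto)
      have fi2: "f integrable_on {a..v}" using f by (rule integrable_on_subinterval) (use ab in auto)
      have "integral {a..v} f - integral {a..u} f = integral {u..v} f"
        using Henstock_Kurzweil_Integration.integral_combine[OF ab(1) K'(2) fi2] by (simp add: algebra_simps)
      then have "norm (integral {a..v} f - integral {a..u} f) \<le> integral {u..v} h"
        using integral_norm_bound_integral[OF fi hi] fh ab by auto
      also have "\<dots> \<le> integral {u..v} (\<lambda>x. g x + real n)"
        using hi gi' by (intro integral_le integrable_add integrable_const_ivl) (auto simp: g_def)
      also have "\<dots> = integral {u..v} g + real n * (v - u)"
        using gi' K' by (subst integral_add) (auto simp: integrable_const_ivl)
      finally show "norm (integral {a..Sup K} f - integral {a..Inf K} f) \<le> integral K g + real n * (Sup K - Inf K)"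
        using K' by simp
    qed
    have "(g has_integral (\<Sum>K\<in>D. integral K g)) (\<Union>D)"
      by (rule has_integral_combine_division[OF D(1) gK])
    then have sumg: "(\<Sum>K\<in>D. integral K g) = integral (\<Union>D) g" "g integrable_on \<Union>D"
      by (auto simp: integral_unique)
    have "integral (\<Union>D) g \<le> integral {a..b} g"
      using sumg(2) gi g0 D(2) by (intro integral_subset_le) auto
    then have 1: "(\<Sum>K\<in>D. integral K g) < e/2" using n(2) sumg(1) unfolding g_def by linarith
    have "(\<Sum>K\<in>D. norm (integral {a..Sup K} f - integral {a..Inf K} f)) \<le> (\<Sum>K\<in>D. integral K g + real n * (Sup K - Inf K))"
      by (rule sum_mono[OF bound])
    also have "\<dots> = (\<Sum>K\<in>D. integral K g) + real n * (\<Sum>K\<in>D. Sup K - Inf K)"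
      by (simp add: sum.distrib sum_distrib_left)
    also have "real n * (\<Sum>K\<in>D. Sup K - Inf K) \<le> (real n + 1) * (\<Sum>K\<in>D. Sup K - Inf K)"
      using len0 by (intro mult_right_mono sum_nonneg) auto
    also have "\<dots> < (real n + 1) * (e / (2 * (real n + 1)))"
      using D(3) by (intro mult_strict_left_mono) auto
    also have "\<dots> = e/2" by (simp add: field_simps)
    finally show ?thesis using 1 by linarith
  qed
  show "\<exists>d>0. \<forall>D. D division_of \<Union>D \<and> \<Union>D \<subseteq> {a..b} \<and> (\<Sum>K\<in>D. Sup K - Inf K) < d \<longrightarrow>
      (\<Sum>K\<in>D. norm (integral {a..Sup K} f - integral {a..Inf K} f)) < e"
    by (rule exI[of _ "e / (2 * (real n + 1))"], intro conjI allI impI, use \<open>e > 0\<close> in simp, elim conjE, rule key)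
qed

text \<open>The common route by which absolute continuity is transferred: products, bounded linear
  images, sums, exponentials and Lipschitz functions all have increments dominated by increments of
  known functions.\<close>

lemma abs_continuousI_dominated:
  assumes f: "abs_continuous_on_interval a b f" and g: "abs_continuous_on_interval a b g"
    and AB: "A \<ge> 0" "B \<ge> 0"
    and le: "\<And>x y. \<lbrakk>x \<in> {a..b}; y \<in> {a..b}\<rbrakk> \<Longrightarrow> norm (h x - h y) \<le> A * norm (f x - f y) + B * norm (g x - g y)"
  shows "abs_continuous_on_interval a b h"
  unfolding abs_continuous_on_interval_def
proof (intro allI impI)
  fix e :: real assume e: "e > 0"
  \<comment> \<open>\<open>A + 1\<close> and \<open>B + 1\<close> keep the denominators positive
    when \<open>A\<close> or \<open>B\<close> is 0.\<close>
  have eA: "e / (2 * (A + 1)) > 0" and eB: "e / (2 * (B + 1)) > 0" using e AB by simp_all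
  obtain d1 where d1: "d1 > 0" and f1: "\<forall>D. D division_of \<Union>D \<and> \<Union>D \<subseteq> {a..b} \<and> (\<Sum>K\<in>D. Sup K - Inf K) < d1 \<longrightarrow>
      (\<Sum>K\<in>D. norm (f (Sup K) - f (Inf K))) < e / (2 * (A + 1))"
    using f[unfolded abs_continuous_on_interval_def, rule_format, OF eA] by (elim exE conjE)
  obtain d2 where d2: "d2 > 0" and g1: "\<forall>D. D division_of \<Union>D \<and> \<Union>D \<subseteq> {a..b} \<and> (\<Sum>K\<in>D. Sup K - Inf K) < d2 \<longrightarrow>
      (\<Sum>K\<in>D. norm (g (Sup K) - g (Inf K))) < e / (2 * (B + 1))"
    using g[unfolded abs_continuous_on_interval_def, rule_format, OF eB] by (elim exE conjE)
  show "\<exists>d>0. \<forall>D. D division_of \<Union>D \<and> \<Union>D \<subseteq> {a..b} \<and> (\<Sum>K\<in>D. Sup K - Inf K) < d \<longrightarrow>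
      (\<Sum>K\<in>D. norm (h (Sup K) - h (Inf K))) < e"
  proof (rule exI[of _ "min d1 d2"], intro conjI allI impI)
    show "0 < min d1 d2" using d1 d2 by simp
  next
    fix D assume D: "D division_of \<Union>D \<and> \<Union>D \<subseteq> {a..b} \<and> (\<Sum>K\<in>D. Sup K - Inf K) < min d1 d2"
    have F: "(\<Sum>K\<in>D. norm (f (Sup K) - f (Inf K))) < e / (2 * (A + 1))" using f1 D by simp
    have G: "(\<Sum>K\<in>D. norm (g (Sup K) - g (Inf K))) < e / (2 * (B + 1))" using g1 D by simp
    have ends: "Sup K \<in> {a..b} \<and> Inf K \<in> {a..b}" if K: "K \<in> D" for K
    proof -
      have Dd: "D division_of \<Union>D" using D by simp
      obtain u v where uv: "K = cbox u v" using division_ofD(4)[OF Dd K] by auto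
      have "K \<noteq> {}" using division_ofD(3)[OF Dd K] .
      then have K': "K = {u..v}" "u \<le> v" using uv by auto
      have "K \<subseteq> {a..b}" using D K by auto
      then show ?thesis using K' by auto
    qed
    have "(\<Sum>K\<in>D. norm (h (Sup K) - h (Inf K))) \<le> (\<Sum>K\<in>D. A * norm (f (Sup K) - f (Inf K)) + B * norm (g (Sup K) - g (Inf K)))"
      by (intro sum_mono le) (use ends in auto)
    also have "\<dots> = A * (\<Sum>K\<in>D. norm (f (Sup K) - f (Inf K))) + B * (\<Sum>K\<in>D. norm (g (Sup K) - g (Inf K)))"
      by (simp add: sum.distrib sum_distrib_left)
    also have "\<dots> \<le> (A + 1) * (\<Sum>K\<in>D. norm (f (Sup K) - f (Inf K))) + (B + 1) * (\<Sum>K\<in>D. norm (g (Sup K) - g (Inf K)))"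
      by (intro add_mono mult_right_mono sum_nonneg) auto
    also have "\<dots> < (A + 1) * (e / (2 * (A + 1))) + (B + 1) * (e / (2 * (B + 1)))"
      using F G AB by (intro add_strict_mono mult_strict_left_mono) auto
    also have "\<dots> = e"
    proof -
      have aux: "p * (e / (2 * p)) = e / 2" if "p > 0" for p using that by simp
      have 1: "(A + 1) * (e / (2 * (A + 1))) = e / 2" and 2: "(B + 1) * (e / (2 * (B + 1))) = e / 2"
        by (rule aux, use AB in simp)+
      show ?thesis unfolding 1 2 by simp
    qed
    finally show "(\<Sum>K\<in>D. norm (h (Sup K) - h (Inf K))) < e" .
  qed
qed

lemma abs_continuous_ident: "abs_continuous_on_interval a b (\<lambda>x::real. x)"
  unfolding abs_continuous_on_interval_def
proof (intro allI impI)
  fix e :: real assume e: "e > 0"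
  have "(\<Sum>K\<in>D. norm (Sup K - Inf K)) < e"
    if D: "D division_of \<Union>D \<and> \<Union>D \<subseteq> {a..b} \<and> (\<Sum>K\<in>D. Sup K - Inf K) < e" for D :: "real set set"
  proof -
    have "norm (Sup K - Inf K) = Sup K - Inf K" if K: "K \<in> D" for K
    proof -
      have Dd: "D division_of \<Union>D" using D by simp
      obtain u v where uv: "K = cbox u v" using division_ofD(4)[OF Dd K] by auto
      have "K \<noteq> {}" using division_ofD(3)[OF Dd K] .
      then show ?thesis using uv by auto
    qed
    then have "(\<Sum>K\<in>D. norm (Sup K - Inf K)) = (\<Sum>K\<in>D. Sup K - Inf K)" by (intro sum.cong) auto
    then show ?thesis using D by simp
  qed
  then show "\<exists>d>0. \<forall>D. D division_of \<Union>D \<and> \<Union>D \<subseteq> {a..b} \<and> (\<Sum>K\<in>D. Sup K - Inf K) < d \<longrightarrow> (\<Sum>K\<in>D. norm (Sup K - Inf K :: real)) < e"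
    using e by (intro exI[of _ e]) simp
qed

lemma abs_continuous_lipschitz:
  assumes "B \<ge> 0" "\<And>x y. \<lbrakk>x \<in> {a..b}; y \<in> {a..b}\<rbrakk> \<Longrightarrow> norm (h x - h y) \<le> B * \<bar>x - y\<bar>"
  shows "abs_continuous_on_interval a b h"
  by (rule abs_continuousI_dominated[OF abs_continuous_ident abs_continuous_ident, of 0 B]) (use assms in auto)

lemma abs_continuous_subinterval:
  assumes "abs_continuous_on_interval a b f" "a \<le> s" "t \<le> b"
  shows "abs_continuous_on_interval s t f"
proof -
  have "{s..t} \<subseteq> {a..b}" using assms by auto
  then show ?thesis using assms(1) unfolding abs_continuous_on_interval_def by (meson order_trans)
qed

lemma abs_continuous_imp_continuous:
  assumes "abs_continuous_on_interval a b f"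
  shows "continuous_on {a..b} f"
  unfolding continuous_on_iff
proof (intro ballI allI impI)
  fix x e :: real assume x: "x \<in> {a..b}" and e: "e > 0"
  obtain d where d: "d > 0" and f1: "\<forall>D. D division_of \<Union>D \<and> \<Union>D \<subseteq> {a..b} \<and> (\<Sum>K\<in>D. Sup K - Inf K) < d \<longrightarrow>
      (\<Sum>K\<in>D. norm (f (Sup K) - f (Inf K))) < e"
    using assms[unfolded abs_continuous_on_interval_def, rule_format, OF e] by (elim exE conjE)
  have "dist (f y) (f x) < e" if y: "y \<in> {a..b}" "dist y x < d" for y
  proof -
    have div: "{{min x y..max x y}} division_of \<Union>{{min x y..max x y}}"
      using division_of_self[of "min x y" "max x y"] by auto
    have "(\<Sum>K\<in>{{min x y..max x y}}. norm (f (Sup K) - f (Inf K))) < e"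
      by (rule f1[rule_format], intro conjI, rule div) (use x y in \<open>auto simp: dist_real_def\<close>)
    then have "norm (f (max x y) - f (min x y)) < e" by simp
    then show ?thesis by (cases "x \<le> y") (auto simp: dist_norm norm_minus_commute min_def max_def)
  qed
  then show "\<exists>d>0. \<forall>y\<in>{a..b}. dist y x < d \<longrightarrow> dist (f y) (f x) < e" using d by (intro exI[of _ d]) simp
qed

lemma abs_continuous_bounded:
  fixes f :: "real \<Rightarrow> 'a::real_normed_vector"
  assumes "abs_continuous_on_interval a b f"
  obtains B where "B > 0" "\<And>x. x \<in> {a..b} \<Longrightarrow> norm (f x) \<le> B"
proof -
  have "compact (f ` {a..b})" using abs_continuous_imp_continuous[OF assms] by (intro compact_continuous_image) auto
  then have "bounded (f ` {a..b})" by (rule compact_imp_bounded)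
  then show ?thesis using that unfolding bounded_pos by auto
qed

subsection \<open>Calculus of absolutely continuous functions\<close>

text \<open>The derivative \<open>g\<close> is an argument that counts only up to null sets, so that
  an equation with \<open>L\<^sub>2\<close> coefficients becomes a single statement of this kind.
  Integrability of \<open>g\<close> follows, see \<open>ac_deriv_has_integral\<close>.\<close>

definition ac_deriv :: "real \<Rightarrow> real \<Rightarrow> (real \<Rightarrow> 'a::real_normed_vector) \<Rightarrow> (real \<Rightarrow> 'a) \<Rightarrow> bool" where
  "ac_deriv a b f g \<longleftrightarrow> abs_continuous_on_interval a b f \<and>
     (\<exists>N. negligible N \<and> (\<forall>x\<in>{a<..<b} - N. (f has_vector_derivative g x) (at x)))"

lemma ac_derivI:
  assumes "abs_continuous_on_interval a b f" "negligible N"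
    "\<And>x. x \<in> {a<..<b} - N \<Longrightarrow> (f has_vector_derivative g x) (at x)"
  shows "ac_deriv a b f g"
  using assms unfolding ac_deriv_def by blast

lemma ac_derivE:
  assumes "ac_deriv a b f g"
  obtains N where "abs_continuous_on_interval a b f" "negligible N"
    "\<And>x. x \<in> {a<..<b} - N \<Longrightarrow> (f has_vector_derivative g x) (at x)"
  using assms unfolding ac_deriv_def by blast

lemma ac_deriv_abs_continuous: "ac_deriv a b f g \<Longrightarrow> abs_continuous_on_interval a b f"
  unfolding ac_deriv_def by simp

lemma ac_deriv_continuous: "ac_deriv a b f g \<Longrightarrow> continuous_on {a..b} f"
  by (rule abs_continuous_imp_continuous[OF ac_deriv_abs_continuous])

lemma ac_deriv_has_integral:
  fixes f :: "real \<Rightarrow> 'a::real_normed_vector"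
  assumes "ac_deriv a b f g" "a \<le> s" "s \<le> t" "t \<le> b"
  shows "(g has_integral (f t - f s)) {s..t}"
proof -
  obtain N where N: "abs_continuous_on_interval a b f" "negligible N"
    "\<And>x. x \<in> {a<..<b} - N \<Longrightarrow> (f has_vector_derivative g x) (at x)"
    using assms(1) by (rule ac_derivE) (rule that, assumption+)
  show ?thesis
    by (rule abs_continuous_fundamental_theorem[OF assms(3) abs_continuous_subinterval[OF N(1) assms(2,4)] N(2) N(3)])
       (use assms in auto)
qed

lemma ac_deriv_ae_cong:
  assumes "ac_deriv a b f g" "negligible M" "\<And>x. x \<in> {a<..<b} - M \<Longrightarrow> g x = g' x"
  shows "ac_deriv a b f g'"
proof -
  obtain N where N: "abs_continuous_on_interval a b f" "negligible N"
    "\<And>x. x \<in> {a<..<b} - N \<Longrightarrow> (f has_vector_derivative g x) (at x)"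
    using assms(1) by (rule ac_derivE) (rule that, assumption+)
  show ?thesis
  proof (rule ac_derivI[OF N(1), of "N \<union> M"])
    show "negligible (N \<union> M)" using N(2) assms(2) by simp
    fix x assume x: "x \<in> {a<..<b} - (N \<union> M)"
    have "(f has_vector_derivative g x) (at x)" using x by (intro N(3)) auto
    moreover have "g x = g' x" using x by (intro assms(3)) auto
    ultimately show "(f has_vector_derivative g' x) (at x)" by simp
  qed
qed

lemma ac_deriv_cong:
  assumes "ac_deriv a b f g" "\<And>x. x \<in> {a<..<b} \<Longrightarrow> g x = g' x"
  shows "ac_deriv a b f g'"
  by (rule ac_deriv_ae_cong[OF assms(1), of "{}"]) (use assms(2) in auto)

lemma ac_deriv_integral:
  fixes f :: "real \<Rightarrow> 'a::euclidean_space"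
  assumes "f integrable_on {a..b}" "h integrable_on {a..b}" "\<And>x. x \<in> {a..b} \<Longrightarrow> norm (f x) \<le> h x"
  shows "ac_deriv a b (\<lambda>x. integral {a..x} f) f"
proof -
  obtain N where N: "negligible N"
    "\<And>x. x \<in> {a<..<b} - N \<Longrightarrow> ((\<lambda>x. integral {a..x} f) has_vector_derivative f x) (at x)"
    by (rule indefinite_integral_has_derivative_ae[OF assms(1)]) (rule that, assumption+)
  show ?thesis by (rule ac_derivI[OF abs_continuous_indefinite_integral[OF assms] N])
qed

text \<open>Stated for an arbitrary bounded bilinear product because it serves real products, inner
  products, matrix products and \<open>cscale\<close> alike.\<close>

lemma ac_deriv_bilinear:
  assumes bil: "bounded_bilinear pr" and f: "ac_deriv a b f f'" and g: "ac_deriv a b g g'"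
  shows "ac_deriv a b (\<lambda>x. pr (f x) (g x)) (\<lambda>x. pr (f x) (g' x) + pr (f' x) (g x))"
proof -
  interpret bounded_bilinear pr by fact
  obtain N where N: "abs_continuous_on_interval a b f" "negligible N"
    "\<And>x. x \<in> {a<..<b} - N \<Longrightarrow> (f has_vector_derivative f' x) (at x)"
    using f by (rule ac_derivE) (rule that, assumption+)
  obtain M where M: "abs_continuous_on_interval a b g" "negligible M"
    "\<And>x. x \<in> {a<..<b} - M \<Longrightarrow> (g has_vector_derivative g' x) (at x)"
    using g by (rule ac_derivE) (rule that, assumption+)
  obtain A where A: "A > 0" "\<And>x. x \<in> {a..b} \<Longrightarrow> norm (f x) \<le> A" by (rule abs_continuous_bounded[OF N(1)]) (rule that, assumption+)
  obtain B where B: "B > 0" "\<And>x. x \<in> {a..b} \<Longrightarrow> norm (g x) \<le> B" by (rule abs_continuous_bounded[OF M(1)]) (rule that, assumption+)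
  obtain K where K: "K > 0" "\<And>u v. norm (pr u v) \<le> norm u * norm v * K" using pos_bounded by auto
  show ?thesis
  proof (rule ac_derivI[of _ _ _ "N \<union> M"])
    show "negligible (N \<union> M)" using N M by simp
    show "((\<lambda>x. pr (f x) (g x)) has_vector_derivative pr (f x) (g' x) + pr (f' x) (g x)) (at x)"
      if "x \<in> {a<..<b} - (N \<union> M)" for x
      using that by (intro bounded_bilinear.has_vector_derivative[OF bil] N(3) M(3)) auto
    show "abs_continuous_on_interval a b (\<lambda>x. pr (f x) (g x))"
    proof (rule abs_continuousI_dominated[OF N(1) M(1), of "B * K" "A * K"])
      fix x y assume xy: "x \<in> {a..b}" "y \<in> {a..b}"
      have "pr (f x) (g x) - pr (f y) (g y) = pr (f x - f y) (g x) + pr (f y) (g x - g y)"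
        by (simp add: diff_left diff_right)
      then have "norm (pr (f x) (g x) - pr (f y) (g y)) \<le> norm (pr (f x - f y) (g x)) + norm (pr (f y) (g x - g y))"
        by (metis norm_triangle_ineq)
      also have "norm (pr (f x - f y) (g x)) \<le> norm (f x - f y) * B * K"
        using K B(2)[OF xy(1)] by (intro order_trans[OF K(2)] mult_right_mono mult_left_mono) auto
      also have "norm (pr (f y) (g x - g y)) \<le> A * norm (g x - g y) * K"
        using K A(2)[OF xy(2)] by (intro order_trans[OF K(2)] mult_right_mono) auto
      finally show "norm (pr (f x) (g x) - pr (f y) (g y)) \<le> B * K * norm (f x - f y) + A * K * norm (g x - g y)"
        by (simp add: mult_ac)
    qed (use A B K in auto)
  qed
qed

lemma ac_deriv_linear:
  assumes lin: "bounded_linear L" and f: "ac_deriv a b f f'"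
  shows "ac_deriv a b (\<lambda>x. L (f x)) (\<lambda>x. L (f' x))"
proof -
  interpret bounded_linear L by fact
  obtain N where N: "abs_continuous_on_interval a b f" "negligible N"
    "\<And>x. x \<in> {a<..<b} - N \<Longrightarrow> (f has_vector_derivative f' x) (at x)"
    using f by (rule ac_derivE) (rule that, assumption+)
  obtain K where K: "K > 0" "\<And>u. norm (L u) \<le> norm u * K" using pos_bounded by auto
  show ?thesis
  proof (rule ac_derivI[OF _ N(2)])
    show "((\<lambda>x. L (f x)) has_vector_derivative L (f' x)) (at x)" if "x \<in> {a<..<b} - N" for x
      by (rule bounded_linear.has_vector_derivative[OF lin N(3)[OF that]])
    show "abs_continuous_on_interval a b (\<lambda>x. L (f x))"
      by (rule abs_continuousI_dominated[OF N(1) N(1), of K 0])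
         (use K(1) K(2)[of "f _ - f _"] in \<open>auto simp: diff mult.commute\<close>)
  qed
qed

lemma ac_deriv_add:
  assumes f: "ac_deriv a b f f'" and g: "ac_deriv a b g g'"
  shows "ac_deriv a b (\<lambda>x. f x + g x) (\<lambda>x. f' x + g' x)"
proof -
  obtain N where N: "abs_continuous_on_interval a b f" "negligible N"
    "\<And>x. x \<in> {a<..<b} - N \<Longrightarrow> (f has_vector_derivative f' x) (at x)"
    using f by (rule ac_derivE) (rule that, assumption+)
  obtain M where M: "abs_continuous_on_interval a b g" "negligible M"
    "\<And>x. x \<in> {a<..<b} - M \<Longrightarrow> (g has_vector_derivative g' x) (at x)"
    using g by (rule ac_derivE) (rule that, assumption+)
  show ?thesis
  proof (rule ac_derivI[of _ _ _ "N \<union> M"])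
    show "negligible (N \<union> M)" using N M by simp
    show "((\<lambda>x. f x + g x) has_vector_derivative f' x + g' x) (at x)" if "x \<in> {a<..<b} - (N \<union> M)" for x
      using that by (intro has_vector_derivative_add N(3) M(3)) auto
    have "norm (f x + g x - (f y + g y)) \<le> norm (f x - f y) + norm (g x - g y)" for x y
      by (metis add_diff_add norm_triangle_ineq)
    then show "abs_continuous_on_interval a b (\<lambda>x. f x + g x)"
      by (intro abs_continuousI_dominated[OF N(1) M(1), of 1 1]) auto
  qed
qed

lemma ac_deriv_minus:
  assumes "ac_deriv a b f f'"
  shows "ac_deriv a b (\<lambda>x. - f x) (\<lambda>x. - f' x)"
  by (rule ac_deriv_linear[OF bounded_linear_minus[OF bounded_linear_ident] assms])

lemma ac_deriv_diff:
  assumes f: "ac_deriv a b f f'" and g: "ac_deriv a b g g'"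
  shows "ac_deriv a b (\<lambda>x. f x - g x) (\<lambda>x. f' x - g' x)"
  using ac_deriv_add[OF f ac_deriv_minus[OF g]] by simp

lemma ac_deriv_smooth:
  fixes f :: "real \<Rightarrow> 'a::real_normed_vector"
  assumes d: "\<And>x. x \<in> {a..b} \<Longrightarrow> (f has_vector_derivative f' x) (at x)" and B: "\<And>x. x \<in> {a..b} \<Longrightarrow> norm (f' x) \<le> B"
  shows "ac_deriv a b f f'"
proof (rule ac_derivI[of _ _ _ "{}"])
  show "abs_continuous_on_interval a b f"
  proof (rule abs_continuous_lipschitz[of "max B 0"])
    fix x y assume xy: "x \<in> {a..b}" "y \<in> {a..b}"
    have "norm (f x - f y) \<le> max B 0 * norm (x - y)"
    proof (rule differentiable_bound[of "{a..b}" f "\<lambda>z h. h *\<^sub>R f' z"])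
      show "(f has_derivative (\<lambda>h. h *\<^sub>R f' z)) (at z within {a..b})" if "z \<in> {a..b}" for z
        using d[OF that] unfolding has_vector_derivative_def by (rule has_derivative_at_withinI)
      show "onorm (\<lambda>h. h *\<^sub>R f' z) \<le> max B 0" if "z \<in> {a..b}" for z
      proof (rule onorm_bound)
        show "norm (h *\<^sub>R f' z) \<le> max B 0 * norm h" for h
          using mult_right_mono[of "norm (f' z)" "max B 0" "norm h"] B[OF that] by (simp add: mult.commute)
      qed simp
    qed (use xy in auto)
    then show "norm (f x - f y) \<le> max B 0 * \<bar>x - y\<bar>" by simp
  qed simp
qed (use d in auto)

lemma ac_deriv_const: "ac_deriv a b (\<lambda>x. c) (\<lambda>x. 0)"
  by (rule ac_deriv_smooth[of _ _ _ _ 0]) auto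

text \<open>\<open>exp\<close> is not globally Lipschitz, but \<open>p\<close> is bounded by some
  \<open>A\<close>, and on \<open>[-A, A]\<close> the constant \<open>exp A\<close> serves.\<close>

lemma ac_deriv_exp:
  fixes p :: "real \<Rightarrow> real"
  assumes p: "ac_deriv a b p p'"
  shows "ac_deriv a b (\<lambda>x. exp (p x)) (\<lambda>x. exp (p x) * p' x)"
proof -
  obtain N where N: "abs_continuous_on_interval a b p" "negligible N"
    "\<And>x. x \<in> {a<..<b} - N \<Longrightarrow> (p has_vector_derivative p' x) (at x)"
    using p by (rule ac_derivE) (rule that, assumption+)
  obtain A where A: "A > 0" "\<And>x. x \<in> {a..b} \<Longrightarrow> norm (p x) \<le> A" by (rule abs_continuous_bounded[OF N(1)]) (rule that, assumption+)
  show ?thesis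
  proof (rule ac_derivI[OF _ N(2)])
    show "((\<lambda>x. exp (p x)) has_vector_derivative exp (p x) * p' x) (at x)" if "x \<in> {a<..<b} - N" for x
    proof -
      have "(p has_real_derivative p' x) (at x)" using N(3)[OF that] by (simp add: has_real_derivative_iff_has_vector_derivative)
      then have "((\<lambda>x. exp (p x)) has_real_derivative exp (p x) * p' x) (at x)" by (rule DERIV_fun_exp)
      then show ?thesis by (simp add: has_real_derivative_iff_has_vector_derivative)
    qed
    have lip: "norm (exp u - exp v :: real) \<le> exp A * norm (u - v)" if "u \<in> {-A..A}" "v \<in> {-A..A}" for u v
    proof (rule field_differentiable_bound[of "{-A..A}" exp exp])
      show "(exp has_field_derivative exp z) (at z within {-A..A})" for z :: real
        by (rule DERIV_subset[OF DERIV_exp]) simp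
    qed (use that in auto)
    show "abs_continuous_on_interval a b (\<lambda>x. exp (p x))"
    proof (rule abs_continuousI_dominated[OF N(1) N(1), of "exp A" 0])
      fix x y assume "x \<in> {a..b}" "y \<in> {a..b}"
      then have "p x \<in> {-A..A}" "p y \<in> {-A..A}" using A(2)[of x] A(2)[of y] by (auto simp: abs_le_iff)
      from lip[OF this] show "norm (exp (p x) - exp (p y)) \<le> exp A * norm (p x - p y) + 0 * norm (p x - p y)" by simp
    qed auto
  qed
qed

lemma ac_deriv_mono:
  fixes f g :: "real \<Rightarrow> real"
  assumes f: "ac_deriv a b f f'" and g: "ac_deriv a b g g'"
    and le: "\<And>x. x \<in> {a<..<b} \<Longrightarrow> f' x \<le> g' x" and st: "a \<le> s" "s \<le> t" "t \<le> b"
  shows "f t - f s \<le> g t - g s"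
proof -
  have 1: "(f' has_integral (f t - f s)) {s..t}" using f st by (rule ac_deriv_has_integral)
  have 2: "(g' has_integral (g t - g s)) {s..t}" using g st by (rule ac_deriv_has_integral)
  \<comment> \<open>Both derivatives are set to 0 at the endpoints, where the inequality is not
    assumed.\<close>
  have n: "negligible {a, b}" by simp
  have "((\<lambda>x. if x \<in> {a,b} then 0 else f' x) has_integral (f t - f s)) {s..t}"
    by (rule has_integral_spike[OF n _ 1]) auto
  moreover have "((\<lambda>x. if x \<in> {a,b} then 0 else g' x) has_integral (g t - g s)) {s..t}"
    by (rule has_integral_spike[OF n _ 2]) auto
  ultimately show ?thesis by (rule has_integral_le) (use le st in auto)
qed

lemma ac_deriv_norm_le:
  fixes f :: "real \<Rightarrow> 'a::euclidean_space"
  assumes f: "ac_deriv a b f f'" and g: "ac_deriv a b g g'"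
    and le: "\<And>x. x \<in> {a<..<b} \<Longrightarrow> norm (f' x) \<le> g' x" and st: "a \<le> s" "s \<le> t" "t \<le> b"
  shows "norm (f t - f s) \<le> g t - g s"
proof -
  have 1: "(f' has_integral (f t - f s)) {s..t}" using f st by (rule ac_deriv_has_integral)
  have 2: "(g' has_integral (g t - g s)) {s..t}" using g st by (rule ac_deriv_has_integral)
  have n: "negligible {a, b}" by simp
  have 3: "((\<lambda>x. if x \<in> {a,b} then 0 else f' x) has_integral (f t - f s)) {s..t}"
    by (rule has_integral_spike[OF n _ 1]) auto
  have 4: "((\<lambda>x. if x \<in> {a,b} then 0 else g' x) has_integral (g t - g s)) {s..t}"
    by (rule has_integral_spike[OF n _ 2]) auto
  have "norm (integral {s..t} (\<lambda>x. if x \<in> {a,b} then 0 else f' x)) \<le> integral {s..t} (\<lambda>x. if x \<in> {a,b} then 0 else g' x)"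
    using 3 4 le st by (intro integral_norm_bound_integral) (auto simp: has_integral_integrable)
  then show ?thesis using 3 4 by (simp add: integral_unique)
qed

lemma ac_deriv_zero_const:
  fixes f :: "real \<Rightarrow> 'a::euclidean_space"
  assumes f: "ac_deriv a b f (\<lambda>x. 0)" and st: "s \<in> {a..b}" "t \<in> {a..b}"
  shows "f s = f t"
proof -
  have "f v = f u" if "u \<le> v" "a \<le> u" "v \<le> b" for u v
  proof -
    have "((\<lambda>x. 0) has_integral (f v - f u)) {u..v}" using f that by (intro ac_deriv_has_integral)
    then show ?thesis using has_integral_unique[OF has_integral_0] by force
  qed
  then show ?thesis using st by (cases "s \<le> t") (auto simp: not_le)
qed

text \<open>All integrals of \<open>g\<close> from \<open>a\<close> vanish, and by continuity they
  have derivative \<open>g\<close> within the closed interval. Hence \<open>g\<close> vanishes at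
  every point, including the endpoints, where initial values are read off.\<close>

lemma ac_deriv_zero_fun_continuous:
  fixes f :: "real \<Rightarrow> 'a::euclidean_space"
  assumes f: "ac_deriv a b f g" and z: "\<And>x. x \<in> {a..b} \<Longrightarrow> f x = 0" and ab: "a < b" and c: "continuous_on {a..b} g"
    and t: "t \<in> {a..b}"
  shows "g t = 0"
proof -
  have i: "integral {a..x} g = 0" if x: "x \<in> {a..b}" for x
  proof -
    have "(g has_integral (f x - f a)) {a..x}" using x by (intro ac_deriv_has_integral[OF f]) auto
    then show ?thesis using z[of x] z[of a] x ab by (auto simp: integral_unique)
  qed
  have d1: "((\<lambda>u. integral {a..u} g) has_vector_derivative g t) (at t within {a..b})"
    by (rule integral_has_vector_derivative[OF c t])
  have d2: "((\<lambda>u. integral {a..u} g) has_vector_derivative 0) (at t within {a..b})"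
    by (rule has_vector_derivative_transform[of t "{a..b}" _ "\<lambda>_. 0"]) (use i t in auto)
  show ?thesis
    by (rule vector_derivative_unique_within_closed_interval[of a b t, OF _ _ d1[folded cbox_interval] d2[folded cbox_interval]]) (use ab t in auto)
qed

text \<open>Compares \<open>E x * exp (- P x)\<close> with \<open>c * x\<close>: the derivative of
  the exponential absorbs the term \<open>p x * E x\<close>, and the exponential is at most 1
  because \<open>P\<close> increases from 0.\<close>

lemma gronwall:
  fixes E P :: "real \<Rightarrow> real"
  assumes E: "ac_deriv a b E E'" and P: "ac_deriv a b P p" and c: "c \<ge> 0"
    and P0: "P a = 0" and p0: "\<And>x. x \<in> {a<..<b} \<Longrightarrow> 0 \<le> p x"
    and le: "\<And>x. x \<in> {a<..<b} \<Longrightarrow> E' x \<le> p x * E x + c" and t: "t \<in> {a..b}"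
  shows "E t \<le> (E a + c * (t - a)) * exp (P t)"
proof -
  have ab: "a \<le> a" "a \<le> t" "t \<le> b" using t by auto
  have "ac_deriv a b (\<lambda>x. exp (- P x)) (\<lambda>x. exp (- P x) * - p x)"
    by (rule ac_deriv_exp[OF ac_deriv_minus[OF P]])
  from ac_deriv_bilinear[OF bounded_bilinear_mult E this]
  have F: "ac_deriv a b (\<lambda>x. E x * exp (- P x)) (\<lambda>x. E x * (exp (- P x) * - p x) + E' x * exp (- P x))" .
  have P_pos: "0 \<le> P x" if "x \<in> {a<..<b}" for x
    using ac_deriv_mono[OF ac_deriv_const[of a b "0::real"] P p0, of a x] that P0 by auto
  have G: "ac_deriv a b (\<lambda>x. c * x) (\<lambda>x. c)"
    by (rule ac_deriv_smooth[of _ _ _ _ "\<bar>c\<bar>"]) (auto intro!: derivative_eq_intros)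
  have "E t * exp (- P t) - E a * exp (- P a) \<le> c * t - c * a"
  proof (rule ac_deriv_mono[OF F G _ ab])
    fix x assume x: "x \<in> {a<..<b}"
    have "E x * (exp (- P x) * - p x) + E' x * exp (- P x) = (E' x - p x * E x) * exp (- P x)"
      by (simp add: algebra_simps)
    also have "\<dots> \<le> c * exp (- P x)" using le[OF x] by (intro mult_right_mono) auto
    also have "\<dots> \<le> c * 1" using P_pos[OF x] c by (intro mult_left_mono) auto
    finally show "E x * (exp (- P x) * - p x) + E' x * exp (- P x) \<le> c" by simp
  qed
  then have "E t * exp (- P t) \<le> E a + c * (t - a)" using P0 by (simp add: algebra_simps)
  then have "E t * exp (- P t) * exp (P t) \<le> (E a + c * (t - a)) * exp (P t)" by (intro mult_right_mono) auto
  then show ?thesis by (simp add: mult.assoc flip: exp_add)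
qed

subsection \<open>Linear systems with integrable coefficients\<close>

text \<open>Measurability is assumed for \<open>A t v\<close> with fixed \<open>v\<close>; expanding
  \<open>f t\<close> in the Euclidean basis reduces the moving argument to finitely many fixed
  vectors.\<close>

lemma carathe_integrand:
  fixes A :: "real \<Rightarrow> 'e::euclidean_space \<Rightarrow> 'e"
  assumes lin: "\<And>t. linear (A t)"
    and meas: "\<And>v. (\<lambda>t. A t v) \<in> borel_measurable (lebesgue_on {a..b})"
    and bd: "\<And>t v. t \<in> {a..b} \<Longrightarrow> norm (A t v) \<le> q t * norm v"
    and q: "q integrable_on {a..b}" and q0: "\<And>t. t \<in> {a..b} \<Longrightarrow> 0 \<le> q t"
    and f: "continuous_on {a..b} f"
  shows "ac_deriv a b (\<lambda>x. integral {a..x} (\<lambda>t. A t (f t))) (\<lambda>t. A t (f t))"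
    and "(\<lambda>t. A t (f t)) integrable_on {a..b}"
proof -
  have "bounded (f ` {a..b})" using f by (intro compact_imp_bounded compact_continuous_image) auto
  then obtain B where B: "B > 0" "\<And>t. t \<in> {a..b} \<Longrightarrow> norm (f t) \<le> B" unfolding bounded_pos by auto
  have eq: "A t (f t) = (\<Sum>i\<in>Basis. (f t \<bullet> i) *\<^sub>R A t i)" for t
  proof -
    have "A t (f t) = A t (\<Sum>i\<in>Basis. (f t \<bullet> i) *\<^sub>R i)" by (simp add: euclidean_representation)
    also have "\<dots> = (\<Sum>i\<in>Basis. (f t \<bullet> i) *\<^sub>R A t i)"
      using lin[of t] by (simp add: linear_sum linear_scale)
    finally show ?thesis .
  qed
  have fm: "(\<lambda>t. f t \<bullet> i) \<in> borel_measurable (lebesgue_on {a..b})" for i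
    using f by (intro continuous_imp_measurable_on_sets_lebesgue continuous_intros) auto
  have m: "(\<lambda>t. A t (f t)) \<in> borel_measurable (lebesgue_on {a..b})"
    unfolding eq by (intro borel_measurable_sum borel_measurable_scaleR fm meas)
  have bd': "norm (A t (f t)) \<le> q t * B" if "t \<in> {a..b}" for t
    using order_trans[OF bd[OF that] mult_left_mono[OF B(2)[OF that] q0[OF that]]] .
  have qB: "(\<lambda>t. q t * B) integrable_on {a..b}" using q by (rule integrable_on_mult_left)
  show int: "(\<lambda>t. A t (f t)) integrable_on {a..b}"
    by (rule measurable_bounded_by_integrable_imp_integrable[OF m qB bd']) auto
  show "ac_deriv a b (\<lambda>x. integral {a..x} (\<lambda>t. A t (f t))) (\<lambda>t. A t (f t))"
    by (rule ac_deriv_integral[OF int qB bd'])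
qed

text \<open>Picard iteration on the whole interval at once. Measured against the weight
  \<open>exp (2 * Q x)\<close>, where \<open>Q\<close> is the integral of \<open>q\<close>, each
  step halves the increment, because the integral of \<open>q * exp (2 * Q)\<close> is at most half
  of \<open>exp (2 * Q)\<close>.\<close>

theorem caratheodory_linear_existence:
  fixes A :: "real \<Rightarrow> 'e::euclidean_space \<Rightarrow> 'e"
  assumes ab: "a \<le> b" and lin: "\<And>t. linear (A t)"
    and meas: "\<And>v. (\<lambda>t. A t v) \<in> borel_measurable (lebesgue_on {a..b})"
    and bd: "\<And>t v. t \<in> {a..b} \<Longrightarrow> norm (A t v) \<le> q t * norm v"
    and q: "q integrable_on {a..b}" and q0: "\<And>t. t \<in> {a..b} \<Longrightarrow> 0 \<le> q t"
  shows "\<exists>Z. Z a = z0 \<and> ac_deriv a b Z (\<lambda>t. A t (Z t))"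
proof -
  define K where "K = (\<lambda>f x. integral {a..x} (\<lambda>t. A t (f t)))"
  have Kac: "ac_deriv a b (K f) (\<lambda>t. A t (f t))" if "continuous_on {a..b} f" for f
    unfolding K_def by (rule carathe_integrand(1)[OF lin meas bd q q0 that])
  have Ka: "K f a = 0" for f unfolding K_def by simp
  \<comment> \<open>\<open>D n\<close> is the increment from the \<open>n\<close>-th Picard iterate
    to the next, so the solution is \<open>z0\<close> plus the sum of all
    \<open>D n\<close>.\<close>
  define D where "D = rec_nat (K (\<lambda>x. z0)) (\<lambda>n. K)"
  have D0: "D 0 = K (\<lambda>x. z0)" and DS: "D (Suc n) = K (D n)" for n unfolding D_def by simp_all
  have Dc: "continuous_on {a..b} (D n)" for n
    by (induction n) (auto simp: D0 DS intro!: ac_deriv_continuous[OF Kac])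
  define Q where "Q = (\<lambda>x. integral {a..x} q)"
  have Qac: "ac_deriv a b Q q" unfolding Q_def by (rule ac_deriv_integral[OF q q]) (use q0 in auto)
  have Q_0: "Q a = 0" unfolding Q_def by simp
  have Q0: "0 \<le> Q x" if "x \<in> {a..b}" for x
    using ac_deriv_mono[OF ac_deriv_const[of a b "0::real"] Qac, of a x] q0 that Q_0 by auto
  have QM: "Q x \<le> Q b" if "x \<in> {a..b}" for x
    using ac_deriv_mono[OF ac_deriv_const[of a b "0::real"] Qac, of x b] q0 that by auto
  have ac2Q: "ac_deriv a b (\<lambda>x. 2 * Q x) (\<lambda>x. 2 * q x)"
    by (rule ac_deriv_linear[OF bounded_linear_mult_right Qac])
  have acG: "ac_deriv a b (\<lambda>x. c * exp (2 * Q x)) (\<lambda>x. c * (exp (2 * Q x) * (2 * q x)))" for c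
    by (rule ac_deriv_linear[OF bounded_linear_mult_right ac_deriv_exp[OF ac2Q]])
  have Dbound: "norm (D n x) \<le> norm z0 / 2 ^ n * exp (2 * Q x)" if x: "x \<in> {a..b}" for n x
    using x
  proof (induction n arbitrary: x)
    case 0
    have "norm (K (\<lambda>x. z0) x - K (\<lambda>x. z0) a) \<le> norm z0 * exp (2 * Q x) - norm z0 * exp (2 * Q a)"
    proof (rule ac_deriv_norm_le[OF Kac[OF continuous_on_const] acG])
      fix t assume t: "t \<in> {a<..<b}"
      then have t': "t \<in> {a..b}" by auto
      have "norm (A t z0) \<le> q t * norm z0" by (rule bd[OF t'])
      also have "\<dots> \<le> (exp (2 * Q t) * (2 * q t)) * norm z0"
      proof (intro mult_right_mono)
        have "1 * q t \<le> (exp (2 * Q t) * 2) * q t"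
          using Q0[OF t'] q0[OF t'] by (intro mult_right_mono) (auto intro: order_trans[of 1 "exp (2 * Q t)"])
        then show "q t \<le> exp (2 * Q t) * (2 * q t)" by simp
      qed simp
      finally show "norm (A t z0) \<le> norm z0 * (exp (2 * Q t) * (2 * q t))" by (simp add: mult.commute)
    qed (use 0 in auto)
    then have "norm (K (\<lambda>x. z0) x) \<le> norm z0 * exp (2 * Q x) - norm z0" by (simp add: Ka Q_0)
    then show ?case using norm_ge_zero[of z0] unfolding D0 by (simp only: power_0 div_by_1)
  next
    case (Suc n)
    have "norm (K (D n) x - K (D n) a) \<le> norm z0 / 2 ^ Suc n * exp (2 * Q x) - norm z0 / 2 ^ Suc n * exp (2 * Q a)"
    proof (rule ac_deriv_norm_le[OF Kac[OF Dc] acG])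
      fix t assume t: "t \<in> {a<..<b}"
      then have t': "t \<in> {a..b}" by auto
      have "norm (A t (D n t)) \<le> q t * norm (D n t)" by (rule bd[OF t'])
      also have "\<dots> \<le> q t * (norm z0 / 2 ^ n * exp (2 * Q t))" by (rule mult_left_mono[OF Suc.IH[OF t'] q0[OF t']])
      finally show "norm (A t (D n t)) \<le> norm z0 / 2 ^ Suc n * (exp (2 * Q t) * (2 * q t))" by (simp add: mult_ac)
    qed (use Suc in auto)
    moreover have "0 \<le> norm z0 / 2 ^ Suc n * exp (2 * Q a)" by simp
    ultimately have "norm (K (D n) x) \<le> norm z0 / 2 ^ Suc n * exp (2 * Q x)" unfolding Ka diff_0_right by linarith
    then show ?case unfolding DS .
  qed
  define C where "C = norm z0 * exp (2 * Q b)"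
  have Dbound': "norm (D n x) \<le> C * (1/2) ^ n" if x: "x \<in> {a..b}" for n x
  proof -
    have "norm (D n x) \<le> norm z0 / 2 ^ n * exp (2 * Q x)" by (rule Dbound[OF x])
    also have "\<dots> \<le> norm z0 / 2 ^ n * exp (2 * Q b)" using QM[OF x] by (intro mult_left_mono) auto
    finally show ?thesis unfolding C_def by (simp add: power_divide mult_ac)
  qed
  have sumM: "summable (\<lambda>n. C * (1/2) ^ n)" by (intro summable_mult summable_geometric) simp
  define W where "W = (\<lambda>x. \<Sum>n. D n x)"
  have ul: "uniform_limit {a..b} (\<lambda>n x. \<Sum>i<n. D i x) W sequentially"
    unfolding W_def by (rule Weierstrass_m_test[OF Dbound' sumM])
  have Pc: "continuous_on {a..b} (\<lambda>x. \<Sum>i<n. D i x)" for n by (intro continuous_on_sum Dc)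
  have Wc: "continuous_on {a..b} W"
    by (rule uniform_limit_theorem[OF _ ul]) (use Pc in auto)
  define Z where "Z = (\<lambda>x. z0 + W x)"
  have Zc: "continuous_on {a..b} Z" unfolding Z_def by (intro continuous_intros Wc)
  \<comment> \<open>The integrand is linear in the unknown, so applying \<open>K\<close> to a
    partial sum shifts the sum by one index.\<close>
  have KS: "K (\<lambda>x. z0 + (\<Sum>i<n. D i x)) x = (\<Sum>i<Suc n. D i x)" if x: "x \<in> {a..b}" for n x
  proof -
    have int: "(\<lambda>t. A t (f t)) integrable_on {a..x}" if "continuous_on {a..b} f" for f
      by (rule integrable_on_subinterval[OF carathe_integrand(2)[OF lin meas bd q q0 that]]) (use x in auto)
    have "(\<lambda>t. A t (z0 + (\<Sum>i<n. D i t))) = (\<lambda>t. A t z0 + (\<Sum>i<n. A t (D i t)))"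
      using lin by (simp add: fun_eq_iff linear_add linear_sum)
    then have "K (\<lambda>x. z0 + (\<Sum>i<n. D i x)) x = integral {a..x} (\<lambda>t. A t z0 + (\<Sum>i<n. A t (D i t)))"
      unfolding K_def by simp
    also have "\<dots> = integral {a..x} (\<lambda>t. A t z0) + (\<Sum>i<n. integral {a..x} (\<lambda>t. A t (D i t)))"
      by (subst integral_add) (auto intro!: int Dc integrable_sum continuous_intros integral_sum)
    also have "\<dots> = D 0 x + (\<Sum>i<n. D (Suc i) x)" unfolding D0 DS K_def ..
    also have "\<dots> = (\<Sum>i<Suc n. D i x)" by (rule sum.lessThan_Suc_shift[symmetric])
    finally show ?thesis .
  qed
  have fixW: "W x = K Z x" if x: "x \<in> {a..b}" for x
  proof -
    have lim1: "(\<lambda>n. \<Sum>i<Suc n. D i x) \<longlonglongrightarrow> W x"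
      using tendsto_uniform_limitI[OF ul x] by (rule LIMSEQ_Suc)
    have "(\<lambda>n. K (\<lambda>x. z0 + (\<Sum>i<n. D i x)) x) \<longlonglongrightarrow> K Z x"
    proof (rule metric_LIMSEQ_I)
      fix r :: real assume r: "r > 0"
      \<comment> \<open>\<open>K\<close> magnifies uniform distances by at most \<open>Q b\<close>;
        the \<open>+ 1\<close> covers \<open>Q b = 0\<close>.\<close>
      define e where "e = r / (Q b + 1)"
      have Qb: "0 \<le> Q b" using Q0[of b] ab by auto
      then have e: "e > 0" unfolding e_def using r by simp
      obtain N where N: "\<forall>n\<ge>N. \<forall>x\<in>{a..b}. dist (\<Sum>i<n. D i x) (W x) < e"
        using uniform_limitD[OF ul e] unfolding eventually_sequentially by (elim exE)
      have "dist (K (\<lambda>x. z0 + (\<Sum>i<n. D i x)) x) (K Z x) < r" if n: "n \<ge> N" for n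
      proof -
        define S where "S = (\<lambda>x. z0 + (\<Sum>i<n. D i x))"
        have Sc: "continuous_on {a..b} S" unfolding S_def by (intro continuous_intros Dc)
        have "ac_deriv a b (\<lambda>x. K S x - K Z x) (\<lambda>t. A t (S t) - A t (Z t))"
          by (rule ac_deriv_diff[OF Kac[OF Sc] Kac[OF Zc]])
        moreover have "ac_deriv a b (\<lambda>x. e * Q x) (\<lambda>x. e * q x)"
          by (rule ac_deriv_linear[OF bounded_linear_mult_right Qac])
        ultimately have "norm (K S x - K Z x - (K S a - K Z a)) \<le> e * Q x - e * Q a"
        proof (rule ac_deriv_norm_le)
          fix t assume "t \<in> {a<..<b}"
          then have t': "t \<in> {a..b}" by auto
          have "norm (A t (S t) - A t (Z t)) = norm (A t (S t - Z t))" using lin[of t] by (simp add: linear_diff)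
          also have "\<dots> \<le> q t * norm (S t - Z t)" by (rule bd[OF t'])
          also have "\<dots> \<le> q t * e"
            using N[rule_format, OF n t'] q0[OF t'] unfolding S_def Z_def by (intro mult_left_mono) (auto simp: dist_norm)
          finally show "norm (A t (S t) - A t (Z t)) \<le> e * q t" by (simp add: mult.commute)
        qed (use x in auto)
        then have "norm (K S x - K Z x) \<le> e * Q x" by (simp add: Ka Q_0)
        also have "\<dots> \<le> e * Q b" using QM[OF x] e by (intro mult_left_mono) auto
        also have "\<dots> < e * (Q b + 1)" using e by simp
        also have "\<dots> = r" unfolding e_def using Qb by simp
        finally show ?thesis unfolding S_def by (simp add: dist_norm)
      qed
      then show "\<exists>N. \<forall>n\<ge>N. dist (K (\<lambda>x. z0 + (\<Sum>i<n. D i x)) x) (K Z x) < r" by (intro exI[of _ N]) simp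
    qed
    then have "(\<lambda>n. \<Sum>i<Suc n. D i x) \<longlonglongrightarrow> K Z x" unfolding KS[OF x] .
    with lim1 show ?thesis by (rule LIMSEQ_unique)
  qed
  define Z' where "Z' = (\<lambda>x. z0 + K Z x)"
  have ZZ': "Z t = Z' t" if "t \<in> {a..b}" for t unfolding Z'_def fixW[OF that, symmetric] by (simp add: Z_def)
  have "ac_deriv a b Z' (\<lambda>t. 0 + A t (Z t))" unfolding Z'_def by (rule ac_deriv_add[OF ac_deriv_const Kac[OF Zc]])
  then have "ac_deriv a b Z' (\<lambda>t. A t (Z' t))" by (rule ac_deriv_cong) (use ZZ' in auto)
  moreover have "Z' a = z0" unfolding Z'_def by (simp add: Ka)
  ultimately show ?thesis by (intro exI[of _ Z'] conjI)
qed

subsection \<open>Complex matrices\<close>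

lemma norm_vec_sq: "(norm (A :: 'a::real_normed_vector^'n))\<^sup>2 = (\<Sum>i\<in>UNIV. (norm (A $ i))\<^sup>2)"
  by (simp add: norm_vec_def L2_set_def real_sqrt_pow2 sum_nonneg)

lemma norm_mat_sq: "(norm (A :: complex^'n^'m))\<^sup>2 = (\<Sum>i\<in>UNIV. \<Sum>j\<in>UNIV. (norm (A $ i $ j))\<^sup>2)"
  by (simp add: norm_vec_sq)

lemma norm_entry_le: "norm (A $ i $ j) \<le> norm (A :: complex^'n^'m)"
  by (meson Finite_Cartesian_Product.norm_nth_le order_trans)

lemma cauchy_schwarz_sum:
  fixes f g :: "'i::finite \<Rightarrow> complex"
  shows "(norm (\<Sum>k\<in>UNIV. f k * g k))\<^sup>2 \<le> (\<Sum>k\<in>UNIV. (norm (f k))\<^sup>2) * (\<Sum>k\<in>UNIV. (norm (g k))\<^sup>2)"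
proof -
  have "norm (\<Sum>k\<in>UNIV. f k * g k) \<le> (\<Sum>k\<in>UNIV. \<bar>norm (f k)\<bar> * \<bar>norm (g k)\<bar>)"
    by (rule order_trans[OF norm_sum]) (simp add: norm_mult)
  also have "\<dots> \<le> L2_set (\<lambda>k. norm (f k)) UNIV * L2_set (\<lambda>k. norm (g k)) UNIV"
    by (rule L2_set_mult_ineq)
  finally have "(norm (\<Sum>k\<in>UNIV. f k * g k))\<^sup>2 \<le> (L2_set (\<lambda>k. norm (f k)) UNIV * L2_set (\<lambda>k. norm (g k)) UNIV)\<^sup>2"
    by (intro power_mono) auto
  then show ?thesis by (simp add: power_mult_distrib L2_set_def sum_nonneg)
qed

text \<open>The norm of the nested vector type is the Frobenius norm, so submultiplicativity is
  Cauchy-Schwarz applied to each entry of the product.\<close>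

lemma norm_matrix_mult_le: "norm (A ** B) \<le> norm (A :: complex^'k^'m) * norm (B :: complex^'n^'k)"
proof -
  have "(norm (A ** B))\<^sup>2 \<le> (\<Sum>i\<in>UNIV. \<Sum>j\<in>UNIV. (\<Sum>k\<in>UNIV. (norm (A $ i $ k))\<^sup>2) * (\<Sum>k\<in>UNIV. (norm (B $ k $ j))\<^sup>2))"
    unfolding norm_mat_sq by (intro sum_mono) (simp add: matrix_matrix_mult_def cauchy_schwarz_sum)
  also have "\<dots> = (\<Sum>i\<in>UNIV. \<Sum>k\<in>UNIV. (norm (A $ i $ k))\<^sup>2) * (\<Sum>j\<in>UNIV. \<Sum>k\<in>UNIV. (norm (B $ k $ j))\<^sup>2)"
    by (simp add: sum_product)
  also have "(\<Sum>j\<in>UNIV. \<Sum>k\<in>UNIV. (norm (B $ k $ j))\<^sup>2) = (norm B)\<^sup>2"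
    unfolding norm_mat_sq by (rule sum.swap)
  finally have "(norm (A ** B))\<^sup>2 \<le> (norm A * norm B)\<^sup>2" unfolding norm_mat_sq[of A, symmetric] by (simp add: power_mult_distrib)
  then show ?thesis by (rule power2_le_imp_le) simp
qed

lemma bounded_bilinear_matrix_mult:
  "bounded_bilinear ((**) :: complex^'k^'m \<Rightarrow> complex^'n^'k \<Rightarrow> complex^'n^'m)"
proof
  fix A A' :: "complex^'k^'m" and B B' :: "complex^'n^'k" and r :: real
  show "(A + A') ** B = A ** B + A' ** B" by (simp add: matrix_matrix_mult_def vec_eq_iff sum.distrib algebra_simps)
  show "A ** (B + B') = A ** B + A ** B'" by (rule matrix_add_ldistrib)
  show "(r *\<^sub>R A) ** B = r *\<^sub>R (A ** B)"
    by (simp add: matrix_matrix_mult_def vec_eq_iff scaleR_sum_right)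
  show "A ** (r *\<^sub>R B) = r *\<^sub>R (A ** B)"
    by (simp add: matrix_matrix_mult_def vec_eq_iff scaleR_sum_right)
  show "\<exists>K. \<forall>(a :: complex^'k^'m) (b :: complex^'n^'k). norm (a ** b) \<le> norm a * norm b * K"
    by (intro exI[of _ 1]) (simp add: norm_matrix_mult_le)
qed

interpretation mm: bounded_bilinear "(**) :: complex^'k^'m \<Rightarrow> complex^'n^'k \<Rightarrow> complex^'n^'m"
  by (rule bounded_bilinear_matrix_mult)

lemmas mm_simps = mm.add_left mm.add_right mm.diff_left mm.diff_right mm.minus_left mm.minus_right
  mm.zero_left mm.zero_right matrix_mul_assoc matrix_mul_lid matrix_mul_rid

lemma cscale_nth [simp]: "cscale c A $ i $ j = c * A $ i $ j"
  by (simp add: cscale_def)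

lemma norm_cscale: "norm (cscale c (A :: complex^'n^'m)) = norm c * norm A"
proof -
  have "(norm (cscale c A))\<^sup>2 = (norm c * norm A)\<^sup>2"
    by (simp add: norm_mat_sq norm_mult power_mult_distrib sum_distrib_left)
  then show ?thesis by (rule power2_eq_imp_eq) auto
qed

lemma bounded_bilinear_cscale: "bounded_bilinear (cscale :: complex \<Rightarrow> complex^'n^'m \<Rightarrow> complex^'n^'m)"
proof
  fix c c' :: complex and B B' :: "complex^'n^'m" and r :: real
  show "cscale (c + c') B = cscale c B + cscale c' B" by (simp add: vec_eq_iff algebra_simps)
  show "cscale c (B + B') = cscale c B + cscale c B'" by (simp add: vec_eq_iff algebra_simps)
  show "cscale (r *\<^sub>R c) B = r *\<^sub>R cscale c B" by (simp add: vec_eq_iff)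
  show "cscale c (r *\<^sub>R B) = r *\<^sub>R cscale c B" by (simp add: vec_eq_iff)
  show "\<exists>K. \<forall>c (B :: complex^'n^'m). norm (cscale c B) \<le> norm c * norm B * K"
    by (intro exI[of _ 1]) (simp add: norm_cscale)
qed

interpretation cs: bounded_bilinear "cscale :: complex \<Rightarrow> complex^'n^'m \<Rightarrow> complex^'n^'m"
  by (rule bounded_bilinear_cscale)

lemma cscale_mult_left: "cscale c A ** B = cscale c (A ** B)"
  by (simp add: vec_eq_iff matrix_matrix_mult_def sum_distrib_left mult_ac)

lemma cscale_mult_right: "A ** cscale c B = cscale c (A ** B)"
  by (simp add: vec_eq_iff matrix_matrix_mult_def sum_distrib_left mult_ac)

lemma cscale_cscale [simp]: "cscale c (cscale d A) = cscale (c * d) A"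
  by (simp add: vec_eq_iff mult_ac)

lemma cscale_one [simp]: "cscale 1 A = A"
  by (simp add: vec_eq_iff)

lemma cscale_of_real: "cscale (of_real r) A = r *\<^sub>R A"
  by (simp add: vec_eq_iff complex_eq_iff)

lemmas cs_simps = cs.add_left cs.add_right cs.diff_left cs.diff_right cs.minus_left cs.minus_right
  cs.zero_left cs.zero_right cscale_mult_left cscale_mult_right cscale_cscale cscale_one

lemma dagger_nth [simp]: "dagger A $ i $ j = cnj (A $ j $ i)"
  by (simp add: dagger_def transpose_def)

lemma dagger_dagger [simp]: "dagger (dagger A) = A"
  by (simp add: vec_eq_iff)

lemma dagger_mult: "dagger (A ** B) = dagger B ** dagger A"
  by (simp add: vec_eq_iff matrix_matrix_mult_def mult.commute)

lemma dagger_add: "dagger (A + B) = dagger A + dagger B" by (simp add: vec_eq_iff)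
lemma dagger_diff: "dagger (A - B) = dagger A - dagger B" by (simp add: vec_eq_iff)
lemma dagger_minus: "dagger (- B) = - dagger B" by (simp add: vec_eq_iff)
lemma dagger_zero [simp]: "dagger 0 = 0" by (simp add: vec_eq_iff)
lemma dagger_cscale: "dagger (cscale c A) = cscale (cnj c) (dagger A)" by (simp add: vec_eq_iff)
lemma dagger_mat1 [simp]: "dagger (mat 1) = mat 1" by (simp add: vec_eq_iff mat_def)

lemmas dagger_simps = dagger_mult dagger_add dagger_diff dagger_minus dagger_cscale dagger_dagger dagger_zero

lemma norm_dagger [simp]: "norm (dagger (A :: complex^'n^'m)) = norm A"
proof -
  have "(norm (dagger A))\<^sup>2 = (norm A)\<^sup>2"
    unfolding norm_mat_sq by (subst sum.swap) simp
  then show ?thesis by (rule power2_eq_imp_eq) auto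
qed

lemma bounded_linear_dagger: "bounded_linear (dagger :: complex^'n^'m \<Rightarrow> complex^'m^'n)"
  by (rule bounded_linear_intro[of _ 1]) (auto simp: vec_eq_iff)

text \<open>The trace turns the matrix-valued Lagrange identity into a scalar one; by
  \<open>trc_dagger_mult\<close> it recovers the squared norm.\<close>

definition trc :: "complex^'n^'n \<Rightarrow> complex" where "trc A = (\<Sum>i\<in>UNIV. A $ i $ i)"

lemma bounded_linear_trc: "bounded_linear (trc :: complex^'n^'n \<Rightarrow> complex)"
proof (rule bounded_linear_intro[of _ "real CARD('n)"])
  fix A :: "complex^'n^'n"
  have "norm (trc A) \<le> (\<Sum>i\<in>(UNIV :: 'n set). norm A)"
    unfolding trc_def by (rule order_trans[OF norm_sum]) (intro sum_mono norm_entry_le)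
  then show "norm (trc A) \<le> norm A * real CARD('n)" by (simp add: mult.commute)
qed (auto simp: trc_def sum.distrib scaleR_sum_right)

lemma trc_dagger_mult: "trc (dagger A ** A) = of_real ((norm (A :: complex^'n^'m))\<^sup>2)"
proof -
  have "trc (dagger A ** A) = (\<Sum>i\<in>UNIV. \<Sum>j\<in>UNIV. of_real ((norm (A $ j $ i))\<^sup>2))"
    unfolding complex_norm_square by (simp add: trc_def matrix_matrix_mult_def mult.commute)
  also have "\<dots> = of_real ((norm A)\<^sup>2)"
    unfolding norm_mat_sq by (subst sum.swap) simp
  finally show ?thesis .
qed

lemma inner_mat: "inner (A :: complex^'n^'m) B = (\<Sum>i\<in>UNIV. \<Sum>j\<in>UNIV. Re (cnj (A $ i $ j) * B $ i $ j))"
  by (simp add: inner_vec_def inner_complex_def)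

lemma inner_cscale_self: "inner A (cscale c A) = Re c * (norm (A :: complex^'n^'m))\<^sup>2"
proof -
  have "Re (cnj z * (c * z)) = Re c * (norm z)\<^sup>2" for z
    unfolding cmod_power2 by (simp add: power2_eq_square algebra_simps)
  then show ?thesis unfolding inner_mat norm_mat_sq by (simp add: sum_distrib_left)
qed

lemma inner_bound: "inner A B \<le> norm A * norm (B :: 'a::real_inner)"
  by (rule norm_cauchy_schwarz)

definition orth_proj :: "complex^'m^'m \<Rightarrow> bool" where
  "orth_proj T \<longleftrightarrow> T = dagger T \<and> T ** T = T"

lemma orth_projD:
  assumes "orth_proj T"
  shows "dagger T = T" "T ** T = T" "perp T ** T = 0" "T ** perp T = 0" "perp T ** perp T = perp T"
    "dagger (perp T) = perp T"
  using assms unfolding orth_proj_def perp_def by (auto simp: mm_simps dagger_simps)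

lemma orth_proj_perp: "orth_proj T \<Longrightarrow> orth_proj (perp T)"
  unfolding orth_proj_def[of "perp T"] using orth_projD by metis

lemma perp_perp [simp]: "perp (perp T) = T" by (simp add: perp_def)

lemma proj_add_perp: "T ** A + perp T ** A = A" by (simp add: perp_def mm_simps)

text \<open>Pythagoras: \<open>T ** A\<close> and \<open>perp T ** A\<close> are orthogonal for the
  form \<open>trc (dagger A ** B)\<close>, and their squared norms add up to that of
  \<open>A\<close>.\<close>

lemma norm_orth_proj_mult_le:
  assumes "orth_proj T" shows "norm (T ** A) \<le> norm (A :: complex^'n^'m)"
proof -
  have "dagger (T ** A) ** (T ** A) + dagger (perp T ** A) ** (perp T ** A) = dagger A ** ((T ** T) ** A + (perp T ** perp T) ** A)"
    unfolding dagger_mult orth_projD(1,6)[OF assms] by (simp add: mm.add_right matrix_mul_assoc)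
  also have "\<dots> = dagger A ** A" using orth_projD[OF assms] proj_add_perp by metis
  finally have "trc (dagger (T ** A) ** (T ** A)) + trc (dagger (perp T ** A) ** (perp T ** A)) = trc (dagger A ** A)"
    by (metis linear_add bounded_linear.linear bounded_linear_trc)
  then have "(norm (T ** A))\<^sup>2 + (norm (perp T ** A))\<^sup>2 = (norm A)\<^sup>2"
    unfolding trc_dagger_mult by (simp flip: of_real_add add: of_real_eq_iff del: of_real_power)
  then have "(norm (T ** A))\<^sup>2 \<le> (norm A)\<^sup>2" by (metis le_add_same_cancel1 zero_le_power2)
  then show ?thesis by (rule power2_le_imp_le) simp
qed

lemma AE_lebesgue_on_iff_negligible:
  assumes "S \<in> sets lebesgue"
  shows "(AE x in lebesgue_on S. P x) \<longleftrightarrow> (\<exists>N. negligible N \<and> (\<forall>x\<in>S - N. P x))"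
proof -
  have "(AE x in lebesgue_on S. P x) \<longleftrightarrow> (AE x in lebesgue. x \<in> S \<longrightarrow> P x)"
    using assms by (intro AE_restrict_space_iff) simp
  also have "\<dots> \<longleftrightarrow> (\<exists>N. negligible N \<and> (\<forall>x\<in>S - N. P x))"
    unfolding eventually_ae_filter negligible_iff_null_sets by auto
  finally show ?thesis .
qed

subsection \<open>The quasi-derivative system\<close>

text \<open>The equation \<open>\<ell> Y = z Y + f\<close> as a first order system. The right-hand
  side \<open>f\<close> is there because differences of solutions for two spectral parameters solve
  such an equation.\<close>

definition sl_system ::
  "(real \<Rightarrow> complex^'m^'m) \<Rightarrow> complex \<Rightarrow> (real \<Rightarrow> complex^'n^'m) \<Rightarrow> (real \<Rightarrow> complex^'n^'m) \<Rightarrow> (real \<Rightarrow> complex^'n^'m) \<Rightarrow> bool" where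
  "sl_system \<sigma> z f Y Y1 \<longleftrightarrow> ac_deriv 0 pi Y (\<lambda>x. \<sigma> x ** Y x + Y1 x) \<and>
     ac_deriv 0 pi Y1 (\<lambda>x. - (\<sigma> x ** Y1 x) - (\<sigma> x ** \<sigma> x) ** Y x - cscale z (Y x) - f x)"

lemma sl_solution_iff_system: "sl_solution \<sigma> z Y Y1 \<longleftrightarrow> sl_system \<sigma> z (\<lambda>x. 0) Y Y1"
proof -
  have S: "{0<..<pi} \<in> sets lebesgue" by simp
  have 1: "(\<exists>dY. (Y has_vector_derivative dY) (at x) \<and> Y1 x = dY - \<sigma> x ** Y x) \<longleftrightarrow>
     (Y has_vector_derivative (\<sigma> x ** Y x + Y1 x)) (at x)" for x
    by (auto simp: algebra_simps)
  have 2: "(\<exists>dY1. (Y1 has_vector_derivative dY1) (at x) \<and> - dY1 - \<sigma> x ** Y1 x - (\<sigma> x ** \<sigma> x) ** Y x = cscale z (Y x)) \<longleftrightarrow>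
     (Y1 has_vector_derivative (- (\<sigma> x ** Y1 x) - (\<sigma> x ** \<sigma> x) ** Y x - cscale z (Y x) - 0)) (at x)" for x
  proof -
    have "- d - \<sigma> x ** Y1 x - (\<sigma> x ** \<sigma> x) ** Y x = cscale z (Y x) \<longleftrightarrow>
      d = - (\<sigma> x ** Y1 x) - (\<sigma> x ** \<sigma> x) ** Y x - cscale z (Y x) - 0" (is "?l d \<longleftrightarrow> ?r d") for d
    proof
      assume h: "?l d" show "?r d" unfolding h[symmetric] by simp
    next
      assume h: "?r d" show "?l d" unfolding h by simp
    qed
    then show ?thesis by simp
  qed
  show ?thesis
    unfolding sl_solution_def quasi_derivative_def sl_system_def ac_deriv_def AE_lebesgue_on_iff_negligible[OF S] 1 2
    by blast
qed

lemma sl_system_add: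
  assumes "sl_system \<sigma> z f Y Y1" "sl_system \<sigma> z g W W1"
  shows "sl_system \<sigma> z (\<lambda>x. f x + g x) (\<lambda>x. Y x + W x) (\<lambda>x. Y1 x + W1 x)"
  using assms unfolding sl_system_def
  by (auto intro!: ac_deriv_cong[OF ac_deriv_add] simp: mm_simps cs_simps algebra_simps)

lemma sl_system_cscale:
  assumes "sl_system \<sigma> z f Y Y1"
  shows "sl_system \<sigma> z (\<lambda>x. cscale c (f x)) (\<lambda>x. cscale c (Y x)) (\<lambda>x. cscale c (Y1 x))"
  using assms unfolding sl_system_def
  by (auto intro!: ac_deriv_cong[OF ac_deriv_linear[OF cs.bounded_linear_right]] simp: mm_simps cs_simps algebra_simps)

lemma sl_system_mult_right:
  assumes "sl_system \<sigma> z f Y Y1"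
  shows "sl_system \<sigma> z (\<lambda>x. f x ** C) (\<lambda>x. Y x ** C) (\<lambda>x. Y1 x ** C)"
  using assms unfolding sl_system_def
  by (auto intro!: ac_deriv_cong[OF ac_deriv_linear[OF mm.bounded_linear_left]] simp: mm_simps cs_simps algebra_simps)

text \<open>A change of the spectral parameter is paid for by a right-hand side; this is how
  solutions for different parameters are compared.\<close>

lemma sl_system_shift:
  assumes "sl_system \<sigma> z f Y Y1" "\<And>x. g x = f x + cscale (z - w) (Y x)"
  shows "sl_system \<sigma> w g Y Y1"
  using assms unfolding sl_system_def
  by (auto elim!: ac_deriv_cong simp: mm_simps cs_simps algebra_simps)

lemma sl_system_diff:
  assumes "sl_system \<sigma> z f Y Y1" "sl_system \<sigma> z g W W1"
  shows "sl_system \<sigma> z (\<lambda>x. f x - g x) (\<lambda>x. Y x - W x) (\<lambda>x. Y1 x - W1 x)"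
  using sl_system_add[OF assms(1) sl_system_cscale[OF assms(2), of "-1"]] by (simp add: cs_simps)

lemma ac_deriv_norm_sq:
  fixes f :: "real \<Rightarrow> 'a::real_inner"
  assumes "ac_deriv a b f f'"
  shows "ac_deriv a b (\<lambda>x. (norm (f x))\<^sup>2) (\<lambda>x. 2 * (f x \<bullet> f' x))"
  using ac_deriv_bilinear[OF bounded_bilinear_inner assms assms]
  by (simp add: power2_norm_eq_inner inner_commute)

text \<open>Integration from right to left: \<open>E x * exp (P x)\<close> is nondecreasing, so
  Cauchy data at the right end control those at the left end.\<close>

lemma gronwall_backward:
  fixes E P :: "real \<Rightarrow> real"
  assumes E: "ac_deriv a b E E'" and P: "ac_deriv a b P p"
    and le: "\<And>x. x \<in> {a<..<b} \<Longrightarrow> - p x * E x \<le> E' x" and ab: "a \<le> b"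
  shows "E a * exp (P a) \<le> E b * exp (P b)"
proof -
  have F: "ac_deriv a b (\<lambda>x. E x * exp (P x)) (\<lambda>x. E x * (exp (P x) * p x) + E' x * exp (P x))"
    by (rule ac_deriv_bilinear[OF bounded_bilinear_mult E ac_deriv_exp[OF P]])
  have "0 - 0 \<le> E b * exp (P b) - E a * exp (P a)"
  proof (rule ac_deriv_mono[OF ac_deriv_const F])
    fix x assume x: "x \<in> {a<..<b}"
    have "0 \<le> (E' x + p x * E x) * exp (P x)" using le[OF x] by (intro mult_nonneg_nonneg) auto
    then show "0 \<le> E x * (exp (P x) * p x) + E' x * exp (P x)" by (simp add: algebra_simps)
  qed (use ab in auto)
  then show ?thesis by simp
qed

text \<open>The cross terms are split by \<open>2 x y \<le> x\<^sup>2 + y\<^sup>2\<close> and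
  \<open>2 s \<le> 1 + s\<^sup>2\<close>, so the norm of the potential enters squared and the weight
  in Gronwall's inequality is integrable. The absolute value serves both directions of
  integration.\<close>

lemma sl_energy_derivative_bound:
  fixes Y Y1 F :: "complex^'n^'m" and \<sigma> :: "complex^'m^'m"
  shows "\<bar>2 * inner Y (\<sigma> ** Y + Y1) + 2 * inner Y1 (- (\<sigma> ** Y1) - (\<sigma> ** \<sigma>) ** Y - cscale z Y - F)\<bar>
    \<le> (3 + norm z + 2 * (norm \<sigma>)\<^sup>2) * ((norm Y)\<^sup>2 + (norm Y1)\<^sup>2) + (norm F)\<^sup>2"
proof -
  define y where "y = norm Y" define w where "w = norm Y1" define s where "s = norm \<sigma>" define k where "k = norm z" define c where "c = norm F"
  have pos: "y \<ge> 0" "w \<ge> 0" "s \<ge> 0" "k \<ge> 0" "c \<ge> 0" unfolding y_def w_def s_def k_def c_def by auto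
  have sY: "norm (\<sigma> ** Y) \<le> s * y" and sY1: "norm (\<sigma> ** Y1) \<le> s * w" unfolding s_def y_def w_def by (rule norm_matrix_mult_le)+
  have ssY: "norm ((\<sigma> ** \<sigma>) ** Y) \<le> s * s * y"
    unfolding s_def y_def by (rule order_trans[OF norm_matrix_mult_le]) (intro mult_right_mono norm_matrix_mult_le norm_ge_zero)
  have i1: "\<bar>inner Y (\<sigma> ** Y + Y1)\<bar> \<le> y * (s * y + w)"
  proof -
    have "\<bar>inner Y (\<sigma> ** Y + Y1)\<bar> \<le> norm Y * norm (\<sigma> ** Y + Y1)" by (rule Cauchy_Schwarz_ineq2)
    also have "norm (\<sigma> ** Y + Y1) \<le> s * y + w" using sY norm_triangle_ineq[of "\<sigma> ** Y" Y1] unfolding w_def by linarith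
    finally show ?thesis unfolding y_def by (simp add: mult_left_mono)
  qed
  have i2: "\<bar>inner Y1 (- (\<sigma> ** Y1) - (\<sigma> ** \<sigma>) ** Y - cscale z Y - F)\<bar> \<le> w * (s * w + s * s * y + k * y + c)"
  proof -
    have "\<bar>inner Y1 (- (\<sigma> ** Y1) - (\<sigma> ** \<sigma>) ** Y - cscale z Y - F)\<bar> \<le> norm Y1 * norm (- (\<sigma> ** Y1) - (\<sigma> ** \<sigma>) ** Y - cscale z Y - F)"
      by (rule Cauchy_Schwarz_ineq2)
    also have "norm (- (\<sigma> ** Y1) - (\<sigma> ** \<sigma>) ** Y - cscale z Y - F) \<le> norm (\<sigma> ** Y1) + norm ((\<sigma> ** \<sigma>) ** Y) + norm (cscale z Y) + norm F"
      using norm_triangle_ineq4[of "- (\<sigma> ** Y1)" "(\<sigma> ** \<sigma>) ** Y"]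
        norm_triangle_ineq4[of "- (\<sigma> ** Y1) - (\<sigma> ** \<sigma>) ** Y" "cscale z Y"]
        norm_triangle_ineq4[of "- (\<sigma> ** Y1) - (\<sigma> ** \<sigma>) ** Y - cscale z Y" F] norm_minus_cancel[of "\<sigma> ** Y1"] by linarith
    also have "\<dots> \<le> s * w + s * s * y + k * y + c" using sY1 ssY unfolding c_def k_def y_def norm_cscale by linarith
    finally show ?thesis unfolding w_def by (simp add: mult_left_mono)
  qed
  have q1: "2 * s \<le> 1 + s\<^sup>2" using sum_squares_bound[of 1 s] by simp
  have q2: "2 * (y * w) \<le> y\<^sup>2 + w\<^sup>2" using sum_squares_bound[of y w] by simp
  have q3: "2 * (w * c) \<le> w\<^sup>2 + c\<^sup>2" using sum_squares_bound[of w c] by simp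
  have "2 * (y * (s * y + w)) + 2 * (w * (s * w + s * s * y + k * y + c)) =
     (2 * s) * (y\<^sup>2 + w\<^sup>2) + (1 + s\<^sup>2 + k) * (2 * (y * w)) + 2 * (w * c)" by (simp add: power2_eq_square algebra_simps)
  also have "\<dots> \<le> (1 + s\<^sup>2) * (y\<^sup>2 + w\<^sup>2) + (1 + s\<^sup>2 + k) * (y\<^sup>2 + w\<^sup>2) + (w\<^sup>2 + c\<^sup>2)"
    using pos by (intro add_mono mult_right_mono mult_left_mono q1 q2 q3) auto
  also have "\<dots> \<le> (3 + k + 2 * s\<^sup>2) * (y\<^sup>2 + w\<^sup>2) + c\<^sup>2" by (simp add: algebra_simps)
  finally have fin: "2 * (y * (s * y + w)) + 2 * (w * (s * w + s * s * y + k * y + c)) \<le> (3 + k + 2 * s\<^sup>2) * (y\<^sup>2 + w\<^sup>2) + c\<^sup>2" .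
  have "\<bar>2 * inner Y (\<sigma> ** Y + Y1) + 2 * inner Y1 (- (\<sigma> ** Y1) - (\<sigma> ** \<sigma>) ** Y - cscale z Y - F)\<bar>
     \<le> 2 * \<bar>inner Y (\<sigma> ** Y + Y1)\<bar> + 2 * \<bar>inner Y1 (- (\<sigma> ** Y1) - (\<sigma> ** \<sigma>) ** Y - cscale z Y - F)\<bar>" by linarith
  then show ?thesis using i1 i2 fin unfolding y_def w_def s_def k_def c_def by linarith
qed

lemma continuous_potential_terms:
  fixes Y Y1 :: "complex^'n^'m"
  shows "continuous_on UNIV (\<lambda>M :: complex^'m^'m. (M ** Y + Y1, - (M ** Y1) - (M ** M) ** Y - cscale z Y))"
  by (intro continuous_intros bounded_bilinear.continuous_on[OF bounded_bilinear_matrix_mult])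

section \<open>Existence, uniqueness and energy estimates for a square integrable potential\<close>

locale sl_pot =
  fixes \<sigma> :: "real \<Rightarrow> complex^'m^'m"
  assumes sigma_meas: "\<sigma> \<in> borel_measurable (lebesgue_on {0<..<pi})"
    and sigma_L2: "integrable (lebesgue_on {0<..<pi}) (\<lambda>x. (norm (\<sigma> x))\<^sup>2)"
begin

text \<open>Set to 0 outside the open interval, where nothing is known about
  \<open>\<sigma>\<close>; it is thus nonnegative everywhere and integrable over the closed
  interval.\<close>

definition s2 :: "real \<Rightarrow> real" where "s2 x = (if x \<in> {0<..<pi} then (norm (\<sigma> x))\<^sup>2 else 0)"
definition S2 :: "real \<Rightarrow> real" where "S2 x = integral {0..x} s2"

lemma s2_nonneg: "0 \<le> s2 x" unfolding s2_def by simp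

lemma s2_integrable: "s2 integrable_on {0..pi}"
proof -
  have "(\<lambda>x. (norm (\<sigma> x))\<^sup>2) integrable_on {0<..<pi}"
    using integrable_on_lebesgue_on[OF sigma_L2] by simp
  then have "s2 integrable_on {0<..<pi}" by (rule integrable_eq) (simp add: s2_def)
  then show ?thesis using integrable_on_open_interval_real[of s2 0 pi] by simp
qed

lemma S2_ac: "ac_deriv 0 pi S2 s2"
  unfolding S2_def by (rule ac_deriv_integral[OF s2_integrable s2_integrable]) (simp add: s2_nonneg)

lemma S2_0 [simp]: "S2 0 = 0" by (simp add: S2_def)

lemma S2_bounds: assumes "x \<in> {0..pi}" shows "0 \<le> S2 x" "S2 x \<le> S2 pi"
  using ac_deriv_mono[OF ac_deriv_const[of 0 pi "0::real"] S2_ac s2_nonneg, of 0 x]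
    ac_deriv_mono[OF ac_deriv_const[of 0 pi "0::real"] S2_ac s2_nonneg, of x pi] assms by auto

lemma P_ac: "ac_deriv 0 pi (\<lambda>x. c * x + d * S2 x) (\<lambda>x. c + d * s2 x)"
proof (rule ac_deriv_add)
  show "ac_deriv 0 pi (\<lambda>x. c * x) (\<lambda>x. c)"
    by (rule ac_deriv_smooth[of _ _ _ _ "\<bar>c\<bar>"]) (auto intro!: derivative_eq_intros)
  show "ac_deriv 0 pi (\<lambda>x. d * S2 x) (\<lambda>x. d * s2 x)"
    by (rule ac_deriv_linear[OF bounded_linear_mult_right S2_ac])
qed

lemma sl_exists:
  fixes A B :: "complex^'n^'m"
  shows "\<exists>Y Y1. sl_system \<sigma> z (\<lambda>x. 0) Y Y1 \<and> Y 0 = A \<and> Y1 0 = B"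
proof -
  \<comment> \<open>The existence theorem works on the closed interval, whereas
    \<open>\<sigma>\<close> is arbitrary outside the open one.\<close>
  define \<sigma>0 where "\<sigma>0 = (\<lambda>x. if x \<in> {0<..<pi} then \<sigma> x else 0)"
  have m0: "\<sigma>0 \<in> borel_measurable (lebesgue_on {0..pi})"
  proof -
    have "\<sigma>0 \<in> borel_measurable lebesgue" unfolding \<sigma>0_def using sigma_meas by (subst borel_measurable_if) auto
    then show ?thesis by (rule measurable_restrict_space1)
  qed
  define G where "G = (\<lambda>t (v :: (complex^'n^'m) \<times> (complex^'n^'m)). (\<sigma>0 t ** fst v + snd v, - (\<sigma>0 t ** snd v) - (\<sigma>0 t ** \<sigma>0 t) ** fst v - cscale z (fst v)))"
  \<comment> \<open>With \<open>s\<close> the norm of the potential, the right side of the system is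
    bounded by \<open>1 + 2 s + s\<^sup>2 + norm z\<close> times the unknown, and
    \<open>2 s \<le> 1 + s\<^sup>2\<close>.\<close>
  define q where "q = (\<lambda>t. (2 + norm z) + 2 * s2 t)"
  have lin: "linear (G t)" for t
    by (rule linearI) (simp_all add: G_def mm_simps cs_simps mm.scaleR_right cs.scaleR_right algebra_simps)
  have meas: "(\<lambda>t. G t v) \<in> borel_measurable (lebesgue_on {0..pi})" for v
    unfolding G_def using borel_measurable_continuous_on[OF continuous_potential_terms m0] .
  have q: "q integrable_on {0..pi}" unfolding q_def
    by (intro integrable_add integrable_const_ivl integrable_on_mult_right s2_integrable)
  have q0: "0 \<le> q t" for t unfolding q_def using s2_nonneg[of t] by simp
  have bd: "norm (G t v) \<le> q t * norm v" for t v
  proof -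
    define y where "y = norm (fst v)" define w where "w = norm (snd v)" define n where "n = norm v" define s where "s = norm (\<sigma>0 t)"
    have yw: "y \<le> n" "w \<le> n" "0 \<le> n" "0 \<le> s" unfolding y_def w_def n_def s_def using norm_fst_le[of "fst v" "snd v"] norm_snd_le[of "snd v" "fst v"] by auto
    have sY: "norm (\<sigma>0 t ** fst v) \<le> s * y" and sY1: "norm (\<sigma>0 t ** snd v) \<le> s * w" unfolding s_def y_def w_def by (rule norm_matrix_mult_le)+
    have ssY: "norm ((\<sigma>0 t ** \<sigma>0 t) ** fst v) \<le> s * s * y"
      unfolding s_def y_def by (rule order_trans[OF norm_matrix_mult_le]) (intro mult_right_mono norm_matrix_mult_le norm_ge_zero)
    have "norm (G t v) \<le> norm (\<sigma>0 t ** fst v + snd v) + norm (- (\<sigma>0 t ** snd v) - (\<sigma>0 t ** \<sigma>0 t) ** fst v - cscale z (fst v))"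
      unfolding G_def by (rule norm_Pair_le)
    also have "\<dots> \<le> (s * y + w) + (s * w + s * s * y + norm z * y)"
      using norm_triangle_ineq[of "\<sigma>0 t ** fst v" "snd v"] norm_triangle_ineq4[of "- (\<sigma>0 t ** snd v)" "(\<sigma>0 t ** \<sigma>0 t) ** fst v"]
        norm_triangle_ineq4[of "- (\<sigma>0 t ** snd v) - (\<sigma>0 t ** \<sigma>0 t) ** fst v" "cscale z (fst v)"] norm_minus_cancel[of "\<sigma>0 t ** snd v"]
        sY sY1 ssY unfolding norm_cscale w_def y_def by linarith
    also have "\<dots> \<le> (s * n + n) + (s * n + s * s * n + norm z * n)"
      using yw by (intro add_mono mult_left_mono) auto
    also have "\<dots> = (1 + 2 * s + s\<^sup>2 + norm z) * n" by (simp add: power2_eq_square algebra_simps)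
    also have "\<dots> \<le> (2 + norm z + 2 * s\<^sup>2) * n"
      using sum_squares_bound[of 1 s] yw by (intro mult_right_mono) auto
    also have "s\<^sup>2 = s2 t" unfolding s_def s2_def \<sigma>0_def by simp
    finally show ?thesis unfolding q_def n_def .
  qed
  obtain Z where Z: "Z 0 = (A, B)" "ac_deriv 0 pi Z (\<lambda>t. G t (Z t))"
    using caratheodory_linear_existence[where A=G and a=0 and b=pi and q=q and ?z0.0="(A, B)", OF _ lin meas bd q q0] by (auto simp: pi_ge_zero)
  have "sl_system \<sigma> z (\<lambda>x. 0) (\<lambda>x. fst (Z x)) (\<lambda>x. snd (Z x))"
    unfolding sl_system_def
  proof (intro conjI)
    show "ac_deriv 0 pi (\<lambda>x. fst (Z x)) (\<lambda>x. \<sigma> x ** fst (Z x) + snd (Z x))"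
      by (rule ac_deriv_cong[OF ac_deriv_linear[OF bounded_linear_fst Z(2)]]) (simp add: G_def \<sigma>0_def)
    show "ac_deriv 0 pi (\<lambda>x. snd (Z x)) (\<lambda>x. - (\<sigma> x ** snd (Z x)) - (\<sigma> x ** \<sigma> x) ** fst (Z x) - cscale z (fst (Z x)) - 0)"
      by (rule ac_deriv_cong[OF ac_deriv_linear[OF bounded_linear_snd Z(2)]]) (simp add: G_def \<sigma>0_def)
  qed
  then show ?thesis using Z(1) by (intro exI[of _ "\<lambda>x. fst (Z x)"] exI[of _ "\<lambda>x. snd (Z x)"]) simp
qed

lemma sl_energy_ac:
  assumes "sl_system \<sigma> z f Y Y1"
  shows "ac_deriv 0 pi (\<lambda>x. (norm (Y x))\<^sup>2 + (norm (Y1 x))\<^sup>2)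
    (\<lambda>x. 2 * inner (Y x) (\<sigma> x ** Y x + Y1 x) + 2 * inner (Y1 x) (- (\<sigma> x ** Y1 x) - (\<sigma> x ** \<sigma> x) ** Y x - cscale z (Y x) - f x))"
  using assms unfolding sl_system_def by (intro ac_deriv_add ac_deriv_norm_sq) auto

definition growth :: "complex \<Rightarrow> real" where "growth z = exp ((3 + norm z) * pi + 2 * S2 pi)"

lemma sl_energy_bound:
  fixes Y Y1 :: "real \<Rightarrow> complex^'n^'m"
  assumes sys: "sl_system \<sigma> z f Y Y1" and f: "\<And>x. x \<in> {0..pi} \<Longrightarrow> norm (f x) \<le> c" and c: "c \<ge> 0" and t: "t \<in> {0..pi}"
  shows "(norm (Y t))\<^sup>2 + (norm (Y1 t))\<^sup>2 \<le> ((norm (Y 0))\<^sup>2 + (norm (Y1 0))\<^sup>2 + c\<^sup>2 * pi) * growth z"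
proof -
  let ?E = "\<lambda>x. (norm (Y x))\<^sup>2 + (norm (Y1 x))\<^sup>2"
  have "?E t \<le> (?E 0 + c\<^sup>2 * (t - 0)) * exp ((3 + norm z) * t + 2 * S2 t)"
  proof (rule gronwall[OF sl_energy_ac[OF sys] P_ac _ _ _ _ t])
    fix x assume x: "x \<in> {0<..<pi}"
    have s: "s2 x = (norm (\<sigma> x))\<^sup>2" using x by (simp add: s2_def)
    have "(norm (f x))\<^sup>2 \<le> c\<^sup>2" using f[of x] x by (intro power_mono) auto
    then show "2 * inner (Y x) (\<sigma> x ** Y x + Y1 x) + 2 * inner (Y1 x) (- (\<sigma> x ** Y1 x) - (\<sigma> x ** \<sigma> x) ** Y x - cscale z (Y x) - f x)
       \<le> (3 + norm z + 2 * s2 x) * ?E x + c\<^sup>2"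
      using sl_energy_derivative_bound[of "Y x" "\<sigma> x" "Y1 x" z "f x"] unfolding s by linarith
    show "0 \<le> 3 + norm z + 2 * s2 x" using s2_nonneg[of x] by simp
  qed auto
  also have "\<dots> \<le> (?E 0 + c\<^sup>2 * pi) * growth z"
    unfolding growth_def using t S2_bounds[OF t] by (intro mult_mono add_mono mult_left_mono) (auto intro!: add_mono mult_left_mono)
  finally show ?thesis by simp
qed

lemma sl_unique_at_0:
  fixes Y Y1 :: "real \<Rightarrow> complex^'n^'m"
  assumes sys: "sl_system \<sigma> z (\<lambda>x. 0) Y Y1" and "Y 0 = 0" "Y1 0 = 0" and t: "t \<in> {0..pi}"
  shows "Y t = 0" "Y1 t = 0"
proof -
  have "(norm (Y t))\<^sup>2 + (norm (Y1 t))\<^sup>2 \<le> 0" using sl_energy_bound[OF sys, of 0] assms by auto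
  then show "Y t = 0" "Y1 t = 0" by (auto simp: sum_power2_le_zero_iff)
qed

lemma sl_unique_at_pi:
  fixes Y Y1 :: "real \<Rightarrow> complex^'n^'m"
  assumes sys: "sl_system \<sigma> z (\<lambda>x. 0) Y Y1" and "Y pi = 0" "Y1 pi = 0"
  shows "Y 0 = 0" "Y1 0 = 0"
proof -
  let ?E = "\<lambda>x. (norm (Y x))\<^sup>2 + (norm (Y1 x))\<^sup>2"
  have "?E 0 * exp ((3 + norm z) * 0 + 2 * S2 0) \<le> ?E pi * exp ((3 + norm z) * pi + 2 * S2 pi)"
  proof (rule gronwall_backward[OF sl_energy_ac[OF sys] P_ac])
    fix x assume x: "x \<in> {0<..<pi}"
    have s: "s2 x = (norm (\<sigma> x))\<^sup>2" using x by (simp add: s2_def)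
    have "\<bar>2 * inner (Y x) (\<sigma> x ** Y x + Y1 x) + 2 * inner (Y1 x) (- (\<sigma> x ** Y1 x) - (\<sigma> x ** \<sigma> x) ** Y x - cscale z (Y x) - 0)\<bar> \<le> (3 + norm z + 2 * s2 x) * ?E x"
      using sl_energy_derivative_bound[of "Y x" "\<sigma> x" "Y1 x" z "0"] unfolding s by simp
    then show "- (3 + norm z + 2 * s2 x) * ?E x \<le> 2 * inner (Y x) (\<sigma> x ** Y x + Y1 x) + 2 * inner (Y1 x) (- (\<sigma> x ** Y1 x) - (\<sigma> x ** \<sigma> x) ** Y x - cscale z (Y x) - 0)"
      unfolding mult_minus_left by linarith
  qed simp
  then have "?E 0 \<le> 0" using assms by simp
  then show "Y 0 = 0" "Y1 0 = 0" by (auto simp: sum_power2_le_zero_iff)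
qed

end

subsection \<open>Analytic dependence on the spectral parameter\<close>

text \<open>Difference quotients that are Lipschitz in the increment are Cauchy as the increment
  tends to 0, hence converge. Holomorphy follows although no candidate for the derivative is at
  hand.\<close>

lemma lipschitz_quotients_imp_holomorphic:
  fixes g :: "complex \<Rightarrow> complex"
  assumes "\<And>z. \<exists>C. \<forall>h k. h \<noteq> 0 \<longrightarrow> norm h \<le> 1 \<longrightarrow> k \<noteq> 0 \<longrightarrow> norm k \<le> 1 \<longrightarrow>
     norm ((g (z + h) - g z) / h - (g (z + k) - g z) / k) \<le> C * norm (h - k)"
  shows "g holomorphic_on UNIV"
proof -
  have "g field_differentiable (at z)" for z
  proof -
    obtain C where C: "\<And>h k. \<lbrakk>h \<noteq> 0; norm h \<le> 1; k \<noteq> 0; norm k \<le> 1\<rbrakk> \<Longrightarrow>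
      norm ((g (z + h) - g z) / h - (g (z + k) - g z) / k) \<le> C * norm (h - k)"
      using assms[of z] by blast
    define q where "q = (\<lambda>h. (g (z + h) - g z) / h)"
    \<comment> \<open>A concrete null sequence that produces the limit \<open>L\<close>; the
      Lipschitz bound then extends the convergence to all increments.\<close>
    define e where "e = (\<lambda>n. of_real (inverse (real (Suc n))) :: complex)"
    have e0: "e n \<noteq> 0" "norm (e n) \<le> 1" for n
      unfolding e_def of_real_eq_0_iff norm_of_real by (simp_all add: inverse_le_1_iff del: of_nat_Suc)
    have elim: "e \<longlonglongrightarrow> 0" unfolding e_def by (rule tendsto_of_real[OF LIMSEQ_inverse_real_of_nat, unfolded of_real_0])
    define C' where "C' = max C 1"
    have C': "norm (q h - q k) \<le> C' * norm (h - k)" if "h \<noteq> 0" "norm h \<le> 1" "k \<noteq> 0" "norm k \<le> 1" for h k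
      using C[OF that] mult_right_mono[of C C' "norm (h - k)"] unfolding q_def C'_def by simp
    have "Cauchy (\<lambda>n. q (e n))"
    proof (rule metric_CauchyI)
      fix r :: real assume r: "r > 0"
      have "r / C' > 0" using r unfolding C'_def by simp
      then obtain M where M: "\<forall>m\<ge>M. \<forall>n\<ge>M. dist (e m) (e n) < r / C'"
        using LIMSEQ_imp_Cauchy[OF elim] unfolding Cauchy_def by blast
      have "dist (q (e m)) (q (e n)) < r" if "m \<ge> M" "n \<ge> M" for m n
      proof -
        have "dist (q (e m)) (q (e n)) \<le> C' * norm (e m - e n)" unfolding dist_norm by (rule C') (rule e0)+
        also have "\<dots> < C' * (r / C')" using M that unfolding dist_norm C'_def by (intro mult_strict_left_mono) auto
        finally show ?thesis unfolding C'_def by simp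
      qed
      then show "\<exists>M. \<forall>m\<ge>M. \<forall>n\<ge>M. dist (q (e m)) (q (e n)) < r" by blast
    qed
    then obtain L where L: "(\<lambda>n. q (e n)) \<longlonglongrightarrow> L" using Cauchy_convergent convergent_def by blast
    have bound: "norm (q h - L) \<le> C' * norm h" if h: "h \<noteq> 0" "norm h \<le> 1" for h
    proof (rule LIMSEQ_le)
      show "(\<lambda>n. norm (q h - q (e n))) \<longlonglongrightarrow> norm (q h - L)" by (intro tendsto_intros L)
      show "(\<lambda>n. C' * norm (h - e n)) \<longlonglongrightarrow> C' * norm h" using tendsto_mult[OF tendsto_const tendsto_norm[OF tendsto_diff[OF tendsto_const elim]], of C' h] by simp
      show "\<exists>N. \<forall>n\<ge>N. norm (q h - q (e n)) \<le> C' * norm (h - e n)" using C'[OF h e0] by blast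
    qed
    have "(q \<longlongrightarrow> L) (at 0)"
    proof (rule Lim_null_comparison[of "\<lambda>h. q h - L" "\<lambda>h. C' * norm h", THEN LIM_zero_cancel])
      show "\<forall>\<^sub>F h in at 0. norm (q h - L) \<le> C' * norm h"
        unfolding eventually_at by (intro exI[of _ 1]) (auto intro: bound)
      have "((\<lambda>h::complex. C' * norm h) \<longlongrightarrow> C' * norm (0::complex)) (at 0)" by (intro tendsto_intros)
      then show "((\<lambda>h::complex. C' * norm h) \<longlongrightarrow> 0) (at 0)" by simp
    qed
    then have "(g has_field_derivative L) (at z)" unfolding q_def DERIV_def .
    then show ?thesis unfolding field_differentiable_def by blast
  qed
  then show ?thesis unfolding holomorphic_on_def by simp
qed

context sl_pot
begin

text \<open>Solutions are unique on \<open>[0, pi]\<close> but arbitrary outside of it; hence the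
  pair is chosen and not given by a definite description.\<close>

definition fs :: "complex \<Rightarrow> complex^'m^'m \<Rightarrow> complex^'m^'m \<Rightarrow> (real \<Rightarrow> complex^'m^'m) \<times> (real \<Rightarrow> complex^'m^'m)" where
  "fs z A B = (SOME p. sl_system \<sigma> z (\<lambda>x. 0) (fst p) (snd p) \<and> fst p 0 = A \<and> snd p 0 = B)"

lemma fs: "sl_system \<sigma> z (\<lambda>x. 0) (fst (fs z A B)) (snd (fs z A B))"
    "fst (fs z A B) 0 = A" "snd (fs z A B) 0 = B"
proof -
  have "\<exists>p. sl_system \<sigma> z (\<lambda>x. 0) (fst p) (snd p) \<and> fst p 0 = A \<and> snd p 0 = B"
    using sl_exists[of z A B] by auto
  from someI_ex[OF this] show "sl_system \<sigma> z (\<lambda>x. 0) (fst (fs z A B)) (snd (fs z A B))"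
    "fst (fs z A B) 0 = A" "snd (fs z A B) 0 = B" unfolding fs_def by auto
qed

lemma sl_norm_bound:
  fixes Y Y1 :: "real \<Rightarrow> complex^'n^'m"
  assumes sys: "sl_system \<sigma> z f Y Y1" and f: "\<And>x. x \<in> {0..pi} \<Longrightarrow> norm (f x) \<le> c" and c: "c \<ge> 0" and t: "t \<in> {0..pi}"
    and G: "growth z \<le> G"
  shows "norm (Y t) \<le> sqrt (((norm (Y 0))\<^sup>2 + (norm (Y1 0))\<^sup>2 + c\<^sup>2 * pi) * G)"
    and "norm (Y1 t) \<le> sqrt (((norm (Y 0))\<^sup>2 + (norm (Y1 0))\<^sup>2 + c\<^sup>2 * pi) * G)"
proof -
  have "(norm (Y t))\<^sup>2 + (norm (Y1 t))\<^sup>2 \<le> ((norm (Y 0))\<^sup>2 + (norm (Y1 0))\<^sup>2 + c\<^sup>2 * pi) * growth z"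
    by (rule sl_energy_bound[OF sys f c t])
  also have "\<dots> \<le> ((norm (Y 0))\<^sup>2 + (norm (Y1 0))\<^sup>2 + c\<^sup>2 * pi) * G" using G by (intro mult_left_mono) auto
  finally have 1: "(norm (Y t))\<^sup>2 + (norm (Y1 t))\<^sup>2 \<le> ((norm (Y 0))\<^sup>2 + (norm (Y1 0))\<^sup>2 + c\<^sup>2 * pi) * G" .
  show "norm (Y t) \<le> sqrt (((norm (Y 0))\<^sup>2 + (norm (Y1 0))\<^sup>2 + c\<^sup>2 * pi) * G)"
    by (rule real_le_rsqrt) (use 1 zero_le_power2[of "norm (Y1 t)"] in linarith)
  show "norm (Y1 t) \<le> sqrt (((norm (Y 0))\<^sup>2 + (norm (Y1 0))\<^sup>2 + c\<^sup>2 * pi) * G)"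
    by (rule real_le_rsqrt) (use 1 zero_le_power2[of "norm (Y t)"] in linarith)
qed

text \<open>Three applications of the energy bound, each feeding the next as a right-hand side:
  solutions near \<open>z\<close> are bounded (\<open>C0\<close>), their differences are of size
  \<open>norm (h - k)\<close> (\<open>C1\<close>), and so are the differences of difference
  quotients (\<open>C2\<close>).\<close>

lemma fs_quotient_lipschitz:
  fixes A B :: "complex^'m^'m"
  defines "D \<equiv> \<lambda>z h x. cscale (1 / h) (fst (fs (z + h) A B) x - fst (fs z A B) x)"
    and "D1 \<equiv> \<lambda>z h x. cscale (1 / h) (snd (fs (z + h) A B) x - snd (fs z A B) x)"
  assumes x: "x \<in> {0..pi}"
  shows "\<exists>C. \<forall>h k. h \<noteq> 0 \<longrightarrow> norm h \<le> 1 \<longrightarrow> k \<noteq> 0 \<longrightarrow> norm k \<le> 1 \<longrightarrow>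
    norm (D z h x - D z k x) \<le> C * norm (h - k) \<and> norm (D1 z h x - D1 z k x) \<le> C * norm (h - k)"
proof -
  define Y where "Y = (\<lambda>w. fst (fs w A B))"
  define Y1 where "Y1 = (\<lambda>w. snd (fs w A B))"
  have sys: "sl_system \<sigma> w (\<lambda>x. 0) (Y w) (Y1 w)" and init: "Y w 0 = A" "Y1 w 0 = B" for w
    unfolding Y_def Y1_def by (rule fs)+
  \<comment> \<open>One growth constant for all parameters within distance 1 of \<open>z\<close>,
    hence 4 in place of 3.\<close>
  define G where "G = exp ((4 + norm z) * pi + 2 * S2 pi)"
  have G0: "G > 0" unfolding G_def by simp
  have Gb: "growth (z + h) \<le> G" if "norm h \<le> 1" for h
    unfolding growth_def G_def using norm_triangle_ineq[of z h] that by (simp add: mult_right_mono)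
  have Gb0: "growth z \<le> G" using Gb[of 0] by simp
  define C0 where "C0 = sqrt (((norm A)\<^sup>2 + (norm B)\<^sup>2) * G)"
  have C00: "C0 \<ge> 0" unfolding C0_def using G0 by simp
  have Yb: "norm (Y (z + h) t) \<le> C0" if "norm h \<le> 1" "t \<in> {0..pi}" for h t
    using sl_norm_bound(1)[OF sys _ _ that(2) Gb[OF that(1)], of 0] unfolding init C0_def by simp
  have shift: "sl_system \<sigma> w (\<lambda>x. cscale (v - w) (Y v x)) (\<lambda>x. Y v x - Y w x) (\<lambda>x. Y1 v x - Y1 w x)" for v w
  proof -
    have "sl_system \<sigma> w (\<lambda>x. cscale (v - w) (Y v x)) (Y v) (Y1 v)" by (rule sl_system_shift[OF sys]) simp
    from sl_system_diff[OF this sys[of w]] show ?thesis by simp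
  qed
  define C1 where "C1 = sqrt (C0\<^sup>2 * pi * G)"
  have dY: "norm (Y (z + h) t - Y (z + k) t) \<le> norm (h - k) * C1" if h: "norm h \<le> 1" "norm k \<le> 1" and t: "t \<in> {0..pi}" for h k t
  proof -
    have "norm (Y (z + h) t - Y (z + k) t) \<le> sqrt (((norm (Y (z + h) 0 - Y (z + k) 0))\<^sup>2 + (norm (Y1 (z + h) 0 - Y1 (z + k) 0))\<^sup>2 + (norm (h - k) * C0)\<^sup>2 * pi) * G)"
    proof (rule sl_norm_bound(1)[OF shift _ _ t Gb[OF h(2)]])
      show "norm (cscale (z + h - (z + k)) (Y (z + h) x)) \<le> norm (h - k) * C0" if "x \<in> {0..pi}" for x
        unfolding norm_cscale using Yb[OF h(1) that] by (simp add: mult_left_mono)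
    qed (use C00 in simp)
    also have "\<dots> = sqrt ((norm (h - k))\<^sup>2 * (C0\<^sup>2 * pi * G))" unfolding init by (simp add: power_mult_distrib mult_ac)
    also have "\<dots> = norm (h - k) * C1" unfolding C1_def by (simp add: real_sqrt_mult)
    finally show ?thesis .
  qed
  have C10: "C1 \<ge> 0" unfolding C1_def using G0 by simp
  define C2 where "C2 = sqrt (C1\<^sup>2 * pi * G)"
  \<comment> \<open>The quotient solves the equation at \<open>z\<close> with right-hand side
    \<open>Y (z + h)\<close> and zero initial values, so differences of quotients are driven by
    \<open>Y (z + h) - Y (z + k)\<close>.\<close>
  have Dsys: "sl_system \<sigma> z (Y (z + h)) (D z h) (D1 z h)" if "h \<noteq> 0" for h
  proof -
    from sl_system_cscale[OF shift[of z "z + h"], of "1 / h"]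
    have "sl_system \<sigma> z (\<lambda>x. cscale (1 / h) (cscale (z + h - z) (Y (z + h) x))) (D z h) (D1 z h)"
      unfolding Y_def Y1_def D_def D1_def .
    then show ?thesis using that by simp
  qed
  have "norm (D z h x - D z k x) \<le> C2 * norm (h - k) \<and> norm (D1 z h x - D1 z k x) \<le> C2 * norm (h - k)"
    if h: "h \<noteq> 0" "norm h \<le> 1" "k \<noteq> 0" "norm k \<le> 1" for h k
  proof -
    have s: "sl_system \<sigma> z (\<lambda>x. Y (z + h) x - Y (z + k) x) (\<lambda>x. D z h x - D z k x) (\<lambda>x. D1 z h x - D1 z k x)"
      by (rule sl_system_diff[OF Dsys[OF h(1)] Dsys[OF h(3)]])
    have nn: "0 \<le> norm (h - k) * C1" using C10 by simp
    have D0: "D z h 0 = 0" "D1 z h 0 = 0" for h unfolding D_def D1_def fs(2,3) by (simp_all add: cs_simps)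
    have eq: "sqrt (((norm (D z h 0 - D z k 0))\<^sup>2 + (norm (D1 z h 0 - D1 z k 0))\<^sup>2 + (norm (h - k) * C1)\<^sup>2 * pi) * G) = C2 * norm (h - k)"
    proof -
      have e: "((norm (D z h 0 - D z k 0))\<^sup>2 + (norm (D1 z h 0 - D1 z k 0))\<^sup>2 + (norm (h - k) * C1)\<^sup>2 * pi) * G = (norm (h - k))\<^sup>2 * (C1\<^sup>2 * pi * G)"
        unfolding D0 by (simp add: power_mult_distrib mult_ac)
      show ?thesis unfolding e C2_def by (simp add: real_sqrt_mult)
    qed
    show ?thesis
      using sl_norm_bound[OF s dY[OF h(2,4)] nn x Gb0] unfolding eq by simp
  qed
  then show ?thesis by (intro exI[of _ C2]) blast
qed

lemma fs_holomorphic: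
  assumes x: "x \<in> {0..pi}"
  shows "(\<lambda>z. fst (fs z A B) x $ i $ j) holomorphic_on UNIV" "(\<lambda>z. snd (fs z A B) x $ i $ j) holomorphic_on UNIV"
proof -
  have hol: "(\<lambda>z. g z $ i $ j) holomorphic_on UNIV"
    if g: "\<And>z. \<exists>C. \<forall>h k. h \<noteq> 0 \<longrightarrow> norm h \<le> 1 \<longrightarrow> k \<noteq> 0 \<longrightarrow> norm k \<le> 1 \<longrightarrow>
      norm (cscale (1 / h) (g (z + h) - g z) - cscale (1 / k) (g (z + k) - g z)) \<le> C * norm (h - k)"
    for g :: "complex \<Rightarrow> complex^'m^'m"
  proof (rule lipschitz_quotients_imp_holomorphic)
    fix z
    obtain C where C: "\<forall>h k. h \<noteq> 0 \<longrightarrow> norm h \<le> 1 \<longrightarrow> k \<noteq> 0 \<longrightarrow> norm k \<le> 1 \<longrightarrow>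
      norm (cscale (1 / h) (g (z + h) - g z) - cscale (1 / k) (g (z + k) - g z)) \<le> C * norm (h - k)"
      using g[of z] by (elim exE)
    have "norm ((g (z + h) $ i $ j - g z $ i $ j) / h - (g (z + k) $ i $ j - g z $ i $ j) / k)
        \<le> norm (cscale (1 / h) (g (z + h) - g z) - cscale (1 / k) (g (z + k) - g z))" for h k
      using norm_entry_le[of "cscale (1 / h) (g (z + h) - g z) - cscale (1 / k) (g (z + k) - g z)" i j] by simp
    then show "\<exists>C. \<forall>h k. h \<noteq> 0 \<longrightarrow> norm h \<le> 1 \<longrightarrow> k \<noteq> 0 \<longrightarrow> norm k \<le> 1 \<longrightarrow>
      norm ((g (z + h) $ i $ j - g z $ i $ j) / h - (g (z + k) $ i $ j - g z $ i $ j) / k) \<le> C * norm (h - k)"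
      using C by (intro exI[of _ C]) (meson order_trans)
  qed
  note q = fs_quotient_lipschitz[OF x, of _ A B]
  show "(\<lambda>z. fst (fs z A B) x $ i $ j) holomorphic_on UNIV" by (rule hol) (use q in blast)
  show "(\<lambda>z. snd (fs z A B) x $ i $ j) holomorphic_on UNIV" by (rule hol) (use q in blast)
qed

text \<open>The map from \<open>(Y 0, Y1 0)\<close> to \<open>(V1_perp, V1)\<close> is a rotation
  with inverse \<open>Y 0 = T ** V1_perp - perp T ** V1\<close>,
  \<open>Y1 0 = perp T ** V1_perp + T ** V1\<close>; this dictates the initial values of the two
  fundamental solutions.\<close>

lemma sl_represent:
  fixes Y Y1 :: "real \<Rightarrow> complex^'n^'m"
  assumes T: "orth_proj T" and sys: "sl_system \<sigma> z (\<lambda>x. 0) Y Y1" and x: "x \<in> {0..pi}"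
  shows "Y x = fst (fs z T (perp T)) x ** V1_perp T Y Y1 + fst (fs z (- perp T) T) x ** V1 T Y Y1"
    and "Y1 x = snd (fs z T (perp T)) x ** V1_perp T Y Y1 + snd (fs z (- perp T) T) x ** V1 T Y Y1"
proof -
  let ?p = "fs z T (perp T)" let ?s = "fs z (- perp T) T"
  let ?a = "V1_perp T Y Y1" let ?b = "V1 T Y Y1"
  have "sl_system \<sigma> z (\<lambda>x. (0 ** ?a + 0 ** ?b) - 0) (\<lambda>x. (fst ?p x ** ?a + fst ?s x ** ?b) - Y x) (\<lambda>x. (snd ?p x ** ?a + snd ?s x ** ?b) - Y1 x)"
    by (intro sl_system_diff sl_system_add sl_system_mult_right fs sys)
  then have s: "sl_system \<sigma> z (\<lambda>x. 0) (\<lambda>x. (fst ?p x ** ?a + fst ?s x ** ?b) - Y x) (\<lambda>x. (snd ?p x ** ?a + snd ?s x ** ?b) - Y1 x)"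
    by (simp add: mm_simps)
  have TT: "X ** T ** T = X ** T" for X :: "complex^'m^'m" using orth_projD(2)[OF T] by (simp flip: matrix_mul_assoc)
  have z0: "(fst ?p 0 ** ?a + fst ?s 0 ** ?b) - Y 0 = 0" "(snd ?p 0 ** ?a + snd ?s 0 ** ?b) - Y1 0 = 0"
    unfolding fs(2,3) V1_perp_def V1_def perp_def using orth_projD(2)[OF T] TT by (simp_all add: mm_simps)
  show "Y x = fst ?p x ** ?a + fst ?s x ** ?b" "Y1 x = snd ?p x ** ?a + snd ?s x ** ?b"
    using sl_unique_at_0[OF s z0 x] by simp_all
qed

end

text \<open>The passage from Cauchy data to \<open>(V1_perp, V1)\<close> preserves the symplectic
  form, so the Lagrange identity can be read in the boundary values that define the Weyl
  matrix.\<close>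

lemma boundary_form_0:
  fixes A B :: "complex^'n^'m" and C D :: "complex^'k^'m"
  assumes T: "orth_proj T"
  shows "dagger A ** D - dagger B ** C = dagger (T ** A + perp T ** B) ** (T ** D - perp T ** C) - dagger (T ** B - perp T ** A) ** (T ** C + perp T ** D)"
proof -
  have TT: "X ** T ** T = X ** T" for X :: "complex^'m^'n" using orth_projD(2)[OF T] by (simp flip: matrix_mul_assoc)
  show ?thesis
    unfolding perp_def using orth_projD(1,2)[OF T] TT by (simp add: mm_simps dagger_simps)
qed

text \<open>The two summands of \<open>V2\<close> lie in the complementary ranges of
  \<open>T2\<close> and \<open>perp T2\<close>, because \<open>T2 ** H2 = H2\<close>; so they vanish
  separately.\<close>

lemma V2_zeroD:
  assumes T: "orth_proj T2" and H: "H2 = T2 ** H2 ** T2" and v: "V2 T2 H2 Y Y1 = 0"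
  shows "perp T2 ** Y pi = 0" "T2 ** Y pi = Y pi" "T2 ** Y1 pi = H2 ** Y pi"
proof -
  have e: "T2 ** (Y1 pi - H2 ** Y pi) - perp T2 ** Y pi = 0" using v unfolding V2_def .
  have "perp T2 ** (T2 ** (Y1 pi - H2 ** Y pi) - perp T2 ** Y pi) = 0" using e by (simp add: mm_simps)
  then show 1: "perp T2 ** Y pi = 0" using orth_projD[OF T] by (simp add: mm.diff_right matrix_mul_assoc mm_simps)
  then show "T2 ** Y pi = Y pi" by (simp add: perp_def mm_simps)
  have "T2 ** H2 = H2" using H orth_projD(2)[OF T] by (metis matrix_mul_assoc)
  then show "T2 ** Y1 pi = H2 ** Y pi" using e 1 by (simp add: mm.diff_right matrix_mul_assoc)
qed

lemma V2_zeroI: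
  assumes T: "orth_proj T2" and H: "H2 = T2 ** H2 ** T2" and v: "perp T2 ** Y pi = 0" "T2 ** Y1 pi = H2 ** Y pi"
  shows "V2 T2 H2 Y Y1 = 0"
proof -
  have "T2 ** H2 = H2" using H orth_projD(2)[OF T] by (metis matrix_mul_assoc)
  then show ?thesis using v unfolding V2_def by (simp add: mm.diff_right matrix_mul_assoc)
qed

subsection \<open>The Weyl solution and the Weyl matrix\<close>

locale sl =
  fixes \<sigma> :: "real \<Rightarrow> complex^'m^'m" and T1 T2 H2 :: "complex^'m^'m"
  assumes prob: "sl_problem \<sigma> T1 T2 H2"
begin

sublocale sl_pot \<sigma>
  using prob unfolding sl_problem_def by unfold_locales auto

lemma T1: "orth_proj T1" and T2: "orth_proj T2" and H2: "dagger H2 = H2" "H2 = T2 ** H2 ** T2"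
  using prob unfolding sl_problem_def orth_proj_def by auto

text \<open>As \<open>\<sigma>\<close> is Hermitian almost everywhere, all its terms cancel; what is
  left is the difference of the spectral parameters.\<close>

lemma lagrange:
  fixes Y Y1 :: "real \<Rightarrow> complex^'n^'m" and W W1 :: "real \<Rightarrow> complex^'k^'m"
  assumes Y: "sl_system \<sigma> z (\<lambda>x. 0) Y Y1" and W: "sl_system \<sigma> w (\<lambda>x. 0) W W1"
  shows "ac_deriv 0 pi (\<lambda>x. dagger (W x) ** Y1 x - dagger (W1 x) ** Y x) (\<lambda>x. cscale (cnj w - z) (dagger (W x) ** Y x))"
proof -
  have "AE x in lebesgue_on {0<..<pi}. \<sigma> x = dagger (\<sigma> x)" using prob unfolding sl_problem_def by blast
  then obtain N where N: "negligible N" "\<forall>x\<in>{0<..<pi} - N. \<sigma> x = dagger (\<sigma> x)"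
    by (subst (asm) AE_lebesgue_on_iff_negligible) auto
  have "ac_deriv 0 pi (\<lambda>x. dagger (W x) ** Y1 x - dagger (W1 x) ** Y x)
     (\<lambda>x. (dagger (W x) ** (- (\<sigma> x ** Y1 x) - (\<sigma> x ** \<sigma> x) ** Y x - cscale z (Y x) - 0) + dagger (\<sigma> x ** W x + W1 x) ** Y1 x) -
       (dagger (W1 x) ** (\<sigma> x ** Y x + Y1 x) + dagger (- (\<sigma> x ** W1 x) - (\<sigma> x ** \<sigma> x) ** W x - cscale w (W x) - 0) ** Y x))"
    using Y W unfolding sl_system_def
    by (intro ac_deriv_diff ac_deriv_bilinear[OF bounded_bilinear_matrix_mult] ac_deriv_linear[OF bounded_linear_dagger]) auto
  then show ?thesis
  proof (rule ac_deriv_ae_cong[OF _ N(1)])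
    fix x assume "x \<in> {0<..<pi} - N"
    then have s: "dagger (\<sigma> x) = \<sigma> x" using N(2) by simp
    show "(dagger (W x) ** (- (\<sigma> x ** Y1 x) - (\<sigma> x ** \<sigma> x) ** Y x - cscale z (Y x) - 0) + dagger (\<sigma> x ** W x + W1 x) ** Y1 x) -
       (dagger (W1 x) ** (\<sigma> x ** Y x + Y1 x) + dagger (- (\<sigma> x ** W1 x) - (\<sigma> x ** \<sigma> x) ** W x - cscale w (W x) - 0) ** Y x)
      = cscale (cnj w - z) (dagger (W x) ** Y x)"
      by (simp add: mm_simps dagger_simps cs_simps s)
  qed
qed

text \<open>Self-adjointness of the condition at \<open>pi\<close>: once \<open>T2\<close> is moved
  to the other factor, both terms become \<open>dagger (W pi) ** (H2 ** Y pi)\<close>.\<close>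

lemma boundary_form_pi:
  fixes Y Y1 :: "real \<Rightarrow> complex^'n^'m" and W W1 :: "real \<Rightarrow> complex^'k^'m"
  assumes Y: "V2 T2 H2 Y Y1 = 0" and W: "V2 T2 H2 W W1 = 0"
  shows "dagger (W pi) ** Y1 pi - dagger (W1 pi) ** Y pi = 0"
proof -
  note y = V2_zeroD[OF T2 H2(2) Y] and w = V2_zeroD[OF T2 H2(2) W]
  have "dagger (W pi) ** Y1 pi = dagger (T2 ** W pi) ** Y1 pi" using w by simp
  also have "\<dots> = dagger (W pi) ** (T2 ** Y1 pi)" unfolding dagger_mult orth_projD(1)[OF T2] by (simp add: matrix_mul_assoc)
  also have "\<dots> = dagger (W pi) ** (H2 ** Y pi)" unfolding y ..
  finally have 1: "dagger (W pi) ** Y1 pi = dagger (W pi) ** (H2 ** Y pi)" .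
  have "dagger (W1 pi) ** Y pi = dagger (W1 pi) ** (T2 ** Y pi)" using y by simp
  also have "\<dots> = dagger (T2 ** W1 pi) ** Y pi" unfolding dagger_mult orth_projD(1)[OF T2] by (simp add: matrix_mul_assoc)
  also have "\<dots> = dagger (W pi) ** (H2 ** Y pi)" unfolding w dagger_mult H2(1) by (simp add: matrix_mul_assoc)
  finally show ?thesis using 1 by simp
qed

text \<open>With Weyl solutions for both arguments the right side becomes a difference of Weyl
  matrices. The symmetry of the Weyl matrix, its Herglotz-type bound and the absence of nonreal
  eigenvalues all come from this identity.\<close>

lemma lagrange_integral:
  fixes Y Y1 :: "real \<Rightarrow> complex^'n^'m" and W W1 :: "real \<Rightarrow> complex^'k^'m"
  assumes Y: "sl_system \<sigma> z (\<lambda>x. 0) Y Y1" "V2 T2 H2 Y Y1 = 0" and W: "sl_system \<sigma> w (\<lambda>x. 0) W W1" "V2 T2 H2 W W1 = 0"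
  shows "((\<lambda>x. cscale (cnj w - z) (dagger (W x) ** Y x)) has_integral
     (dagger (V1 T1 W W1) ** V1_perp T1 Y Y1 - dagger (V1_perp T1 W W1) ** V1 T1 Y Y1)) {0..pi}"
proof -
  have "((\<lambda>x. cscale (cnj w - z) (dagger (W x) ** Y x)) has_integral
     ((dagger (W pi) ** Y1 pi - dagger (W1 pi) ** Y pi) - (dagger (W 0) ** Y1 0 - dagger (W1 0) ** Y 0))) {0..pi}"
    by (rule ac_deriv_has_integral[OF lagrange[OF Y(1) W(1)]]) auto
  then show ?thesis
    unfolding boundary_form_pi[OF Y(2) W(2)] boundary_form_0[OF T1, of "W 0" "Y1 0" "W1 0" "Y 0"]
    unfolding V1_def V1_perp_def by simp
qed

end

lemma V1_mult_right: "V1 T (\<lambda>x. Y x ** C) (\<lambda>x. Y1 x ** C) = V1 T Y Y1 ** C"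
  by (simp add: V1_def mm_simps)

lemma V1_perp_mult_right: "V1_perp T (\<lambda>x. Y x ** C) (\<lambda>x. Y1 x ** C) = V1_perp T Y Y1 ** C"
  by (simp add: V1_perp_def mm_simps)

lemma V2_mult_right: "V2 T H (\<lambda>x. Y x ** C) (\<lambda>x. Y1 x ** C) = V2 T H Y Y1 ** C"
  by (simp add: V2_def mm_simps)

lemma V1_add: "V1 T (\<lambda>x. Y x + W x) (\<lambda>x. Y1 x + W1 x) = V1 T Y Y1 + V1 T W W1"
  by (simp add: V1_def mm_simps)

lemma V1_perp_add: "V1_perp T (\<lambda>x. Y x + W x) (\<lambda>x. Y1 x + W1 x) = V1_perp T Y Y1 + V1_perp T W W1"
  by (simp add: V1_perp_def mm_simps)

lemma trc_cscale: "trc (cscale c A) = c * trc A"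
  by (simp add: trc_def sum_distrib_left)

lemma ac_deriv_fun_cong:
  assumes f: "ac_deriv a b f f'" and eq: "\<And>x. x \<in> {a..b} \<Longrightarrow> f x = g x"
  shows "ac_deriv a b g f'"
proof -
  obtain N where N: "abs_continuous_on_interval a b f" "negligible N"
    "\<And>x. x \<in> {a<..<b} - N \<Longrightarrow> (f has_vector_derivative f' x) (at x)"
    using f by (rule ac_derivE) (rule that, assumption+)
  show ?thesis
  proof (rule ac_derivI[OF _ N(2)])
    show "abs_continuous_on_interval a b g"
      by (rule abs_continuousI_dominated[OF N(1) N(1), of 1 0]) (simp_all add: eq[symmetric])
    fix x assume x: "x \<in> {a<..<b} - N"
    show "(g has_vector_derivative f' x) (at x)"
      by (rule has_vector_derivative_transform_within_open[OF N(3)[OF x], of "{a<..<b}"]) (use x eq in auto)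
  qed
qed

lemma sl_system_fun_cong:
  assumes "sl_system \<sigma> z f Y Y1" "\<And>x. x \<in> {0..pi} \<Longrightarrow> Y x = W x" "\<And>x. x \<in> {0..pi} \<Longrightarrow> Y1 x = W1 x"
  shows "sl_system \<sigma> z f W W1"
proof -
  have a: "ac_deriv 0 pi Y (\<lambda>x. \<sigma> x ** Y x + Y1 x)" "ac_deriv 0 pi Y1 (\<lambda>x. - (\<sigma> x ** Y1 x) - (\<sigma> x ** \<sigma> x) ** Y x - cscale z (Y x) - f x)"
    using assms(1) unfolding sl_system_def by auto
  have "ac_deriv 0 pi W (\<lambda>x. \<sigma> x ** W x + W1 x)"
    by (rule ac_deriv_cong[OF ac_deriv_fun_cong[OF a(1) assms(2)]]) (use assms(2,3) in auto)
  moreover have "ac_deriv 0 pi W1 (\<lambda>x. - (\<sigma> x ** W1 x) - (\<sigma> x ** \<sigma> x) ** W x - cscale z (W x) - f x)"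
    by (rule ac_deriv_cong[OF ac_deriv_fun_cong[OF a(2) assms(3)]]) (use assms(2,3) in auto)
  ultimately show ?thesis unfolding sl_system_def ..
qed

lemma sum_fun_app: "(sum f A) x = (\<Sum>a\<in>A. f a x)"
  by (induction A rule: infinite_finite_induct) auto

text \<open>For \<open>Y = 0\<close> the first equation of the system says that \<open>Y1\<close> is
  the derivative of the zero function.\<close>

lemma sl_zero_quasi_derivative:
  fixes Y Y1 :: "real \<Rightarrow> complex^'n^'m"
  assumes sys: "sl_system \<sigma> z f Y Y1" and Y: "\<And>x. x \<in> {0..pi} \<Longrightarrow> Y x = 0"
  shows "Y1 0 = 0"
proof (rule ac_deriv_zero_fun_continuous[OF _ Y])
  show "ac_deriv 0 pi Y Y1"
    by (rule ac_deriv_cong[of _ _ _ "\<lambda>x. \<sigma> x ** Y x + Y1 x"]) (use sys Y in \<open>auto simp: sl_system_def mm_simps\<close>)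
  show "continuous_on {0..pi} Y1" using sys ac_deriv_continuous unfolding sl_system_def by blast
qed simp_all

section \<open>Determinants, Cramer's rule and holomorphic dependence\<close>

lemma det_nonzeroI:
  fixes A :: "complex^'m^'m"
  assumes "\<And>C :: complex^1^'m. A ** C = 0 \<Longrightarrow> C = 0"
  shows "det A \<noteq> 0"
proof -
  have "x = 0" if "A *v x = 0" for x
  proof -
    let ?C = "(\<chi> i j. x $ i) :: complex^1^'m"
    have "A ** ?C = 0" using that by (simp add: vec_eq_iff matrix_matrix_mult_def matrix_vector_mult_def)
    from assms[OF this] show ?thesis by (simp add: vec_eq_iff)
  qed
  then have "\<exists>B. B ** A = mat 1" unfolding matrix_left_invertible_ker by blast
  then have "invertible A" by (simp add: invertible_left_inverse)
  then show ?thesis by (simp add: invertible_det_nz)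
qed

lemma det_nonzero_cancel:
  fixes A :: "complex^'m^'m" and B C :: "complex^'n^'m"
  assumes "det A \<noteq> 0" "A ** B = A ** C"
  shows "B = C"
proof -
  obtain D where "D ** A = mat 1" using assms(1) unfolding invertible_det_nz[symmetric] invertible_def by blast
  then show ?thesis using assms(2) by (metis matrix_mul_assoc matrix_mul_lid)
qed

text \<open>The numerator in Cramer's rule for entry \<open>(k, j)\<close> of the solution
  \<open>X\<close> of \<open>A ** X = B\<close>. Keeping it apart from the denominator exhibits the
  entries of the Weyl matrix as quotients of entire functions.\<close>

definition cramer_num :: "complex^'m^'m \<Rightarrow> complex^'m^'m \<Rightarrow> 'm \<Rightarrow> 'm \<Rightarrow> complex" where
  "cramer_num A B k j = det (\<chi> i l. if l = k then B $ i $ j else A $ i $ l)"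

lemma cramer_matrix:
  fixes A B :: "complex^'m^'m"
  assumes "det A \<noteq> 0"
  shows "A ** (\<chi> k j. cramer_num A B k j / det A) = B"
proof -
  have "A *v (\<chi> k. cramer_num A B k j / det A) = (\<chi> i. B $ i $ j)" for j
    unfolding cramer[OF assms] cramer_num_def by (simp cong: if_cong)
  then have *: "(A *v (\<chi> k. cramer_num A B k j / det A)) $ i = B $ i $ j" for i j by simp
  show ?thesis
    unfolding vec_eq_iff
  proof (intro allI)
    fix i j show "(A ** (\<chi> k j. cramer_num A B k j / det A)) $ i $ j = B $ i $ j"
      using *[of j i] by (simp add: matrix_matrix_mult_def matrix_vector_mult_def)
  qed
qed

lemma holomorphic_det:
  fixes A :: "complex \<Rightarrow> complex^'m^'m"
  assumes "\<And>i j. (\<lambda>z. A z $ i $ j) holomorphic_on S"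
  shows "(\<lambda>z. det (A z)) holomorphic_on S"
  unfolding det_def by (intro holomorphic_intros assms)

lemma holomorphic_matrix_mult:
  fixes A :: "complex \<Rightarrow> complex^'k^'m" and B :: "complex \<Rightarrow> complex^'n^'k"
  assumes "\<And>i j. (\<lambda>z. A z $ i $ j) holomorphic_on S" "\<And>i j. (\<lambda>z. B z $ i $ j) holomorphic_on S"
  shows "(\<lambda>z. (A z ** B z) $ i $ j) holomorphic_on S"
  unfolding matrix_matrix_mult_def by (simp, intro holomorphic_intros assms)

section \<open>The characteristic function and the Weyl matrix\<close>

context sl
begin

text \<open>\<open>ph\<close> and \<open>sf\<close> are the fundamental solutions for which
  \<open>(V1_perp, V1)\<close> equals \<open>(mat 1, 0)\<close> and
  \<open>(0, mat 1)\<close>.\<close>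

definition "ph z = fst (fs z T1 (perp T1))"
definition "ph1 z = snd (fs z T1 (perp T1))"
definition "sf z = fst (fs z (- perp T1) T1)"
definition "sf1 z = snd (fs z (- perp T1) T1)"

lemma ph_system: "sl_system \<sigma> z (\<lambda>x. 0) (ph z) (ph1 z)" and ph_0: "ph z 0 = T1" "ph1 z 0 = perp T1"
  unfolding ph_def ph1_def by (rule fs)+

lemma sf_system: "sl_system \<sigma> z (\<lambda>x. 0) (sf z) (sf1 z)" and sf_0: "sf z 0 = - perp T1" "sf1 z 0 = T1"
  unfolding sf_def sf1_def by (rule fs)+

lemma V_ph: "V1 T1 (ph z) (ph1 z) = 0" "V1_perp T1 (ph z) (ph1 z) = mat 1"
  unfolding V1_def V1_perp_def ph_0 using orth_projD[OF T1] by (simp_all add: perp_def)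

lemma V_sf: "V1 T1 (sf z) (sf1 z) = mat 1" "V1_perp T1 (sf z) (sf1 z) = 0"
  unfolding V1_def V1_perp_def sf_0 using orth_projD[OF T1] by (simp_all add: mm_simps) (simp_all add: perp_def)

text \<open>A solution \<open>ph z x ** C\<close> meets the condition at \<open>pi\<close> iff
  \<open>Delta z ** C = 0\<close>, so \<open>dd\<close> is the characteristic function.
  \<open>Mw\<close> is \<open>- Delta\<^sup>-\<^sup>1 ** Theta\<close>, written out by Cramer's
  rule; at the zeros of \<open>dd\<close> it is 0 by the convention for division.\<close>

definition "Delta z = V2 T2 H2 (ph z) (ph1 z)"
definition "Theta z = V2 T2 H2 (sf z) (sf1 z)"
definition "dd z = det (Delta z)"
definition "num z k j = cramer_num (Delta z) (- Theta z) k j"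
definition "Mw z = (\<chi> k j. num z k j / dd z)"
definition "Ph z x = sf z x + ph z x ** Mw z"
definition "Ph1 z x = sf1 z x + ph1 z x ** Mw z"

lemma represent:
  assumes "sl_system \<sigma> z (\<lambda>x. 0) Y Y1" "x \<in> {0..pi}"
  shows "Y x = ph z x ** V1_perp T1 Y Y1 + sf z x ** V1 T1 Y Y1"
    "Y1 x = ph1 z x ** V1_perp T1 Y Y1 + sf1 z x ** V1 T1 Y Y1"
  using sl_represent[OF T1 assms] unfolding ph_def ph1_def sf_def sf1_def by auto

lemma V2_represent:
  assumes "sl_system \<sigma> z (\<lambda>x. 0) Y Y1"
  shows "V2 T2 H2 Y Y1 = Delta z ** V1_perp T1 Y Y1 + Theta z ** V1 T1 Y Y1"
proof -
  have "pi \<in> {0..pi}" by simp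
  note r = represent[OF assms this]
  show ?thesis unfolding Delta_def Theta_def V2_def r by (simp add: mm_simps)
qed

lemma holomorphic_ph_pi:
  "(\<lambda>z. ph z pi $ i $ j) holomorphic_on UNIV" "(\<lambda>z. ph1 z pi $ i $ j) holomorphic_on UNIV"
  "(\<lambda>z. sf z pi $ i $ j) holomorphic_on UNIV" "(\<lambda>z. sf1 z pi $ i $ j) holomorphic_on UNIV"
  unfolding ph_def ph1_def sf_def sf1_def by (intro fs_holomorphic; simp)+

lemma holomorphic_Delta: "(\<lambda>z. Delta z $ i $ j) holomorphic_on UNIV"
  and holomorphic_Theta: "(\<lambda>z. Theta z $ i $ j) holomorphic_on UNIV"
proof -
  have h: "(\<lambda>z. V2 T2 H2 (Y z) (Y1 z) $ i $ j) holomorphic_on UNIV"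
    if "\<And>i j. (\<lambda>z. Y z pi $ i $ j) holomorphic_on UNIV" "\<And>i j. (\<lambda>z. Y1 z pi $ i $ j) holomorphic_on UNIV"
    for Y Y1 :: "complex \<Rightarrow> real \<Rightarrow> complex^'m^'m" and i j
    unfolding V2_def vector_minus_component
    by (intro holomorphic_intros holomorphic_matrix_mult that) (simp, intro holomorphic_intros holomorphic_matrix_mult that)+
  show "(\<lambda>z. Delta z $ i $ j) holomorphic_on UNIV" unfolding Delta_def by (intro h holomorphic_ph_pi)
  show "(\<lambda>z. Theta z $ i $ j) holomorphic_on UNIV" unfolding Theta_def by (intro h holomorphic_ph_pi)
qed

lemma holomorphic_dd: "dd holomorphic_on UNIV"
  unfolding dd_def[abs_def] by (intro holomorphic_det holomorphic_Delta)

lemma holomorphic_num: "(\<lambda>z. num z k j) holomorphic_on UNIV"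
  unfolding num_def cramer_num_def
proof (rule holomorphic_det)
  fix i l show "(\<lambda>z. (\<chi> i l. if l = k then (- Theta z) $ i $ j else Delta z $ i $ l) $ i $ l) holomorphic_on UNIV"
    by (cases "l = k") (auto intro!: holomorphic_intros holomorphic_Delta holomorphic_Theta)
qed

lemma Delta_Mw: "dd z \<noteq> 0 \<Longrightarrow> Delta z ** Mw z = - Theta z"
  unfolding Mw_def num_def dd_def by (rule cramer_matrix)

lemma Ph_system: "sl_system \<sigma> z (\<lambda>x. 0) (Ph z) (Ph1 z)"
  using sl_system_add[OF sf_system sl_system_mult_right[OF ph_system, of z "Mw z"]]
  unfolding Ph_def[abs_def] Ph1_def[abs_def] by (simp add: mm_simps)

lemma V_Ph: "V1 T1 (Ph z) (Ph1 z) = mat 1" "V1_perp T1 (Ph z) (Ph1 z) = Mw z"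
  unfolding Ph_def[abs_def] Ph1_def[abs_def] V1_add V1_perp_add V1_mult_right V1_perp_mult_right V_ph V_sf
  by (simp_all add: mm_simps)

lemma V2_Ph: "dd z \<noteq> 0 \<Longrightarrow> V2 T2 H2 (Ph z) (Ph1 z) = 0"
  using V2_represent[OF Ph_system, of z] Delta_Mw[of z] unfolding V_Ph by (simp add: mm_simps)

lemma weyl_unique:
  assumes "dd z \<noteq> 0" "sl_system \<sigma> z (\<lambda>x. 0) Y Y1" "V1 T1 Y Y1 = C" "V2 T2 H2 Y Y1 = 0"
  shows "V1_perp T1 Y Y1 = Mw z ** C"
proof -
  have "Delta z ** V1_perp T1 Y Y1 + Theta z ** C = 0" using V2_represent[OF assms(2)] assms by simp
  then have "Delta z ** V1_perp T1 Y Y1 = (- Theta z) ** C" by (simp add: eq_neg_iff_add_eq_0 mm_simps)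
  also have "\<dots> = Delta z ** (Mw z ** C)" unfolding Delta_Mw[OF assms(1), symmetric] by (simp add: matrix_mul_assoc)
  finally show ?thesis by (rule det_nonzero_cancel[OF assms(1)[unfolded dd_def]])
qed

lemma weyl_matrix_eq: "dd z \<noteq> 0 \<Longrightarrow> weyl_matrix \<sigma> T1 T2 H2 z = Mw z"
  unfolding weyl_matrix_def weyl_solution_def sl_solution_iff_system
proof (rule the_equality)
  assume d: "dd z \<noteq> 0"
  show "\<exists>\<Phi> \<Phi>1. (sl_system \<sigma> z (\<lambda>x. 0) \<Phi> \<Phi>1 \<and> V1 T1 \<Phi> \<Phi>1 = mat 1 \<and> V2 T2 H2 \<Phi> \<Phi>1 = 0) \<and> Mw z = V1_perp T1 \<Phi> \<Phi>1"
    using Ph_system V_Ph V2_Ph[OF d] by (intro exI[of _ "Ph z"] exI[of _ "Ph1 z"]) simp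
  fix M assume "\<exists>\<Phi> \<Phi>1. (sl_system \<sigma> z (\<lambda>x. 0) \<Phi> \<Phi>1 \<and> V1 T1 \<Phi> \<Phi>1 = mat 1 \<and> V2 T2 H2 \<Phi> \<Phi>1 = 0) \<and> M = V1_perp T1 \<Phi> \<Phi>1"
  then obtain \<Phi> \<Phi>1 where "sl_system \<sigma> z (\<lambda>x. 0) \<Phi> \<Phi>1" "V1 T1 \<Phi> \<Phi>1 = mat 1" "V2 T2 H2 \<Phi> \<Phi>1 = 0" "M = V1_perp T1 \<Phi> \<Phi>1"
    by (elim exE conjE)
  then show "M = Mw z" using weyl_unique[OF d, of \<Phi> \<Phi>1 "mat 1"] by (simp add: mm_simps)
qed

text \<open>\<open>lagrange_integral\<close> with both solutions equal: the imaginary part of the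
  trace turns the factor \<open>cnj z - z\<close> into \<open>- 2 * Im z\<close>.\<close>

lemma lagrange_norm:
  fixes Y Y1 :: "real \<Rightarrow> complex^'n^'m"
  assumes "sl_system \<sigma> z (\<lambda>x. 0) Y Y1" "V2 T2 H2 Y Y1 = 0"
  shows "((\<lambda>x. - 2 * Im z * (norm (Y x))\<^sup>2) has_integral
     Im (trc (dagger (V1 T1 Y Y1) ** V1_perp T1 Y Y1 - dagger (V1_perp T1 Y Y1) ** V1 T1 Y Y1))) {0..pi}"
proof -
  have "((Im \<circ> trc \<circ> (\<lambda>x. cscale (cnj z - z) (dagger (Y x) ** Y x))) has_integral
     (Im \<circ> trc) (dagger (V1 T1 Y Y1) ** V1_perp T1 Y Y1 - dagger (V1_perp T1 Y Y1) ** V1 T1 Y Y1)) {0..pi}"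
    by (rule has_integral_linear[OF lagrange_integral[OF assms assms]])
       (auto intro: bounded_linear_compose[OF bounded_linear_Im bounded_linear_trc] simp: comp_def)
  moreover have "(Im \<circ> trc \<circ> (\<lambda>x. cscale (cnj z - z) (dagger (Y x) ** Y x))) = (\<lambda>x. - 2 * Im z * (norm (Y x))\<^sup>2)"
    by (rule ext) (simp add: trc_cscale trc_dagger_mult del: of_real_power)
  ultimately show ?thesis by (simp add: comp_def)
qed

text \<open>Self-adjointness: for nonreal \<open>z\<close> the Lagrange identity makes the
  \<open>L\<^sub>2\<close> norm of a solution with homogeneous boundary conditions vanish.\<close>

lemma nonreal_trivial:
  fixes Y Y1 :: "real \<Rightarrow> complex^'n^'m"
  assumes z: "Im z \<noteq> 0" and Y: "sl_system \<sigma> z (\<lambda>x. 0) Y Y1" "V1 T1 Y Y1 = 0" "V2 T2 H2 Y Y1 = 0"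
  shows "V1_perp T1 Y Y1 = 0"
proof -
  have "((\<lambda>x. - 2 * Im z * (norm (Y x))\<^sup>2) has_integral 0) {0..pi}"
    using lagrange_norm[OF Y(1,3)] unfolding Y(2) by (simp add: mm_simps trc_def)
  from has_integral_mult_right[OF this, of "- 1 / (2 * Im z)"]
  have i: "((\<lambda>x. (norm (Y x))\<^sup>2) has_integral 0) {0..pi}" using z by simp
  have c: "continuous_on {0..pi} Y" using Y(1) ac_deriv_continuous unfolding sl_system_def by blast
  have "Y x = 0" if "x \<in> {0..pi}" for x
  proof -
    have "(norm (Y x))\<^sup>2 = 0"
      by (rule has_integral_0_cbox_imp_0[of 0 pi "\<lambda>x. (norm (Y x))\<^sup>2"]) (use i c that pi_gt_zero in \<open>auto intro!: continuous_intros simp del: pi_gt_zero\<close>)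
    then show ?thesis by simp
  qed
  then have "Y 0 = 0" "Y1 0 = 0" using sl_zero_quasi_derivative[OF Y(1)] by auto
  then show ?thesis unfolding V1_perp_def by (simp add: mm_simps)
qed

lemma dd_nonreal: "Im z \<noteq> 0 \<Longrightarrow> dd z \<noteq> 0"
  unfolding dd_def
proof (rule det_nonzeroI)
  fix C :: "complex^1^'m" assume z: "Im z \<noteq> 0" and C: "Delta z ** C = 0"
  have s: "sl_system \<sigma> z (\<lambda>x. 0) (\<lambda>x. ph z x ** C) (\<lambda>x. ph1 z x ** C)"
    using sl_system_mult_right[OF ph_system, of z C] by (simp add: mm_simps)
  have "V1_perp T1 (\<lambda>x. ph z x ** C) (\<lambda>x. ph1 z x ** C) = 0"
    by (rule nonreal_trivial[OF z s]) (simp_all add: V1_mult_right V2_mult_right V_ph mm_simps C flip: Delta_def)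
  then show "C = 0" unfolding V1_perp_mult_right V_ph by (simp add: mm_simps)
qed

text \<open>For the parameters \<open>z\<close> and \<open>cnj z\<close> the factor in the Lagrange
  identity is 0, so its boundary terms cancel.\<close>

lemma Mw_dagger: "Im z \<noteq> 0 \<Longrightarrow> dagger (Mw (cnj z)) = Mw z"
proof -
  assume z: "Im z \<noteq> 0"
  then have d: "dd z \<noteq> 0" "dd (cnj z) \<noteq> 0" by (auto intro!: dd_nonreal)
  from lagrange_integral[OF Ph_system V2_Ph[OF d(1)] Ph_system V2_Ph[OF d(2)]]
  have "((\<lambda>x. 0 :: complex^'m^'m) has_integral (Mw z - dagger (Mw (cnj z)))) {0..pi}"
    unfolding V_Ph by (simp add: mm_simps cs_simps)
  then have "Mw z - dagger (Mw (cnj z)) = 0" using has_integral_unique[OF _ has_integral_0] by blast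
  then show ?thesis by simp
qed

text \<open>A nonzero \<open>C\<close> in the kernel of \<open>Delta z\<close> yields the
  eigenfunction \<open>ph z x ** C\<close>. It does not vanish because \<open>C\<close> is its value
  of \<open>V1_perp\<close>.\<close>

lemma dd_zero_imp_eigenspace:
  assumes "dd z = 0"
  shows "\<exists>Y \<in> eigenspace \<sigma> T1 T2 H2 z. Y \<noteq> 0"
proof -
  obtain C :: "complex^1^'m" where C: "Delta z ** C = 0" "C \<noteq> 0" using assms det_nonzeroI[of "Delta z"] unfolding dd_def by blast
  have s: "sl_system \<sigma> z (\<lambda>x. 0) (\<lambda>x. ph z x ** C) (\<lambda>x. ph1 z x ** C)"
    using sl_system_mult_right[OF ph_system, of z C] by (simp add: mm_simps)
  define Y where "Y = (\<lambda>x. if x \<in> {0..pi} then ph z x ** C else 0)"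
  define Y1 where "Y1 = (\<lambda>x. ph1 z x ** C)"
  have sY: "sl_system \<sigma> z (\<lambda>x. 0) Y Y1" by (rule sl_system_fun_cong[OF s]) (auto simp: Y_def Y1_def)
  have v: "V1 T1 Y Y1 = V1 T1 (ph z) (ph1 z) ** C" "V1_perp T1 Y Y1 = V1_perp T1 (ph z) (ph1 z) ** C" "V2 T2 H2 Y Y1 = Delta z ** C"
    unfolding V1_def V1_perp_def V2_def Delta_def Y_def Y1_def by (simp_all add: mm_simps)
  have "Y \<in> eigenspace \<sigma> T1 T2 H2 z"
    unfolding eigenspace_def sl_solution_iff_system using sY v C by (auto simp: V_ph mm_simps Y_def)
  moreover have "Y \<noteq> 0"
  proof
    assume Y0: "Y = 0"
    then have "Y 0 = 0" "Y1 0 = 0" using sl_zero_quasi_derivative[OF sY] by auto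
    then have "V1_perp T1 Y Y1 = 0" unfolding V1_perp_def by (simp add: mm_simps)
    then show False using v C unfolding V_ph by (simp add: mm_simps)
  qed
  ultimately show ?thesis by blast
qed

text \<open>\<open>vector_space.dim\<close> is the cardinality of a basis, and \<open>card\<close>
  is 0 for infinite sets. So multiplicity 0 implies a trivial eigenspace only once the latter lies
  in a finite span, here that of the columns of \<open>ph z\<close>.\<close>

lemma eigenspace_finite_span:
  obtains F where "finite F" "eigenspace \<sigma> T1 T2 H2 z \<subseteq> module.span fscale F"
proof -
  interpret vs: vector_space "fscale :: complex \<Rightarrow> (real \<Rightarrow> complex^1^'m) \<Rightarrow> real \<Rightarrow> complex^1^'m"
    by (rule vector_space_fscale)
  define e where "e = (\<lambda>k. (\<lambda>x. if x \<in> {0..pi} then (\<chi> i j. ph z x $ i $ k) else 0) :: real \<Rightarrow> complex^1^'m)"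
  have "Y \<in> vs.span (range e)" if Y: "Y \<in> eigenspace \<sigma> T1 T2 H2 z" for Y
  proof -
    obtain Y1 where Y1: "sl_system \<sigma> z (\<lambda>x. 0) Y Y1" "V1 T1 Y Y1 = 0" and out: "\<And>x. x \<notin> {0..pi} \<Longrightarrow> Y x = 0"
      using Y unfolding eigenspace_def sl_solution_iff_system by blast
    define C where "C = V1_perp T1 Y Y1"
    have Yx: "Y x = ph z x ** C" if "x \<in> {0..pi}" for x
      using represent(1)[OF Y1(1) that] unfolding Y1(2) C_def by (simp add: mm_simps)
    have "Y = (\<Sum>k\<in>UNIV. fscale (C $ k $ 1) (e k))"
    proof
      fix x
      have "(\<Sum>k\<in>UNIV. fscale (C $ k $ 1) (e k)) x = (\<Sum>k\<in>UNIV. cscale (C $ k $ 1) (e k x))"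
        by (simp add: fscale_def sum_fun_app)
      also have "\<dots> = Y x"
      proof (cases "x \<in> {0..pi}")
        case True
        then show ?thesis unfolding Yx[OF True]
          by (simp add: e_def vec_eq_iff matrix_matrix_mult_def mult.commute forall_1)
      next
        case False
        then have "e k x = 0" for k unfolding e_def by (simp only: if_False)
        then show ?thesis using out[OF False] by (simp add: cs_simps)
      qed
      finally show "Y x = (\<Sum>k\<in>UNIV. fscale (C $ k $ 1) (e k)) x" by simp
    qed
    also have "\<dots> \<in> vs.span (range e)" by (intro vs.span_sum vs.span_scale vs.span_base) auto
    finally show ?thesis .
  qed
  then show ?thesis by (intro that[of "range e"]) auto
qed

text \<open>Serves to show that each zero of \<open>dd\<close> is listed among the eigenvalues, so
  that the spectral data prescribe the weight matrix there.\<close>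

lemma eigen_multiplicity_nonzero:
  assumes "dd z = 0"
  shows "eigen_multiplicity \<sigma> T1 T2 H2 z \<noteq> 0"
proof
  interpret vs: vector_space "fscale :: complex \<Rightarrow> (real \<Rightarrow> complex^1^'m) \<Rightarrow> real \<Rightarrow> complex^1^'m"
    by (rule vector_space_fscale)
  let ?V = "eigenspace \<sigma> T1 T2 H2 z"
  assume 0: "eigen_multiplicity \<sigma> T1 T2 H2 z = 0"
  obtain F where F: "finite F" "?V \<subseteq> vs.span F" by (rule eigenspace_finite_span) (rule that, assumption+)
  obtain B where B: "B \<subseteq> ?V" "vs.independent B" "?V \<subseteq> vs.span B" "card B = vs.dim ?V"
    by (rule vs.basis_exists)
  have "finite B" using vs.independent_span_bound[OF F(1) B(2)] B(1) F(2) by blast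
  then have "B = {}" using B(4) 0 unfolding eigen_multiplicity_def by simp
  then have "?V \<subseteq> {0}" using B(3) by simp
  then show False using dd_zero_imp_eigenspace[OF assms] by blast
qed

end

subsection \<open>Entire functions with growth conditions\<close>

text \<open>On the vertical segment above \<open>z0\<close> a pole of order \<open>n\<close> grows
  like \<open>1 / t ^ n\<close>, so the bound \<open>C / t\<close> leaves only order 1; and at a
  simple pole the residue is not 0.\<close>

lemma removable_at_simple_pole_residue_zero:
  fixes f :: "complex \<Rightarrow> complex"
  assumes ne: "not_essential f z0" and hol: "f holomorphic_on ball z0 r - {z0}" and r: "r > 0"
    and bd: "\<And>t. \<lbrakk>0 < t; t < r\<rbrakk> \<Longrightarrow> norm (f (z0 + \<i> * of_real t)) \<le> C / t" and res: "residue f z0 = 0"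
  shows "\<exists>c. f \<midarrow>z0\<rightarrow> c"
proof -
  have "\<not> is_pole f z0"
  proof
    assume pole: "is_pole f z0"
    define n where "n = nat (- zorder f z0)"
    define g where "g = zor_poly f z0"
    have "zorder f z0 < 0 \<and> g z0 \<noteq> 0 \<and> (\<exists>s. s > 0 \<and> cball z0 s \<subseteq> ball z0 r \<and> g holomorphic_on cball z0 s
      \<and> (\<forall>w\<in>cball z0 s - {z0}. f w = g w / (w - z0) ^ n \<and> g w \<noteq> 0))"
      unfolding g_def n_def by (rule zorder_exist_pole[OF hol _ _ pole]) (use r in auto)
    then obtain s where s: "zorder f z0 < 0" "g z0 \<noteq> 0" "s > 0" "cball z0 s \<subseteq> ball z0 r" "g holomorphic_on cball z0 s"
       and fg: "\<And>w. w \<in> cball z0 s - {z0} \<Longrightarrow> f w = g w / (w - z0) ^ n" by blast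
    have "n \<ge> 1" using s(1) unfolding n_def by simp
    have ghol: "g holomorphic_on ball z0 s" using s(5) by (rule holomorphic_on_subset) auto
    show False
    proof (cases "n = 1")
      case True
      have "residue f z0 = residue (\<lambda>w. g w / (w - z0)) z0"
      proof (rule residue_cong)
        have "eventually (\<lambda>w. w \<in> ball z0 s - {z0}) (at z0)" using s(3) by (intro eventually_at_in_open) auto
        then show "\<forall>\<^sub>F z in at z0. f z = g z / (z - z0)"
          by eventually_elim (use fg True in auto)
      qed simp
      also have "\<dots> = g z0" by (rule residue_simple[OF _ _ ghol]) (use s in auto)
      finally show False using res s(2) by simp
    next
      case False
      with \<open>n \<ge> 1\<close> obtain k where k: "n = Suc (Suc k)" by (metis One_nat_def Suc_le_D old.nat.exhaust)
      have "isCont g z0" using holomorphic_on_imp_continuous_on[OF ghol] s(3) by (simp add: continuous_on_eq_continuous_at)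
      then have lim: "((\<lambda>t. g (z0 + \<i> * of_real t)) \<longlongrightarrow> g (z0 + \<i> * of_real 0)) (at_right 0)"
        by (intro isCont_tendsto_compose[of _ g] tendsto_intros) auto
      have "((\<lambda>t. C * t ^ Suc k) \<longlongrightarrow> C * 0 ^ Suc k) (at_right 0)" by (intro tendsto_intros)
      then have lim0: "((\<lambda>t. C * t ^ Suc k) \<longlongrightarrow> 0) (at_right (0::real))" by simp
      \<comment> \<open>For \<open>n = k + 2\<close> the bound makes the regular factor at most
        \<open>C * t ^ Suc k\<close>. It thus tends to 0, against
        \<open>g z0 \<noteq> 0\<close>.\<close>
      have "((\<lambda>t. g (z0 + \<i> * of_real t)) \<longlongrightarrow> 0) (at_right 0)"
      proof (rule Lim_null_comparison[OF _ lim0])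
        have "eventually (\<lambda>t. t \<in> {0<..<s}) (at_right 0)" using s(3) by (intro eventually_at_right_real)
        then show "\<forall>\<^sub>F t in at_right 0. norm (g (z0 + \<i> * of_real t)) \<le> C * t ^ Suc k"
        proof eventually_elim
          fix t assume t: "t \<in> {0<..<s}"
          have w: "z0 + \<i> * of_real t \<in> cball z0 s - {z0}" using t by (auto simp: dist_norm norm_mult)
          have "s \<le> r" using s(3,4) by (simp add: cball_subset_ball_iff)
          then have "norm (f (z0 + \<i> * of_real t)) \<le> C / t" using t by (intro bd) auto
          then have "norm (g (z0 + \<i> * of_real t)) / t ^ n \<le> C / t"
            unfolding fg[OF w] using t by (simp add: norm_divide norm_power norm_mult)
          then have "norm (g (z0 + \<i> * of_real t)) \<le> C / t * t ^ n" using t by (simp add: field_simps)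
          then show "norm (g (z0 + \<i> * of_real t)) \<le> C * t ^ Suc k" using t unfolding k by simp
        qed
      qed
      then have "g z0 = 0" using tendsto_unique[OF _ lim] by simp
      then show False using s(2) by simp
    qed
  qed
  then show ?thesis using ne unfolding not_essential_def by blast
qed

text \<open>On the circle of radius \<open>R\<close> the factor \<open>w\<^sup>2 - R\<^sup>2\<close>
  equals \<open>w * (w - cnj w)\<close> and has modulus \<open>2 R \<bar>Im w\<bar>\<close>, which
  cancels the singular denominator. The maximum principle then gives linear growth at half the
  radius.\<close>

lemma entire_linear_of_imaginary_bound:
  fixes g :: "complex \<Rightarrow> complex"
  assumes hol: "g holomorphic_on UNIV" and C: "C \<ge> 0"
    and bd: "\<And>z. Im z \<noteq> 0 \<Longrightarrow> norm (g z) \<le> C * (1 + norm z)\<^sup>2 / \<bar>Im z\<bar>"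
  shows "\<exists>a b. \<forall>z. g z = a + b * z"
proof -
  have key: "norm (g z) \<le> 12 * C * norm z ^ 1" if z: "1 \<le> norm z" for z
  proof -
    define r where "r = norm z"
    \<comment> \<open>Doubling the radius keeps the modulus of \<open>z\<^sup>2 - R\<^sup>2\<close>
      at least \<open>3 * r\<^sup>2\<close>.\<close>
    define R where "R = 2 * r"
    have r1: "r \<ge> 1" using z unfolding r_def .
    define h where "h = (\<lambda>w. g w * (w\<^sup>2 - of_real (R\<^sup>2)))"
    have hh: "h holomorphic_on UNIV" unfolding h_def by (intro holomorphic_intros hol)
    have "norm (h z) \<le> 2 * R * C * (1 + R)\<^sup>2"
    proof (rule maximum_modulus_frontier[of h "cball 0 R"])
      show "h holomorphic_on interior (cball 0 R)" using hh by (rule holomorphic_on_subset) auto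
      show "continuous_on (closure (cball 0 R)) h"
        by (rule holomorphic_on_imp_continuous_on[OF holomorphic_on_subset[OF hh]]) auto
      show "z \<in> cball 0 R" unfolding R_def r_def by simp
      fix w :: complex assume "w \<in> frontier (cball 0 R)"
      then have w: "norm w = R" using r1 by (simp add: R_def)
      have "of_real (R\<^sup>2) = w * cnj w" unfolding w[symmetric] by (rule complex_norm_square)
      then have e: "w\<^sup>2 - of_real (R\<^sup>2) = w * (w - cnj w)" by (simp add: power2_eq_square algebra_simps)
      have n: "norm (w\<^sup>2 - of_real (R\<^sup>2)) = R * (2 * \<bar>Im w\<bar>)"
        unfolding e complex_diff_cnj norm_mult w by (simp add: abs_mult)
      show "norm (h w) \<le> 2 * R * C * (1 + R)\<^sup>2"
      proof (cases "Im w = 0")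
        case True
        then have "norm (h w) = 0" unfolding h_def norm_mult n by simp
        then show ?thesis using C r1 by (simp add: R_def)
      next
        case False
        have "norm (h w) = norm (g w) * (R * (2 * \<bar>Im w\<bar>))" unfolding h_def norm_mult n ..
        also have "\<dots> \<le> C * (1 + R)\<^sup>2 / \<bar>Im w\<bar> * (R * (2 * \<bar>Im w\<bar>))"
          using bd[OF False] r1 unfolding w by (intro mult_right_mono) (auto simp: R_def)
        also have "\<dots> = 2 * R * C * (1 + R)\<^sup>2" using False by simp
        finally show ?thesis .
      qed
    qed auto
    moreover have "norm (g z) * (3 * r\<^sup>2) \<le> norm (h z)"
    proof -
      have "R\<^sup>2 - r\<^sup>2 \<le> norm (z\<^sup>2 - of_real (R\<^sup>2))"
        using norm_triangle_ineq2[of "of_real (R\<^sup>2) :: complex" "z\<^sup>2"] unfolding r_def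
        by (simp add: norm_power norm_minus_commute del: of_real_power)
      then have "3 * r\<^sup>2 \<le> norm (z\<^sup>2 - of_real (R\<^sup>2))" unfolding R_def by (simp add: power2_eq_square)
      then show ?thesis unfolding h_def norm_mult by (intro mult_left_mono) auto
    qed
    ultimately have 1: "norm (g z) * (3 * r\<^sup>2) \<le> 2 * R * C * (1 + R)\<^sup>2" by linarith
    have "(1 + R)\<^sup>2 \<le> (3 * r)\<^sup>2" using r1 unfolding R_def by (intro power_mono) auto
    then have "2 * R * C * (1 + R)\<^sup>2 \<le> 2 * R * C * (3 * r)\<^sup>2" using C r1 by (intro mult_left_mono) (auto simp: R_def)
    with 1 have "norm (g z) * (3 * r\<^sup>2) \<le> (12 * C * r) * (3 * r\<^sup>2)" unfolding R_def by (simp add: power_mult_distrib mult_ac)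
    then have "norm (g z) \<le> 12 * C * r" using r1 by (simp only: mult_le_cancel_right) (auto simp: not_less mult_le_0_iff)
    then show ?thesis unfolding r_def by simp
  qed
  have "g z = g 0 + deriv g 0 * z" for z
    using Liouville_polynomial[OF hol key, of 1 z] by simp
  then show ?thesis by blast
qed

text \<open>An entire function is at most linear once it is dominated by the kind of bound that
  Herglotz functions satisfy; here the poles cancel because the residues agree.\<close>

lemma linear_of_imaginary_bound:
  fixes f D :: "complex \<Rightarrow> complex"
  assumes D: "D holomorphic_on UNIV" "\<And>z. Im z \<noteq> 0 \<Longrightarrow> D z \<noteq> 0"
    and hol: "f holomorphic_on {z. D z \<noteq> 0}" and ne: "\<And>z. D z = 0 \<Longrightarrow> not_essential f z"
    and res: "\<And>z. D z = 0 \<Longrightarrow> residue f z = 0" and C: "C \<ge> 0"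
    and bd: "\<And>z. Im z \<noteq> 0 \<Longrightarrow> norm (f z) \<le> C * (1 + norm z)\<^sup>2 / \<bar>Im z\<bar>"
  shows "\<exists>a b. \<forall>z. D z \<noteq> 0 \<longrightarrow> f z = a + b * z"
proof -
  have op: "open {z. D z \<noteq> 0}"
    using continuous_open_preimage[OF holomorphic_on_imp_continuous_on[OF D(1)] open_UNIV, of "- {0}"]
    by (simp add: vimage_def open_Compl)
  have fan: "f analytic_on {z}" if "D z \<noteq> 0" for z using hol op that analytic_at by blast
  define g where "g = remove_sings f"
  have gf: "g z = f z" if "D z \<noteq> 0" for z unfolding g_def using fan[OF that] by simp
  have "g analytic_on {z}" for z
  proof (cases "D z = 0")
    case False then show ?thesis unfolding g_def by (intro remove_sings_analytic_on fan)
  next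
    case True
    have D1: "D \<i> \<noteq> 0" by (rule D(2)) simp
    obtain r where r: "0 < r" "\<And>w. w \<in> ball z r - {z} \<Longrightarrow> D w \<noteq> 0"
      using isolated_zeros[OF D(1) open_UNIV connected_UNIV _ True _ D1] by (metis UNIV_I)
    \<comment> \<open>At most 1, so that the modulus is at most \<open>norm z + 1\<close> on the
      whole vertical segment.\<close>
    define r' where "r' = min r 1"
    have r': "0 < r'" unfolding r'_def using r(1) by simp
    have hol': "f holomorphic_on ball z r' - {z}"
      using hol by (rule holomorphic_on_subset) (use r(2) in \<open>auto simp: r'_def\<close>)
    have Imz: "Im z = 0" using D(2)[of z] True by blast
    have "\<exists>c. f \<midarrow>z\<rightarrow> c"
    proof (rule removable_at_simple_pole_residue_zero[OF ne[OF True] hol' r' _ res[OF True]])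
      fix t :: real assume t: "0 < t" "t < r'"
      have "norm (f (z + \<i> * of_real t)) \<le> C * (1 + norm (z + \<i> * of_real t))\<^sup>2 / \<bar>Im (z + \<i> * of_real t)\<bar>"
        by (rule bd) (use t Imz in simp)
      also have "\<dots> = C * (1 + norm (z + \<i> * of_real t))\<^sup>2 / t" using t Imz by simp
      also have "\<dots> \<le> C * (2 + norm z)\<^sup>2 / t"
      proof -
        have "norm (z + \<i> * of_real t) \<le> norm z + 1"
          using norm_triangle_ineq[of z "\<i> * of_real t"] t by (simp add: norm_mult r'_def)
        then show ?thesis using t C by (intro divide_right_mono mult_left_mono power_mono) auto
      qed
      finally show "norm (f (z + \<i> * of_real t)) \<le> C * (2 + norm z)\<^sup>2 / t" .
    qed
    moreover have "isolated_singularity_at f z" unfolding isolated_singularity_at_def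
      using r' hol' by (intro exI[of _ r']) (simp add: analytic_on_open open_delete)
    ultimately show ?thesis unfolding g_def using remove_sings_analytic_at by blast
  qed
  then have ghol: "g holomorphic_on UNIV" using analytic_imp_holomorphic analytic_on_analytic_at by blast
  have gbd: "norm (g z) \<le> C * (1 + norm z)\<^sup>2 / \<bar>Im z\<bar>" if "Im z \<noteq> 0" for z
    unfolding gf[OF D(2)[OF that]] by (rule bd[OF that])
  have "\<exists>a b. \<forall>z. g z = a + b * z" by (rule entire_linear_of_imaginary_bound[OF ghol C gbd])
  then obtain a b where "\<forall>z. g z = a + b * z" by (elim exE)
  then show ?thesis using gf by metis
qed

text \<open>The exponent \<open>3/4\<close> is above the growth order \<open>1/2\<close> and below
  1. The power of a right half-plane therefore stays in a sector of half-angle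
  \<open>3 * pi / 8\<close>, where real part and modulus are comparable.\<close>

lemma Re_powr_lower_bound:
  assumes w: "Re w > 0"
  shows "cos (3 * pi / 8) * (norm w powr (3/4)) \<le> Re (w powr (3/4))"
proof -
  have w0: "w \<noteq> 0" using w by auto
  have im: "\<bar>Im (Ln w)\<bar> < pi / 2" using Re_Ln_pos_lt[OF w0] w by simp
  have "Re (w powr (3/4)) = exp (3/4 * ln (norm w)) * cos (3/4 * Im (Ln w))"
    using w0 by (simp add: powr_def Re_exp)
  moreover have "cos (3 * pi / 8) \<le> cos (3/4 * Im (Ln w))"
  proof -
    have "cos (3 * pi / 8) \<le> cos \<bar>3/4 * Im (Ln w)\<bar>"
      using im by (intro cos_monotone_0_pi_le) (auto simp: abs_mult)
    then show ?thesis by (simp only: cos_abs_real)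
  qed
  moreover have "norm w powr (3/4) = exp (3/4 * ln (norm w))" using w0 by (simp add: powr_def)
  ultimately show ?thesis by (simp add: mult.commute)
qed

text \<open>The factor with exponent \<open>- e * (w + 1) powr (3/4)\<close> beats the growth of
  order \<open>1/2\<close> on large arcs, has modulus at most 1 on the half-plane, and disappears as
  \<open>e\<close> tends to 0. The shift by 1 keeps the half-plane off the branch cut.\<close>

lemma phragmen_lindelof_half_plane:
  fixes g :: "complex \<Rightarrow> complex"
  assumes hol: "g holomorphic_on UNIV" and K: "K > 0" and gr: "\<And>z. norm (g z) \<le> K * exp (K * sqrt (norm z))"
    and M: "M > 0" and bd: "\<And>z. Re z = 0 \<Longrightarrow> norm (g z) \<le> M" and z: "Re z \<ge> 0"
  shows "norm (g z) \<le> M"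
proof -
  define c where "c = cos (3 * pi / 8)"
  have c: "c > 0" unfolding c_def by (intro cos_gt_zero) auto
  have eps: "norm (g z) \<le> M * exp (e * norm ((z + 1) powr (3/4)))" if e: "e > 0" for e
  proof -
    define h where "h = (\<lambda>w. g w * exp (- of_real e * (w + 1) powr (3/4)))"
    have nh: "norm (h w) = norm (g w) * exp (- (e * Re ((w + 1) powr (3/4))))" for w
      unfolding h_def by (simp add: norm_mult)
    have Rlow: "c * norm (w + 1) powr (3/4) \<le> Re ((w + 1) powr (3/4))" if "Re w \<ge> 0" for w
      unfolding c_def using that by (intro Re_powr_lower_bound) simp
    \<comment> \<open>\<open>t \<ge> (K + 1) / (e * c)\<close> makes the exponent on the arc at most
      \<open>- t\<^sup>2\<close>, \<open>t \<ge> K / M\<close> then brings the bound below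
      \<open>M\<close>, and \<open>t \<ge> norm z\<close> puts \<open>z\<close> inside the
      arc.\<close>
    define t where "t = 1 + norm z + (K + 1) / (e * c) + K / M"
    have ts: "(K + 1) / (e * c) > 0" "K / M > 0" using K M e c by auto
    have t: "t \<ge> 1" "t \<ge> norm z" "t \<ge> (K + 1) / (e * c)" "t \<ge> K / M" unfolding t_def using ts norm_ge_zero[of z] by linarith+
    \<comment> \<open>A fourth power, so that \<open>sqrt R\<close> and \<open>R powr (3/4)\<close>
      are \<open>t\<^sup>2\<close> and \<open>t ^ 3\<close>.\<close>
    define R where "R = t ^ 4"
    have R_t: "R \<ge> t" unfolding R_def using power_increasing[of 1 4 t] t by simp
    have sqR: "sqrt R = t\<^sup>2" unfolding R_def using t by (simp add: real_sqrt_unique)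
    have prR: "R powr (3/4) = t ^ 3"
    proof -
      have "R = t powr 4" unfolding R_def using t powr_realpow[of t 4] by simp
      then have "R powr (3/4) = t powr 3" by (simp add: powr_powr)
      then show ?thesis using t powr_realpow[of t 3] by simp
    qed
    define S where "S = {w :: complex. Re w \<ge> 0} \<inter> cball 0 R"
    have clS: "closed S" unfolding S_def by (intro closed_Int closed_cball closed_halfspace_Re_ge)
    have hh: "h holomorphic_on {w. Re w > - 1}"
      unfolding h_def by (intro holomorphic_intros holomorphic_on_subset[OF hol]) (auto simp: complex_nonpos_Reals_iff)
    have Ssub: "S \<subseteq> {w. Re w > - 1}" unfolding S_def by auto
    have "norm (h z) \<le> M"
    proof (rule maximum_modulus_frontier[of h S])
      show "h holomorphic_on interior S" using hh by (rule holomorphic_on_subset) (use Ssub interior_subset in blast)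
      show "continuous_on (closure S) h"
        unfolding closure_closed[OF clS] by (rule continuous_on_subset[OF holomorphic_on_imp_continuous_on[OF hh] Ssub])
      show "bounded S" unfolding S_def by (auto intro: bounded_Int)
      show "z \<in> S" unfolding S_def using z R_t t by simp
      fix w assume "w \<in> frontier S"
      then have wS: "w \<in> S" and wi: "w \<notin> interior S" using clS by (auto simp: frontier_def)
      have Rew: "Re w \<ge> 0" using wS unfolding S_def by simp
      have ex1: "exp (- (e * Re ((w + 1) powr (3/4)))) \<le> 1"
        using Rlow[OF Rew] c e order_trans[of 0 "c * norm (w + 1) powr (3/4)"] by simp
      have "Re w = 0 \<or> norm w = R"
      proof (rule ccontr)
        assume "\<not> (Re w = 0 \<or> norm w = R)"
        then have "w \<in> {w. Re w > 0} \<inter> ball 0 R" using wS unfolding S_def by auto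
        moreover have "{w. Re w > 0} \<inter> ball 0 R \<subseteq> interior S"
          by (rule interior_maximal) (auto simp: S_def intro!: open_Int open_halfspace_Re_gt)
        ultimately show False using wi by blast
      qed
      then show "norm (h w) \<le> M"
      proof
        assume "Re w = 0"
        then have "norm (g w) \<le> M" by (rule bd)
        then have "norm (g w) * exp (- (e * Re ((w + 1) powr (3/4)))) \<le> M * 1"
          using ex1 M by (intro mult_mono) auto
        then show ?thesis unfolding nh by simp
      next
        assume wR: "norm w = R"
        have "R \<le> norm (w + 1)"
        proof -
          have "(norm w)\<^sup>2 \<le> (norm (w + 1))\<^sup>2" using Rew unfolding cmod_power2 by (simp add: power2_eq_square algebra_simps)
          then have "norm w \<le> norm (w + 1)" by (rule power2_le_imp_le) simp
          then show ?thesis using wR by simp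
        qed
        then have "t ^ 3 \<le> norm (w + 1) powr (3/4)"
          unfolding prR[symmetric] using R_t t by (intro powr_mono2) auto
        then have "c * t ^ 3 \<le> Re ((w + 1) powr (3/4))"
          using Rlow[OF Rew] c by (meson order_trans mult_left_mono less_imp_le)
        then have l1: "e * (c * t ^ 3) \<le> e * Re ((w + 1) powr (3/4))" using e by (intro mult_left_mono) auto
        have "(K + 1) * t\<^sup>2 \<le> (t * (e * c)) * t\<^sup>2"
          using t(3) e c by (intro mult_right_mono) (auto simp: pos_divide_le_eq)
        then have l2: "K * t\<^sup>2 - e * (c * t ^ 3) \<le> - t\<^sup>2" by (simp add: power2_eq_square power3_eq_cube algebra_simps)
        have "norm (h w) \<le> (K * exp (K * t\<^sup>2)) * exp (- (e * (c * t ^ 3)))"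
          unfolding nh using gr[of w] l1 K unfolding wR sqR by (intro mult_mono) auto
        also have "\<dots> = K * exp (K * t\<^sup>2 - e * (c * t ^ 3))" by (simp add: exp_diff exp_minus divide_inverse)
        also have "\<dots> \<le> K * exp (- t\<^sup>2)" using l2 K by simp
        also have "\<dots> = K / exp (t\<^sup>2)" by (simp add: exp_minus divide_inverse)
        also have "\<dots> \<le> K / t"
        proof -
          have "t \<le> t\<^sup>2" using t by (simp add: power2_eq_square)
          then have "t \<le> exp (t\<^sup>2)" using exp_ge_add_one_self[of "t\<^sup>2"] by linarith
          then show ?thesis using K t by (intro divide_left_mono) auto
        qed
        also have "\<dots> \<le> M" using t M K by (simp add: pos_divide_le_eq mult.commute)
        finally show ?thesis .
      qed
    qed
    then have "norm (g z) * exp (- (e * Re ((z + 1) powr (3/4)))) \<le> M" unfolding nh .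
    then have "norm (g z) \<le> M * exp (e * Re ((z + 1) powr (3/4)))" by (simp add: exp_minus field_simps)
    also have "\<dots> \<le> M * exp (e * norm ((z + 1) powr (3/4)))"
      using e M complex_Re_le_cmod by (intro mult_left_mono) auto
    finally show ?thesis .
  qed
  define q where "q = norm ((z + 1) powr (3/4))"
  have "((\<lambda>e. M * exp (e * q)) \<longlongrightarrow> M * exp (0 * q)) (at_right 0)" by (intro tendsto_intros)
  then have "((\<lambda>e. M * exp (e * q)) \<longlongrightarrow> M) (at_right 0)" by simp
  then show ?thesis
  proof (rule tendsto_lowerbound)
    show "\<forall>\<^sub>F e in at_right 0. norm (g z) \<le> M * exp (e * q)"
      using eps unfolding q_def eventually_at_right_field by (intro exI[of _ 1]) simp
  qed simp
qed

text \<open>For order \<open>1/2\<close> boundedness on one line suffices: the principle covers both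
  half-planes, so \<open>g\<close> is bounded, hence constant by Liouville, and its decay along the
  line makes the constant 0.\<close>

lemma phragmen_lindelof_zero:
  fixes g :: "complex \<Rightarrow> complex"
  assumes hol: "g holomorphic_on UNIV" and K: "K > 0" and gr: "\<And>z. norm (g z) \<le> K * exp (K * sqrt (norm z))"
    and bd: "\<And>y. \<bar>y\<bar> \<ge> y0 \<Longrightarrow> norm (g (\<i> * of_real y)) \<le> C / sqrt \<bar>y\<bar>"
  shows "g z = 0"
proof -
  have cont: "continuous_on UNIV g" by (rule holomorphic_on_imp_continuous_on[OF hol])
  have "compact ((\<lambda>y. g (\<i> * of_real y)) ` {- \<bar>y0\<bar> - 1..\<bar>y0\<bar> + 1})"
    by (intro compact_continuous_image continuous_on_compose2[OF cont] continuous_intros) auto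
  then obtain B where B: "B > 0" "\<And>y. y \<in> {- \<bar>y0\<bar> - 1..\<bar>y0\<bar> + 1} \<Longrightarrow> norm (g (\<i> * of_real y)) \<le> B"
    using compact_imp_bounded bounded_pos by (metis imageI)
  define M where "M = B + \<bar>C\<bar>"
  have M: "M > 0" unfolding M_def using B by simp
  have im: "norm (g w) \<le> M" if "Re w = 0" for w
  proof -
    have w: "w = \<i> * of_real (Im w)" using that by (simp add: complex_eq_iff)
    show ?thesis
    proof (cases "\<bar>Im w\<bar> \<le> \<bar>y0\<bar> + 1")
      case True
      then have "norm (g w) \<le> B" by (subst w) (rule B(2), auto)
      then show ?thesis unfolding M_def by simp
    next
      case False
      then have y: "\<bar>Im w\<bar> \<ge> 1" "\<bar>Im w\<bar> \<ge> y0" by auto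
      have "norm (g w) \<le> C / sqrt \<bar>Im w\<bar>" by (subst w) (rule bd[OF y(2)])
      also have "\<dots> \<le> \<bar>C\<bar> / sqrt \<bar>Im w\<bar>" by (intro divide_right_mono) auto
      also have "\<dots> \<le> \<bar>C\<bar> / 1" using y by (intro divide_left_mono) auto
      finally show ?thesis unfolding M_def using B by simp
    qed
  qed
  have right: "norm (g w) \<le> M" if "Re w \<ge> 0" for w
    by (rule phragmen_lindelof_half_plane[OF hol K gr M im that])
  have left: "norm (g w) \<le> M" if "Re w \<le> 0" for w
  proof -
    have "norm (g (- (- w))) \<le> M"
      by (rule phragmen_lindelof_half_plane[of "\<lambda>z. g (- z)" K M "- w"])
         (use gr K M im that in \<open>auto intro!: holomorphic_on_compose_gen[OF _ hol, unfolded comp_def] holomorphic_intros simp: norm_minus_cancel\<close>,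
          metis gr norm_minus_cancel)
    then show ?thesis by simp
  qed
  have "bounded (range g)" unfolding bounded_iff by (intro exI[of _ M]) (use right left linear in blast)
  then obtain c where c: "\<And>w. g w = c" using Liouville_theorem[OF hol] unfolding constant_on_def by auto
  have "norm c \<le> 0"
  proof (rule tendsto_lowerbound)
    have "((\<lambda>n. C * inverse (sqrt (real n))) \<longlongrightarrow> C * 0) sequentially"
      by (intro tendsto_intros tendsto_inverse_0_at_top filterlim_compose[OF sqrt_at_top filterlim_real_sequentially])
    then show "((\<lambda>n. C * inverse (sqrt (real n))) \<longlongrightarrow> 0) sequentially" by simp
    show "\<forall>\<^sub>F n in sequentially. norm c \<le> C * inverse (sqrt (real n))"
    proof -
      obtain N :: nat where N: "y0 \<le> real N" using real_arch_simple by blast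
      have "norm c \<le> C * inverse (sqrt (real n))" if "n \<ge> N" for n
        using bd[of "real n"] N that unfolding c by (simp add: divide_inverse)
      then show ?thesis unfolding eventually_sequentially by blast
    qed
  qed simp
  then show ?thesis using c by simp
qed

subsection \<open>Asymptotics along rays\<close>

lemma young_ineq: "t > 0 \<Longrightarrow> 2 * (x * y) \<le> t * x\<^sup>2 + y\<^sup>2 / (t::real)"
proof -
  assume t: "t > 0"
  have "0 \<le> (t * x - y)\<^sup>2 / t" using t by simp
  also have "\<dots> = t * x\<^sup>2 + y\<^sup>2 / t - 2 * (x * y)" using t by (simp add: power2_eq_square field_simps)
  finally show ?thesis by simp
qed

lemma continuous_max_norm:
  fixes f :: "real \<Rightarrow> 'a::real_normed_vector"
  assumes "continuous_on {0..pi} f"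
  obtains y where "y \<in> {0..pi}" "\<And>x. x \<in> {0..pi} \<Longrightarrow> norm (f x) \<le> norm (f y)"
proof -
  have "\<exists>y\<in>{0..pi}. \<forall>x\<in>{0..pi}. norm (f x) \<le> norm (f y)"
    by (rule continuous_attains_sup) (use assms in \<open>auto intro!: continuous_intros\<close>)
  then show ?thesis using that by blast
qed

section \<open>The Herglotz-type bound\<close>

context sl
begin

text \<open>Up to constants, the Lagrange identity for \<open>z\<close> and \<open>z\<close> bounds
  the squared \<open>L\<^sub>2\<close> norm of \<open>Ph z\<close> by
  \<open>norm (Mw z) / \<bar>Im z\<bar>\<close>, and the identity for \<open>z\<close> and
  \<open>\<i>\<close> bounds \<open>norm (Mw z)\<close> by \<open>1 + norm z\<close> times the
  \<open>L\<^sub>2\<close> norm of \<open>Ph z\<close>. So \<open>norm (Mw z)\<close> reappears on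
  the right with power \<open>1/2\<close> and can be absorbed.\<close>

lemma Mw_bound: "\<exists>C\<ge>0. \<forall>z. Im z \<noteq> 0 \<longrightarrow> norm (Mw z) \<le> C * (1 + norm z)\<^sup>2 / \<bar>Im z\<bar>"
proof -
  obtain K where K: "K > 0" "\<And>A :: complex^'m^'m. norm (trc A) \<le> norm A * K"
    using bounded_linear.pos_bounded[OF bounded_linear_trc] by blast
  define I where "I = (\<lambda>z. integral {0..pi} (\<lambda>x. (norm (Ph z x))\<^sup>2))"
  have Pc: "continuous_on {0..pi} (Ph z)" for z
    using Ph_system[of z] ac_deriv_continuous unfolding sl_system_def by blast
  have Pi: "(\<lambda>x. (norm (Ph z x))\<^sup>2) integrable_on {0..pi}" for z
    by (intro integrable_continuous_real continuous_intros Pc)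
  have I0: "I z \<ge> 0" for z unfolding I_def by (intro integral_nonneg Pi) auto
  have I_le: "I z \<le> K * norm (Mw z) / \<bar>Im z\<bar>" if z: "Im z \<noteq> 0" for z
  proof -
    have "((\<lambda>x. - 2 * Im z * (norm (Ph z x))\<^sup>2) has_integral Im (trc (Mw z - dagger (Mw z)))) {0..pi}"
      using lagrange_norm[OF Ph_system V2_Ph[OF dd_nonreal[OF z]]] unfolding V_Ph by (simp add: mm_simps)
    moreover have "((\<lambda>x. - 2 * Im z * (norm (Ph z x))\<^sup>2) has_integral (- 2 * Im z) * I z) {0..pi}"
      unfolding I_def by (intro has_integral_mult_right integrable_integral Pi)
    ultimately have e: "(- 2 * Im z) * I z = Im (trc (Mw z - dagger (Mw z)))" by (rule has_integral_unique[rotated])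
    have "2 * \<bar>Im z\<bar> * I z = \<bar>(- 2 * Im z) * I z\<bar>" using I0[of z] by (simp add: abs_mult)
    also have "\<dots> \<le> norm (trc (Mw z - dagger (Mw z)))" unfolding e by (rule abs_Im_le_cmod)
    also have "\<dots> \<le> norm (Mw z - dagger (Mw z)) * K" by (rule K(2))
    also have "\<dots> \<le> (norm (Mw z) + norm (Mw z)) * K"
      using K norm_triangle_ineq4[of "Mw z" "dagger (Mw z)"] by (intro mult_right_mono) auto
    finally have "\<bar>Im z\<bar> * I z \<le> K * norm (Mw z)" by (simp add: mult.commute)
    then show ?thesis using z by (simp add: pos_le_divide_eq mult.commute)
  qed
  have main: "norm (Mw z) \<le> (2 * norm (Mw \<i>) + I \<i> * K) * (1 + norm z)\<^sup>2 / \<bar>Im z\<bar>" if z: "Im z \<noteq> 0" for z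
  proof -
    define y where "y = \<bar>Im z\<bar>"
    define b where "b = 1 + norm z"
    define m where "m = norm (Mw z)"
    have y: "y > 0" "y \<le> b" using z abs_Im_le_cmod[of z] unfolding y_def b_def by auto
    have b: "b \<ge> 1" unfolding b_def by simp
    \<comment> \<open>With this weight in Young's inequality the bound for the term in
      \<open>I z\<close> is exactly \<open>m / 2\<close>, which moves to the left side.\<close>
    define t where "t = y / (b * K)"
    have t: "t > 0" unfolding t_def using y b K by simp
    have i1: "Im \<i> \<noteq> 0" by simp
    let ?F = "\<lambda>x. cscale (cnj \<i> - z) (dagger (Ph \<i> x) ** Ph z x)"
    have hF: "(?F has_integral (Mw z - dagger (Mw \<i>))) {0..pi}"
      using lagrange_integral[OF Ph_system V2_Ph[OF dd_nonreal[OF z]] Ph_system V2_Ph[OF dd_nonreal[OF i1]]]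
      unfolding V_Ph by (simp add: mm_simps)
    let ?g = "\<lambda>x. (b * t / 2) * (norm (Ph z x))\<^sup>2 + (b / (2 * t)) * (norm (Ph \<i> x))\<^sup>2"
    have hg: "(?g has_integral ((b * t / 2) * I z + (b / (2 * t)) * I \<i>)) {0..pi}"
      unfolding I_def by (intro has_integral_add has_integral_mult_right integrable_integral Pi)
    have Fg: "norm (?F x) \<le> ?g x" for x
    proof -
      have c1: "norm (cnj \<i> - z) \<le> b" unfolding b_def using norm_triangle_ineq4[of "cnj \<i>" z] by simp
      have "norm (?F x) \<le> b * (norm (Ph \<i> x) * norm (Ph z x))"
        unfolding norm_cscale using c1 b norm_matrix_mult_le[of "dagger (Ph \<i> x)" "Ph z x"] by (intro mult_mono) auto
      also have "\<dots> = b / 2 * (2 * (norm (Ph z x) * norm (Ph \<i> x)))" by simp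
      also have "\<dots> \<le> b / 2 * (t * (norm (Ph z x))\<^sup>2 + (norm (Ph \<i> x))\<^sup>2 / t)"
        using b by (intro mult_left_mono young_ineq t) auto
      also have "\<dots> = ?g x" using t by (simp add: field_simps)
      finally show ?thesis .
    qed
    have "norm (integral {0..pi} ?F) \<le> integral {0..pi} ?g"
      using hF hg Fg by (intro integral_norm_bound_integral) (auto intro: has_integral_integrable)
    then have "norm (Mw z - dagger (Mw \<i>)) \<le> (b * t / 2) * I z + (b / (2 * t)) * I \<i>"
      using hF hg by (simp add: integral_unique)
    then have "m \<le> norm (Mw \<i>) + (b * t / 2) * I z + (b / (2 * t)) * I \<i>"
      using norm_triangle_ineq2[of "Mw z" "dagger (Mw \<i>)"] unfolding m_def norm_dagger by linarith
    also have "(b * t / 2) * I z \<le> (b * t / 2) * (K * m / y)"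
      using I_le[OF z] b t unfolding m_def y_def by (intro mult_left_mono) auto
    also have "(b * t / 2) * (K * m / y) = m / 2" unfolding t_def using y b K by (simp add: field_simps)
    also have "(b / (2 * t)) * I \<i> = b\<^sup>2 * (I \<i> * K) / (2 * y)" unfolding t_def using y b K by (simp add: power2_eq_square field_simps)
    finally have 1: "m \<le> 2 * norm (Mw \<i>) + b\<^sup>2 * (I \<i> * K) / y" using y by (simp add: field_simps)
    have "y \<le> b\<^sup>2" using y(2) self_le_power[OF b, of 2] by simp
    then have "2 * norm (Mw \<i>) * 1 \<le> 2 * norm (Mw \<i>) * (b\<^sup>2 / y)" using y by (intro mult_left_mono) auto
    with 1 have "m \<le> 2 * norm (Mw \<i>) * (b\<^sup>2 / y) + b\<^sup>2 * (I \<i> * K) / y" by linarith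
    also have "\<dots> = (2 * norm (Mw \<i>) + I \<i> * K) * b\<^sup>2 / y" using y by (simp add: field_simps)
    finally show ?thesis unfolding m_def b_def y_def .
  qed
  show ?thesis using main I0[of \<i>] K by (intro exI[of _ "2 * norm (Mw \<i>) + I \<i> * K"]) auto
qed

end

section \<open>Decay and growth in rotated coordinates\<close>

context sl_pot
begin

text \<open>For \<open>a\<close>, \<open>b\<close> as below, \<open>a\<close> is nearly constant and \<open>b\<close> is slaved to it: the term \<open>-2 \<i> \<rho> b\<close> forces
  \<open>b\<close> to be of size \<open>u\<^sup>-\<^sup>1\<close> in mean square, with \<open>u\<^sup>2 = Im \<rho>\<close>.\<close>

lemma decay_core:
  fixes a b :: "real \<Rightarrow> complex^'n^'m"
  defines "s \<equiv> S2 pi"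
  assumes a: "ac_deriv 0 pi a (\<lambda>x. \<sigma> x ** b x + cscale (\<i> / (2 * \<rho>)) ((\<sigma> x ** \<sigma> x) ** (a x + b x)))"
    and b: "ac_deriv 0 pi b (\<lambda>x. cscale (- 2 * \<i> * \<rho>) (b x) + (\<sigma> x ** a x - cscale (\<i> / (2 * \<rho>)) ((\<sigma> x ** \<sigma> x) ** (a x + b x))))"
    and bpi: "norm (b pi) \<le> 3 * norm (a pi)" and u: "u \<ge> 8 * (1 + s) + 2" and rho: "Im \<rho> = u\<^sup>2"
  shows "\<And>x. x \<in> {0..pi} \<Longrightarrow> norm (a x) \<le> 2 * norm (a 0)"
    and "\<And>x. x \<in> {0..pi} \<Longrightarrow> norm (b x) \<le> 10 * norm (a 0)"
    and "(norm (b 0))\<^sup>2 \<le> 124 * (1 + s) / u * (norm (a 0))\<^sup>2"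
proof -
  have s0: "s \<ge> 0" unfolding s_def using S2_bounds[of pi] by simp
  have u10: "10 + 8 * s \<le> u" using u by simp
  then have u1: "u \<ge> 1" using s0 by linarith
  then have "u > 0" by linarith
  note u1 = u1 this
  have uu: "u \<le> u\<^sup>2" using u1 by (simp add: power2_eq_square)
  have r: "u\<^sup>2 \<le> norm \<rho>" using abs_Im_le_cmod[of \<rho>] rho by simp
  \<comment> \<open>The maxima \<open>N\<close> and \<open>B\<close> of the norms of
    \<open>a\<close> and \<open>b\<close> are treated as unknowns: integrated inequalities bound
    \<open>B\<close> by \<open>N\<close>, and then \<open>N\<close> by
    \<open>norm (a 0)\<close>.\<close>
  obtain xa where xa: "xa \<in> {0..pi}" "\<And>x. x \<in> {0..pi} \<Longrightarrow> norm (a x) \<le> norm (a xa)"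
    by (rule continuous_max_norm[OF ac_deriv_continuous[OF a]]) (rule that, assumption+)
  obtain xb where xb: "xb \<in> {0..pi}" "\<And>x. x \<in> {0..pi} \<Longrightarrow> norm (b x) \<le> norm (b xb)"
    by (rule continuous_max_norm[OF ac_deriv_continuous[OF b]]) (rule that, assumption+)
  define N where "N = norm (a xa)"
  define B where "B = norm (b xb)"
  have aN: "norm (a x) \<le> N" if "x \<in> {0..pi}" for x unfolding N_def by (rule xa(2)[OF that])
  have bB: "norm (b x) \<le> B" if "x \<in> {0..pi}" for x unfolding B_def by (rule xb(2)[OF that])
  have NB0: "N \<ge> 0" "B \<ge> 0" unfolding N_def B_def by auto
  define G where "G = (\<lambda>x. \<sigma> x ** a x - cscale (\<i> / (2 * \<rho>)) ((\<sigma> x ** \<sigma> x) ** (a x + b x)))"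
  have ss: "norm (cscale (\<i> / (2 * \<rho>)) ((\<sigma> x ** \<sigma> x) ** (a x + b x))) \<le> s2 x * (N + B) / (2 * u\<^sup>2)" if x: "x \<in> {0<..<pi}" for x
  proof -
    have x': "x \<in> {0..pi}" using x by auto
    have "norm ((\<sigma> x ** \<sigma> x) ** (a x + b x)) \<le> norm (\<sigma> x ** \<sigma> x) * norm (a x + b x)" by (rule norm_matrix_mult_le)
    also have "\<dots> \<le> s2 x * (N + B)"
      using norm_matrix_mult_le[of "\<sigma> x" "\<sigma> x"] norm_triangle_ineq[of "a x" "b x"] aN[OF x'] bB[OF x'] x
      by (intro mult_mono) (auto simp: s2_def power2_eq_square)
    finally have 1: "norm ((\<sigma> x ** \<sigma> x) ** (a x + b x)) \<le> s2 x * (N + B)" .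
    have "norm (cscale (\<i> / (2 * \<rho>)) ((\<sigma> x ** \<sigma> x) ** (a x + b x))) = norm ((\<sigma> x ** \<sigma> x) ** (a x + b x)) / (2 * norm \<rho>)"
      unfolding norm_cscale by (simp add: norm_divide norm_mult)
    also have "\<dots> \<le> s2 x * (N + B) / (2 * u\<^sup>2)"
      using 1 r u1 NB0 s2_nonneg[of x] by (intro frac_le) auto
    finally show ?thesis .
  qed
  have sx: "(norm (\<sigma> x))\<^sup>2 = s2 x" if "x \<in> {0<..<pi}" for x using that by (simp add: s2_def)
  have bG: "\<bar>2 * inner (b x) (G x)\<bar> \<le> 2 * (norm (b x) * (norm (\<sigma> x) * N)) + s2 x * (B * (N + B) / u\<^sup>2)" if x: "x \<in> {0<..<pi}" for x
  proof -
    have x': "x \<in> {0..pi}" using x by auto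
    have "norm (\<sigma> x ** a x) \<le> norm (\<sigma> x) * N"
      by (rule order_trans[OF norm_matrix_mult_le]) (intro mult_left_mono aN[OF x'] norm_ge_zero)
    then have "norm (G x) \<le> norm (\<sigma> x) * N + s2 x * (N + B) / (2 * u\<^sup>2)"
      unfolding G_def using norm_triangle_ineq4[of "\<sigma> x ** a x" "cscale (\<i> / (2 * \<rho>)) ((\<sigma> x ** \<sigma> x) ** (a x + b x))"] ss[OF x] by linarith
    then have "norm (b x) * norm (G x) \<le> norm (b x) * (norm (\<sigma> x) * N) + norm (b x) * (s2 x * (N + B) / (2 * u\<^sup>2))"
      unfolding distrib_left[symmetric] by (rule mult_left_mono) simp
    also have "norm (b x) * (s2 x * (N + B) / (2 * u\<^sup>2)) \<le> B * (s2 x * (N + B) / (2 * u\<^sup>2))"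
      using bB[OF x'] NB0 s2_nonneg[of x] by (intro mult_right_mono) auto
    finally have h: "norm (b x) * norm (G x) \<le> norm (b x) * (norm (\<sigma> x) * N) + B * (s2 x * (N + B) / (2 * u\<^sup>2))" by simp
    have "2 * (B * (s2 x * (N + B) / (2 * u\<^sup>2))) = s2 x * (B * (N + B) / u\<^sup>2)" by simp
    with h have "2 * (norm (b x) * norm (G x)) \<le> 2 * (norm (b x) * (norm (\<sigma> x) * N)) + s2 x * (B * (N + B) / u\<^sup>2)" by linarith
    moreover have "\<bar>2 * inner (b x) (G x)\<bar> \<le> 2 * (norm (b x) * norm (G x))" using Cauchy_Schwarz_ineq2[of "b x" "G x"] by simp
    ultimately show ?thesis by linarith
  qed
  \<comment> \<open>The real part of \<open>- 2 * \<i> * \<rho>\<close> is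
    \<open>2 * u\<^sup>2\<close>, so \<open>b\<close> tends to grow to the right and is controlled
    from its value at \<open>pi\<close>, that is, by the boundary condition.\<close>
  have der_b: "ac_deriv 0 pi (\<lambda>x. (norm (b x))\<^sup>2) (\<lambda>x. 4 * u\<^sup>2 * (norm (b x))\<^sup>2 + 2 * inner (b x) (G x))"
  proof (rule ac_deriv_cong[OF ac_deriv_norm_sq[OF b]])
    fix x
    show "2 * inner (b x) (cscale (- 2 * \<i> * \<rho>) (b x) + (\<sigma> x ** a x - cscale (\<i> / (2 * \<rho>)) ((\<sigma> x ** \<sigma> x) ** (a x + b x)))) =
       4 * u\<^sup>2 * (norm (b x))\<^sup>2 + 2 * inner (b x) (G x)"
      unfolding G_def inner_add_right[of _ "cscale _ _"] inner_cscale_self by (simp add: rho)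
  qed
  have bc: "continuous_on {0..pi} (\<lambda>x. (norm (b x))\<^sup>2)" by (intro continuous_intros ac_deriv_continuous[OF b])
  define J where "J = (\<lambda>x. integral {0..x} (\<lambda>x. (norm (b x))\<^sup>2))"
  have J: "ac_deriv 0 pi J (\<lambda>x. (norm (b x))\<^sup>2)"
    unfolding J_def by (rule ac_deriv_integral) (use integrable_continuous_real[OF bc] in auto)
  have J0: "J 0 = 0" unfolding J_def by simp
  define Q where "Q = 2 * (N\<^sup>2 + B\<^sup>2) / u\<^sup>2"
  have Q0: "Q \<ge> 0" unfolding Q_def by simp
  have SQ: "ac_deriv 0 pi (\<lambda>x. Q * S2 x) (\<lambda>x. Q * s2 x)" by (rule ac_deriv_linear[OF bounded_linear_mult_right S2_ac])
  \<comment> \<open>A quarter of the coefficient \<open>4 * u\<^sup>2\<close> pays for the coupling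
    to \<open>a\<close> through Young's inequality; the remaining \<open>3 * u\<^sup>2\<close>
    bounds the mean square \<open>J\<close> of \<open>b\<close>.\<close>
  have lower: "3 * u\<^sup>2 * (norm (b x))\<^sup>2 \<le> 4 * u\<^sup>2 * (norm (b x))\<^sup>2 + 2 * inner (b x) (G x) + Q * s2 x" if x: "x \<in> {0<..<pi}" for x
  proof -
    have u2: "u\<^sup>2 > 0" using u1 by simp
    have "2 * (norm (b x) * (norm (\<sigma> x) * N)) \<le> u\<^sup>2 * (norm (b x))\<^sup>2 + (norm (\<sigma> x) * N)\<^sup>2 / u\<^sup>2" by (rule young_ineq[OF u2])
    also have "(norm (\<sigma> x) * N)\<^sup>2 / u\<^sup>2 = s2 x * (N\<^sup>2 / u\<^sup>2)" unfolding power_mult_distrib sx[OF x] by simp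
    finally have 1: "2 * (norm (b x) * (norm (\<sigma> x) * N)) \<le> u\<^sup>2 * (norm (b x))\<^sup>2 + s2 x * (N\<^sup>2 / u\<^sup>2)" .
    have "s2 x * (N\<^sup>2 / u\<^sup>2) + s2 x * (B * (N + B) / u\<^sup>2) = s2 x * ((N\<^sup>2 + B * (N + B)) / u\<^sup>2)"
      by (simp add: add_divide_distrib distrib_left)
    also have "\<dots> \<le> s2 x * Q"
    proof -
      have "B * N \<le> N\<^sup>2 + B\<^sup>2" using sum_squares_bound[of B N] mult_nonneg_nonneg[OF NB0(2) NB0(1)] by linarith
      then have "N\<^sup>2 + B * (N + B) \<le> 2 * (N\<^sup>2 + B\<^sup>2)" by (simp add: power2_eq_square algebra_simps)
      then show ?thesis unfolding Q_def using s2_nonneg[of x] by (intro mult_left_mono divide_right_mono) auto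
    qed
    finally have 2: "s2 x * (N\<^sup>2 / u\<^sup>2) + s2 x * (B * (N + B) / u\<^sup>2) \<le> Q * s2 x" by (simp add: mult.commute)
    show ?thesis using bG[OF x] 1 2 by linarith
  qed
  have mono_b: "3 * u\<^sup>2 * J pi - 3 * u\<^sup>2 * J x \<le> (norm (b pi))\<^sup>2 + Q * S2 pi - ((norm (b x))\<^sup>2 + Q * S2 x)" if x: "x \<in> {0..pi}" for x
    by (rule ac_deriv_mono[OF ac_deriv_linear[OF bounded_linear_mult_right J] ac_deriv_add[OF der_b SQ] lower]) (use x in auto)
  have J_mono: "J x \<le> J pi" if "x \<in> {0..pi}" for x
    using ac_deriv_mono[OF ac_deriv_const[of 0 pi 0] J, of x pi] that by auto
  have bpi2: "(norm (b pi))\<^sup>2 \<le> 9 * N\<^sup>2"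
  proof -
    have "norm (b pi) \<le> 3 * N" using bpi aN[of pi] by simp
    then have "(norm (b pi))\<^sup>2 \<le> (3 * N)\<^sup>2" by (intro power_mono) auto
    then show ?thesis by (simp add: power_mult_distrib)
  qed
  have "4 * s \<le> u" using u10 s0 by linarith
  then have su: "4 * s \<le> u\<^sup>2" using uu by linarith
  have sQ: "s * Q \<le> (N\<^sup>2 + B\<^sup>2) / 2"
  proof -
    have "s * Q = (4 * s) * (N\<^sup>2 + B\<^sup>2) / (2 * u\<^sup>2)" unfolding Q_def by simp
    also have "\<dots> \<le> u\<^sup>2 * (N\<^sup>2 + B\<^sup>2) / (2 * u\<^sup>2)" using su by (intro divide_right_mono mult_right_mono) auto
    also have "\<dots> = (N\<^sup>2 + B\<^sup>2) / 2" using u1 by simp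
    finally show ?thesis .
  qed
  have "B\<^sup>2 \<le> 9 * N\<^sup>2 + s * Q"
  proof -
    have "0 \<le> 3 * u\<^sup>2 * J pi - 3 * u\<^sup>2 * J xb" using J_mono[OF xb(1)] by (simp add: mult_left_mono)
    moreover have "0 \<le> Q * S2 xb" using Q0 S2_bounds[OF xb(1)] by simp
    ultimately show ?thesis using mono_b[OF xb(1)] bpi2 unfolding B_def s_def by (simp add: mult.commute)
  qed
  moreover have "2 * (s * Q) \<le> N\<^sup>2 + B\<^sup>2" using sQ by (simp add: field_simps)
  ultimately have BN2: "B\<^sup>2 \<le> 19 * N\<^sup>2" by linarith
  also have "\<dots> \<le> (5 * N)\<^sup>2" by (simp add: power_mult_distrib)
  finally have BN: "B \<le> 5 * N" using NB0 by (intro power2_le_imp_le[of B "5 * N"]) auto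
  have Jb: "J pi \<le> 8 * N\<^sup>2 / u\<^sup>2"
  proof -
    have "3 * u\<^sup>2 * J pi - 3 * u\<^sup>2 * J 0 \<le> (norm (b pi))\<^sup>2 + Q * S2 pi - ((norm (b 0))\<^sup>2 + Q * S2 0)" by (rule mono_b) simp
    then have "3 * u\<^sup>2 * J pi \<le> (norm (b pi))\<^sup>2 + s * Q - (norm (b 0))\<^sup>2" unfolding J0 s_def by (simp add: mult.commute)
    then have "3 * u\<^sup>2 * J pi \<le> 9 * N\<^sup>2 + s * Q" using bpi2 zero_le_power2[of "norm (b 0)"] by linarith
    moreover have "2 * (s * Q) \<le> N\<^sup>2 + B\<^sup>2" using sQ by (simp add: field_simps)
    ultimately have "3 * u\<^sup>2 * J pi \<le> 24 * N\<^sup>2" using BN2 zero_le_power2[of N] by linarith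
    then show ?thesis using u1 by (simp add: field_simps)
  qed
  have ab_young: "2 * (norm (b x) * (norm (\<sigma> x) * N)) \<le> u * (norm (b x))\<^sup>2 + s2 x * (N\<^sup>2 / u)" if x: "x \<in> {0<..<pi}" for x
  proof -
    have "2 * (norm (b x) * (norm (\<sigma> x) * N)) \<le> u * (norm (b x))\<^sup>2 + (norm (\<sigma> x) * N)\<^sup>2 / u" by (rule young_ineq[OF u1(2)])
    also have "(norm (\<sigma> x) * N)\<^sup>2 / u = s2 x * (N\<^sup>2 / u)" unfolding power_mult_distrib sx[OF x] by simp
    finally show ?thesis .
  qed
  have N2a: "N \<le> 2 * norm (a 0)"
  proof (cases "N = 0")
    case False
    then have N0: "N > 0" using NB0 by simp
    let ?g = "\<lambda>x. u / (2 * N) * J x + (N / (2 * u) + 3 * N / u\<^sup>2) * S2 x"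
    have "ac_deriv 0 pi ?g (\<lambda>x. u / (2 * N) * (norm (b x))\<^sup>2 + (N / (2 * u) + 3 * N / u\<^sup>2) * s2 x)"
      by (intro ac_deriv_add ac_deriv_linear[OF bounded_linear_mult_right] J S2_ac)
    with a have "norm (a xa - a 0) \<le> ?g xa - ?g 0"
    proof (rule ac_deriv_norm_le)
      fix x assume x: "x \<in> {0<..<pi}"
      have "norm (\<sigma> x ** b x + cscale (\<i> / (2 * \<rho>)) ((\<sigma> x ** \<sigma> x) ** (a x + b x))) \<le> norm (\<sigma> x) * norm (b x) + s2 x * (N + B) / (2 * u\<^sup>2)"
        using norm_triangle_ineq[of "\<sigma> x ** b x" "cscale (\<i> / (2 * \<rho>)) ((\<sigma> x ** \<sigma> x) ** (a x + b x))"] ss[OF x] norm_matrix_mult_le[of "\<sigma> x" "b x"] by linarith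
      also have "norm (\<sigma> x) * norm (b x) \<le> u / (2 * N) * (norm (b x))\<^sup>2 + N / (2 * u) * s2 x"
      proof -
        have "N * (norm (\<sigma> x) * norm (b x)) \<le> (u * (norm (b x))\<^sup>2 + s2 x * (N\<^sup>2 / u)) / 2" using ab_young[OF x] by (simp add: mult_ac)
        then have "norm (\<sigma> x) * norm (b x) \<le> (u * (norm (b x))\<^sup>2 + s2 x * (N\<^sup>2 / u)) / 2 / N" using N0 by (simp add: pos_le_divide_eq mult.commute)
        also have "\<dots> = u / (2 * N) * (norm (b x))\<^sup>2 + N / (2 * u) * s2 x" using N0 u1 by (simp add: field_simps power2_eq_square)
        finally show ?thesis .
      qed
      also have "s2 x * (N + B) / (2 * u\<^sup>2) \<le> s2 x * (6 * N) / (2 * u\<^sup>2)"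
        using BN s2_nonneg[of x] by (intro divide_right_mono mult_left_mono) auto
      finally show "norm (\<sigma> x ** b x + cscale (\<i> / (2 * \<rho>)) ((\<sigma> x ** \<sigma> x) ** (a x + b x))) \<le>
          u / (2 * N) * (norm (b x))\<^sup>2 + (N / (2 * u) + 3 * N / u\<^sup>2) * s2 x" by (simp add: algebra_simps)
    qed (use xa in auto)
    also have "\<dots> \<le> u / (2 * N) * (8 * N\<^sup>2 / u\<^sup>2) + (N / (2 * u) + 3 * N / u\<^sup>2) * s"
    proof -
      have "u / (2 * N) * J xa \<le> u / (2 * N) * (8 * N\<^sup>2 / u\<^sup>2)"
        using order_trans[OF J_mono[OF xa(1)] Jb] u1 N0 by (intro mult_left_mono) auto
      moreover have "(N / (2 * u) + 3 * N / u\<^sup>2) * S2 xa \<le> (N / (2 * u) + 3 * N / u\<^sup>2) * s"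
        using S2_bounds[OF xa(1)] u1 N0 unfolding s_def by (intro mult_left_mono) auto
      ultimately show ?thesis by (simp add: J0)
    qed
    also have "u / (2 * N) * (8 * N\<^sup>2 / u\<^sup>2) = 4 * N / u" using u1 N0 by (simp add: power2_eq_square)
    also have "(N / (2 * u) + 3 * N / u\<^sup>2) * s \<le> (N / u + 3 * N / u) * s"
    proof (intro mult_right_mono add_mono s0)
      show "N / (2 * u) \<le> N / u" using N0 u1 by (intro divide_left_mono) auto
      show "3 * N / u\<^sup>2 \<le> 3 * N / u" using N0 u1 uu by (intro divide_left_mono) auto
    qed
    also have "4 * N / u + (N / u + 3 * N / u) * s = (4 * (1 + s) / u) * N" using u1 by (simp add: field_simps)
    also have "\<dots> \<le> (1 / 2) * N"
    proof (rule mult_right_mono)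
      show "4 * (1 + s) / u \<le> 1 / 2" using u10 u1 by (simp add: field_simps)
    qed (use N0 in simp)
    finally have "norm (a xa - a 0) \<le> (1 / 2) * N" by simp
    then show ?thesis using norm_triangle_ineq2[of "a xa" "a 0"] unfolding N_def by linarith
  qed simp
  show "norm (a x) \<le> 2 * norm (a 0)" if "x \<in> {0..pi}" for x using aN[OF that] N2a by linarith
  show "norm (b x) \<le> 10 * norm (a 0)" if "x \<in> {0..pi}" for x using bB[OF that] BN N2a by linarith
  have ex: "ac_deriv 0 pi (\<lambda>x. exp (- (4 * u\<^sup>2 * x))) (\<lambda>x. exp (- (4 * u\<^sup>2 * x)) * - (4 * u\<^sup>2))"
    by (rule ac_deriv_exp) (rule ac_deriv_minus, rule ac_deriv_smooth[of _ _ _ _ "4 * u\<^sup>2"], auto intro!: derivative_eq_intros)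
  define c where "c = N\<^sup>2 / u + 30 * N\<^sup>2 / u\<^sup>2"
  \<comment> \<open>The damping factor removes the growing term from the derivative of
    \<open>(norm (b x))\<^sup>2\<close>, so the value at 0 is bounded by an exponentially damped
    value at \<open>pi\<close> plus an integral of the coupling.\<close>
  have F: "ac_deriv 0 pi (\<lambda>x. (norm (b x))\<^sup>2 * exp (- (4 * u\<^sup>2 * x)) + (u * J x + c * S2 x))
     (\<lambda>x. ((norm (b x))\<^sup>2 * (exp (- (4 * u\<^sup>2 * x)) * - (4 * u\<^sup>2)) + (4 * u\<^sup>2 * (norm (b x))\<^sup>2 + 2 * inner (b x) (G x)) * exp (- (4 * u\<^sup>2 * x))) + (u * (norm (b x))\<^sup>2 + c * s2 x))"
    by (intro ac_deriv_add ac_deriv_bilinear[OF bounded_bilinear_mult] der_b ex ac_deriv_linear[OF bounded_linear_mult_right] J S2_ac)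
  have "0 - 0 \<le> (norm (b pi))\<^sup>2 * exp (- (4 * u\<^sup>2 * pi)) + (u * J pi + c * S2 pi) - ((norm (b 0))\<^sup>2 * exp (- (4 * u\<^sup>2 * 0)) + (u * J 0 + c * S2 0))"
  proof (rule ac_deriv_mono[OF ac_deriv_const F])
    fix x assume x: "x \<in> {0<..<pi}"
    have "s2 x * (B * (N + B) / u\<^sup>2) \<le> s2 x * (30 * N\<^sup>2 / u\<^sup>2)"
    proof (intro mult_left_mono divide_right_mono s2_nonneg)
      have "B * (N + B) \<le> (5 * N) * (6 * N)" using BN NB0 by (intro mult_mono) auto
      then show "B * (N + B) \<le> 30 * N\<^sup>2" by (simp add: power2_eq_square)
    qed simp
    then have g: "\<bar>2 * inner (b x) (G x)\<bar> \<le> u * (norm (b x))\<^sup>2 + c * s2 x"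
      using bG[OF x] ab_young[OF x] unfolding c_def by (simp add: distrib_left mult.commute)
    have e1: "exp (- (4 * u\<^sup>2 * x)) \<le> 1" using x by simp
    have "\<bar>2 * inner (b x) (G x) * exp (- (4 * u\<^sup>2 * x))\<bar> \<le> \<bar>2 * inner (b x) (G x)\<bar> * 1"
      unfolding abs_mult using e1 by (intro mult_mono) auto
    then have "0 \<le> 2 * inner (b x) (G x) * exp (- (4 * u\<^sup>2 * x)) + (u * (norm (b x))\<^sup>2 + c * s2 x)" using g by linarith
    then show "0 \<le> ((norm (b x))\<^sup>2 * (exp (- (4 * u\<^sup>2 * x)) * - (4 * u\<^sup>2)) + (4 * u\<^sup>2 * (norm (b x))\<^sup>2 + 2 * inner (b x) (G x)) * exp (- (4 * u\<^sup>2 * x))) + (u * (norm (b x))\<^sup>2 + c * s2 x)"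
      by (simp add: algebra_simps)
  qed auto
  then have "(norm (b 0))\<^sup>2 \<le> (norm (b pi))\<^sup>2 * exp (- (4 * u\<^sup>2 * pi)) + (u * J pi + c * s)" by (simp add: J0 s_def)
  also have "(norm (b pi))\<^sup>2 * exp (- (4 * u\<^sup>2 * pi)) \<le> 9 * N\<^sup>2 * (1 / u)"
  proof (rule mult_mono[OF bpi2])
    have "4 * u\<^sup>2 * 1 \<le> 4 * u\<^sup>2 * pi" using pi_ge_two by (intro mult_left_mono) auto
    then have "u \<le> 4 * u\<^sup>2 * pi" using uu u1 by linarith
    then have "u \<le> exp (4 * u\<^sup>2 * pi)" using exp_ge_add_one_self[of "4 * u\<^sup>2 * pi"] by linarith
    then have "1 / exp (4 * u\<^sup>2 * pi) \<le> 1 / u" using u1 by (intro divide_left_mono) auto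
    then show "exp (- (4 * u\<^sup>2 * pi)) \<le> 1 / u" by (simp add: exp_minus divide_inverse)
  qed auto
  also have "u * J pi \<le> 8 * N\<^sup>2 * (1 / u)"
  proof -
    have "u * J pi \<le> u * (8 * N\<^sup>2 / u\<^sup>2)" using Jb u1 by (intro mult_left_mono) auto
    then show ?thesis using u1 by (simp add: power2_eq_square)
  qed
  also have "c * s \<le> (31 * N\<^sup>2 * (1 / u)) * s"
  proof (rule mult_right_mono[OF _ s0])
    have "30 * N\<^sup>2 / u\<^sup>2 \<le> 30 * N\<^sup>2 / u" using u1 uu by (intro divide_left_mono) auto
    moreover have "31 * N\<^sup>2 * (1 / u) = N\<^sup>2 / u + 30 * N\<^sup>2 / u" by (simp flip: add_divide_distrib)
    ultimately show "c \<le> 31 * N\<^sup>2 * (1 / u)" unfolding c_def by linarith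
  qed
  finally have "(norm (b 0))\<^sup>2 \<le> (17 + 31 * s) * (N\<^sup>2 / u)" by (simp add: algebra_simps)
  \<comment> \<open>The factor 124 is \<open>31 * 2\<^sup>2\<close>, from
    \<open>N \<le> 2 * norm (a 0)\<close>.\<close>
  also have "\<dots> \<le> (31 * (1 + s)) * ((2 * norm (a 0))\<^sup>2 / u)"
    using N2a NB0 s0 u1 by (intro mult_mono divide_right_mono power_mono) auto
  also have "\<dots> = 124 * (1 + s) / u * (norm (a 0))\<^sup>2" by (simp add: power_mult_distrib)
  finally show "(norm (b 0))\<^sup>2 \<le> 124 * (1 + s) / u * (norm (a 0))\<^sup>2" .
qed

text \<open>For zero potential \<open>a\<close> and \<open>b\<close> are the modes proportional to
  \<open>exp (\<i> * \<rho> * x)\<close> and \<open>exp (- \<i> * \<rho> * x)\<close>. The potential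
  couples them, and its square enters with the small factor \<open>1 / \<rho>\<close>.\<close>

lemma rotated_system:
  fixes Y Y1 :: "real \<Rightarrow> complex^'n^'m" and \<rho> :: complex
  defines "a \<equiv> \<lambda>x. Y x - cscale (\<i> / \<rho>) (Y1 x)" and "b \<equiv> \<lambda>x. Y x + cscale (\<i> / \<rho>) (Y1 x)"
  defines "g \<equiv> \<lambda>x. cscale (\<i> / (2 * \<rho>)) ((\<sigma> x ** \<sigma> x) ** (a x + b x))"
  assumes sys: "sl_system \<sigma> (\<rho>\<^sup>2) (\<lambda>x. 0) Y Y1" and rho0: "\<rho> \<noteq> 0"
  shows "ac_deriv 0 pi a (\<lambda>x. cscale (\<i> * \<rho>) (a x) + (\<sigma> x ** b x + g x))"
    and "ac_deriv 0 pi b (\<lambda>x. cscale (- \<i> * \<rho>) (b x) + (\<sigma> x ** a x - g x))"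
proof -
  have "a x + b x = cscale 2 (Y x)" for x by (simp add: a_def b_def vec_eq_iff)
  then have g_eq: "g x = cscale (\<i> / \<rho>) ((\<sigma> x ** \<sigma> x) ** Y x)" for x unfolding g_def by (simp add: cs_simps)
  have Yd: "ac_deriv 0 pi Y (\<lambda>x. \<sigma> x ** Y x + Y1 x)"
    and Y1d: "ac_deriv 0 pi (\<lambda>x. cscale (\<i> / \<rho>) (Y1 x)) (\<lambda>x. cscale (\<i> / \<rho>) (- (\<sigma> x ** Y1 x) - (\<sigma> x ** \<sigma> x) ** Y x - cscale (\<rho>\<^sup>2) (Y x) - 0))"
    using sys unfolding sl_system_def by (auto intro: ac_deriv_linear[OF cs.bounded_linear_right])
  show "ac_deriv 0 pi a (\<lambda>x. cscale (\<i> * \<rho>) (a x) + (\<sigma> x ** b x + g x))"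
    unfolding a_def by (rule ac_deriv_cong[OF ac_deriv_diff[OF Yd Y1d]])
      (unfold g_eq, simp add: a_def b_def mm_simps cs_simps, simp add: vec_eq_iff field_simps power2_eq_square rho0)
  show "ac_deriv 0 pi b (\<lambda>x. cscale (- \<i> * \<rho>) (b x) + (\<sigma> x ** a x - g x))"
    unfolding b_def by (rule ac_deriv_cong[OF ac_deriv_add[OF Yd Y1d]])
      (unfold g_eq, simp add: a_def b_def mm_simps cs_simps, simp add: vec_eq_iff field_simps power2_eq_square rho0)
qed

text \<open>In rotated coordinates the parameter adds only \<open>\<bar>Im \<rho>\<bar>\<close> to
  the growth rate, whereas it adds \<open>norm z\<close> in \<open>sl_energy_bound\<close>; this is
  what gives order \<open>1/2\<close> in the spectral parameter.\<close>

lemma sl_growth: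
  fixes Y Y1 :: "real \<Rightarrow> complex^'n^'m"
  assumes sys: "sl_system \<sigma> (\<rho>\<^sup>2) (\<lambda>x. 0) Y Y1" and rho: "norm \<rho> \<ge> 1" and t: "t \<in> {0..pi}"
  shows "(norm (Y t))\<^sup>2 \<le> ((norm (Y 0))\<^sup>2 + (norm (Y1 0) / norm \<rho>)\<^sup>2) * exp (pi + 3 * S2 pi) * exp (2 * \<bar>Im \<rho>\<bar> * t)"
proof -
  have rho0: "\<rho> \<noteq> 0" using rho by auto
  define a where "a = (\<lambda>x. Y x - cscale (\<i> / \<rho>) (Y1 x))"
  define b where "b = (\<lambda>x. Y x + cscale (\<i> / \<rho>) (Y1 x))"
  define g where "g = (\<lambda>x. cscale (\<i> / (2 * \<rho>)) ((\<sigma> x ** \<sigma> x) ** (a x + b x)))"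
  have ad: "ac_deriv 0 pi a (\<lambda>x. cscale (\<i> * \<rho>) (a x) + (\<sigma> x ** b x + g x))"
    and bd: "ac_deriv 0 pi b (\<lambda>x. cscale (- \<i> * \<rho>) (b x) + (\<sigma> x ** a x - g x))"
    using rotated_system[OF sys rho0] unfolding a_def b_def g_def .
  let ?E = "\<lambda>x. (norm (a x))\<^sup>2 + (norm (b x))\<^sup>2"
  have Ed: "ac_deriv 0 pi ?E (\<lambda>x. 2 * inner (a x) (cscale (\<i> * \<rho>) (a x) + (\<sigma> x ** b x + g x)) + 2 * inner (b x) (cscale (- \<i> * \<rho>) (b x) + (\<sigma> x ** a x - g x)))"
    by (intro ac_deriv_add ac_deriv_norm_sq ad bd)
  have "?E t \<le> (?E 0 + 0 * (t - 0)) * exp ((2 * \<bar>Im \<rho>\<bar> + 1) * t + 3 * S2 t)"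
  proof (rule gronwall[OF Ed P_ac _ _ _ _ t])
    fix x assume x: "x \<in> {0<..<pi}"
    show "0 \<le> 2 * \<bar>Im \<rho>\<bar> + 1 + 3 * s2 x" using s2_nonneg[of x] by simp
    define p where "p = norm (a x)" define q where "q = norm (b x)" define s where "s = norm (\<sigma> x)"
    have pos: "p \<ge> 0" "q \<ge> 0" "s \<ge> 0" unfolding p_def q_def s_def by auto
    have gx: "norm (g x) \<le> s\<^sup>2 * (p + q) / 2"
    proof -
      have "norm ((\<sigma> x ** \<sigma> x) ** (a x + b x)) \<le> norm (\<sigma> x ** \<sigma> x) * norm (a x + b x)" by (rule norm_matrix_mult_le)
      also have "\<dots> \<le> s\<^sup>2 * (p + q)"
        using norm_matrix_mult_le[of "\<sigma> x" "\<sigma> x"] norm_triangle_ineq[of "a x" "b x"] unfolding s_def p_def q_def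
        by (intro mult_mono) (auto simp: power2_eq_square)
      finally have 1: "norm ((\<sigma> x ** \<sigma> x) ** (a x + b x)) \<le> s\<^sup>2 * (p + q)" .
      have "norm (g x) = norm ((\<sigma> x ** \<sigma> x) ** (a x + b x)) / (2 * norm \<rho>)"
        unfolding g_def norm_cscale by (simp add: norm_divide norm_mult)
      also have "\<dots> \<le> s\<^sup>2 * (p + q) / 2" using 1 rho pos by (intro frac_le) auto
      finally show ?thesis .
    qed
    have "norm (\<sigma> x ** b x + g x) \<le> s * q + s\<^sup>2 * (p + q) / 2"
      using gx norm_triangle_ineq[of "\<sigma> x ** b x" "g x"] norm_matrix_mult_le[of "\<sigma> x" "b x"] unfolding s_def q_def by linarith
    then have ia: "inner (a x) (\<sigma> x ** b x + g x) \<le> p * (s * q + s\<^sup>2 * (p + q) / 2)"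
      using inner_bound[of "a x" "\<sigma> x ** b x + g x"] mult_left_mono[OF _ pos(1)] unfolding p_def by (meson order_trans norm_ge_zero mult_left_mono)
    have "norm (\<sigma> x ** a x - g x) \<le> s * p + s\<^sup>2 * (p + q) / 2"
      using gx norm_triangle_ineq4[of "\<sigma> x ** a x" "g x"] norm_matrix_mult_le[of "\<sigma> x" "a x"] unfolding s_def p_def by linarith
    then have ib: "inner (b x) (\<sigma> x ** a x - g x) \<le> q * (s * p + s\<^sup>2 * (p + q) / 2)"
      using inner_bound[of "b x" "\<sigma> x ** a x - g x"] unfolding q_def by (meson order_trans norm_ge_zero mult_left_mono)
    have k1: "2 * (- Im \<rho> * p\<^sup>2) \<le> 2 * \<bar>Im \<rho>\<bar> * p\<^sup>2" "2 * (Im \<rho> * q\<^sup>2) \<le> 2 * \<bar>Im \<rho>\<bar> * q\<^sup>2"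
      using mult_right_mono[of "- Im \<rho>" "\<bar>Im \<rho>\<bar>" "p\<^sup>2"] mult_right_mono[of "Im \<rho>" "\<bar>Im \<rho>\<bar>" "q\<^sup>2"] by auto
    have "2 * (p * (s * q + s\<^sup>2 * (p + q) / 2)) + 2 * (q * (s * p + s\<^sup>2 * (p + q) / 2)) = (2 * s) * (2 * (p * q)) + s\<^sup>2 * (p\<^sup>2 + q\<^sup>2 + 2 * (p * q))"
      by (simp add: power2_eq_square field_simps)
    also have "\<dots> \<le> (1 + s\<^sup>2) * (p\<^sup>2 + q\<^sup>2) + s\<^sup>2 * (p\<^sup>2 + q\<^sup>2 + (p\<^sup>2 + q\<^sup>2))"
      using pos sum_squares_bound[of p q] sum_squares_bound[of 1 s] by (intro add_mono mult_mono mult_left_mono) auto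
    also have "\<dots> = (1 + 3 * s\<^sup>2) * (p\<^sup>2 + q\<^sup>2)" by (simp add: algebra_simps)
    finally have k2: "2 * (p * (s * q + s\<^sup>2 * (p + q) / 2)) + 2 * (q * (s * p + s\<^sup>2 * (p + q) / 2)) \<le> (1 + 3 * s\<^sup>2) * (p\<^sup>2 + q\<^sup>2)" .
    have "2 * inner (a x) (cscale (\<i> * \<rho>) (a x) + (\<sigma> x ** b x + g x)) + 2 * inner (b x) (cscale (- \<i> * \<rho>) (b x) + (\<sigma> x ** a x - g x))
      = 2 * (- Im \<rho> * p\<^sup>2) + 2 * (Im \<rho> * q\<^sup>2) + 2 * inner (a x) (\<sigma> x ** b x + g x) + 2 * inner (b x) (\<sigma> x ** a x - g x)"
      unfolding p_def q_def inner_add_right[of _ "cscale _ _"] inner_cscale_self by simp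
    also have "\<dots> \<le> (2 * \<bar>Im \<rho>\<bar>) * (p\<^sup>2 + q\<^sup>2) + (1 + 3 * s\<^sup>2) * (p\<^sup>2 + q\<^sup>2)" using ia ib k1 k2 unfolding distrib_left by linarith
    also have "\<dots> = (2 * \<bar>Im \<rho>\<bar> + 1 + 3 * s2 x) * (p\<^sup>2 + q\<^sup>2) + 0" using x unfolding s2_def s_def by (simp add: algebra_simps)
    finally show "2 * inner (a x) (cscale (\<i> * \<rho>) (a x) + (\<sigma> x ** b x + g x)) + 2 * inner (b x) (cscale (- \<i> * \<rho>) (b x) + (\<sigma> x ** a x - g x)) \<le> (2 * \<bar>Im \<rho>\<bar> + 1 + 3 * s2 x) * ?E x + 0"
      unfolding p_def q_def .
  qed auto
  also have "\<dots> \<le> ?E 0 * (exp (pi + 3 * S2 pi) * exp (2 * \<bar>Im \<rho>\<bar> * t))"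
  proof -
    have "(2 * \<bar>Im \<rho>\<bar> + 1) * t + 3 * S2 t \<le> pi + 3 * S2 pi + 2 * \<bar>Im \<rho>\<bar> * t"
      using t S2_bounds[OF t] by (simp add: algebra_simps)
    then have "exp ((2 * \<bar>Im \<rho>\<bar> + 1) * t + 3 * S2 t) \<le> exp (pi + 3 * S2 pi) * exp (2 * \<bar>Im \<rho>\<bar> * t)"
      unfolding exp_add[symmetric] by (simp only: exp_le_cancel_iff)
    then have "?E 0 * exp ((2 * \<bar>Im \<rho>\<bar> + 1) * t + 3 * S2 t) \<le> ?E 0 * (exp (pi + 3 * S2 pi) * exp (2 * \<bar>Im \<rho>\<bar> * t))"
      by (rule mult_left_mono) simp
    then show ?thesis by simp
  qed
  finally have Et: "?E t \<le> ?E 0 * (exp (pi + 3 * S2 pi) * exp (2 * \<bar>Im \<rho>\<bar> * t))" .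
  have par: "?E x = 2 * ((norm (Y x))\<^sup>2 + (norm (Y1 x) / norm \<rho>)\<^sup>2)" for x
  proof -
    have "(norm (u - v))\<^sup>2 + (norm (u + v))\<^sup>2 = 2 * ((norm u)\<^sup>2 + (norm v)\<^sup>2)" for u v :: "complex^'n^'m"
      by (simp add: power2_norm_eq_inner inner_diff_left inner_diff_right inner_add_left inner_add_right)
    then show ?thesis unfolding a_def b_def by (simp add: norm_cscale norm_divide)
  qed
  have "2 * (norm (Y t))\<^sup>2 \<le> ?E t" unfolding par by simp
  from order_trans[OF this Et] show ?thesis unfolding par[of 0] by (simp only: mult.assoc)
qed

end

section \<open>Weyl solutions and fundamental solutions for large parameters\<close>

context sl
begin

text \<open>The condition at \<open>pi\<close> reflects one mode into the other: with coefficient -1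
  on the range of \<open>perp T2\<close>, and with coefficient 1 on the range of \<open>T2\<close>
  up to \<open>2 * \<i> / \<rho>\<close> times \<open>H2 ** Y pi\<close>. For
  \<open>4 * norm H2 \<le> norm \<rho>\<close> this gives
  \<open>norm b \<le> 2 * norm a + (norm a + norm b) / 4\<close>.\<close>

lemma boundary_reflection:
  fixes Y Y1 :: "real \<Rightarrow> complex^'n^'m"
  assumes v: "V2 T2 H2 Y Y1 = 0" and rho: "4 * norm H2 \<le> norm \<rho>" "\<rho> \<noteq> 0"
  shows "norm (Y pi + cscale (\<i> / \<rho>) (Y1 pi)) \<le> 3 * norm (Y pi - cscale (\<i> / \<rho>) (Y1 pi))"
proof -
  note y = V2_zeroD[OF T2 H2(2) v]
  define a where "a = Y pi - cscale (\<i> / \<rho>) (Y1 pi)"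
  define b where "b = Y pi + cscale (\<i> / \<rho>) (Y1 pi)"
  have Y2: "cscale 2 (Y pi) = a + b" unfolding a_def b_def by (simp add: vec_eq_iff)
  have "perp T2 ** (a + b) = 0" unfolding Y2[symmetric] cscale_mult_right y by (simp add: cs_simps)
  then have pb: "perp T2 ** b = - (perp T2 ** a)" by (simp add: mm.add_right eq_neg_iff_add_eq_0 add.commute)
  have "T2 ** b - T2 ** a = cscale (2 * \<i> / \<rho>) (T2 ** Y1 pi)"
    unfolding a_def b_def by (simp add: mm_simps cs_simps) (simp add: vec_eq_iff)
  then have tb: "T2 ** b = T2 ** a + cscale (2 * \<i> / \<rho>) (H2 ** Y pi)" unfolding y by (simp add: algebra_simps)
  have "norm (cscale (2 * \<i> / \<rho>) (H2 ** Y pi)) = norm (H2 ** cscale 2 (Y pi)) / norm \<rho>"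
    unfolding cscale_mult_right norm_cscale by (simp add: norm_divide norm_mult)
  also have "\<dots> \<le> norm H2 * norm (a + b) / norm \<rho>"
    unfolding Y2 by (intro divide_right_mono norm_matrix_mult_le) auto
  also have "\<dots> \<le> norm (a + b) / 4"
  proof -
    have "norm H2 / norm \<rho> \<le> 1 / 4" using rho by (simp add: field_simps)
    from mult_right_mono[OF this, of "norm (a + b)"] show ?thesis by simp
  qed
  also have "\<dots> \<le> (norm a + norm b) / 4" by (intro divide_right_mono norm_triangle_ineq) auto
  finally have e: "norm (cscale (2 * \<i> / \<rho>) (H2 ** Y pi)) \<le> (norm a + norm b) / 4" .
  have "norm b = norm (T2 ** b + perp T2 ** b)" by (simp add: proj_add_perp)
  also have "\<dots> \<le> norm (T2 ** b) + norm (perp T2 ** b)" by (rule norm_triangle_ineq)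
  also have "norm (T2 ** b) \<le> norm (T2 ** a) + (norm a + norm b) / 4"
    unfolding tb using norm_triangle_ineq[of "T2 ** a" "cscale (2 * \<i> / \<rho>) (H2 ** Y pi)"] e by linarith
  also have "norm (T2 ** a) \<le> norm a" by (rule norm_orth_proj_mult_le[OF T2])
  also have "norm (perp T2 ** b) \<le> norm a" unfolding pb norm_minus_cancel by (rule norm_orth_proj_mult_le[OF orth_proj_perp[OF T2]])
  finally show ?thesis unfolding a_def[symmetric] b_def[symmetric] by (simp add: field_simps)
qed

text \<open>\<open>decay_core\<close> is applied after the factor
  \<open>exp (- \<i> * \<rho> * x)\<close> has removed the main exponential from the decaying mode.
  The second bound holds because the difference of \<open>Y1 0\<close> and
  \<open>\<i> * \<rho>\<close> times \<open>Y 0\<close> is, up to the factor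
  \<open>- \<i> * \<rho>\<close>, the small quantity \<open>b 0\<close>.\<close>

lemma ray_decay:
  "\<exists>U\<ge>1. \<exists>C>0. \<forall>u \<rho> Y Y1. u \<ge> U \<longrightarrow> Im \<rho> = u\<^sup>2 \<longrightarrow> sl_system \<sigma> (\<rho>\<^sup>2) (\<lambda>x. 0) Y Y1 \<longrightarrow> V2 T2 H2 Y Y1 = 0 \<longrightarrow>
     (\<forall>x\<in>{0..pi}. norm (Y x) \<le> C * exp (- (u\<^sup>2 * x)) * norm (Y 0)) \<and>
     norm (Y1 0 - cscale (\<i> * \<rho>) (Y 0 :: complex^'m^'m)) \<le> C / sqrt u * norm \<rho> * norm (Y 0)"
proof -
  define c where "c = sqrt (124 * (1 + S2 pi))"
  have s0: "S2 pi \<ge> 0" using S2_bounds[of pi] by simp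
  then have c0: "c \<ge> 0" unfolding c_def by simp
  \<comment> \<open>The summands serve the threshold of \<open>decay_core\<close>, the reflection
    bound at \<open>pi\<close>, and \<open>c / sqrt u \<le> 1 / 2\<close>.\<close>
  define U where "U = 8 * (1 + S2 pi) + 2 + 4 * norm H2 + (2 * c)\<^sup>2"
  have U1: "U \<ge> 1" unfolding U_def using s0 by (simp add: add_nonneg_nonneg)
  \<comment> \<open>24 is \<open>(2 + 10) * 4 / 2\<close>: the bounds of \<open>decay_core\<close>
    for \<open>a\<close> and \<open>b\<close>, then \<open>A \<le> 4 * norm (Y 0)\<close>, and the
    factor 2 in \<open>a + b = 2 E Y\<close>.\<close>
  define C where "C = 24 + 4 * c"
  have C0: "C > 0" unfolding C_def using c0 by simp
  have main: "(\<forall>x\<in>{0..pi}. norm (Y x) \<le> C * exp (- (u\<^sup>2 * x)) * norm (Y 0)) \<and>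
     norm (Y1 0 - cscale (\<i> * \<rho>) (Y 0)) \<le> C / sqrt u * norm \<rho> * norm (Y 0)"
    if u: "u \<ge> U" and rho: "Im \<rho> = u\<^sup>2" and sys: "sl_system \<sigma> (\<rho>\<^sup>2) (\<lambda>x. 0) Y Y1" and v: "V2 T2 H2 Y Y1 = 0"
    for u \<rho> and Y Y1 :: "real \<Rightarrow> complex^'m^'m"
  proof -
    have u1: "u \<ge> 1" using u U1 by linarith
    have uu: "u \<le> u\<^sup>2" using self_le_power[OF u1, of 2] by simp
    have r: "u\<^sup>2 \<le> norm \<rho>" using abs_Im_le_cmod[of \<rho>] rho by simp
    have rho0: "\<rho> \<noteq> 0" using r uu u1 by auto
    have Un: "(2 * c)\<^sup>2 \<ge> 0" "norm H2 \<ge> 0" by simp_all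
    have u8: "u \<ge> 8 * (1 + S2 pi) + 2" using u Un unfolding U_def by argo
    have u4: "4 * norm H2 \<le> norm \<rho>" using u Un s0 uu r unfolding U_def by argo
    have uc: "(2 * c)\<^sup>2 \<le> u" using u Un s0 unfolding U_def by argo
    define E where "E = (\<lambda>x::real. exp (- \<i> * \<rho> * of_real x))"
    have Ed: "ac_deriv 0 pi E (\<lambda>x. - \<i> * \<rho> * E x)"
    proof (rule ac_deriv_smooth[of _ _ _ _ "norm \<rho> * exp (norm \<rho> * pi)"])
      fix x assume x: "x \<in> {0..pi}"
      have "((\<lambda>z. exp (- \<i> * \<rho> * z)) has_field_derivative (- \<i> * \<rho> * exp (- \<i> * \<rho> * of_real x))) (at (of_real x))"
        by (auto intro!: derivative_eq_intros)
      from has_vector_derivative_real_field[OF this] show "(E has_vector_derivative - \<i> * \<rho> * E x) (at x)"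
        unfolding E_def .
      have "norm (E x) \<le> exp (norm (- \<i> * \<rho> * of_real x))" unfolding E_def by (rule norm_exp)
      also have "\<dots> \<le> exp (norm \<rho> * pi)" using x by (auto simp: norm_mult intro!: mult_left_mono)
      finally show "norm (- \<i> * \<rho> * E x) \<le> norm \<rho> * exp (norm \<rho> * pi)" unfolding norm_mult by (simp add: mult_left_mono)
    qed
    have nE: "norm (E x) = exp (u\<^sup>2 * x)" for x unfolding E_def norm_exp_eq_Re by (simp add: rho)
    define a0 where "a0 = (\<lambda>x. Y x - cscale (\<i> / \<rho>) (Y1 x))"
    define b0 where "b0 = (\<lambda>x. Y x + cscale (\<i> / \<rho>) (Y1 x))"
    define a where "a = (\<lambda>x. cscale (E x) (a0 x))"
    define b where "b = (\<lambda>x. cscale (E x) (b0 x))"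
    have rot1: "ac_deriv 0 pi a0 (\<lambda>x. cscale (\<i> * \<rho>) (a0 x) + (\<sigma> x ** b0 x + cscale (\<i> / (2 * \<rho>)) ((\<sigma> x ** \<sigma> x) ** (a0 x + b0 x))))"
      using rotated_system(1)[OF sys rho0] unfolding a0_def b0_def .
    have rot2: "ac_deriv 0 pi b0 (\<lambda>x. cscale (- \<i> * \<rho>) (b0 x) + (\<sigma> x ** a0 x - cscale (\<i> / (2 * \<rho>)) ((\<sigma> x ** \<sigma> x) ** (a0 x + b0 x))))"
      using rotated_system(2)[OF sys rho0] unfolding a0_def b0_def .
    have ad: "ac_deriv 0 pi a (\<lambda>x. \<sigma> x ** b x + cscale (\<i> / (2 * \<rho>)) ((\<sigma> x ** \<sigma> x) ** (a x + b x)))"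
      unfolding a_def
      by (rule ac_deriv_cong[OF ac_deriv_bilinear[OF bounded_bilinear_cscale Ed rot1]])
         (simp add: a_def b_def mm_simps cs_simps, simp add: vec_eq_iff algebra_simps)
    have bd: "ac_deriv 0 pi b (\<lambda>x. cscale (- 2 * \<i> * \<rho>) (b x) + (\<sigma> x ** a x - cscale (\<i> / (2 * \<rho>)) ((\<sigma> x ** \<sigma> x) ** (a x + b x))))"
      unfolding b_def
      by (rule ac_deriv_cong[OF ac_deriv_bilinear[OF bounded_bilinear_cscale Ed rot2]])
         (simp add: a_def b_def mm_simps cs_simps, simp add: vec_eq_iff algebra_simps)
    have bpi: "norm (b pi) \<le> 3 * norm (a pi)"
      using mult_left_mono[OF boundary_reflection[OF v u4 rho0] norm_ge_zero[of "E pi"]]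
      unfolding a_def b_def a0_def b0_def norm_cscale by (simp only: mult.left_commute)
    note dec = decay_core[OF ad bd bpi u8 rho]
    define A where "A = norm (a 0)"
    have E0: "E 0 = 1" unfolding E_def by simp
    have b0_small: "norm (b 0) \<le> c / sqrt u * A"
    proof (rule power2_le_imp_le)
      show "(norm (b 0))\<^sup>2 \<le> (c / sqrt u * A)\<^sup>2"
        using dec(3) u1 s0 unfolding A_def c_def by (simp add: power_mult_distrib power_divide)
      show "0 \<le> c / sqrt u * A" using c0 u1 unfolding A_def by simp
    qed
    have half: "c / sqrt u \<le> 1 / 2"
    proof -
      have "2 * c \<le> sqrt u" using uc by (rule real_le_rsqrt)
      then show ?thesis using u1 by (simp add: field_simps)
    qed
    have ab: "a x + b x = cscale (2 * E x) (Y x)" for x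
      unfolding a_def b_def a0_def b0_def by (simp add: vec_eq_iff algebra_simps)
    have A4: "A \<le> 4 * norm (Y 0)"
    proof -
      have "A \<le> norm (a 0 + b 0) + norm (b 0)" unfolding A_def using norm_triangle_ineq4[of "a 0 + b 0" "b 0"] by simp
      also have "norm (a 0 + b 0) = 2 * norm (Y 0)" unfolding ab E0 norm_cscale by simp
      also have "norm (b 0) \<le> 1 / 2 * A"
        by (rule order_trans[OF b0_small mult_right_mono[OF half]]) (simp add: A_def)
      finally show ?thesis by simp
    qed
    have "norm (Y x) \<le> C * exp (- (u\<^sup>2 * x)) * norm (Y 0)" if x: "x \<in> {0..pi}" for x
    proof -
      have "2 * exp (u\<^sup>2 * x) * norm (Y x) = norm (a x + b x)" unfolding ab norm_cscale norm_mult nE by simp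
      also have "\<dots> \<le> 2 * A + 10 * A" using norm_triangle_ineq[of "a x" "b x"] dec(1)[OF x] dec(2)[OF x] unfolding A_def by linarith
      also have "\<dots> \<le> 2 * (24 * norm (Y 0))" using A4 by simp
      finally have "exp (u\<^sup>2 * x) * norm (Y x) \<le> 24 * norm (Y 0)" by (simp add: mult.commute)
      then have "exp (- (u\<^sup>2 * x)) * (exp (u\<^sup>2 * x) * norm (Y x)) \<le> exp (- (u\<^sup>2 * x)) * (24 * norm (Y 0))" by (intro mult_left_mono) auto
      then have "norm (Y x) \<le> 24 * (exp (- (u\<^sup>2 * x)) * norm (Y 0))" by (simp add: mult.assoc[symmetric] exp_minus)
      also have "\<dots> \<le> C * (exp (- (u\<^sup>2 * x)) * norm (Y 0))" unfolding C_def using c0 by (intro mult_right_mono) auto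
      finally show ?thesis by (simp add: mult.assoc)
    qed
    moreover have "norm (Y1 0 - cscale (\<i> * \<rho>) (Y 0)) \<le> C / sqrt u * norm \<rho> * norm (Y 0)"
    proof -
      have "Y1 0 - cscale (\<i> * \<rho>) (Y 0) = cscale (- \<i> * \<rho>) (b 0)"
        unfolding b_def b0_def E0 using rho0 by (simp add: vec_eq_iff field_simps)
      then have "norm (Y1 0 - cscale (\<i> * \<rho>) (Y 0)) = norm \<rho> * norm (b 0)" unfolding norm_cscale by (simp add: norm_cscale norm_mult)
      also have "\<dots> \<le> norm \<rho> * (c / sqrt u * (4 * norm (Y 0)))"
        using c0 u1 A4 by (intro mult_left_mono order_trans[OF b0_small]) auto
      also have "\<dots> = (4 * c) / sqrt u * norm \<rho> * norm (Y 0)" by simp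
      also have "\<dots> \<le> C / sqrt u * norm \<rho> * norm (Y 0)"
        unfolding C_def using u1 by (intro mult_right_mono divide_right_mono) auto
      finally show ?thesis .
    qed
    ultimately show ?thesis by blast
  qed
  show ?thesis
    by (rule exI[of _ U], rule conjI[OF U1], rule exI[of _ C], rule conjI[OF C0]) (intro allI impI, rule main)
qed

text \<open>Columns in the ranges of \<open>T1\<close> and \<open>perp T1\<close> are recorded
  separately because they differ by a factor \<open>\<rho>\<close>. The model is zero potential on
  the half-line, with Weyl solution
  \<open>exp (\<i> \<rho> x) (T1 / (\<i> \<rho>) - perp T1)\<close> and Weyl matrix
  \<open>T1 / (\<i> \<rho>) - \<i> \<rho> (perp T1)\<close>.\<close>

definition weyl_bound :: "real \<Rightarrow> real \<Rightarrow> bool" where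
  "weyl_bound U K \<longleftrightarrow> (\<forall>u \<rho>. u \<ge> U \<longrightarrow> Im \<rho> = u\<^sup>2 \<longrightarrow> dd (\<rho>\<^sup>2) \<noteq> 0 \<longrightarrow>
     norm (Mw (\<rho>\<^sup>2) ** T1) \<le> K / sqrt u \<and> norm (Mw (\<rho>\<^sup>2) + cscale (\<i> * \<rho>) (perp T1)) \<le> K * norm \<rho> / sqrt u \<and>
     (\<forall>x\<in>{0..pi}. norm (Ph (\<rho>\<^sup>2) x ** T1) \<le> K * exp (- (u\<^sup>2 * x)) / norm \<rho> \<and>
        norm (Ph (\<rho>\<^sup>2) x ** perp T1) \<le> K * exp (- (u\<^sup>2 * x))))"

lemma weyl_ray: "\<exists>U\<ge>1. \<exists>K>0. weyl_bound U K"
proof -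
  obtain U C where U: "U \<ge> 1" and C: "C > 0" and dec: "\<forall>u \<rho> Y Y1. u \<ge> U \<longrightarrow> Im \<rho> = u\<^sup>2 \<longrightarrow> sl_system \<sigma> (\<rho>\<^sup>2) (\<lambda>x. 0) Y Y1 \<longrightarrow> V2 T2 H2 Y Y1 = 0 \<longrightarrow>
     (\<forall>x\<in>{0..pi}. norm (Y x) \<le> C * exp (- (u\<^sup>2 * x)) * norm (Y 0)) \<and>
     norm (Y1 0 - cscale (\<i> * \<rho>) (Y 0 :: complex^'m^'m)) \<le> C / sqrt u * norm \<rho> * norm (Y 0)"
    using ray_decay by (elim exE conjE)
  define U' where "U' = U + (2 * C)\<^sup>2"
  define p where "p = norm T1"
  define q where "q = norm (perp T1)"
  have pq: "p \<ge> 0" "q \<ge> 0" unfolding p_def q_def by auto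
  define K where "K = 1 + p * (1 + 4 * C) + (p + 4 * C * (q + p)) + 2 * C * p + 2 * C * q"
  have cp: "C * p \<ge> 0" "C * q \<ge> 0" using C pq by auto
  have K0: "K > 0" unfolding K_def using C pq by (intro add_pos_nonneg add_nonneg_nonneg mult_nonneg_nonneg) auto
  have K1: "p * (1 + 4 * C) \<le> K" "p + 4 * C * (q + p) \<le> K" "2 * C * p \<le> K" "2 * C * q \<le> K"
    unfolding K_def using pq cp by (simp_all add: distrib_left add_nonneg_nonneg)
  have U'1: "U' \<ge> 1" unfolding U'_def using U by (simp add: add_increasing2)
  \<comment> \<open>One half of \<open>y 0\<close> is given by
    \<open>perp T1 ** y 0 = - (perp T1 ** c)\<close>; the other follows from
    \<open>T1 ** y1 0 = T1 ** c\<close> and \<open>y1 0 \<approx> \<i> \<rho> y 0\<close>. The error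
    is at most \<open>\<epsilon>\<close> times \<open>norm (y 0)\<close> with
    \<open>\<epsilon> \<le> 1 / 2\<close> and is absorbed. The bounds come from \<open>c\<close>
    equal to \<open>T1\<close>, \<open>mat 1\<close> and \<open>perp T1\<close>.\<close>
  have gen: "norm (Mw (\<rho>\<^sup>2) ** c + cscale (\<i> * \<rho>) (perp T1 ** c)) \<le> norm (T1 ** c) / norm \<rho> + 4 * (C / sqrt u) * (norm \<rho> * norm (perp T1 ** c) + norm (T1 ** c))
      \<and> (\<forall>x\<in>{0..pi}. norm (Ph (\<rho>\<^sup>2) x ** c) \<le> 2 * C * exp (- (u\<^sup>2 * x)) * (norm (perp T1 ** c) + norm (T1 ** c) / norm \<rho>))"
    if u: "u \<ge> U'" and rho: "Im \<rho> = u\<^sup>2" and d: "dd (\<rho>\<^sup>2) \<noteq> 0" for u \<rho> and c :: "complex^'m^'m"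
  proof -
    have u1: "u \<ge> 1" "u \<ge> U" using u U'1 unfolding U'_def by (auto intro: order_trans[of U "U + (2 * C)\<^sup>2"])
    have uu: "u \<le> u\<^sup>2" using self_le_power[OF u1(1), of 2] by simp
    have r: "u\<^sup>2 \<le> norm \<rho>" using abs_Im_le_cmod[of \<rho>] rho by simp
    have r1: "norm \<rho> \<ge> 1" using r uu u1 by linarith
    define y where "y = (\<lambda>x. Ph (\<rho>\<^sup>2) x ** c)"
    define y1 where "y1 = (\<lambda>x. Ph1 (\<rho>\<^sup>2) x ** c)"
    have sys: "sl_system \<sigma> (\<rho>\<^sup>2) (\<lambda>x. 0) y y1"
      using sl_system_mult_right[OF Ph_system, of "\<rho>\<^sup>2" c] unfolding y_def y1_def by (simp add: mm_simps)
    have v: "V2 T2 H2 y y1 = 0" "V1 T1 y y1 = c" "V1_perp T1 y y1 = Mw (\<rho>\<^sup>2) ** c"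
      unfolding y_def y1_def V2_mult_right V1_mult_right V1_perp_mult_right V_Ph V2_Ph[OF d] by (simp_all add: mm_simps)
    define e where "e = y1 0 - cscale (\<i> * \<rho>) (y 0)"
    define \<epsilon> where "\<epsilon> = C / sqrt u"
    have dy: "\<forall>x\<in>{0..pi}. norm (y x) \<le> C * exp (- (u\<^sup>2 * x)) * norm (y 0)" and de: "norm e \<le> \<epsilon> * norm \<rho> * norm (y 0)"
      using dec[rule_format, OF u1(2) rho sys v(1)] unfolding e_def \<epsilon>_def by auto
    have ep: "0 \<le> \<epsilon>" "\<epsilon> \<le> 1 / 2"
    proof -
      show "0 \<le> \<epsilon>" unfolding \<epsilon>_def using C u1 by simp
      have "(2 * C)\<^sup>2 \<le> u" using u U unfolding U'_def by linarith
      then have "2 * C \<le> sqrt u" by (rule real_le_rsqrt)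
      then show "\<epsilon> \<le> 1 / 2" unfolding \<epsilon>_def using u1 by (simp add: field_simps)
    qed
    have V1e: "T1 ** y1 0 - perp T1 ** y 0 = c" using v(2) unfolding V1_def .
    have py: "perp T1 ** y 0 = - (perp T1 ** c)"
      unfolding V1e[symmetric] using orth_projD[OF T1] by (simp add: mm.diff_right matrix_mul_assoc mm.zero_left)
    have ty: "T1 ** y1 0 = T1 ** c"
      unfolding V1e[symmetric] using orth_projD[OF T1] by (simp add: mm.diff_right matrix_mul_assoc mm.zero_left)
    have y1e: "y1 0 = cscale (\<i> * \<rho>) (y 0) + e" unfolding e_def by simp
    have "cscale (\<i> * \<rho>) (T1 ** y 0) = T1 ** c - T1 ** e" using ty unfolding y1e by (simp add: mm_simps cs_simps algebra_simps)
    then have "norm \<rho> * norm (T1 ** y 0) = norm (T1 ** c - T1 ** e)" by (metis norm_cscale norm_mult norm_ii mult_1)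
    also have "\<dots> \<le> norm (T1 ** c) + norm e"
      using norm_triangle_ineq4[of "T1 ** c" "T1 ** e"] norm_orth_proj_mult_le[OF T1, of e] by linarith
    finally have "norm \<rho> * norm (T1 ** y 0) \<le> norm (T1 ** c) + norm \<rho> * (\<epsilon> * norm (y 0))" using de by (simp add: mult_ac)
    then have "norm \<rho> * (norm (T1 ** y 0) - \<epsilon> * norm (y 0)) \<le> norm (T1 ** c)" by (simp add: right_diff_distrib)
    then have "norm (T1 ** y 0) - \<epsilon> * norm (y 0) \<le> norm (T1 ** c) / norm \<rho>" using r1 by (subst pos_le_divide_eq) (linarith, simp add: mult.commute)
    then have Ty: "norm (T1 ** y 0) \<le> norm (T1 ** c) / norm \<rho> + \<epsilon> * norm (y 0)" by simp
    have "norm (y 0) \<le> norm (T1 ** y 0) + norm (perp T1 ** y 0)" using norm_triangle_ineq[of "T1 ** y 0" "perp T1 ** y 0"] by (simp add: proj_add_perp)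
    then have "norm (y 0) \<le> norm (T1 ** c) / norm \<rho> + \<epsilon> * norm (y 0) + norm (perp T1 ** c)" using Ty unfolding py norm_minus_cancel by linarith
    moreover have "\<epsilon> * norm (y 0) \<le> 1 / 2 * norm (y 0)" using ep by (intro mult_right_mono) auto
    ultimately have y0: "norm (y 0) \<le> 2 * (norm (perp T1 ** c) + norm (T1 ** c) / norm \<rho>)" by argo
    have "Mw (\<rho>\<^sup>2) ** c = T1 ** y 0 + perp T1 ** y1 0" using v(3) unfolding V1_perp_def by simp
    also have "perp T1 ** y1 0 = cscale (\<i> * \<rho>) (perp T1 ** y 0) + perp T1 ** e" unfolding y1e by (simp add: mm_simps cs_simps)
    finally have Mc: "Mw (\<rho>\<^sup>2) ** c + cscale (\<i> * \<rho>) (perp T1 ** c) = T1 ** y 0 + perp T1 ** e" unfolding py by (simp add: cs_simps)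
    have "norm (T1 ** y 0 + perp T1 ** e) \<le> norm (T1 ** c) / norm \<rho> + \<epsilon> * norm (y 0) + \<epsilon> * norm \<rho> * norm (y 0)"
      using norm_triangle_ineq[of "T1 ** y 0" "perp T1 ** e"] norm_orth_proj_mult_le[OF orth_proj_perp[OF T1], of e] Ty de by linarith
    also have "\<epsilon> * norm (y 0) \<le> \<epsilon> * norm \<rho> * norm (y 0)"
      using mult_left_mono[OF r1, of \<epsilon>] ep by (intro mult_right_mono) auto
    finally have "norm (T1 ** y 0 + perp T1 ** e) \<le> norm (T1 ** c) / norm \<rho> + 2 * (\<epsilon> * norm \<rho> * norm (y 0))" by simp
    also have "\<epsilon> * norm \<rho> * norm (y 0) \<le> \<epsilon> * norm \<rho> * (2 * (norm (perp T1 ** c) + norm (T1 ** c) / norm \<rho>))"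
      using ep y0 by (intro mult_left_mono) auto
    also have "\<epsilon> * norm \<rho> * (2 * (norm (perp T1 ** c) + norm (T1 ** c) / norm \<rho>)) = 2 * \<epsilon> * (norm \<rho> * norm (perp T1 ** c) + norm (T1 ** c))"
    proof -
      have "norm \<rho> * (norm (perp T1 ** c) + norm (T1 ** c) / norm \<rho>) = norm \<rho> * norm (perp T1 ** c) + norm (T1 ** c)"
        using r1 norm_eq_zero[of \<rho>] by (auto simp: distrib_left)
      then show ?thesis by (metis (no_types, opaque_lifting) mult.assoc mult.left_commute)
    qed
    finally have 1: "norm (Mw (\<rho>\<^sup>2) ** c + cscale (\<i> * \<rho>) (perp T1 ** c)) \<le> norm (T1 ** c) / norm \<rho> + 4 * \<epsilon> * (norm \<rho> * norm (perp T1 ** c) + norm (T1 ** c))"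
      unfolding Mc by simp
    have 2: "norm (y x) \<le> 2 * C * exp (- (u\<^sup>2 * x)) * (norm (perp T1 ** c) + norm (T1 ** c) / norm \<rho>)" if x: "x \<in> {0..pi}" for x
    proof -
      have "norm (y x) \<le> C * exp (- (u\<^sup>2 * x)) * norm (y 0)" using dy x by blast
      also have "\<dots> \<le> C * exp (- (u\<^sup>2 * x)) * (2 * (norm (perp T1 ** c) + norm (T1 ** c) / norm \<rho>))"
        using y0 C by (intro mult_left_mono) auto
      also have "\<dots> = 2 * C * exp (- (u\<^sup>2 * x)) * (norm (perp T1 ** c) + norm (T1 ** c) / norm \<rho>)" by (simp only: mult_ac)
      finally show ?thesis .
    qed
    show ?thesis using 1 2 unfolding \<epsilon>_def y_def by blast
  qed
  have main: "norm (Mw (\<rho>\<^sup>2) ** T1) \<le> K / sqrt u \<and> norm (Mw (\<rho>\<^sup>2) + cscale (\<i> * \<rho>) (perp T1)) \<le> K * norm \<rho> / sqrt u \<and>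
     (\<forall>x\<in>{0..pi}. norm (Ph (\<rho>\<^sup>2) x ** T1) \<le> K * exp (- (u\<^sup>2 * x)) / norm \<rho> \<and>
        norm (Ph (\<rho>\<^sup>2) x ** perp T1) \<le> K * exp (- (u\<^sup>2 * x)))"
    if u: "u \<ge> U'" and rho: "Im \<rho> = u\<^sup>2" and d: "dd (\<rho>\<^sup>2) \<noteq> 0" for u \<rho>
  proof -
    note proj = orth_projD[OF T1]
    have u1: "u \<ge> 1" using u U'1 by linarith
    have uu: "u \<le> u\<^sup>2" using self_le_power[OF u1, of 2] by simp
    have r: "u\<^sup>2 \<le> norm \<rho>" using abs_Im_le_cmod[of \<rho>] rho by simp
    have r1: "norm \<rho> \<ge> 1" "norm \<rho> \<ge> u" using r uu u1 by linarith+
    have squ: "sqrt u \<le> u" "sqrt u > 0" "sqrt u \<ge> 1" using u1 self_le_power[of "sqrt u" 2] by auto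
    have rs: "sqrt u \<le> norm \<rho>" "0 < norm \<rho> * sqrt u" using r1 squ by (linarith, intro mult_pos_pos, linarith+)
    have "norm (Mw (\<rho>\<^sup>2) ** T1) \<le> p / norm \<rho> + 4 * (C / sqrt u) * p"
      using gen[OF u rho d, of T1] unfolding proj p_def by (simp add: cs_simps)
    also have "p / norm \<rho> \<le> p / sqrt u" by (rule divide_left_mono[OF rs(1) pq(1) rs(2)])
    also have "p / sqrt u + 4 * (C / sqrt u) * p = (p * (1 + 4 * C)) / sqrt u" by (simp add: algebra_simps add_divide_distrib)
    also have "\<dots> \<le> K / sqrt u" using K1(1) squ by (intro divide_right_mono) auto
    finally have 1: "norm (Mw (\<rho>\<^sup>2) ** T1) \<le> K / sqrt u" by simp
    have "norm (Mw (\<rho>\<^sup>2) + cscale (\<i> * \<rho>) (perp T1)) \<le> p / norm \<rho> + 4 * (C / sqrt u) * (norm \<rho> * q + p)"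
      using gen[OF u rho d, of "mat 1"] unfolding p_def q_def by (simp add: mm_simps)
    also have "p / norm \<rho> \<le> (p * norm \<rho>) / sqrt u"
    proof (rule frac_le)
      show "p \<le> p * norm \<rho>" using pq r1 mult_left_mono[of 1 "norm \<rho>" p] by simp
    qed (use pq r1 squ in auto)
    also have "4 * (C / sqrt u) * (norm \<rho> * q + p) \<le> 4 * (C / sqrt u) * (norm \<rho> * q + norm \<rho> * p)"
    proof (intro mult_left_mono add_left_mono)
      show "p \<le> norm \<rho> * p" using pq r1 mult_right_mono[of 1 "norm \<rho>" p] by simp
    qed (use C squ in auto)
    also have "(p * norm \<rho>) / sqrt u + 4 * (C / sqrt u) * (norm \<rho> * q + norm \<rho> * p) = (p + 4 * C * (q + p)) * norm \<rho> / sqrt u"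
      by (simp add: algebra_simps add_divide_distrib)
    also have "\<dots> \<le> K * norm \<rho> / sqrt u" using K1(2) squ by (intro divide_right_mono mult_right_mono) auto
    finally have 2: "norm (Mw (\<rho>\<^sup>2) + cscale (\<i> * \<rho>) (perp T1)) \<le> K * norm \<rho> / sqrt u" by simp
    have 3: "norm (Ph (\<rho>\<^sup>2) x ** T1) \<le> K * exp (- (u\<^sup>2 * x)) / norm \<rho> \<and> norm (Ph (\<rho>\<^sup>2) x ** perp T1) \<le> K * exp (- (u\<^sup>2 * x))"
      if x: "x \<in> {0..pi}" for x
    proof
      have "norm (Ph (\<rho>\<^sup>2) x ** T1) \<le> 2 * C * exp (- (u\<^sup>2 * x)) * (p / norm \<rho>)"
        using gen[OF u rho d, of T1] x unfolding proj p_def by simp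
      also have "\<dots> = (2 * C * p) * exp (- (u\<^sup>2 * x)) / norm \<rho>" by simp
      also have "\<dots> \<le> K * exp (- (u\<^sup>2 * x)) / norm \<rho>" using K1(3) by (intro divide_right_mono mult_right_mono) auto
      finally show "norm (Ph (\<rho>\<^sup>2) x ** T1) \<le> K * exp (- (u\<^sup>2 * x)) / norm \<rho>" .
      have "norm (Ph (\<rho>\<^sup>2) x ** perp T1) \<le> 2 * C * exp (- (u\<^sup>2 * x)) * q"
        using gen[OF u rho d, of "perp T1"] x unfolding proj q_def by simp
      also have "\<dots> = (2 * C * q) * exp (- (u\<^sup>2 * x))" by simp
      also have "\<dots> \<le> K * exp (- (u\<^sup>2 * x))" using K1(4) by (intro mult_right_mono) auto
      finally show "norm (Ph (\<rho>\<^sup>2) x ** perp T1) \<le> K * exp (- (u\<^sup>2 * x))" .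
    qed
    show ?thesis using 1 2 3 by blast
  qed
  show ?thesis
    unfolding weyl_bound_def
    by (rule exI[of _ U'], rule conjI[OF U'1], rule exI[of _ K], rule conjI[OF K0]) (intro allI impI, rule main)
qed

text \<open>Multiplied by \<open>perp T1\<close> the solution \<open>ph\<close> has initial values
  \<open>(0, perp T1)\<close>, so that it inherits the factor \<open>1 / norm \<rho>\<close> which
  the quasi-derivative carries in \<open>sl_growth\<close>.\<close>

definition solution_bound :: "real \<Rightarrow> bool" where
  "solution_bound K \<longleftrightarrow> (\<forall>\<rho> x. norm \<rho> \<ge> 1 \<longrightarrow> x \<in> {0..pi} \<longrightarrow>
     norm (ph (\<rho>\<^sup>2) x) \<le> K * exp (\<bar>Im \<rho>\<bar> * x) \<and> norm (sf (\<rho>\<^sup>2) x) \<le> K * exp (\<bar>Im \<rho>\<bar> * x) \<and>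
     norm (ph (\<rho>\<^sup>2) x ** T1) \<le> K * exp (\<bar>Im \<rho>\<bar> * x) \<and> norm (ph (\<rho>\<^sup>2) x ** perp T1) \<le> K * exp (\<bar>Im \<rho>\<bar> * x) / norm \<rho>)"

lemma solution_growth: "\<exists>K>0. solution_bound K"
proof -
  define G where "G = sqrt (exp (pi + 3 * S2 pi))"
  have G0: "G > 0" unfolding G_def by simp
  have gr: "norm (Y x) \<le> (norm (Y 0) + norm (Y1 0) / norm \<rho>) * (G * exp (\<bar>Im \<rho>\<bar> * x))"
    if "sl_system \<sigma> (\<rho>\<^sup>2) (\<lambda>x. 0) Y Y1" "norm \<rho> \<ge> 1" "x \<in> {0..pi}" for \<rho> x and Y Y1 :: "real \<Rightarrow> complex^'m^'m"
  proof (rule power2_le_imp_le)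
    have "(norm (Y x))\<^sup>2 \<le> ((norm (Y 0))\<^sup>2 + (norm (Y1 0) / norm \<rho>)\<^sup>2) * exp (pi + 3 * S2 pi) * exp (2 * \<bar>Im \<rho>\<bar> * x)"
      by (rule sl_growth[OF that])
    also have "exp (pi + 3 * S2 pi) = G\<^sup>2" unfolding G_def by simp
    also have "exp (2 * \<bar>Im \<rho>\<bar> * x) = (exp (\<bar>Im \<rho>\<bar> * x))\<^sup>2" by (simp add: exp_double[symmetric] mult.assoc)
    also have "((norm (Y 0))\<^sup>2 + (norm (Y1 0) / norm \<rho>)\<^sup>2) * G\<^sup>2 * (exp (\<bar>Im \<rho>\<bar> * x))\<^sup>2 \<le> (norm (Y 0) + norm (Y1 0) / norm \<rho>)\<^sup>2 * G\<^sup>2 * (exp (\<bar>Im \<rho>\<bar> * x))\<^sup>2"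
    proof (intro mult_right_mono)
      show "(norm (Y 0))\<^sup>2 + (norm (Y1 0) / norm \<rho>)\<^sup>2 \<le> (norm (Y 0) + norm (Y1 0) / norm \<rho>)\<^sup>2"
        unfolding power2_sum by simp
    qed auto
    finally show "(norm (Y x))\<^sup>2 \<le> ((norm (Y 0) + norm (Y1 0) / norm \<rho>) * (G * exp (\<bar>Im \<rho>\<bar> * x)))\<^sup>2"
      by (simp add: power_mult_distrib mult.assoc)
  qed (use G0 in simp)
  define K where "K = (norm T1 + norm (perp T1) + 1) * G"
  have K0: "K > 0" unfolding K_def using G0 by (intro mult_pos_pos add_nonneg_pos) auto
  have fin: "t * (G * exp (\<bar>Im \<rho>\<bar> * x)) \<le> K * exp (\<bar>Im \<rho>\<bar> * x)" if "t \<le> norm T1 + norm (perp T1)" for t \<rho> x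
  proof -
    have "t * (G * exp (\<bar>Im \<rho>\<bar> * x)) \<le> (norm T1 + norm (perp T1) + 1) * (G * exp (\<bar>Im \<rho>\<bar> * x))"
      using that G0 by (intro mult_right_mono) auto
    then show ?thesis unfolding K_def by (simp add: mult.assoc)
  qed
  have dl: "t / norm \<rho> \<le> t" if "t \<ge> 0" "norm \<rho> \<ge> 1" for t and \<rho> :: complex
  proof -
    have "norm \<rho> > 0" using that(2) by linarith
    then show ?thesis using divide_left_mono[of 1 "norm \<rho>" t] that by simp
  qed
  have "norm (ph (\<rho>\<^sup>2) x) \<le> K * exp (\<bar>Im \<rho>\<bar> * x) \<and> norm (sf (\<rho>\<^sup>2) x) \<le> K * exp (\<bar>Im \<rho>\<bar> * x) \<and>
     norm (ph (\<rho>\<^sup>2) x ** T1) \<le> K * exp (\<bar>Im \<rho>\<bar> * x) \<and> norm (ph (\<rho>\<^sup>2) x ** perp T1) \<le> K * exp (\<bar>Im \<rho>\<bar> * x) / norm \<rho>"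
    if r: "norm \<rho> \<ge> 1" and x: "x \<in> {0..pi}" for \<rho> x
  proof (intro conjI)
    note proj = orth_projD[OF T1]
    have s: "sl_system \<sigma> (\<rho>\<^sup>2) (\<lambda>x. 0) (\<lambda>x. ph (\<rho>\<^sup>2) x ** C) (\<lambda>x. ph1 (\<rho>\<^sup>2) x ** C)" for C :: "complex^'m^'m"
      using sl_system_mult_right[OF ph_system, of "\<rho>\<^sup>2" C] by (simp add: mm_simps)
    show "norm (ph (\<rho>\<^sup>2) x) \<le> K * exp (\<bar>Im \<rho>\<bar> * x)"
      using dl[of "norm (perp T1)" \<rho>] r by (intro order_trans[OF gr[OF ph_system r x] fin]) (simp add: ph_0)
    show "norm (sf (\<rho>\<^sup>2) x) \<le> K * exp (\<bar>Im \<rho>\<bar> * x)"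
      using dl[of "norm T1" \<rho>] r by (intro order_trans[OF gr[OF sf_system r x] fin]) (simp add: sf_0)
    show "norm (ph (\<rho>\<^sup>2) x ** T1) \<le> K * exp (\<bar>Im \<rho>\<bar> * x)"
      by (intro order_trans[OF gr[OF s r x] fin]) (simp add: ph_0 proj)
    have "norm (ph (\<rho>\<^sup>2) x ** perp T1) \<le> norm (perp T1) / norm \<rho> * (G * exp (\<bar>Im \<rho>\<bar> * x))"
      using gr[OF s r x, of "perp T1"] by (simp add: ph_0 proj)
    also have "\<dots> = (norm (perp T1) * (G * exp (\<bar>Im \<rho>\<bar> * x))) / norm \<rho>" by simp
    also have "\<dots> \<le> K * exp (\<bar>Im \<rho>\<bar> * x) / norm \<rho>" by (intro divide_right_mono fin) auto
    finally show "norm (ph (\<rho>\<^sup>2) x ** perp T1) \<le> K * exp (\<bar>Im \<rho>\<bar> * x) / norm \<rho>" .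
  qed
  then show ?thesis unfolding solution_bound_def using K0 by (intro exI[of _ K]) blast
qed

end

subsection \<open>Problems with equal Weyl matrices\<close>

lemma holomorphic_cnj_cnj:
  assumes "f holomorphic_on UNIV"
  shows "(\<lambda>z. cnj (f (cnj z))) holomorphic_on UNIV"
proof -
  have "cnj \<circ> f \<circ> cnj holomorphic_on UNIV"
    by (rule holomorphic_on_compose_cnj_cnj) (use assms holomorphic_on_subset in auto)
  then show ?thesis by (simp add: comp_def)
qed

text \<open>Inserting \<open>T ** T + perp T ** perp T\<close> between the factors lets the column
  bounds be multiplied range by range, so that a gain \<open>1 / \<rho>\<close> may come from a
  different factor on each range.\<close>

lemma norm_mult_dagger_split:
  fixes X W :: "complex^'m^'m"
  assumes T: "orth_proj T" and le: "norm (X ** T) \<le> a" "norm (W ** T) \<le> b" "norm (X ** perp T) \<le> c" "norm (W ** perp T) \<le> d"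
  shows "norm (X ** dagger W) \<le> a * b + c * d"
proof -
  note proj = orth_projD[OF T]
  have "X ** dagger W = X ** ((T ** T) ** dagger W) + X ** ((perp T ** perp T) ** dagger W)"
    unfolding mm.add_right[symmetric] proj proj_add_perp ..
  also have "\<dots> = (X ** T) ** dagger (W ** T) + (X ** perp T) ** dagger (W ** perp T)"
    by (simp only: dagger_mult proj(1,6) matrix_mul_assoc)
  finally have "norm (X ** dagger W) \<le> norm ((X ** T) ** dagger (W ** T)) + norm ((X ** perp T) ** dagger (W ** perp T))"
    by (simp add: norm_triangle_ineq)
  also have "\<dots> \<le> norm (X ** T) * norm (W ** T) + norm (X ** perp T) * norm (W ** perp T)"
    using norm_matrix_mult_le[of "X ** T" "dagger (W ** T)"] norm_matrix_mult_le[of "X ** perp T" "dagger (W ** perp T)"] by simp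
  also have "\<dots> \<le> a * b + c * d"
    using le order_trans[OF norm_ge_zero le(1)] order_trans[OF norm_ge_zero le(3)] by (intro add_mono mult_mono) auto
  finally show ?thesis .
qed

lemma ac_deriv_zero_fun:
  assumes f: "ac_deriv a b f g" and z: "\<And>x. x \<in> {a..b} \<Longrightarrow> f x = 0"
  obtains N where "negligible N" "\<And>x. x \<in> {a<..<b} - N \<Longrightarrow> g x = 0"
proof -
  obtain N where N: "abs_continuous_on_interval a b f" "negligible N"
    "\<And>x. x \<in> {a<..<b} - N \<Longrightarrow> (f has_vector_derivative g x) (at x)"
    using f by (rule ac_derivE) (rule that, assumption+)
  have "g x = 0" if x: "x \<in> {a<..<b} - N" for x
  proof -
    have "((\<lambda>_. 0) has_vector_derivative g x) (at x)"
      by (rule has_vector_derivative_transform_within_open[OF N(3)[OF x], of "{a<..<b}"]) (use x z in auto)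
    then show ?thesis using vector_derivative_unique_at[OF _ has_vector_derivative_const] by blast
  qed
  then show ?thesis by (rule that[OF N(2)])
qed

section \<open>Cauchy data prescribed at the right endpoint\<close>

context sl_pot
begin

lemma fs_unique:
  assumes "sl_system \<sigma> z (\<lambda>x. 0) Y Y1" "x \<in> {0..pi}" "Y 0 = A" "Y1 0 = B"
  shows "fst (fs z A B) x = Y x" "snd (fs z A B) x = Y1 x"
proof -
  have s: "sl_system \<sigma> z (\<lambda>x. 0) (\<lambda>x. fst (fs z A B) x - Y x) (\<lambda>x. snd (fs z A B) x - Y1 x)"
    using sl_system_diff[OF fs(1) assms(1)] by simp
  show "fst (fs z A B) x = Y x" "snd (fs z A B) x = Y1 x"
    using sl_unique_at_0[OF s _ _ assms(2)] assms(3,4) by (simp_all add: fs)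
qed

text \<open>The map from initial to final Cauchy data is linear and injective on a
  finite-dimensional space, hence surjective.\<close>

lemma solve_backward:
  fixes u w :: "complex^'m^'m"
  shows "\<exists>Y Y1. sl_system \<sigma> z (\<lambda>x. 0) Y Y1 \<and> Y pi = u \<and> Y1 pi = w"
proof -
  define F where "F = (\<lambda>p. (fst (fs z (fst p) (snd p)) pi, snd (fs z (fst p) (snd p)) pi))"
  have pi: "pi \<in> {0..pi}" by simp
  have lin: "linear F"
  proof (rule linearI)
    fix p q
    have "sl_system \<sigma> z (\<lambda>x. 0) (\<lambda>x. fst (fs z (fst p) (snd p)) x + fst (fs z (fst q) (snd q)) x) (\<lambda>x. snd (fs z (fst p) (snd p)) x + snd (fs z (fst q) (snd q)) x)"
      using sl_system_add[OF fs(1) fs(1)] by simp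
    from fs_unique[OF this pi] show "F (p + q) = F p + F q" unfolding F_def by (simp add: fs)
  next
    fix r :: real and p
    have "sl_system \<sigma> z (\<lambda>x. 0) (\<lambda>x. cscale (of_real r) (fst (fs z (fst p) (snd p)) x)) (\<lambda>x. cscale (of_real r) (snd (fs z (fst p) (snd p)) x))"
      using sl_system_cscale[OF fs(1), of z "of_real r"] by (simp add: cs_simps)
    from fs_unique[OF this pi] show "F (r *\<^sub>R p) = r *\<^sub>R F p" unfolding F_def by (simp add: fs cscale_of_real scaleR_prod_def)
  qed
  have "inj F"
    unfolding linear_injective_0[OF lin]
  proof (intro allI impI)
    fix p assume "F p = 0"
    then have "fst (fs z (fst p) (snd p)) pi = 0" "snd (fs z (fst p) (snd p)) pi = 0" unfolding F_def by (simp_all add: zero_prod_def)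
    from sl_unique_at_pi[OF fs(1) this] show "p = 0" by (simp add: fs prod_eq_iff)
  qed
  then have "surj F" by (rule linear_injective_imp_surjective[OF lin _ refl])
  then obtain p where p: "F p = (u, w)" by (metis surjD)
  then show ?thesis unfolding F_def
    by (intro exI[of _ "fst (fs z (fst p) (snd p))"] exI[of _ "snd (fs z (fst p) (snd p))"]) (simp add: fs)
qed

end

text \<open>The situation after the shift by \<open>H\<close>: \<open>T1\<close> is already known to
  be shared and the Weyl matrices agree.\<close>

locale sl_pair = A: sl \<sigma> T1 T2 H2 + B: sl \<sigma>' T1 T2' H2'
  for \<sigma> \<sigma>' :: "real \<Rightarrow> complex^'m^'m" and T1 T2 H2 T2' H2' +
  assumes Mw_eq: "Im z \<noteq> 0 \<Longrightarrow> A.Mw z = B.Mw z"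
begin

text \<open>By the Lagrange identity the inverse of a fundamental matrix at \<open>z\<close> is
  built from daggers of fundamental solutions at \<open>cnj z\<close>; in this form
  \<open>P12\<close> is visibly entire in \<open>z\<close>.\<close>

definition P12 :: "complex \<Rightarrow> real \<Rightarrow> complex^'m^'m" where
  "P12 z x = A.sf z x ** dagger (B.ph (cnj z) x) - A.ph z x ** dagger (B.sf (cnj z) x)"

text \<open>Replacing \<open>sf\<close> by \<open>Ph\<close> adds
  \<open>A.ph z x ** A.Mw z ** dagger (B.ph (cnj z) x)\<close> to both products, because the Weyl
  matrices agree and \<open>dagger (Mw (cnj z)) = Mw z\<close>. Now each growing solution is paired
  with a decaying one.\<close>

lemma P12_weyl:
  assumes "Im z \<noteq> 0"
  shows "P12 z x = A.Ph z x ** dagger (B.ph (cnj z) x) - A.ph z x ** dagger (B.Ph (cnj z) x)"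
  unfolding P12_def A.Ph_def B.Ph_def dagger_add dagger_mult B.Mw_dagger[OF assms] Mw_eq[OF assms]
  by (simp add: mm_simps)

lemma P12_holomorphic:
  assumes x: "x \<in> {0..pi}"
  shows "(\<lambda>z. P12 z x $ i $ j) holomorphic_on UNIV"
proof -
  have h: "(\<lambda>z. (X z ** dagger (W (cnj z))) $ i $ j) holomorphic_on UNIV"
    if "\<And>i j. (\<lambda>z. X z $ i $ j) holomorphic_on UNIV" "\<And>i j. (\<lambda>z. W z $ i $ j) holomorphic_on UNIV"
    for X W :: "complex \<Rightarrow> complex^'m^'m"
    by (rule holomorphic_matrix_mult[OF that(1)]) (simp add: holomorphic_cnj_cnj[OF that(2)])
  have e: "(\<lambda>z. A.ph z x $ i $ j) holomorphic_on UNIV" "(\<lambda>z. A.sf z x $ i $ j) holomorphic_on UNIV"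
     "(\<lambda>z. B.ph z x $ i $ j) holomorphic_on UNIV" "(\<lambda>z. B.sf z x $ i $ j) holomorphic_on UNIV" for i j
    unfolding A.ph_def A.sf_def B.ph_def B.sf_def by (intro A.fs_holomorphic(1) B.fs_holomorphic(1) x)+
  show ?thesis unfolding P12_def vector_minus_component by (intro holomorphic_on_diff h e)
qed

lemma P12_growth:
  assumes x: "x \<in> {0..pi}"
  shows "\<exists>K>0. \<forall>z. norm (P12 z x $ i $ j) \<le> K * exp (K * sqrt (norm z))"
proof -
  obtain KA where KA: "KA > 0" "A.solution_bound KA"
    using A.solution_growth by (elim exE conjE)
  obtain KB where KB: "KB > 0" "B.solution_bound KB"
    using B.solution_growth by (elim exE conjE)
  have "bounded ((\<lambda>z. P12 z x $ i $ j) ` cball 0 1)"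
    by (intro compact_imp_bounded compact_continuous_image holomorphic_on_imp_continuous_on holomorphic_on_subset[OF P12_holomorphic[OF x]]) auto
  then obtain M where M: "M > 0" "\<forall>w\<in>(\<lambda>z. P12 z x $ i $ j) ` cball 0 1. norm w \<le> M"
    unfolding bounded_pos by (elim exE conjE)
  \<comment> \<open>\<open>M\<close> covers \<open>norm z \<le> 1\<close>, where
    \<open>solution_bound\<close> gives no information; \<open>2 * pi\<close> is the exponential
    rate of a product of two solutions.\<close>
  define K where "K = 2 * (KA * KB) + M + 2 * pi"
  have KAB: "KA * KB > 0" using KA(1) KB(1) by simp
  have K0: "K > 0" unfolding K_def using KAB M(1) by (simp add: add_pos_pos)
  have "norm (P12 z x $ i $ j) \<le> K * exp (K * sqrt (norm z))" for z
  proof (cases "norm z \<le> 1")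
    case True
    then have "norm (P12 z x $ i $ j) \<le> M" by (intro M(2)[rule_format] imageI) simp
    also have "\<dots> \<le> K" unfolding K_def using KAB by simp
    also have "\<dots> \<le> K * exp (K * sqrt (norm z))" using K0 mult_left_mono[of 1 "exp (K * sqrt (norm z))" K] by simp
    finally show ?thesis .
  next
    case False
    define \<rho> where "\<rho> = csqrt z"
    have r: "\<rho>\<^sup>2 = z" "(cnj \<rho>)\<^sup>2 = cnj z" unfolding \<rho>_def by (simp_all flip: complex_cnj_power)
    have rn: "norm \<rho> = sqrt (norm z)" unfolding r(1)[symmetric] by (simp add: norm_power)
    have r1: "norm \<rho> \<ge> 1" "norm (cnj \<rho>) \<ge> 1" using False unfolding complex_mod_cnj rn by simp_all
    define E where "E = exp (sqrt (norm z) * pi)"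
    have imE: "exp (\<bar>Im \<rho>\<bar> * x) \<le> E" unfolding E_def using x abs_Im_le_cmod[of \<rho>] unfolding rn by (simp add: mult_mono)
    have imE': "exp (\<bar>Im (cnj \<rho>)\<bar> * x) \<le> E" using imE by simp
    have kA: "KA * exp (\<bar>Im \<rho>\<bar> * x) \<le> KA * E" and kB: "KB * exp (\<bar>Im (cnj \<rho>)\<bar> * x) \<le> KB * E"
      by (rule mult_left_mono[OF imE less_imp_le[OF KA(1)]], rule mult_left_mono[OF imE' less_imp_le[OF KB(1)]])
    note hA = KA(2)[unfolded A.solution_bound_def, rule_format, OF r1(1) x, unfolded r(1)] and hB = KB(2)[unfolded B.solution_bound_def, rule_format, OF r1(2) x, unfolded r(2)]
    have a: "norm (A.ph z x) \<le> KA * E" "norm (A.sf z x) \<le> KA * E"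
      by (rule order_trans[OF conjunct1[OF hA] kA], rule order_trans[OF conjunct1[OF conjunct2[OF hA]] kA])
    have b: "norm (B.ph (cnj z) x) \<le> KB * E" "norm (B.sf (cnj z) x) \<le> KB * E"
      by (rule order_trans[OF conjunct1[OF hB] kB], rule order_trans[OF conjunct1[OF conjunct2[OF hB]] kB])
    have n1: "norm (A.sf z x ** dagger (B.ph (cnj z) x)) \<le> (KA * E) * (KB * E)"
      by (rule order_trans[OF norm_matrix_mult_le mult_mono]) (use a b KA KB in \<open>auto simp: E_def\<close>)
    have n2: "norm (A.ph z x ** dagger (B.sf (cnj z) x)) \<le> (KA * E) * (KB * E)"
      by (rule order_trans[OF norm_matrix_mult_le mult_mono]) (use a b KA KB in \<open>auto simp: E_def\<close>)
    have "norm (P12 z x $ i $ j) \<le> norm (P12 z x)" by (rule norm_entry_le)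
    also have "\<dots> \<le> (KA * E) * (KB * E) + (KA * E) * (KB * E)"
      unfolding P12_def using norm_triangle_ineq4[of "A.sf z x ** dagger (B.ph (cnj z) x)" "A.ph z x ** dagger (B.sf (cnj z) x)"] n1 n2 by linarith
    also have "\<dots> = 2 * (KA * KB) * (E * E)" by simp
    also have "E * E = exp (2 * pi * sqrt (norm z))" unfolding E_def by (simp add: mult_ac flip: exp_add)
    also have "2 * (KA * KB) * exp (2 * pi * sqrt (norm z)) \<le> K * exp (K * sqrt (norm z))"
      using KAB M(1) unfolding K_def by (intro mult_mono) (auto intro!: mult_right_mono)
    finally show ?thesis .
  qed
  then show ?thesis using K0 by blast
qed

lemma P12_ray:
  assumes x: "x \<in> {0..pi}"
  shows "\<exists>y0 C. \<forall>y. \<bar>y\<bar> \<ge> y0 \<longrightarrow> norm (P12 (\<i> * of_real y) x $ i $ j) \<le> C / sqrt \<bar>y\<bar>"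
proof -
  obtain KA where KA: "KA > 0" "A.solution_bound KA"
    using A.solution_growth by (elim exE conjE)
  obtain KB where KB: "KB > 0" "B.solution_bound KB"
    using B.solution_growth by (elim exE conjE)
  obtain UA LA where UA: "UA \<ge> 1" "LA > 0" "A.weyl_bound UA LA"
    using A.weyl_ray by (elim exE conjE)
  obtain UB LB where UB: "UB \<ge> 1" "LB > 0" "B.weyl_bound UB LB"
    using B.weyl_ray by (elim exE conjE)
  define U where "U = max UA UB"
  have U1: "U \<ge> 1" "U \<ge> UA" "U \<ge> UB" unfolding U_def using UA(1) UB(1) by auto
  define C where "C = 2 * (LA * KB) + 2 * (KA * LB)"
  \<comment> \<open>The threshold is what \<open>u \<ge> U\<close> amounts to for
    \<open>\<bar>y\<bar> = 2 * t\<^sup>2\<close> and \<open>t = u\<^sup>2\<close>.\<close>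
  have main: "norm (P12 (\<i> * of_real y) x $ i $ j) \<le> C / sqrt \<bar>y\<bar>" if y: "\<bar>y\<bar> \<ge> 2 * U ^ 4" for y
  proof -
    define t where "t = sqrt (\<bar>y\<bar> / 2)"
    define u where "u = sqrt t"
    have t2: "t\<^sup>2 = \<bar>y\<bar> / 2" unfolding t_def by simp
    have "U\<^sup>2 \<le> t" unfolding t_def using y by (intro real_le_rsqrt) (simp add: power_mult[symmetric])
    then have uU: "U \<le> u" unfolding u_def by (rule real_le_rsqrt)
    have t1: "1 \<le> t" using \<open>U\<^sup>2 \<le> t\<close> one_le_power[OF U1(1), of 2] by linarith
    have u2: "u\<^sup>2 = t" unfolding u_def using t1 by simp
    have y0: "y \<noteq> 0" using t2 t1 by auto
    \<comment> \<open>Square roots of the point and of its conjugate, both taken in the upper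
      half-plane, where the Weyl solutions decay.\<close>
    define \<rho> where "\<rho> = Complex (sgn y * t) t"
    define \<rho>' where "\<rho>' = Complex (- sgn y * t) t"
    have sq: "(sgn y)\<^sup>2 = 1" using y0 by (simp add: sgn_real_def)
    have yy: "2 * (sgn y * t\<^sup>2) = y" unfolding t2 by (simp add: sgn_real_def)
    have r: "\<rho>\<^sup>2 = \<i> * of_real y"
      unfolding \<rho>_def using yy sq by (simp add: complex_eq_iff power2_eq_square algebra_simps)
    have r': "\<rho>'\<^sup>2 = cnj (\<i> * of_real y)"
      unfolding \<rho>'_def using yy sq by (simp add: complex_eq_iff power2_eq_square algebra_simps)
    have im: "Im \<rho> = u\<^sup>2" "Im \<rho>' = u\<^sup>2" unfolding \<rho>_def \<rho>'_def u2 by auto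
    have rn: "norm \<rho> = sqrt \<bar>y\<bar>"
    proof -
      have "(norm \<rho>)\<^sup>2 = \<bar>y\<bar>" by (metis r norm_power norm_mult norm_ii mult_1 norm_of_real)
      then show ?thesis by (metis real_sqrt_unique norm_ge_zero)
    qed
    have rn': "norm \<rho>' = sqrt \<bar>y\<bar>"
    proof -
      have "(norm \<rho>')\<^sup>2 = \<bar>y\<bar>" by (metis r' norm_power norm_mult norm_ii mult_1 norm_of_real complex_mod_cnj)
      then show ?thesis by (metis real_sqrt_unique norm_ge_zero)
    qed
    have r1: "norm \<rho> \<ge> 1" "norm \<rho>' \<ge> 1" using abs_Im_le_cmod[of \<rho>] abs_Im_le_cmod[of \<rho>'] t1 unfolding im u2 by auto
    have nz: "Im (\<i> * of_real y) \<noteq> 0" "Im (cnj (\<i> * of_real y)) \<noteq> 0" using y0 by auto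
    let ?z = "\<i> * of_real y"
    let ?e = "exp (t * x)" let ?f = "exp (- (t * x))" let ?q = "sqrt \<bar>y\<bar>"
    have ef: "?f * ?e = 1" by (simp flip: exp_add)
    have q0: "?q > 0" using y0 by simp
    have a1: "norm (A.ph ?z x ** T1) \<le> KA * ?e" "norm (A.ph ?z x ** perp T1) \<le> KA * ?e / ?q"
      using KA(2)[unfolded A.solution_bound_def, rule_format, OF r1(1) x] t1 unfolding r im u2 rn by auto
    have b1: "norm (B.ph (cnj ?z) x ** T1) \<le> KB * ?e" "norm (B.ph (cnj ?z) x ** perp T1) \<le> KB * ?e / ?q"
      using KB(2)[unfolded B.solution_bound_def, rule_format, OF r1(2) x] t1 unfolding r' im u2 rn' by auto
    have dA: "A.dd (\<rho>\<^sup>2) \<noteq> 0" unfolding r by (rule A.dd_nonreal[OF nz(1)])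
    have dB: "B.dd (\<rho>'\<^sup>2) \<noteq> 0" unfolding r' by (rule B.dd_nonreal[OF nz(2)])
    have uA: "UA \<le> u" and uB: "UB \<le> u" using uU U1 by linarith+
    have a2: "norm (A.Ph ?z x ** T1) \<le> LA * ?f / ?q" "norm (A.Ph ?z x ** perp T1) \<le> LA * ?f"
      using UA(3)[unfolded A.weyl_bound_def, rule_format, OF uA im(1) dA] x unfolding r u2 rn by auto
    have b2: "norm (B.Ph (cnj ?z) x ** T1) \<le> LB * ?f / ?q" "norm (B.Ph (cnj ?z) x ** perp T1) \<le> LB * ?f"
      using UB(3)[unfolded B.weyl_bound_def, rule_format, OF uB im(2) dB] x unfolding r' u2 rn' by auto
    \<comment> \<open>In each summand the exponentials multiply to 1 and exactly one factor carries
      \<open>1 / ?q\<close>.\<close>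
    have n1: "norm (A.Ph ?z x ** dagger (B.ph (cnj ?z) x)) \<le> (LA * ?f / ?q) * (KB * ?e) + (LA * ?f) * (KB * ?e / ?q)"
      by (rule norm_mult_dagger_split[OF A.T1 a2(1) b1(1) a2(2) b1(2)])
    have n2: "norm (A.ph ?z x ** dagger (B.Ph (cnj ?z) x)) \<le> (KA * ?e) * (LB * ?f / ?q) + (KA * ?e / ?q) * (LB * ?f)"
      by (rule norm_mult_dagger_split[OF A.T1 a1(1) b2(1) a1(2) b2(2)])
    have "norm (P12 ?z x $ i $ j) \<le> norm (P12 ?z x)" by (rule norm_entry_le)
    also have "\<dots> \<le> ((LA * ?f / ?q) * (KB * ?e) + (LA * ?f) * (KB * ?e / ?q)) + ((KA * ?e) * (LB * ?f / ?q) + (KA * ?e / ?q) * (LB * ?f))"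
      unfolding P12_weyl[OF nz(1)]
      using norm_triangle_ineq4[of "A.Ph ?z x ** dagger (B.ph (cnj ?z) x)" "A.ph ?z x ** dagger (B.Ph (cnj ?z) x)"] n1 n2 by linarith
    also have "\<dots> = (2 * (LA * KB) * (?f * ?e) + 2 * (KA * LB) * (?f * ?e)) / ?q" using q0 by (simp add: field_simps)
    also have "\<dots> = C / ?q" unfolding ef C_def by simp
    finally show ?thesis .
  qed
  then show ?thesis by blast
qed

lemma P12_zero:
  assumes x: "x \<in> {0..pi}"
  shows "P12 z x = 0"
proof -
  have "P12 z x $ i $ j = 0" for i j
  proof -
    obtain K where K: "K > 0" "\<forall>z. norm (P12 z x $ i $ j) \<le> K * exp (K * sqrt (norm z))"
      using P12_growth[OF x, of i j] by (elim exE conjE)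
    obtain y0 C where C: "\<forall>y. \<bar>y\<bar> \<ge> y0 \<longrightarrow> norm (P12 (\<i> * of_real y) x $ i $ j) \<le> C / sqrt \<bar>y\<bar>"
      using P12_ray[OF x, of i j] by (elim exE)
    show ?thesis
      by (rule phragmen_lindelof_zero[OF P12_holomorphic[OF x] K(1) K(2)[rule_format] C[rule_format]])
  qed
  then show ?thesis by (simp add: vec_eq_iff)
qed

text \<open>With \<open>P\<^sub>1\<^sub>2 = 0\<close>, the equation \<open>P' = A P - P A'\<close> for the product \<open>P\<close> of one fundamental matrix with the
  inverse of the other forces the other blocks to be constant; the value \<open>0\<close> of the spectral parameter suffices.\<close>

lemma potentials_eq:
  obtains N where "negligible N" "\<And>x. x \<in> {0<..<pi} - N \<Longrightarrow> \<sigma> x = \<sigma>' x"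
proof -
  define p where "p = A.ph 0" define p1 where "p1 = A.ph1 0" define s where "s = A.sf 0" define s1 where "s1 = A.sf1 0"
  define q where "q = B.ph 0" define q1 where "q1 = B.ph1 0" define r where "r = B.sf 0" define r1 where "r1 = B.sf1 0"
  have d: "ac_deriv 0 pi p (\<lambda>x. \<sigma> x ** p x + p1 x)" "ac_deriv 0 pi p1 (\<lambda>x. - (\<sigma> x ** p1 x) - (\<sigma> x ** \<sigma> x) ** p x)"
    "ac_deriv 0 pi s (\<lambda>x. \<sigma> x ** s x + s1 x)" "ac_deriv 0 pi s1 (\<lambda>x. - (\<sigma> x ** s1 x) - (\<sigma> x ** \<sigma> x) ** s x)"
    using A.ph_system[of 0] A.sf_system[of 0] unfolding sl_system_def p_def p1_def s_def s1_def by (simp_all add: cs_simps)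
  have e0: "ac_deriv 0 pi q (\<lambda>x. \<sigma>' x ** q x + q1 x)" "ac_deriv 0 pi q1 (\<lambda>x. - (\<sigma>' x ** q1 x) - (\<sigma>' x ** \<sigma>' x) ** q x)"
    "ac_deriv 0 pi r (\<lambda>x. \<sigma>' x ** r x + r1 x)" "ac_deriv 0 pi r1 (\<lambda>x. - (\<sigma>' x ** r1 x) - (\<sigma>' x ** \<sigma>' x) ** r x)"
    using B.ph_system[of 0] B.sf_system[of 0] unfolding sl_system_def q_def q1_def r_def r1_def by (simp_all add: cs_simps)
  have "AE x in lebesgue_on {0<..<pi}. \<sigma>' x = dagger (\<sigma>' x)" using B.prob unfolding sl_problem_def by blast
  then obtain M where M: "negligible M" "\<forall>x\<in>{0<..<pi} - M. \<sigma>' x = dagger (\<sigma>' x)"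
    by (subst (asm) AE_lebesgue_on_iff_negligible) auto
  have dg: "dagger (\<sigma>' x) = \<sigma>' x" if "x \<in> {0<..<pi} - M" for x using M(2) that by simp
  note dag = ac_deriv_linear[OF bounded_linear_dagger]
  have e: "ac_deriv 0 pi (\<lambda>x. dagger (q x)) (\<lambda>x. dagger (q x) ** \<sigma>' x + dagger (q1 x))"
    "ac_deriv 0 pi (\<lambda>x. dagger (q1 x)) (\<lambda>x. - (dagger (q1 x) ** \<sigma>' x) - dagger (q x) ** (\<sigma>' x ** \<sigma>' x))"
    "ac_deriv 0 pi (\<lambda>x. dagger (r x)) (\<lambda>x. dagger (r x) ** \<sigma>' x + dagger (r1 x))"
    "ac_deriv 0 pi (\<lambda>x. dagger (r1 x)) (\<lambda>x. - (dagger (r1 x) ** \<sigma>' x) - dagger (r x) ** (\<sigma>' x ** \<sigma>' x))"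
    by (rule ac_deriv_ae_cong[OF dag[OF e0(1)] M(1)], simp add: dagger_simps dg)
       (rule ac_deriv_ae_cong[OF dag[OF e0(2)] M(1)], simp add: dagger_simps dg,
        rule ac_deriv_ae_cong[OF dag[OF e0(3)] M(1)], simp add: dagger_simps dg,
        rule ac_deriv_ae_cong[OF dag[OF e0(4)] M(1)], simp add: dagger_simps dg)
  note bil = ac_deriv_bilinear[OF bounded_bilinear_matrix_mult]
  \<comment> \<open>The blocks of the product of fundamental matrices; the inverse is expressed by
    daggers at the same parameter, since 0 is real.\<close>
  define p11 where "p11 = (\<lambda>x. p x ** dagger (r1 x) - s x ** dagger (q1 x))"
  define p12 where "p12 = (\<lambda>x. s x ** dagger (q x) - p x ** dagger (r x))"
  define p21 where "p21 = (\<lambda>x. p1 x ** dagger (r1 x) - s1 x ** dagger (q1 x))"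
  define p22 where "p22 = (\<lambda>x. s1 x ** dagger (q x) - p1 x ** dagger (r x))"
  have p12z: "p12 x = 0" if "x \<in> {0..pi}" for x
    using P12_zero[OF that, of 0] unfolding P12_def p12_def p_def s_def q_def r_def by simp
  have p12z': "p12 x = 0" if "x \<in> {0<..<pi}" for x using p12z that by auto
  have d12: "ac_deriv 0 pi p12 (\<lambda>x. p22 x - p11 x)"
  proof -
    have "ac_deriv 0 pi p12 (\<lambda>x. \<sigma> x ** p12 x + p12 x ** \<sigma>' x + p22 x - p11 x)"
      unfolding p12_def by (rule ac_deriv_cong[OF ac_deriv_diff[OF bil[OF d(3) e(1)] bil[OF d(1) e(3)]]])
        (simp add: p11_def p22_def mm_simps algebra_simps)
    then show ?thesis by (rule ac_deriv_cong) (simp add: p12z' mm.zero_left mm.zero_right)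
  qed
  have d11: "ac_deriv 0 pi p11 (\<lambda>x. \<sigma> x ** p11 x + p21 x - p11 x ** \<sigma>' x)"
  proof -
    have "ac_deriv 0 pi p11 (\<lambda>x. \<sigma> x ** p11 x + p21 x - p11 x ** \<sigma>' x + p12 x ** (\<sigma>' x ** \<sigma>' x))"
      unfolding p11_def by (rule ac_deriv_cong[OF ac_deriv_diff[OF bil[OF d(1) e(4)] bil[OF d(3) e(2)]]])
        (simp add: p12_def p21_def mm_simps algebra_simps)
    then show ?thesis by (rule ac_deriv_cong) (simp add: p12z' mm.zero_left mm.zero_right)
  qed
  have d22: "ac_deriv 0 pi p22 (\<lambda>x. - (\<sigma> x ** p22 x) - p21 x + p22 x ** \<sigma>' x)"
  proof -
    have "ac_deriv 0 pi p22 (\<lambda>x. - (\<sigma> x ** p22 x) - p21 x + p22 x ** \<sigma>' x - (\<sigma> x ** \<sigma> x) ** p12 x)"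
      unfolding p22_def by (rule ac_deriv_cong[OF ac_deriv_diff[OF bil[OF d(4) e(1)] bil[OF d(2) e(3)]]])
        (simp add: p12_def p21_def mm_simps algebra_simps)
    then show ?thesis by (rule ac_deriv_cong) (simp add: p12z' mm.zero_left mm.zero_right)
  qed
  have d21: "ac_deriv 0 pi p21 (\<lambda>x. - (\<sigma> x ** p21 x) - (\<sigma> x ** \<sigma> x) ** p11 x - p21 x ** \<sigma>' x + p22 x ** (\<sigma>' x ** \<sigma>' x))"
    unfolding p21_def by (rule ac_deriv_cong[OF ac_deriv_diff[OF bil[OF d(2) e(4)] bil[OF d(4) e(2)]]])
      (simp add: p11_def p22_def mm_simps algebra_simps)
  \<comment> \<open>The derivative of \<open>p12 = 0\<close> is \<open>p22 - p11\<close>, which is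
    continuous, so the diagonal blocks agree. Their derivatives then add up to 0, so their sum stays
    at its initial value.\<close>
  have "p22 x - p11 x = 0" if "x \<in> {0..pi}" for x
    by (rule ac_deriv_zero_fun_continuous[OF d12 p12z _ _ that])
       (auto intro!: continuous_on_diff ac_deriv_continuous[OF d22] ac_deriv_continuous[OF d11])
  then have p22: "p22 x = p11 x" if "x \<in> {0..pi}" for x using that by simp
  have sum0: "ac_deriv 0 pi (\<lambda>x. p11 x + p22 x) (\<lambda>x. 0)"
    by (rule ac_deriv_cong[OF ac_deriv_add[OF d11 d22]]) (simp add: p22)
  note proj = orth_projD[OF A.T1]
  have init: "p11 0 = mat 1" "p22 0 = mat 1" "p21 0 = 0"
    unfolding p11_def p22_def p21_def p_def p1_def s_def s1_def q_def q1_def r_def r1_def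
      A.ph_0 A.sf_0 B.ph_0 B.sf_0 dagger_minus proj by (simp_all add: mm.minus_left mm.minus_right proj) (simp_all add: perp_def)
  have p11: "p11 x = mat 1" if x: "x \<in> {0..pi}" for x
  proof -
    have "p11 x + p22 x = p11 0 + p22 0" by (rule ac_deriv_zero_const[OF sum0]) (use x in auto)
    then have "cscale 2 (p11 x) = cscale 2 (mat 1)" unfolding p22[OF x] init by (simp add: vec_eq_iff)
    then have "cscale (1/2) (cscale 2 (p11 x)) = cscale (1/2) (cscale 2 (mat 1))" by simp
    then show ?thesis by simp
  qed
  \<comment> \<open>Since \<open>p11\<close> is constantly \<open>mat 1\<close>, its derivative
    \<open>\<sigma> + p21 - \<sigma>'\<close> is 0 almost everywhere. Inserted into the equation for
    \<open>p21\<close> this gives derivative 0, and \<open>p21\<close> starts at 0.\<close>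
  have "ac_deriv 0 pi (\<lambda>x. p11 x - mat 1) (\<lambda>x. \<sigma> x ** p11 x + p21 x - p11 x ** \<sigma>' x)"
    using ac_deriv_diff[OF d11 ac_deriv_const] by simp
  then obtain N where N: "negligible N" "\<And>x. x \<in> {0<..<pi} - N \<Longrightarrow> \<sigma> x ** p11 x + p21 x - p11 x ** \<sigma>' x = 0"
    by (rule ac_deriv_zero_fun) (use p11 in auto)
  have p21: "p21 x = \<sigma>' x - \<sigma> x" if x: "x \<in> {0<..<pi} - N" for x
  proof -
    have "p11 x = mat 1" using p11 x by simp
    then have "\<sigma> x + p21 x - \<sigma>' x = 0" using N(2)[OF x] by simp
    then show ?thesis by (simp add: algebra_simps)
  qed
  have "ac_deriv 0 pi p21 (\<lambda>x. 0)"
  proof (rule ac_deriv_ae_cong[OF d21 N(1)])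
    fix x assume x: "x \<in> {0<..<pi} - N"
    then have "p11 x = mat 1" "p22 x = mat 1" using p11 p22 by simp_all
    then show "- (\<sigma> x ** p21 x) - (\<sigma> x ** \<sigma> x) ** p11 x - p21 x ** \<sigma>' x + p22 x ** (\<sigma>' x ** \<sigma>' x) = 0"
      unfolding p21[OF x] by (simp add: mm_simps)
  qed
  then have "p21 x = 0" if "x \<in> {0..pi}" for x
    using ac_deriv_zero_const[of 0 pi p21 x 0] that init(3) by simp
  then have "\<sigma> x = \<sigma>' x" if "x \<in> {0<..<pi} - N" for x using p21[OF that] that by simp
  then show ?thesis by (rule that[OF N(1)])
qed

lemma sl_system_transfer:
  assumes "sl_system \<sigma> z f Y Y1"
  shows "sl_system \<sigma>' z f Y Y1"
proof -
  obtain N where N: "negligible N" "\<And>x. x \<in> {0<..<pi} - N \<Longrightarrow> \<sigma> x = \<sigma>' x" by (rule potentials_eq) (rule that, assumption+)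
  have a: "ac_deriv 0 pi Y (\<lambda>x. \<sigma> x ** Y x + Y1 x)" "ac_deriv 0 pi Y1 (\<lambda>x. - (\<sigma> x ** Y1 x) - (\<sigma> x ** \<sigma> x) ** Y x - cscale z (Y x) - f x)"
    using assms unfolding sl_system_def by auto
  show ?thesis unfolding sl_system_def
    by (rule conjI; rule ac_deriv_ae_cong[OF _ N(1)]; (rule a)?) (simp_all add: N(2))
qed

lemma boundary_transfer:
  assumes v: "perp T2 ** u = 0" "T2 ** w = H2 ** u"
  shows "perp T2' ** u = (0 :: complex^'m^'m)" "T2' ** w = H2' ** u"
proof -
  have i: "Im \<i> \<noteq> 0" by simp
  obtain Y Y1 where Y: "sl_system \<sigma> \<i> (\<lambda>x. 0) Y Y1" "Y pi = u" "Y1 pi = w"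
    using A.solve_backward[of \<i> u w] by (elim exE conjE)
  have V: "V2 T2 H2 Y Y1 = 0" by (rule V2_zeroI[OF A.T2 A.H2(2)]) (use v Y in auto)
  define C where "C = V1 T1 Y Y1"
  have vp: "V1_perp T1 Y Y1 = B.Mw \<i> ** C"
    using A.weyl_unique[OF A.dd_nonreal[OF i] Y(1) C_def[symmetric] V] Mw_eq[OF i] by simp
  have "V2 T2' H2' Y Y1 = B.Delta \<i> ** V1_perp T1 Y Y1 + B.Theta \<i> ** V1 T1 Y Y1"
    by (rule B.V2_represent[OF sl_system_transfer[OF Y(1)]])
  also have "\<dots> = (B.Delta \<i> ** B.Mw \<i>) ** C + B.Theta \<i> ** C" unfolding vp C_def[symmetric] by (simp add: matrix_mul_assoc)
  also have "\<dots> = 0" unfolding B.Delta_Mw[OF B.dd_nonreal[OF i]] by (simp add: mm_simps)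
  finally have V': "V2 T2' H2' Y Y1 = 0" .
  from V2_zeroD[OF B.T2 B.H2(2) V'] show "perp T2' ** u = 0" "T2' ** w = H2' ** u" unfolding Y by auto
qed

end

lemma le_zero_of_decay:
  fixes x c U :: real
  assumes "\<And>u. \<lbrakk>u \<ge> U; u \<ge> 1\<rbrakk> \<Longrightarrow> x \<le> c / sqrt u"
  shows "x \<le> 0"
proof (rule ccontr)
  assume "\<not> x \<le> 0"
  then have x: "x > 0" by simp
  define u where "u = max U (max 1 ((\<bar>c\<bar> / x + 1)\<^sup>2))"
  have u: "u \<ge> U" "u \<ge> 1" "u \<ge> (\<bar>c\<bar> / x + 1)\<^sup>2" unfolding u_def by auto
  have "\<bar>c\<bar> / x + 1 \<le> sqrt u" using u(3) by (rule real_le_rsqrt)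
  then have "\<bar>c\<bar> / x < sqrt u" by simp
  then have "\<bar>c\<bar> < x * sqrt u" using x by (simp add: pos_divide_less_eq mult.commute)
  moreover have "x * sqrt u \<le> c" using assms[OF u(1,2)] u(2) by (simp add: pos_le_divide_eq)
  ultimately show False by simp
qed

section \<open>Poles and residues of the Weyl matrix\<close>

context sl
begin

lemma dd_isolated: obtains r where "r > 0" "\<And>w. w \<in> ball z r - {z} \<Longrightarrow> dd w \<noteq> 0"
proof (cases "dd z = 0")
  case True
  have "dd \<i> \<noteq> 0" by (rule dd_nonreal) simp
  then obtain r where "r > 0" "\<And>w. w \<in> ball z r - {z} \<Longrightarrow> dd w \<noteq> 0"
    using isolated_zeros[OF holomorphic_dd open_UNIV connected_UNIV UNIV_I True UNIV_I] by blast
  then show ?thesis by (rule that)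
next
  case False
  have "continuous_on UNIV dd" by (rule holomorphic_on_imp_continuous_on[OF holomorphic_dd])
  then obtain r where "r > 0" "\<And>w. dist z w < r \<Longrightarrow> dd w \<noteq> 0"
    using continuous_on_avoid[of UNIV dd z 0] False by auto
  then show ?thesis by (intro that[of r]) auto
qed

lemma Mw_holomorphic:
  assumes "\<And>w. w \<in> S \<Longrightarrow> dd w \<noteq> 0"
  shows "(\<lambda>z. Mw z $ k $ j) holomorphic_on S"
proof -
  have "(\<lambda>z. num z k j / dd z) holomorphic_on S"
    by (intro holomorphic_intros holomorphic_on_subset[OF holomorphic_num] holomorphic_on_subset[OF holomorphic_dd]) (use assms in auto)
  then show ?thesis unfolding Mw_def by simp
qed

text \<open>The zeros of \<open>dd\<close> are isolated and off them \<open>weyl_matrix\<close>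
  agrees with the quotient formula; a residue depends on a punctured neighbourhood only.\<close>

lemma weight_matrix_eq: "weight_matrix \<sigma> T1 T2 H2 z $ k $ j = residue (\<lambda>z. Mw z $ k $ j) z"
proof -
  obtain r where r: "r > 0" "\<And>w. w \<in> ball z r - {z} \<Longrightarrow> dd w \<noteq> 0" by (rule dd_isolated[of z]) (rule that, assumption+)
  have "eventually (\<lambda>w. w \<in> ball z r - {z}) (at z)" using r(1) by (intro eventually_at_in_open) auto
  then have "\<forall>\<^sub>F w in at z. weyl_matrix \<sigma> T1 T2 H2 w $ k $ j = Mw w $ k $ j"
    by eventually_elim (use weyl_matrix_eq r(2) in simp)
  then show ?thesis unfolding weight_matrix_def by (simp add: residue_cong)
qed

end

subsection \<open>The shift of the potential\<close>

lemma admissible_shiftD: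
  assumes T: "orth_proj T1" and H: "admissible_shift T1 H"
  shows "dagger H = H" "T1 ** H = 0" "H ** T1 = 0" "H ** perp T1 = H"
proof -
  note proj = orth_projD[OF T]
  have H': "dagger H = H" "H = perp T1 ** H ** perp T1" using H unfolding admissible_shift_def by simp_all
  show "dagger H = H" by (rule H'(1))
  have "T1 ** H = (T1 ** perp T1) ** H ** perp T1" by (subst H'(2)) (simp add: matrix_mul_assoc)
  then show "T1 ** H = 0" unfolding proj by (simp add: mm.zero_left)
  have "H ** T1 = perp T1 ** H ** (perp T1 ** T1)" by (subst H'(2)) (simp add: matrix_mul_assoc)
  then show "H ** T1 = 0" unfolding proj by (simp add: mm.zero_right)
  then show "H ** perp T1 = H" by (simp add: perp_def mm_simps)
qed

text \<open>The transform prescribes \<open>\<sigma>\<close> up to null sets; measurability survives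
  because Lebesgue measure is complete.\<close>

lemma shift_measurable_L2:
  fixes \<sigma> \<sigma>' :: "real \<Rightarrow> complex^'m^'m"
  assumes m: "\<sigma>' \<in> borel_measurable (lebesgue_on {0<..<pi})" and i: "integrable (lebesgue_on {0<..<pi}) (\<lambda>x. (norm (\<sigma>' x))\<^sup>2)"
    and ae: "AE x in lebesgue_on {0<..<pi}. \<sigma> x = \<sigma>' x + H"
  shows "\<sigma> \<in> borel_measurable (lebesgue_on {0<..<pi})" "integrable (lebesgue_on {0<..<pi}) (\<lambda>x. (norm (\<sigma> x))\<^sup>2)"
proof -
  let ?S = "{0<..<pi}"
  have m': "(\<lambda>x. \<sigma>' x + H) \<in> borel_measurable (lebesgue_on ?S)" using m by (intro borel_measurable_add borel_measurable_const)
  then have "(\<lambda>x. if x \<in> ?S then \<sigma>' x + H else 0) \<in> borel_measurable lebesgue" by (subst borel_measurable_if) auto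
  moreover have "AE x in lebesgue. (if x \<in> ?S then \<sigma>' x + H else 0) = (if x \<in> ?S then \<sigma> x else 0)"
  proof -
    have "AE x in lebesgue. x \<in> ?S \<longrightarrow> \<sigma> x = \<sigma>' x + H" using ae by (subst (asm) AE_restrict_space_iff) auto
    then show ?thesis by eventually_elim auto
  qed
  ultimately have "(\<lambda>x. if x \<in> ?S then \<sigma> x else 0) \<in> borel_measurable lebesgue" by (rule borel_measurable_AE)
  then show sm: "\<sigma> \<in> borel_measurable (lebesgue_on ?S)" by (subst (asm) borel_measurable_if) auto
  have fin: "finite_measure (lebesgue_on ?S)" by (rule finite_measure_lebesgue_on) simp
  have ib: "integrable (lebesgue_on ?S) (\<lambda>x. 2 * (norm (\<sigma>' x))\<^sup>2 + 2 * (norm H)\<^sup>2)"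
    using i finite_measure.integrable_const[OF fin] by (intro Bochner_Integration.integrable_add integrable_mult_right) auto
  show "integrable (lebesgue_on ?S) (\<lambda>x. (norm (\<sigma> x))\<^sup>2)"
  proof (rule Bochner_Integration.integrable_bound[OF ib])
    show "(\<lambda>x. (norm (\<sigma> x))\<^sup>2) \<in> borel_measurable (lebesgue_on ?S)" by (intro borel_measurable_power measurable_compose[OF sm borel_measurable_norm])
    show "AE x in lebesgue_on ?S. norm ((norm (\<sigma> x))\<^sup>2) \<le> norm (2 * (norm (\<sigma>' x))\<^sup>2 + 2 * (norm H)\<^sup>2)"
      using ae
    proof eventually_elim
      case (elim x)
      have "(norm (\<sigma> x))\<^sup>2 \<le> (norm (\<sigma>' x) + norm H)\<^sup>2" unfolding elim by (intro power_mono norm_triangle_ineq) auto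
      also have "\<dots> \<le> 2 * (norm (\<sigma>' x))\<^sup>2 + 2 * (norm H)\<^sup>2"
        using sum_squares_bound[of "norm (\<sigma>' x)" "norm H"] unfolding power2_sum by linarith
      finally show ?case by simp
    qed
  qed
qed

lemma shift_problem:
  assumes p: "sl_problem \<sigma>' T1 T2 H2" and H: "admissible_shift T1 H"
    and ae: "AE x in lebesgue_on {0<..<pi}. \<sigma> x = \<sigma>' x + H"
  shows "sl_problem \<sigma> T1 T2 (H2 - T2 ** H ** T2)"
proof -
  interpret B: sl \<sigma>' T1 T2 H2 by (rule sl.intro[OF p])
  note proj = orth_projD[OF B.T2]
  have dH: "dagger H = H" using H unfolding admissible_shift_def by simp
  have "AE x in lebesgue_on {0<..<pi}. \<sigma>' x = dagger (\<sigma>' x)" using p unfolding sl_problem_def by blast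
  with ae have herm: "AE x in lebesgue_on {0<..<pi}. \<sigma> x = dagger (\<sigma> x)"
    by eventually_elim (simp add: dagger_add dH)
  have TT: "X ** T2 ** T2 = X ** T2" for X :: "complex^'a^'a" using proj(2) by (simp flip: matrix_mul_assoc)
  have "T2 ** H2 ** T2 = H2" using B.H2(2) by simp
  then have "T2 ** (H2 - T2 ** H ** T2) ** T2 = H2 - T2 ** H ** T2" by (simp add: mm_simps proj(2) TT)
  moreover have "dagger (H2 - T2 ** H ** T2) = H2 - T2 ** H ** T2"
    by (simp add: dagger_simps B.H2(1) proj(1) dH matrix_mul_assoc)
  ultimately show ?thesis
    using p herm shift_measurable_L2[OF B.sigma_meas B.sigma_L2 ae] unfolding sl_problem_def by simp
qed

text \<open>\<open>Y\<close> is kept and \<open>H\<close> moves from the potential into the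
  quasi-derivative, as \<open>\<sigma>' Y + Y1 = (\<sigma>' + H) Y + (Y1 - H Y)\<close>. In the
  second equation \<open>(\<sigma>' + H) (Y1 - H Y) + (\<sigma>' + H)\<^sup>2 Y\<close> collapses to
  \<open>(\<sigma>' + H) (Y1 + \<sigma>' Y)\<close>.\<close>

lemma shift_system:
  assumes ae: "AE x in lebesgue_on {0<..<pi}. \<sigma> x = \<sigma>' x + H" and sys: "sl_system \<sigma>' z f Y Y1"
  shows "sl_system \<sigma> z f Y (\<lambda>x. Y1 x - H ** Y x)"
proof -
  obtain N where N: "negligible N" "\<forall>x\<in>{0<..<pi} - N. \<sigma> x = \<sigma>' x + H"
    using ae by (subst (asm) AE_lebesgue_on_iff_negligible) auto
  have s: "\<sigma> x = \<sigma>' x + H" if "x \<in> {0<..<pi} - N" for x using N(2) that by blast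
  have a: "ac_deriv 0 pi Y (\<lambda>x. \<sigma>' x ** Y x + Y1 x)" "ac_deriv 0 pi Y1 (\<lambda>x. - (\<sigma>' x ** Y1 x) - (\<sigma>' x ** \<sigma>' x) ** Y x - cscale z (Y x) - f x)"
    using sys unfolding sl_system_def by auto
  have "ac_deriv 0 pi Y (\<lambda>x. \<sigma> x ** Y x + (Y1 x - H ** Y x))"
    by (rule ac_deriv_ae_cong[OF a(1) N(1)]) (simp add: s mm_simps)
  moreover have "ac_deriv 0 pi (\<lambda>x. Y1 x - H ** Y x) (\<lambda>x. - (\<sigma> x ** (Y1 x - H ** Y x)) - (\<sigma> x ** \<sigma> x) ** Y x - cscale z (Y x) - f x)"
    by (rule ac_deriv_ae_cong[OF ac_deriv_diff[OF a(2) ac_deriv_linear[OF mm.bounded_linear_right a(1)]] N(1)])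
       (simp add: s mm_simps)
  ultimately show ?thesis unfolding sl_system_def ..
qed

text \<open>\<open>H\<close> acts within the range of \<open>perp T1\<close>, so it leaves
  \<open>T1 ** Y1 0\<close> alone, while \<open>H ** V1\<close> equals \<open>- (H ** Y 0)\<close>.
  Hence the Weyl matrix changes by the constant \<open>H\<close>.\<close>

lemma shift_V:
  assumes T: "orth_proj T1" and H: "admissible_shift T1 H"
  shows "V1 T1 Y (\<lambda>x. Y1 x - H ** Y x) = V1 T1 Y Y1"
    and "V1_perp T1 Y (\<lambda>x. Y1 x - H ** Y x) = V1_perp T1 Y Y1 + H ** V1 T1 Y Y1"
proof -
  note h = admissible_shiftD[OF T H]
  show "V1 T1 Y (\<lambda>x. Y1 x - H ** Y x) = V1 T1 Y Y1"
    unfolding V1_def by (simp add: mm.diff_right matrix_mul_assoc h mm.zero_left)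
  have "H ** (T1 ** Y1 0 - perp T1 ** Y 0) = - (H ** Y 0)" by (simp add: mm.diff_right matrix_mul_assoc h mm.zero_left)
  moreover have "perp T1 ** (H ** Y 0) = H ** Y 0" unfolding perp_def by (simp add: mm_simps h)
  ultimately show "V1_perp T1 Y (\<lambda>x. Y1 x - H ** Y x) = V1_perp T1 Y Y1 + H ** V1 T1 Y Y1"
    unfolding V1_def V1_perp_def by (simp add: mm.diff_right)
qed

lemma shift_V2:
  assumes T: "orth_proj T2" and H2: "H2 = T2 ** H2 ** T2" and H2': "H2 - T2 ** H ** T2 = T2 ** (H2 - T2 ** H ** T2) ** T2"
    and v: "V2 T2 H2 Y Y1 = 0"
  shows "V2 T2 (H2 - T2 ** H ** T2) Y (\<lambda>x. Y1 x - H ** Y x) = 0"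
proof (rule V2_zeroI[OF T H2'])
  note y = V2_zeroD[OF T H2 v]
  show "perp T2 ** Y pi = 0" by (rule y(1))
  have "T2 ** H ** T2 ** Y pi = T2 ** H ** (T2 ** Y pi)" by (simp add: matrix_mul_assoc)
  then show "T2 ** (Y1 pi - H ** Y pi) = (H2 - T2 ** H ** T2) ** Y pi"
    unfolding mm.diff_left mm.diff_right y by (simp add: matrix_mul_assoc)
qed

lemma shift_eigenspace_subset:
  assumes p: "sl_problem \<sigma>' T1 T2 H2" and H: "admissible_shift T1 H"
    and ae: "AE x in lebesgue_on {0<..<pi}. \<sigma> x = \<sigma>' x + H"
  shows "eigenspace \<sigma>' T1 T2 H2 z \<subseteq> eigenspace \<sigma> T1 T2 (H2 - T2 ** H ** T2) z"
proof
  interpret B: sl \<sigma>' T1 T2 H2 by (rule sl.intro[OF p])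
  interpret A: sl \<sigma> T1 T2 "H2 - T2 ** H ** T2" by (rule sl.intro[OF shift_problem[OF p H ae]])
  fix Y assume "Y \<in> eigenspace \<sigma>' T1 T2 H2 z"
  then obtain Y1 where out: "\<forall>x. x \<notin> {0..pi} \<longrightarrow> Y x = 0" and Y: "sl_system \<sigma>' z (\<lambda>x. 0) Y Y1" "V1 T1 Y Y1 = 0" "V2 T2 H2 Y Y1 = 0"
    unfolding eigenspace_def sl_solution_iff_system by blast
  have "sl_system \<sigma> z (\<lambda>x. 0) Y (\<lambda>x. Y1 x - H ** Y x)" by (rule shift_system[OF ae Y(1)])
  moreover have "V1 T1 Y (\<lambda>x. Y1 x - H ** Y x) = 0" unfolding shift_V(1)[OF B.T1 H] by (rule Y(2))
  moreover have "V2 T2 (H2 - T2 ** H ** T2) Y (\<lambda>x. Y1 x - H ** Y x) = 0" by (rule shift_V2[OF B.T2 B.H2(2) A.H2(2) Y(3)])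
  ultimately show "Y \<in> eigenspace \<sigma> T1 T2 (H2 - T2 ** H ** T2) z"
    unfolding eigenspace_def sl_solution_iff_system using out by blast
qed

text \<open>The second inclusion is the first one for the inverse transform, with
  \<open>- H\<close>.\<close>

lemma shift_eigenspace:
  assumes p: "sl_problem \<sigma>' T1 T2 H2" and H: "admissible_shift T1 H"
    and ae: "AE x in lebesgue_on {0<..<pi}. \<sigma> x = \<sigma>' x + H"
  shows "eigenspace \<sigma> T1 T2 (H2 - T2 ** H ** T2) z = eigenspace \<sigma>' T1 T2 H2 z"
proof (rule subset_antisym)
  have H': "admissible_shift T1 (- H)" using H unfolding admissible_shift_def by (simp add: dagger_minus mm_simps)
  have ae': "AE x in lebesgue_on {0<..<pi}. \<sigma>' x = \<sigma> x + (- H)" using ae by eventually_elim simp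
  show "eigenspace \<sigma> T1 T2 (H2 - T2 ** H ** T2) z \<subseteq> eigenspace \<sigma>' T1 T2 H2 z"
    using shift_eigenspace_subset[OF shift_problem[OF p H ae] H' ae', of z] by (simp add: mm_simps)
qed (rule shift_eigenspace_subset[OF p H ae])

lemma shift_Mw:
  assumes p: "sl_problem \<sigma>' T1 T2 H2" and H: "admissible_shift T1 H"
    and ae: "AE x in lebesgue_on {0<..<pi}. \<sigma> x = \<sigma>' x + H"
    and d: "sl.dd \<sigma> T1 T2 (H2 - T2 ** H ** T2) z \<noteq> 0" "sl.dd \<sigma>' T1 T2 H2 z \<noteq> 0"
  shows "sl.Mw \<sigma> T1 T2 (H2 - T2 ** H ** T2) z = sl.Mw \<sigma>' T1 T2 H2 z + H"
proof -
  interpret B: sl \<sigma>' T1 T2 H2 by (rule sl.intro[OF p])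
  interpret A: sl \<sigma> T1 T2 "H2 - T2 ** H ** T2" by (rule sl.intro[OF shift_problem[OF p H ae]])
  have "V1_perp T1 (B.Ph z) (\<lambda>x. B.Ph1 z x - H ** B.Ph z x) = A.Mw z ** mat 1"
  proof (rule A.weyl_unique[OF d(1) shift_system[OF ae B.Ph_system]])
    show "V1 T1 (B.Ph z) (\<lambda>x. B.Ph1 z x - H ** B.Ph z x) = mat 1" unfolding shift_V(1)[OF B.T1 H] B.V_Ph ..
    show "V2 T2 (H2 - T2 ** H ** T2) (B.Ph z) (\<lambda>x. B.Ph1 z x - H ** B.Ph z x) = 0"
      by (rule shift_V2[OF B.T2 B.H2(2) A.H2(2) B.V2_Ph[OF d(2)]])
  qed
  then show ?thesis unfolding shift_V(2)[OF B.T1 H] B.V_Ph by (simp add: mm_simps)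
qed

text \<open>A constant has residue 0, so the shift of the Weyl matrix by \<open>H\<close> leaves its
  residues unchanged.\<close>

lemma shift_weight_matrix:
  assumes p: "sl_problem \<sigma>' T1 T2 H2" and H: "admissible_shift T1 H"
    and ae: "AE x in lebesgue_on {0<..<pi}. \<sigma> x = \<sigma>' x + H"
  shows "weight_matrix \<sigma> T1 T2 (H2 - T2 ** H ** T2) z = weight_matrix \<sigma>' T1 T2 H2 z"
proof -
  interpret B: sl \<sigma>' T1 T2 H2 by (rule sl.intro[OF p])
  interpret A: sl \<sigma> T1 T2 "H2 - T2 ** H ** T2" by (rule sl.intro[OF shift_problem[OF p H ae]])
  obtain r where r: "r > 0" "\<And>w. w \<in> ball z r - {z} \<Longrightarrow> A.dd w \<noteq> 0" by (rule A.dd_isolated[of z]) (rule that, assumption+)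
  obtain s where s: "s > 0" "\<And>w. w \<in> ball z s - {z} \<Longrightarrow> B.dd w \<noteq> 0" by (rule B.dd_isolated[of z]) (rule that, assumption+)
  have "residue (\<lambda>z. A.Mw z $ k $ j) z = residue (\<lambda>z. B.Mw z $ k $ j) z" for k j
  proof -
    have "eventually (\<lambda>w. w \<in> ball z (min r s) - {z}) (at z)" using r(1) s(1) by (intro eventually_at_in_open) auto
    then have "\<forall>\<^sub>F w in at z. A.Mw w $ k $ j = B.Mw w $ k $ j + H $ k $ j"
    proof eventually_elim
      fix w assume "w \<in> ball z (min r s) - {z}"
      then have "A.dd w \<noteq> 0" "B.dd w \<noteq> 0" using r(2) s(2) by auto
      from shift_Mw[OF p H ae this] show "A.Mw w $ k $ j = B.Mw w $ k $ j + H $ k $ j" by simp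
    qed
    then have "residue (\<lambda>z. A.Mw z $ k $ j) z = residue (\<lambda>z. B.Mw z $ k $ j + H $ k $ j) z" by (rule residue_cong) simp
    also have "\<dots> = residue (\<lambda>z. B.Mw z $ k $ j) z + residue (\<lambda>z. H $ k $ j) z"
      by (rule residue_add[of "ball z s"]) (use s in \<open>auto intro!: B.Mw_holomorphic\<close>)
    finally show ?thesis by (simp add: residue_const)
  qed
  then show ?thesis by (simp add: vec_eq_iff A.weight_matrix_eq B.weight_matrix_eq)
qed

lemma shift_spectral_data:
  assumes p: "sl_problem \<sigma>' T1 T2 H2" and H: "admissible_shift T1 H"
    and ae: "AE x in lebesgue_on {0<..<pi}. \<sigma> x = \<sigma>' x + H"
  shows "spectral_data \<sigma> T1 T2 (H2 - T2 ** H ** T2) lam \<alpha> \<longleftrightarrow> spectral_data \<sigma>' T1 T2 H2 lam \<alpha>"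
  unfolding spectral_data_def eigenvalue_numbering_def eigen_multiplicity_def
    shift_eigenspace[OF p H ae] shift_weight_matrix[OF p H ae] ..

subsection \<open>Problems with equal spectral data\<close>

text \<open>Equality is demanded at the zeros of either characteristic function, so that the
  difference of the Weyl matrices has residue 0 even at points not yet known to be eigenvalues of
  both problems.\<close>

locale sl_two = A: sl \<sigma> T1 T2 H2 + B: sl \<sigma>' T1' T2' H2'
  for \<sigma> \<sigma>' :: "real \<Rightarrow> complex^'m^'m" and T1 T2 H2 T1' T2' H2' +
  assumes weights: "A.dd z = 0 \<or> B.dd z = 0 \<Longrightarrow> weight_matrix \<sigma> T1 T2 H2 z = weight_matrix \<sigma>' T1' T2' H2' z"
begin

lemma Mw_difference_linear_entry:
  "\<exists>a b. \<forall>z. Im z \<noteq> 0 \<longrightarrow> A.Mw z $ k $ j - B.Mw z $ k $ j = a + b * z"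
proof -
  define D where "D = (\<lambda>z. A.dd z * B.dd z)"
  \<comment> \<open>The difference over a common denominator: a quotient of entire functions, hence
    without essential singularities.\<close>
  define f where "f = (\<lambda>z. (A.num z k j * B.dd z - B.num z k j * A.dd z) / (A.dd z * B.dd z))"
  have Dh: "D holomorphic_on UNIV" unfolding D_def by (intro holomorphic_intros A.holomorphic_dd B.holomorphic_dd)
  have numh: "(\<lambda>z. A.num z k j * B.dd z - B.num z k j * A.dd z) holomorphic_on UNIV"
    by (intro holomorphic_intros A.holomorphic_dd B.holomorphic_dd A.holomorphic_num B.holomorphic_num)
  have fM: "f z = A.Mw z $ k $ j - B.Mw z $ k $ j" if "A.dd z \<noteq> 0" "B.dd z \<noteq> 0" for z
    unfolding f_def A.Mw_def B.Mw_def using that by (simp add: field_simps)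
  obtain CA where CA: "CA \<ge> 0" "\<forall>z. Im z \<noteq> 0 \<longrightarrow> norm (A.Mw z) \<le> CA * (1 + norm z)\<^sup>2 / \<bar>Im z\<bar>" using A.Mw_bound by (elim exE conjE)
  obtain CB where CB: "CB \<ge> 0" "\<forall>z. Im z \<noteq> 0 \<longrightarrow> norm (B.Mw z) \<le> CB * (1 + norm z)\<^sup>2 / \<bar>Im z\<bar>" using B.Mw_bound by (elim exE conjE)
  have "\<exists>a b. \<forall>z. D z \<noteq> 0 \<longrightarrow> f z = a + b * z"
  proof (rule linear_of_imaginary_bound[OF Dh, of f "CA + CB"])
    show "D z \<noteq> 0" if "Im z \<noteq> 0" for z unfolding D_def using A.dd_nonreal[OF that] B.dd_nonreal[OF that] by simp
    show "f holomorphic_on {z. D z \<noteq> 0}"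
      unfolding f_def D_def
      by (intro holomorphic_on_divide holomorphic_on_subset[OF numh] holomorphic_on_subset[OF Dh[unfolded D_def]]) auto
    have an: "g analytic_on {z}" if "g holomorphic_on UNIV" for g z
      using that analytic_on_open[OF open_UNIV, of g] analytic_on_subset[of g UNIV "{z}"] by simp
    show "not_essential f z" for z
      unfolding f_def by (intro not_essential_divide not_essential_analytic isolated_singularity_at_analytic an numh Dh[unfolded D_def])
    show "CA + CB \<ge> 0" using CA CB by simp
    show "norm (f z) \<le> (CA + CB) * (1 + norm z)\<^sup>2 / \<bar>Im z\<bar>" if z: "Im z \<noteq> 0" for z
    proof -
      have "norm (f z) \<le> norm (A.Mw z $ k $ j) + norm (B.Mw z $ k $ j)"
        unfolding fM[OF A.dd_nonreal[OF z] B.dd_nonreal[OF z]] by (rule norm_triangle_ineq4)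
      also have "\<dots> \<le> norm (A.Mw z) + norm (B.Mw z)" by (intro add_mono norm_entry_le)
      also have "\<dots> \<le> CA * (1 + norm z)\<^sup>2 / \<bar>Im z\<bar> + CB * (1 + norm z)\<^sup>2 / \<bar>Im z\<bar>" using CA(2) CB(2) z by (intro add_mono) auto
      also have "\<dots> = (CA + CB) * (1 + norm z)\<^sup>2 / \<bar>Im z\<bar>" by (simp add: add_divide_distrib distrib_right)
      finally show ?thesis .
    qed
    show "residue f z = 0" if z: "D z = 0" for z
    proof -
      obtain r where r: "r > 0" "\<And>w. w \<in> ball z r - {z} \<Longrightarrow> A.dd w \<noteq> 0" by (rule A.dd_isolated[of z]) (rule that, assumption+)
      obtain s where s: "s > 0" "\<And>w. w \<in> ball z s - {z} \<Longrightarrow> B.dd w \<noteq> 0" by (rule B.dd_isolated[of z]) (rule that, assumption+)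
      have "eventually (\<lambda>w. w \<in> ball z (min r s) - {z}) (at z)" using r(1) s(1) by (intro eventually_at_in_open) auto
      then have "\<forall>\<^sub>F w in at z. f w = A.Mw w $ k $ j - B.Mw w $ k $ j"
      proof eventually_elim
        fix w assume "w \<in> ball z (min r s) - {z}"
        then show "f w = A.Mw w $ k $ j - B.Mw w $ k $ j" by (intro fM r(2) s(2)) auto
      qed
      then have "residue f z = residue (\<lambda>w. A.Mw w $ k $ j - B.Mw w $ k $ j) z" by (rule residue_cong) simp
      also have "\<dots> = residue (\<lambda>w. A.Mw w $ k $ j) z - residue (\<lambda>w. B.Mw w $ k $ j) z"
      proof (rule residue_diff[of "ball z (min r s)"])
        show "(\<lambda>w. A.Mw w $ k $ j) holomorphic_on ball z (min r s) - {z}" by (rule A.Mw_holomorphic) (use r(2) in auto)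
        show "(\<lambda>w. B.Mw w $ k $ j) holomorphic_on ball z (min r s) - {z}" by (rule B.Mw_holomorphic) (use s(2) in auto)
      qed (use r(1) s(1) in auto)
      also have "\<dots> = 0" using weights[of z] z unfolding A.weight_matrix_eq[symmetric] B.weight_matrix_eq[symmetric] D_def by simp
      finally show ?thesis .
    qed
  qed
  then obtain a b where "\<forall>z. D z \<noteq> 0 \<longrightarrow> f z = a + b * z" by (elim exE)
  then have "A.Mw z $ k $ j - B.Mw z $ k $ j = a + b * z" if "Im z \<noteq> 0" for z
    using fM[OF A.dd_nonreal[OF that] B.dd_nonreal[OF that]] A.dd_nonreal[OF that] B.dd_nonreal[OF that] unfolding D_def by simp
  then show ?thesis by blast
qed

lemma Mw_difference_linear:
  obtains E F where "\<And>z. Im z \<noteq> 0 \<Longrightarrow> A.Mw z - B.Mw z = E + cscale z F"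
proof -
  have "\<forall>k j. \<exists>p. \<forall>z. Im z \<noteq> 0 \<longrightarrow> A.Mw z $ k $ j - B.Mw z $ k $ j = fst p + snd p * z"
    using Mw_difference_linear_entry by simp
  then obtain p where p: "\<And>k j z. Im z \<noteq> 0 \<Longrightarrow> A.Mw z $ k $ j - B.Mw z $ k $ j = fst (p k j) + snd (p k j) * z"
    by metis
  show ?thesis
    by (rule that[of "\<chi> k j. fst (p k j)" "\<chi> k j. snd (p k j)"]) (simp add: vec_eq_iff p mult.commute)
qed

text \<open>The affine difference is compared with the asymptotics on one ray, power by power: order
  \<open>\<rho>\<^sup>2\<close> forces \<open>F = 0\<close>, order \<open>\<rho>\<close> forces
  \<open>perp T1 = perp T1'\<close>, and the decay of \<open>Mw ** T1\<close> forces
  \<open>E ** T1 = 0\<close>. The symmetry of the Weyl matrices makes \<open>E\<close>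
  Hermitian.\<close>

theorem Mw_difference:
  "T1 = T1' \<and> (\<exists>H. admissible_shift T1 H \<and> (\<forall>z. Im z \<noteq> 0 \<longrightarrow> A.Mw z = B.Mw z + H))"
proof -
  obtain E F where EF: "\<And>z. Im z \<noteq> 0 \<Longrightarrow> A.Mw z - B.Mw z = E + cscale z F" by (rule Mw_difference_linear) (rule that, assumption+)
  obtain UA LA where UA: "UA \<ge> 1" "LA > 0" "A.weyl_bound UA LA"
    using A.weyl_ray by (elim exE conjE)
  obtain UB LB where UB: "UB \<ge> 1" "LB > 0" "B.weyl_bound UB LB"
    using B.weyl_ray by (elim exE conjE)
  define U where "U = max UA UB"
  define L where "L = LA + LB"
  \<comment> \<open>On this ray \<open>\<rho>\<^sup>2\<close> is purely imaginary, so both Weyl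
    matrices exist there.\<close>
  define \<rho> where "\<rho> = (\<lambda>u::real. Complex (u\<^sup>2) (u\<^sup>2))"
  have ray: "Im ((\<rho> u)\<^sup>2) \<noteq> 0" "sqrt u \<le> norm (\<rho> u)" "norm (\<rho> u) \<ge> 1" "sqrt u \<ge> 1"
    "norm (A.Mw ((\<rho> u)\<^sup>2) ** T1) + norm (B.Mw ((\<rho> u)\<^sup>2) ** T1') \<le> L / sqrt u"
    "norm (A.Mw ((\<rho> u)\<^sup>2) + cscale (\<i> * \<rho> u) (perp T1)) + norm (B.Mw ((\<rho> u)\<^sup>2) + cscale (\<i> * \<rho> u) (perp T1')) \<le> L * norm (\<rho> u) / sqrt u"
    if u: "u \<ge> U" "u \<ge> 1" for u
  proof -
    have im: "Im (\<rho> u) = u\<^sup>2" unfolding \<rho>_def by simp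
    have uu: "u \<le> u\<^sup>2" using self_le_power[OF u(2), of 2] by simp
    have r: "u\<^sup>2 \<le> norm (\<rho> u)" using abs_Im_le_cmod[of "\<rho> u"] im by simp
    show nz: "Im ((\<rho> u)\<^sup>2) \<noteq> 0" unfolding \<rho>_def using u by (simp add: power2_eq_square)
    show s1: "sqrt u \<ge> 1" using u by simp
    have "sqrt u \<le> u" using self_le_power[OF s1, of 2] u by simp
    then show "sqrt u \<le> norm (\<rho> u)" "norm (\<rho> u) \<ge> 1" using uu r u by linarith+
    have uA: "u \<ge> UA" and uB: "u \<ge> UB" using u unfolding U_def by auto
    note a = UA(3)[unfolded A.weyl_bound_def, rule_format, OF uA im A.dd_nonreal[OF nz]] and b = UB(3)[unfolded B.weyl_bound_def, rule_format, OF uB im B.dd_nonreal[OF nz]]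
    have "L / sqrt u = LA / sqrt u + LB / sqrt u" unfolding L_def by (rule add_divide_distrib)
    then show "norm (A.Mw ((\<rho> u)\<^sup>2) ** T1) + norm (B.Mw ((\<rho> u)\<^sup>2) ** T1') \<le> L / sqrt u" using a b by linarith
    have "L * norm (\<rho> u) / sqrt u = LA * norm (\<rho> u) / sqrt u + LB * norm (\<rho> u) / sqrt u"
      unfolding L_def by (simp add: distrib_right add_divide_distrib)
    then show "norm (A.Mw ((\<rho> u)\<^sup>2) + cscale (\<i> * \<rho> u) (perp T1)) + norm (B.Mw ((\<rho> u)\<^sup>2) + cscale (\<i> * \<rho> u) (perp T1')) \<le> L * norm (\<rho> u) / sqrt u"
      using a b by linarith
  qed
  have L0: "L > 0" unfolding L_def using UA(2) UB(2) by simp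
  define c where "c = norm (perp T1 - perp T1')"
  have split: "cscale ((\<rho> u)\<^sup>2) F + E + cscale (\<i> * \<rho> u) (perp T1 - perp T1') = (A.Mw ((\<rho> u)\<^sup>2) + cscale (\<i> * \<rho> u) (perp T1)) - (B.Mw ((\<rho> u)\<^sup>2) + cscale (\<i> * \<rho> u) (perp T1'))"
    if u: "u \<ge> U" "u \<ge> 1" for u
    using EF[OF ray(1)[OF u]] by (simp add: cs_simps algebra_simps)
  have splitn: "norm (cscale ((\<rho> u)\<^sup>2) F + E + cscale (\<i> * \<rho> u) (perp T1 - perp T1')) \<le> L * norm (\<rho> u) / sqrt u"
    if u: "u \<ge> U" "u \<ge> 1" for u
    unfolding split[OF u] by (rule order_trans[OF norm_triangle_ineq4 ray(6)[OF u]])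
  have "norm F \<le> 0"
  proof (rule le_zero_of_decay[of U _ "L + norm E + c"])
    fix u assume u: "u \<ge> U" "u \<ge> 1"
    note r = ray[OF u]
    define R where "R = norm (\<rho> u)"
    have R: "R \<ge> 1" "R \<ge> sqrt u" "sqrt u \<ge> 1" using r(2-4) unfolding R_def by linarith+
    have "R\<^sup>2 * norm F = norm (cscale ((\<rho> u)\<^sup>2) F)" unfolding norm_cscale R_def by (simp add: norm_power)
    also have "\<dots> = norm ((cscale ((\<rho> u)\<^sup>2) F + E + cscale (\<i> * \<rho> u) (perp T1 - perp T1')) - E - cscale (\<i> * \<rho> u) (perp T1 - perp T1'))" by simp
    also have "\<dots> \<le> norm (cscale ((\<rho> u)\<^sup>2) F + E + cscale (\<i> * \<rho> u) (perp T1 - perp T1')) + norm E + norm (cscale (\<i> * \<rho> u) (perp T1 - perp T1'))"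
      by (meson norm_triangle_ineq4 norm_triangle_le_diff order_trans add_mono order_refl)
    also have "norm (cscale (\<i> * \<rho> u) (perp T1 - perp T1')) = R * c" unfolding norm_cscale R_def c_def by (simp add: norm_mult)
    also have "norm (cscale ((\<rho> u)\<^sup>2) F + E + cscale (\<i> * \<rho> u) (perp T1 - perp T1')) \<le> L * R"
    proof -
      have "0 \<le> L * R" using L0 R(1) by (intro mult_nonneg_nonneg) linarith+
      then have "L * R / sqrt u \<le> L * R / 1" using R(3) by (intro divide_left_mono) auto
      then show ?thesis using splitn[OF u] unfolding R_def by simp
    qed
    also have "norm E \<le> norm E * R" using mult_left_mono[OF R(1), of "norm E"] by simp
    finally have "R\<^sup>2 * norm F \<le> (L + norm E + c) * R" by (simp add: algebra_simps)
    then have "norm F * R \<le> L + norm E + c" using R(1) by (simp add: power2_eq_square mult.commute[of "norm F"])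
    moreover have "norm F * sqrt u \<le> norm F * R" using R(2) by (intro mult_left_mono) auto
    ultimately show "norm F \<le> (L + norm E + c) / sqrt u" using R(3) by (subst pos_le_divide_eq) linarith+
  qed
  then have F0: "F = 0" by simp
  have "c \<le> 0"
  proof (rule le_zero_of_decay[of U _ "L + norm E"])
    fix u assume u: "u \<ge> U" "u \<ge> 1"
    note r = ray[OF u]
    define R where "R = norm (\<rho> u)"
    have R: "R \<ge> 1" "R \<ge> sqrt u" "sqrt u \<ge> 1" "R > 0" using r(2-4) unfolding R_def by linarith+
    have "R * c = norm (cscale (\<i> * \<rho> u) (perp T1 - perp T1'))" unfolding norm_cscale R_def c_def by (simp add: norm_mult)
    also have "\<dots> = norm ((cscale ((\<rho> u)\<^sup>2) F + E + cscale (\<i> * \<rho> u) (perp T1 - perp T1')) - E)" unfolding F0 by (simp add: cs_simps)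
    also have "\<dots> \<le> L * R / sqrt u + norm E"
      using order_trans[OF norm_triangle_ineq4 add_right_mono[OF splitn[OF u]]] unfolding R_def .
    also have "norm E \<le> norm E * R / sqrt u"
    proof -
      have "1 \<le> R / sqrt u" using R(2,3) by (subst pos_le_divide_eq) linarith+
      then have "norm E * 1 \<le> norm E * (R / sqrt u)" by (intro mult_left_mono) auto
      then show ?thesis by simp
    qed
    also have "L * R / sqrt u + norm E * R / sqrt u = R * ((L + norm E) / sqrt u)" by (simp add: algebra_simps add_divide_distrib)
    finally show "c \<le> (L + norm E) / sqrt u" using R(4) by (simp only: mult_le_cancel_left_pos)
  qed
  then have "perp T1 = perp T1'" unfolding c_def by simp
  then have T: "T1 = T1'" by (metis perp_perp)
  have "norm (E ** T1) \<le> 0"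
  proof (rule le_zero_of_decay[of U _ L])
    fix u assume u: "u \<ge> U" "u \<ge> 1"
    have "E ** T1 = A.Mw ((\<rho> u)\<^sup>2) ** T1 - B.Mw ((\<rho> u)\<^sup>2) ** T1'"
      using EF[OF ray(1)[OF u]] unfolding F0 T[symmetric] mm.diff_left[symmetric] by (simp add: cs_simps)
    then show "norm (E ** T1) \<le> L / sqrt u" using order_trans[OF norm_triangle_ineq4 ray(5)[OF u]] by simp
  qed
  then have ET: "E ** T1 = 0" by simp
  have i: "Im \<i> \<noteq> 0" "Im (cnj \<i>) \<noteq> 0" by simp_all
  have "dagger E = dagger (A.Mw (cnj \<i>) - B.Mw (cnj \<i>))" using EF[OF i(2)] unfolding F0 by (simp add: cs_simps)
  also have "\<dots> = A.Mw \<i> - B.Mw \<i>" unfolding dagger_diff A.Mw_dagger[OF i(1)] B.Mw_dagger[OF i(1)] ..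
  also have "\<dots> = E" using EF[OF i(1)] unfolding F0 by (simp add: cs_simps)
  finally have dE: "dagger E = E" .
  have "T1 ** E = dagger (E ** T1)" unfolding dagger_mult dE orth_projD(1)[OF A.T1] ..
  then have TE: "T1 ** E = 0" unfolding ET by simp
  have "E = perp T1 ** E ** perp T1" unfolding perp_def by (simp add: mm_simps TE ET)
  then have "admissible_shift T1 E" unfolding admissible_shift_def using dE by simp
  moreover have "A.Mw z = B.Mw z + E" if "Im z \<noteq> 0" for z
    using EF[OF that] unfolding F0 by (simp add: cs_simps algebra_simps)
  ultimately show ?thesis using T by blast
qed

end

text \<open>A zero of \<open>dd\<close> has positive multiplicity and the numbering lists it that
  often, so some index carries it.\<close>

lemma spectral_data_weight_cover:
  assumes p: "sl_problem \<sigma> T1 T2 H2" and s: "spectral_data \<sigma> T1 T2 H2 lam \<alpha>" and d: "sl.dd \<sigma> T1 T2 H2 z = 0"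
  obtains n k where "(n, k) \<in> index_set T1 T2" "complex_of_real (lam n k) = z" "\<alpha> n k = weight_matrix \<sigma> T1 T2 H2 z"
proof -
  interpret A: sl \<sigma> T1 T2 H2 by (rule sl.intro[OF p])
  have "card {(n, k) \<in> index_set T1 T2. complex_of_real (lam n k) = z} = eigen_multiplicity \<sigma> T1 T2 H2 z"
    using s unfolding spectral_data_def eigenvalue_numbering_def by blast
  then have "card {(n, k) \<in> index_set T1 T2. complex_of_real (lam n k) = z} \<noteq> 0" using A.eigen_multiplicity_nonzero[OF d] by simp
  then have "{(n, k) \<in> index_set T1 T2. complex_of_real (lam n k) = z} \<noteq> {}" by (metis card.empty)
  then obtain n k where nk: "(n, k) \<in> index_set T1 T2" "complex_of_real (lam n k) = z" by auto
  have "\<alpha> n k = weight_matrix \<sigma> T1 T2 H2 (complex_of_real (lam n k))" using s nk(1) unfolding spectral_data_def by blast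
  then show ?thesis using nk by (intro that[of n k]) simp_all
qed

lemma sl_two_of_spectral_data:
  assumes p: "sl_problem \<sigma> T1 T2 H2" and p': "sl_problem \<sigma>' T1' T2' H2'"
    and s: "spectral_data \<sigma> T1 T2 H2 lam \<alpha>" and s': "spectral_data \<sigma>' T1' T2' H2' lam' \<alpha>'"
    and J: "index_set T1 T2 = index_set T1' T2'"
    and eq: "\<And>n k. (n, k) \<in> index_set T1 T2 \<Longrightarrow> lam n k = lam' n k \<and> \<alpha> n k = \<alpha>' n k"
  shows "sl_two \<sigma> \<sigma>' T1 T2 H2 T1' T2' H2'"
proof (intro sl_two.intro sl.intro p p' sl_two_axioms.intro)
  fix z assume "sl.dd \<sigma> T1 T2 H2 z = 0 \<or> sl.dd \<sigma>' T1' T2' H2' z = 0"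
  then show "weight_matrix \<sigma> T1 T2 H2 z = weight_matrix \<sigma>' T1' T2' H2' z"
  proof
    assume "sl.dd \<sigma> T1 T2 H2 z = 0"
    then obtain n k where nk: "(n, k) \<in> index_set T1 T2" "complex_of_real (lam n k) = z" "\<alpha> n k = weight_matrix \<sigma> T1 T2 H2 z"
      by (rule spectral_data_weight_cover[OF p s]) (rule that, assumption+)
    have "\<alpha>' n k = weight_matrix \<sigma>' T1' T2' H2' (complex_of_real (lam' n k))"
      using s' nk(1) unfolding J spectral_data_def by blast
    then show ?thesis using nk eq[OF nk(1)] by simp
  next
    assume "sl.dd \<sigma>' T1' T2' H2' z = 0"
    then obtain n k where nk: "(n, k) \<in> index_set T1' T2'" "complex_of_real (lam' n k) = z" "\<alpha>' n k = weight_matrix \<sigma>' T1' T2' H2' z"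
      by (rule spectral_data_weight_cover[OF p' s']) (rule that, assumption+)
    have "\<alpha> n k = weight_matrix \<sigma> T1 T2 H2 (complex_of_real (lam n k))"
      using s nk(1) unfolding J[symmetric] spectral_data_def by blast
    then show ?thesis using nk eq[of n k] unfolding J by simp
  qed
qed

text \<open>The pair \<open>(T2, H2)\<close> itself satisfies the first condition at
  \<open>pi\<close>, so \<open>boundary_transfer\<close> gives \<open>T2' ** T2 = T2\<close>.
  Exchanging the problems gives \<open>T2 ** T2' = T2'\<close>, and daggers identify the two
  projections.\<close>

lemma (in sl_pair) boundary_eq: "T2 = T2'" "H2 = H2'"
proof -
  note a = orth_projD[OF A.T2] and b = orth_projD[OF B.T2]
  interpret R: sl_pair \<sigma>' \<sigma> T1 T2' H2' T2 H2
    by (intro sl_pair.intro A.sl_axioms B.sl_axioms sl_pair_axioms.intro) (simp add: Mw_eq)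
  have h: "T2 ** H2 = H2" "H2 ** T2 = H2"
    using A.H2(2) a(2) by (metis matrix_mul_assoc)+
  have h': "T2' ** H2' = H2'" "H2' ** T2' = H2'"
    using B.H2(2) b(2) by (metis matrix_mul_assoc)+
  have 1: "perp T2' ** T2 = 0" "T2' ** H2 = H2' ** T2"
    by (rule boundary_transfer[of T2 H2], simp_all add: a h)+
  have 2: "perp T2 ** T2' = 0" by (rule R.boundary_transfer(1)[of T2' H2']) (simp_all add: b h')
  have e1: "T2' ** T2 = T2" using 1(1) by (simp add: perp_def mm_simps)
  have "T2 ** T2' = T2'" using 2 by (simp add: perp_def mm_simps)
  then have "dagger (T2 ** T2') = dagger T2'" by simp
  then have "T2' ** T2 = T2'" unfolding dagger_mult a b .
  then show T: "T2 = T2'" using e1 by simp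
  show "H2 = H2'" using 1(2) h h' unfolding T by simp
qed

theorem theorem6p2:
  fixes \<sigma> \<sigma>' :: "real \<Rightarrow> complex^'m^'m"
    and T1 T2 H2 T1' T2' H2' :: "complex^'m^'m"
    and lam lam' :: "nat \<Rightarrow> nat \<Rightarrow> real"
    and \<alpha> \<alpha>' :: "nat \<Rightarrow> nat \<Rightarrow> complex^'m^'m"
  assumes "sl_problem \<sigma> T1 T2 H2" and "sl_problem \<sigma>' T1' T2' H2'"
    and "spectral_data \<sigma> T1 T2 H2 lam \<alpha>" and "spectral_data \<sigma>' T1' T2' H2' lam' \<alpha>'"
  shows "(index_set T1 T2 = index_set T1' T2' \<and>
          (\<forall>(n, k) \<in> index_set T1 T2. lam n k = lam' n k \<and> \<alpha> n k = \<alpha>' n k)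
          \<longrightarrow> (\<exists>H. admissible_shift T1 H \<and> shift_transform H \<sigma> T1 T2 H2 \<sigma>' T1' T2' H2'))
       \<and> (\<forall>H \<sigma>0 T10 T20 H20.
            admissible_shift T1' H \<and> shift_transform H \<sigma>0 T10 T20 H20 \<sigma>' T1' T2' H2'
            \<longrightarrow> sl_problem \<sigma>0 T10 T20 H20 \<and> spectral_data \<sigma>0 T10 T20 H20 lam' \<alpha>')"
proof (intro conjI[of "_ \<longrightarrow> _"] impI allI)
  assume "index_set T1 T2 = index_set T1' T2' \<and> (\<forall>(n, k) \<in> index_set T1 T2. lam n k = lam' n k \<and> \<alpha> n k = \<alpha>' n k)"
  then have J: "index_set T1 T2 = index_set T1' T2'"
    and eq: "\<And>n k. (n, k) \<in> index_set T1 T2 \<Longrightarrow> lam n k = lam' n k \<and> \<alpha> n k = \<alpha>' n k" by auto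
  interpret sl_two \<sigma> \<sigma>' T1 T2 H2 T1' T2' H2'
    by (rule sl_two_of_spectral_data[OF assms J eq])
  obtain H where T: "T1 = T1'" and H: "admissible_shift T1 H" and M: "\<And>z. Im z \<noteq> 0 \<Longrightarrow> A.Mw z = B.Mw z + H"
    using Mw_difference by blast
  \<comment> \<open>\<open>\<tau>\<close> and \<open>G\<close> describe the second problem after the
    transform by \<open>H\<close>, whose Weyl matrix is that of the first problem.\<close>
  define \<tau> where "\<tau> = (\<lambda>x. \<sigma>' x + H)"
  define G where "G = H2' - T2' ** H ** T2'"
  have ae: "AE x in lebesgue_on {0<..<pi}. \<tau> x = \<sigma>' x + H" unfolding \<tau>_def by simp
  note p' = assms(2)[folded T]
  interpret C: sl \<tau> T1 T2' G unfolding G_def by (rule sl.intro[OF shift_problem[OF p' H ae]])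
  interpret pair: sl_pair \<sigma> \<tau> T1 T2 H2 T2' G
  proof (intro sl_pair.intro A.sl_axioms C.sl_axioms sl_pair_axioms.intro)
    fix z :: complex assume z: "Im z \<noteq> 0"
    have "C.Mw z = sl.Mw \<sigma>' T1 T2' H2' z + H"
      unfolding G_def
      by (rule shift_Mw[OF p' H ae]) (use C.dd_nonreal[OF z] B.dd_nonreal[OF z] T in \<open>simp_all add: G_def\<close>)
    then show "A.Mw z = C.Mw z" using M[OF z] unfolding T by simp
  qed
  obtain N where N: "negligible N" "\<And>x. x \<in> {0<..<pi} - N \<Longrightarrow> \<sigma> x = \<tau> x"
    by (rule pair.potentials_eq) (rule that, assumption+)
  have "AE x in lebesgue_on {0<..<pi}. \<sigma> x = \<sigma>' x + H"
    using N by (subst AE_lebesgue_on_iff_negligible) (auto simp: \<tau>_def)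
  then have "shift_transform H \<sigma> T1 T2 H2 \<sigma>' T1' T2' H2'"
    unfolding shift_transform_def using T pair.boundary_eq unfolding G_def by simp
  then show "\<exists>H. admissible_shift T1 H \<and> shift_transform H \<sigma> T1 T2 H2 \<sigma>' T1' T2' H2'" using H by blast
next
  fix H \<sigma>0 T10 T20 H20
  assume "admissible_shift T1' H \<and> shift_transform H \<sigma>0 T10 T20 H20 \<sigma>' T1' T2' H2'"
  then have H: "admissible_shift T1' H" and ae: "AE x in lebesgue_on {0<..<pi}. \<sigma>0 x = \<sigma>' x + H"
    and e: "T10 = T1'" "T20 = T2'" "H20 = H2' - T2' ** H ** T2'" unfolding shift_transform_def by auto
  \<comment> \<open>The shift lemmas hold for every \<open>\<sigma>0\<close> that agrees with
    \<open>\<sigma>' + H\<close> almost everywhere, so no particular representative has to be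
    chosen.\<close>
  show "sl_problem \<sigma>0 T10 T20 H20 \<and> spectral_data \<sigma>0 T10 T20 H20 lam' \<alpha>'"
    unfolding e shift_spectral_data[OF assms(2) H ae] using shift_problem[OF assms(2) H ae] assms(4) by simp
qed

end
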